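(* Let $K$ be a field, $A=KQ/I$ a finite-dimensional $K$-algebra given by a finite quiver $Q$ and an admissible ideal $I$, and let $k$ be a vertex of $Q$ without loops. Let $f\colon P_k\to\bigoplus_{\alpha:\,t(\alpha)=k}P_{s(\alpha)}$ be the map induced by all arrows ending at $k$, and let $T^-_k$ be the complex defined in the context. Then: (a) $T^-_k$ is a tilting complex if and only if $\ker f\simeq S_k^m$ for some $m\geq 0$. (b) $T^-_k$ is isomorphic in $\mathcal{D}^b(A)$ to a tilting module if and only if $f$ is a monomorphism.
   Context: For an arrow $\alpha$ of $Q$, $s(\alpha)$ and $t(\alpha)$ denote its start and end vertices; paths compose left to right, i.e. $\alpha\beta$ is defined if $t(\alpha)=s(\beta)$. Modules are finite-dimensional right $A$-modules, and $\mathcal{D}^b(A)$ is the bounded derived category of $\operatorname{mod} A$. For a vertex $i$, $S_i$ is the simple module at $i$ and $P_i$ its projective cover, spanned by the (non-zero) paths starting at $i$. An arrow $\alpha$ induces a map $P_{t(\alpha)}\xrightarrow{\alpha}P_{s(\alpha)}$ (left multiplication by $\alpha$). $L_k$ is the two-term complex $P_k\xrightarrow{f}\bigoplus_{\alpha:\,t(\alpha)=k}P_{s(\alpha)}$ with $P_k$ in degree $-1$, and $T^-_k=L_k\oplus\bigoplus_{i\neq k}P_i$. A tilting complex is a bounded complex $T$ of finitely generated projective modules with $\operatorname{Hom}_{\mathcal{D}^b(A)}(T,T[r])=0$ for all $r\neq 0$ whose direct summands generate the category $\operatorname{per}A$ of perfect complexes as a triangulated category. A tilting module is a module which, viewed as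 a complex concentrated in degree $0$, is isomorphic in $\mathcal{D}^b(A)$ to a tilting complex. *)

theory Defs
  imports
    "Graph_Theory.Arc_Walk"
    "HOL-Algebra.QuotRing"
    "HOL-Algebra.Ideal_Product"
    "HOL-Algebra.Module"
begin

section \<open>Bound quiver algebras\<close>

text \<open>
  A finite quiver is a digraph \<open>Q\<close> with \<^locale>\<open>fin_digraph\<close>: loops and multiple arrows are
  allowed, and an arrow \<open>\<alpha>\<close> starts at \<open>tail Q \<alpha>\<close> and ends at \<open>head Q \<alpha>\<close>.  A path is given
  by its starting vertex and its list of arrows, read from left to right, so that \<open>(i, [])\<close> is
  the trivial path at \<open>i\<close>.
\<close>

type_synonym ('v, 'a) path = "'v \<times> 'a list"

definition paths :: "('v, 'a) pre_digraph \<Rightarrow> ('v, 'a) path set" where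
  "paths Q = {(u, p). \<exists>v. pre_digraph.awalk Q u p v}"

abbreviation path_end :: "('v, 'a) pre_digraph \<Rightarrow> 'v \<Rightarrow> 'a list \<Rightarrow> 'v" where
  "path_end Q u p \<equiv> last (pre_digraph.awalk_verts Q u p)"

text \<open>
  An element of the path algebra is a finitely supported family of coefficients indexed by the
  paths.  The coefficient of a product at a path sums over all ways to cut that path in two.
\<close>

definition path_algebra :: "('v, 'a) pre_digraph \<Rightarrow> (('v, 'a) path \<Rightarrow> 'k::field) ring" where
  "path_algebra Q =
    \<lparr>carrier = {x. finite {w. x w \<noteq> 0} \<and> {w. x w \<noteq> 0} \<subseteq> paths Q},
     mult = (\<lambda>x y (u, r). \<Sum>j\<le>length r.
               x (u, take j r) * y (path_end Q u (take j r), drop j r)),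
     one = (\<lambda>(u, r). if u \<in> verts Q \<and> r = [] then 1 else 0),
     zero = (\<lambda>w. 0),
     add = (\<lambda>x y w. x w + y w)\<rparr>"

definition path_elem :: "('v, 'a) path \<Rightarrow> ('v, 'a) path \<Rightarrow> 'k::field" where
  "path_elem w = (\<lambda>w'. if w' = w then 1 else 0)"

definition arrow_elem :: "('v, 'a) pre_digraph \<Rightarrow> 'a \<Rightarrow> ('v, 'a) path \<Rightarrow> 'k::field" where
  "arrow_elem Q \<alpha> = path_elem (tail Q \<alpha>, [\<alpha>])"

definition arrow_ideal :: "('v, 'a) pre_digraph \<Rightarrow> (('v, 'a) path \<Rightarrow> 'k::field) set" where
  "arrow_ideal Q = Idl\<^bsub>path_algebra Q\<^esub> (arrow_elem Q ` arcs Q)"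

primrec arrow_ideal_power ::
  "('v, 'a) pre_digraph \<Rightarrow> nat \<Rightarrow> (('v, 'a) path \<Rightarrow> 'k::field) set" where
  "arrow_ideal_power Q 0 = carrier (path_algebra Q)"
| "arrow_ideal_power Q (Suc n) = ideal_prod (path_algebra Q) (arrow_ideal_power Q n) (arrow_ideal Q)"

definition admissible_ideal ::
  "('v, 'a) pre_digraph \<Rightarrow> (('v, 'a) path \<Rightarrow> 'k::field) set \<Rightarrow> bool" where
  "admissible_ideal Q I \<longleftrightarrow>
     ideal I (path_algebra Q) \<and>
     (\<exists>m\<ge>2. arrow_ideal_power Q m \<subseteq> I) \<and> I \<subseteq> arrow_ideal_power Q 2"

text \<open>
  The quotient ring \<open>KQ/I\<close>, with the scalar multiplication induced from \<open>KQ\<close>.  Here and below the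
  record \<^typ>\<open>('k, 'r) module\<close> serves to represent a (noncommutative) algebra over the
  field \<open>'k\<close>.
\<close>

definition bound_quiver_algebra ::
  "('v, 'a) pre_digraph \<Rightarrow> (('v, 'a) path \<Rightarrow> 'k::field) set
     \<Rightarrow> ('k, (('v, 'a) path \<Rightarrow> 'k) set) module" where
  "bound_quiver_algebra Q I =
     ring.extend (path_algebra Q Quot I)
       (module.fields (\<lambda>c X. \<Union>x\<in>X. I +>\<^bsub>path_algebra Q\<^esub> (\<lambda>w. c * x w)))"


section \<open>Finite-dimensional right modules\<close>

text \<open>
  As in \<^typ>\<open>('k, 'r) module\<close>, the record of a module extends the one of rings in order to
  inherit the notation for its additive group; the fields \<open>mult\<close> and \<open>one\<close> are not used.
\<close>

record ('r, 'm) rmodule = "'m ring" +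
  act :: "'m \<Rightarrow> 'r \<Rightarrow> 'm"

locale right_module = A?: ring A + M?: abelian_group M
  for A :: "('k::field, 'r) module" and M :: "('r, 'm) rmodule" +
  assumes act_closed: "\<lbrakk>m \<in> carrier M; a \<in> carrier A\<rbrakk> \<Longrightarrow> act M m a \<in> carrier M"
    and act_add_left: "\<lbrakk>m \<in> carrier M; n \<in> carrier M; a \<in> carrier A\<rbrakk>
      \<Longrightarrow> act M (m \<oplus>\<^bsub>M\<^esub> n) a = act M m a \<oplus>\<^bsub>M\<^esub> act M n a"
    and act_add_right: "\<lbrakk>m \<in> carrier M; a \<in> carrier A; b \<in> carrier A\<rbrakk>
      \<Longrightarrow> act M m (a \<oplus>\<^bsub>A\<^esub> b) = act M m a \<oplus>\<^bsub>M\<^esub> act M m b"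
    and act_mult: "\<lbrakk>m \<in> carrier M; a \<in> carrier A; b \<in> carrier A\<rbrakk>
      \<Longrightarrow> act M m (a \<otimes>\<^bsub>A\<^esub> b) = act M (act M m a) b"
    and act_one: "m \<in> carrier M \<Longrightarrow> act M m \<one>\<^bsub>A\<^esub> = m"

text \<open>The scalar \<open>c\<close> acts on an \<open>A\<close>-module as the element \<open>c \<cdot> 1\<close> of \<open>A\<close>.\<close>

definition fd_module :: "('k::field, 'r) module \<Rightarrow> ('r, 'm) rmodule \<Rightarrow> bool" where
  "fd_module A M \<longleftrightarrow> right_module A M \<and>
     (\<exists>B. finite B \<and> B \<subseteq> carrier M \<and>
        (\<forall>m\<in>carrier M. \<exists>c. m = (\<Oplus>\<^bsub>M\<^esub>b\<in>B. act M b (c b \<odot>\<^bsub>A\<^esub> \<one>\<^bsub>A\<^esub>))))"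

definition mod_hom ::
  "('k::field, 'r) module \<Rightarrow> ('r, 'm) rmodule \<Rightarrow> ('r, 'n) rmodule \<Rightarrow> ('m \<Rightarrow> 'n) set" where
  "mod_hom A M N = {f. f \<in> carrier M \<rightarrow> carrier N \<and>
     (\<forall>x\<in>carrier M. \<forall>y\<in>carrier M. f (x \<oplus>\<^bsub>M\<^esub> y) = f x \<oplus>\<^bsub>N\<^esub> f y) \<and>
     (\<forall>x\<in>carrier M. \<forall>a\<in>carrier A. f (act M x a) = act N (f x) a)}"

definition mod_iso ::
  "('k::field, 'r) module \<Rightarrow> ('r, 'm) rmodule \<Rightarrow> ('r, 'n) rmodule \<Rightarrow> bool" where
  "mod_iso A M N \<longleftrightarrow> (\<exists>f\<in>mod_hom A M N. bij_betw f (carrier M) (carrier N))"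

definition mod_kernel ::
  "('r, 'm) rmodule \<Rightarrow> ('r, 'n) rmodule \<Rightarrow> ('m \<Rightarrow> 'n) \<Rightarrow> ('r, 'm) rmodule" where
  "mod_kernel M N f = M\<lparr>carrier := {x \<in> carrier M. f x = \<zero>\<^bsub>N\<^esub>}\<rparr>"

definition zero_submodule :: "('r, 'm) rmodule \<Rightarrow> ('r, 'm) rmodule" where
  "zero_submodule M = M\<lparr>carrier := {\<zero>\<^bsub>M\<^esub>}\<rparr>"

definition mod_sum ::
  "('r, 'm) rmodule \<Rightarrow> ('r, 'n) rmodule \<Rightarrow> ('r, 'm \<times> 'n) rmodule" where
  "mod_sum M N =
    \<lparr>carrier = carrier M \<times> carrier N, mult = undefined, one = undefined,
     zero = (\<zero>\<^bsub>M\<^esub>, \<zero>\<^bsub>N\<^esub>),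
     add = (\<lambda>(x, y) (x', y'). (x \<oplus>\<^bsub>M\<^esub> x', y \<oplus>\<^bsub>N\<^esub> y')),
     act = (\<lambda>(x, y) a. (act M x a, act N y a))\<rparr>"

text \<open>The direct sum of a family indexed by a finite set \<open>J\<close>.\<close>

definition mod_bigsum :: "'i set \<Rightarrow> ('i \<Rightarrow> ('r, 'm) rmodule) \<Rightarrow> ('r, 'i \<Rightarrow> 'm) rmodule" where
  "mod_bigsum J M =
    \<lparr>carrier = (\<Pi>\<^sub>E i\<in>J. carrier (M i)), mult = undefined, one = undefined,
     zero = (\<lambda>i\<in>J. \<zero>\<^bsub>M i\<^esub>),
     add = (\<lambda>x y. \<lambda>i\<in>J. x i \<oplus>\<^bsub>M i\<^esub> y i),
     act = (\<lambda>x a. \<lambda>i\<in>J. act (M i) (x i) a)\<rparr>"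

text \<open>
  Every finite-dimensional \<open>A\<close>-module is isomorphic to one whose elements are lists of scalars
  (carried by \<open>K\<^sup>n\<close>), so the modules of type \<^typ>\<open>('r, 'k list) rmodule\<close> make up the category
  \<open>mod A\<close> up to equivalence.  Quantification over all modules or complexes is done over this
  type; given modules and complexes may have elements of any type.
\<close>

definition projective :: "('k::field, 'r) module \<Rightarrow> ('r, 'm) rmodule \<Rightarrow> bool" where
  "projective A P \<longleftrightarrow> right_module A P \<and>
     (\<forall>(M :: ('r, 'k list) rmodule) (N :: ('r, 'k list) rmodule) g h.
        fd_module A M \<and> fd_module A N \<and> g \<in> mod_hom A M N \<and> g ` carrier M = carrier N \<and>
        h \<in> mod_hom A P N \<longrightarrow>
        (\<exists>l\<in>mod_hom A P M. \<forall>x\<in>carrier P. g (l x) = h x))"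


section \<open>The bounded derived category\<close>

record ('r, 'm) cochain_complex =
  obj :: "int \<Rightarrow> ('r, 'm) rmodule"
  diff :: "int \<Rightarrow> 'm \<Rightarrow> 'm"

definition bounded_complex :: "('k::field, 'r) module \<Rightarrow> ('r, 'm) cochain_complex \<Rightarrow> bool" where
  "bounded_complex A X \<longleftrightarrow>
     (\<forall>n. fd_module A (obj X n)) \<and>
     (\<forall>n. diff X n \<in> mod_hom A (obj X n) (obj X (n + 1))) \<and>
     (\<forall>n. \<forall>x\<in>carrier (obj X n). diff X (n + 1) (diff X n x) = \<zero>\<^bsub>obj X (n + 2)\<^esub>) \<and>
     (\<exists>N. \<forall>n. \<bar>n\<bar> > N \<longrightarrow> carrier (obj X n) = {\<zero>\<^bsub>obj X n\<^esub>})"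

definition chain_map ::
  "('k::field, 'r) module \<Rightarrow> ('r, 'm) cochain_complex \<Rightarrow> ('r, 'n) cochain_complex
     \<Rightarrow> (int \<Rightarrow> 'm \<Rightarrow> 'n) \<Rightarrow> bool" where
  "chain_map A X Y f \<longleftrightarrow>
     (\<forall>n. f n \<in> mod_hom A (obj X n) (obj Y n)) \<and>
     (\<forall>n. \<forall>x\<in>carrier (obj X n). f (n + 1) (diff X n x) = diff Y n (f n x))"

definition chain_comp :: "(int \<Rightarrow> 'n \<Rightarrow> 'l) \<Rightarrow> (int \<Rightarrow> 'm \<Rightarrow> 'n) \<Rightarrow> int \<Rightarrow> 'm \<Rightarrow> 'l"
    (infixl \<open>\<circ>\<^sub>c\<close> 55) where
  "g \<circ>\<^sub>c f = (\<lambda>n. g n \<circ> f n)"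

definition chain_zero :: "('r, 'n) cochain_complex \<Rightarrow> int \<Rightarrow> 'm \<Rightarrow> 'n" where
  "chain_zero Y = (\<lambda>n x. \<zero>\<^bsub>obj Y n\<^esub>)"

definition homotopic ::
  "('k::field, 'r) module \<Rightarrow> ('r, 'm) cochain_complex \<Rightarrow> ('r, 'n) cochain_complex
     \<Rightarrow> (int \<Rightarrow> 'm \<Rightarrow> 'n) \<Rightarrow> (int \<Rightarrow> 'm \<Rightarrow> 'n) \<Rightarrow> bool" where
  "homotopic A X Y f g \<longleftrightarrow>
     (\<exists>h. (\<forall>n. h n \<in> mod_hom A (obj X n) (obj Y (n - 1))) \<and>
          (\<forall>n. \<forall>x\<in>carrier (obj X n).
             f n x \<ominus>\<^bsub>obj Y n\<^esub> g n x = diff Y (n - 1) (h n x) \<oplus>\<^bsub>obj Y n\<^esub> h (n + 1) (diff X n x)))"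

definition cycles :: "('r, 'm) cochain_complex \<Rightarrow> int \<Rightarrow> 'm set" where
  "cycles X n = {x \<in> carrier (obj X n). diff X n x = \<zero>\<^bsub>obj X (n + 1)\<^esub>}"

definition boundaries :: "('r, 'm) cochain_complex \<Rightarrow> int \<Rightarrow> 'm set" where
  "boundaries X n = diff X (n - 1) ` carrier (obj X (n - 1))"

definition cohomology :: "('r, 'm) cochain_complex \<Rightarrow> int \<Rightarrow> 'm set set" where
  "cohomology X n = (\<lambda>x. boundaries X n +>\<^bsub>obj X n\<^esub> x) ` cycles X n"

definition cohomology_map ::
  "('r, 'n) cochain_complex \<Rightarrow> (int \<Rightarrow> 'm \<Rightarrow> 'n) \<Rightarrow> int \<Rightarrow> 'm set \<Rightarrow> 'n set" where
  "cohomology_map Y f n C = (\<Union>x\<in>C. boundaries Y n +>\<^bsub>obj Y n\<^esub> f n x)"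

definition quasi_iso ::
  "('k::field, 'r) module \<Rightarrow> ('r, 'm) cochain_complex \<Rightarrow> ('r, 'n) cochain_complex
     \<Rightarrow> (int \<Rightarrow> 'm \<Rightarrow> 'n) \<Rightarrow> bool" where
  "quasi_iso A X Y f \<longleftrightarrow> chain_map A X Y f \<and>
     (\<forall>n. bij_betw (cohomology_map Y f n) (cohomology X n) (cohomology Y n))"

text \<open>
  The derived category is the localization of the homotopy category at the quasi-isomorphisms.
  By the calculus of fractions, a morphism \<open>X \<rightarrow> Y\<close> is represented by a roof
  \<open>X \<leftarrow>s\<midarrow> Z \<midarrow>f\<rightarrow> Y\<close> with \<open>s\<close> a quasi-isomorphism, standing for \<open>f s\<^sup>-\<^sup>1\<close>.
\<close>

type_synonym ('k, 'r, 'm, 'n) roof =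
  "('r, 'k list) cochain_complex \<times> (int \<Rightarrow> 'k list \<Rightarrow> 'm) \<times> (int \<Rightarrow> 'k list \<Rightarrow> 'n)"

fun is_roof ::
  "('k::field, 'r) module \<Rightarrow> ('r, 'm) cochain_complex \<Rightarrow> ('r, 'n) cochain_complex
     \<Rightarrow> ('k, 'r, 'm, 'n) roof \<Rightarrow> bool" where
  "is_roof A X Y (Z, s, f) \<longleftrightarrow> bounded_complex A Z \<and> quasi_iso A Z X s \<and> chain_map A Z Y f"

fun roof_equiv ::
  "('k::field, 'r) module \<Rightarrow> ('r, 'm) cochain_complex \<Rightarrow> ('r, 'n) cochain_complex
     \<Rightarrow> ('k, 'r, 'm, 'n) roof \<Rightarrow> ('k, 'r, 'm, 'n) roof \<Rightarrow> bool" where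
  "roof_equiv A X Y (Z, s, f) (Z', s', f') \<longleftrightarrow>
     (\<exists>(W :: ('r, 'k list) cochain_complex) u u'.
        bounded_complex A W \<and> chain_map A W Z u \<and> chain_map A W Z' u' \<and>
        quasi_iso A W X (s \<circ>\<^sub>c u) \<and>
        homotopic A W X (s \<circ>\<^sub>c u) (s' \<circ>\<^sub>c u') \<and>
        homotopic A W Y (f \<circ>\<^sub>c u) (f' \<circ>\<^sub>c u'))"

text \<open>\<open>roof_comp A Y \<rho> \<sigma> \<tau>\<close>: the roof \<open>\<tau>\<close> is a composite of \<open>\<rho> : X \<rightarrow> Y\<close> followed by \<open>\<sigma> : Y \<rightarrow> V\<close>.\<close>

fun roof_comp ::
  "('k::field, 'r) module \<Rightarrow> ('r, 'n) cochain_complex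
     \<Rightarrow> ('k, 'r, 'm, 'n) roof \<Rightarrow> ('k, 'r, 'n, 'l) roof \<Rightarrow> ('k, 'r, 'm, 'l) roof \<Rightarrow> bool" where
  "roof_comp A Y (Z, s, f) (W, t, g) (P, e, h) \<longleftrightarrow>
     bounded_complex A P \<and>
     (\<exists>p q. quasi_iso A P Z p \<and> chain_map A P W q \<and>
        homotopic A P Y (f \<circ>\<^sub>c p) (t \<circ>\<^sub>c q) \<and> e = s \<circ>\<^sub>c p \<and> h = g \<circ>\<^sub>c q)"

text \<open>The identity of \<open>X\<close> is represented by \<open>X \<leftarrow>s\<midarrow> Z \<midarrow>s\<rightarrow> X\<close>, for any quasi-isomorphism \<open>s\<close>.\<close>

fun roof_is_identity ::
  "('k::field, 'r) module \<Rightarrow> ('r, 'm) cochain_complex \<Rightarrow> ('k, 'r, 'm, 'm) roof \<Rightarrow> bool" where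
  "roof_is_identity A X (Z, s, f) \<longleftrightarrow> roof_equiv A X X (Z, s, f) (Z, s, s)"

definition derived_iso ::
  "('k::field, 'r) module \<Rightarrow> ('r, 'm) cochain_complex \<Rightarrow> ('r, 'n) cochain_complex \<Rightarrow> bool" where
  "derived_iso A X Y \<longleftrightarrow>
     (\<exists>\<rho> \<sigma>. is_roof A X Y \<rho> \<and> is_roof A Y X \<sigma> \<and>
        (\<exists>\<tau>. roof_comp A Y \<rho> \<sigma> \<tau> \<and> roof_is_identity A X \<tau>) \<and>
        (\<exists>\<tau>. roof_comp A X \<sigma> \<rho> \<tau> \<and> roof_is_identity A Y \<tau>))"

definition derived_hom_vanishes ::
  "('k::field, 'r) module \<Rightarrow> ('r, 'm) cochain_complex \<Rightarrow> ('r, 'n) cochain_complex \<Rightarrow> bool" where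
  "derived_hom_vanishes A X Y \<longleftrightarrow>
     (\<forall>Z s f. is_roof A X Y (Z, s, f) \<longrightarrow> roof_equiv A X Y (Z, s, f) (Z, s, chain_zero Y))"

definition stalk :: "('r, 'm) rmodule \<Rightarrow> ('r, 'm) cochain_complex" where
  "stalk M = \<lparr>obj = (\<lambda>n. if n = 0 then M else zero_submodule M), diff = (\<lambda>n x. \<zero>\<^bsub>M\<^esub>)\<rparr>"

definition shift :: "('r, 'm) cochain_complex \<Rightarrow> int \<Rightarrow> ('r, 'm) cochain_complex" where
  "shift X r =
    \<lparr>obj = (\<lambda>n. obj X (n + r)),
     diff = (\<lambda>n x. if even r then diff X (n + r) x
                   else \<ominus>\<^bsub>obj X (n + r + 1)\<^esub> diff X (n + r) x)\<rparr>"

definition complex_sum ::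
  "('r, 'm) cochain_complex \<Rightarrow> ('r, 'n) cochain_complex \<Rightarrow> ('r, 'm \<times> 'n) cochain_complex" where
  "complex_sum X Y =
    \<lparr>obj = (\<lambda>n. mod_sum (obj X n) (obj Y n)),
     diff = (\<lambda>n (x, y). (diff X n x, diff Y n y))\<rparr>"

definition cone ::
  "('r, 'm) cochain_complex \<Rightarrow> ('r, 'n) cochain_complex \<Rightarrow> (int \<Rightarrow> 'm \<Rightarrow> 'n)
     \<Rightarrow> ('r, 'm \<times> 'n) cochain_complex" where
  "cone X Y f =
    \<lparr>obj = (\<lambda>n. mod_sum (obj X (n + 1)) (obj Y n)),
     diff = (\<lambda>n (x, y). (\<ominus>\<^bsub>obj X (n + 2)\<^esub> diff X (n + 1) x,
                         f (n + 1) x \<oplus>\<^bsub>obj Y (n + 1)\<^esub> diff Y n y))\<rparr>"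


section \<open>Tilting complexes\<close>

text \<open>For modules over a finite-dimensional algebra, finitely generated means finite-dimensional.\<close>

definition projective_complex :: "('k::field, 'r) module \<Rightarrow> ('r, 'm) cochain_complex \<Rightarrow> bool" where
  "projective_complex A P \<longleftrightarrow> bounded_complex A P \<and> (\<forall>n. projective A (obj P n))"

definition per :: "('k::field, 'r) module \<Rightarrow> ('r, 'k list) cochain_complex set" where
  "per A = {X. bounded_complex A X \<and>
     (\<exists>P :: ('r, 'k list) cochain_complex. projective_complex A P \<and> derived_iso A X P)}"

definition derived_summands ::
  "('k::field, 'r) module \<Rightarrow> ('r, 'm) cochain_complex \<Rightarrow> ('r, 'k list) cochain_complex set" where
  "derived_summands A T = {X. bounded_complex A X \<and>
     (\<exists>Y :: ('r, 'k list) cochain_complex.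
        bounded_complex A Y \<and> derived_iso A T (complex_sum X Y))}"

text \<open>
  Strictly full triangulated subcategories of \<open>per A\<close>.  Each morphism between objects of such a
  subcategory is, up to an isomorphism of its source, the image of a chain map, so closure under
  the cones of chain maps is enough.
\<close>

definition triangulated_subcategory ::
  "('k::field, 'r) module \<Rightarrow> ('r, 'k list) cochain_complex set \<Rightarrow> bool" where
  "triangulated_subcategory A \<T> \<longleftrightarrow>
     \<T> \<noteq> {} \<and> \<T> \<subseteq> per A \<and>
     (\<forall>X\<in>\<T>. \<forall>Y. bounded_complex A Y \<and> derived_iso A X Y \<longrightarrow> Y \<in> \<T>) \<and>
     (\<forall>X\<in>\<T>. \<forall>r. shift X r \<in> \<T>) \<and>
     (\<forall>X\<in>\<T>. \<forall>Y\<in>\<T>. \<forall>f Z. chain_map A X Y f \<and> bounded_complex A Z \<and>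
        derived_iso A Z (cone X Y f) \<longrightarrow> Z \<in> \<T>)"

definition tilting_complex :: "('k::field, 'r) module \<Rightarrow> ('r, 'm) cochain_complex \<Rightarrow> bool" where
  "tilting_complex A T \<longleftrightarrow>
     projective_complex A T \<and>
     (\<forall>r. r \<noteq> 0 \<longrightarrow> derived_hom_vanishes A T (shift T r)) \<and>
     (\<forall>\<T>. triangulated_subcategory A \<T> \<and> derived_summands A T \<subseteq> \<T> \<longrightarrow> \<T> = per A)"

definition tilting_module :: "('k::field, 'r) module \<Rightarrow> ('r, 'k list) rmodule \<Rightarrow> bool" where
  "tilting_module A M \<longleftrightarrow> fd_module A M \<and>
     (\<exists>T :: ('r, 'k list) cochain_complex. tilting_complex A T \<and> derived_iso A (stalk M) T)"


section \<open>The complex \<open>T\<^sub>k\<^sup>-\<close>\<close>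

context
  fixes Q :: "('v, 'a) pre_digraph" and I :: "(('v, 'a) path \<Rightarrow> 'k::field) set"
begin

private abbreviation (input) "A \<equiv> bound_quiver_algebra Q I"

definition path_class :: "('v, 'a) path \<Rightarrow> (('v, 'a) path \<Rightarrow> 'k) set" where
  "path_class w = I +>\<^bsub>path_algebra Q\<^esub> path_elem w"

text \<open>
  \<open>P\<^sub>i = e\<^sub>i A\<close>, with \<open>e\<^sub>i\<close> the class of the trivial path at \<open>i\<close>; it is spanned by the classes of
  the paths starting at \<open>i\<close>.
\<close>

definition proj_at ::
  "'v \<Rightarrow> ((('v, 'a) path \<Rightarrow> 'k) set, (('v, 'a) path \<Rightarrow> 'k) set) rmodule" where
  "proj_at i =
    \<lparr>carrier = (\<lambda>x. path_class (i, []) \<otimes>\<^bsub>A\<^esub> x) ` carrier A, mult = undefined, one = undefined,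
     zero = \<zero>\<^bsub>A\<^esub>, add = add A, act = mult A\<rparr>"

text \<open>
  \<open>S\<^sub>i\<close> is \<open>K\<close>, on which the class of \<open>x \<in> KQ\<close> acts as the coefficient of \<open>x\<close> at the trivial
  path at \<open>i\<close>; this does not depend on the representative if \<open>I\<close> is admissible.
\<close>

definition simple_at :: "'v \<Rightarrow> ((('v, 'a) path \<Rightarrow> 'k) set, 'k) rmodule" where
  "simple_at i =
    \<lparr>carrier = UNIV, mult = undefined, one = undefined, zero = 0, add = (+),
     act = (\<lambda>c X. c * (SOME x. x \<in> X) (i, []))\<rparr>"

definition arrows_to :: "'v \<Rightarrow> 'a set" where
  "arrows_to k = {\<alpha> \<in> arcs Q. head Q \<alpha> = k}"

definition incoming_sum ::
  "'v \<Rightarrow> ((('v, 'a) path \<Rightarrow> 'k) set, 'a \<Rightarrow> (('v, 'a) path \<Rightarrow> 'k) set) rmodule" where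
  "incoming_sum k = mod_bigsum (arrows_to k) (\<lambda>\<alpha>. proj_at (tail Q \<alpha>))"

definition incoming_map ::
  "'v \<Rightarrow> (('v, 'a) path \<Rightarrow> 'k) set \<Rightarrow> 'a \<Rightarrow> (('v, 'a) path \<Rightarrow> 'k) set" where
  "incoming_map k x = (\<lambda>\<alpha>\<in>arrows_to k. path_class (tail Q \<alpha>, [\<alpha>]) \<otimes>\<^bsub>A\<^esub> x)"

text \<open>
  Since all terms of a complex have the same element type, the term of \<open>L\<^sub>k\<close> in degree \<open>-1\<close> is
  \<open>P\<^sub>k \<times> 0\<close> and the one in degree \<open>0\<close> is \<open>0 \<times> \<Oplus>\<^sub>\<alpha> P\<^bsub>s(\<alpha>)\<^esub>\<close>.
\<close>

definition L_complex ::
  "'v \<Rightarrow> ((('v, 'a) path \<Rightarrow> 'k) set,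
     (('v, 'a) path \<Rightarrow> 'k) set \<times> ('a \<Rightarrow> (('v, 'a) path \<Rightarrow> 'k) set)) cochain_complex" where
  "L_complex k =
    \<lparr>obj = (\<lambda>n. mod_sum
       (if n = -1 then proj_at k else zero_submodule (proj_at k))
       (if n = 0 then incoming_sum k else zero_submodule (incoming_sum k))),
     diff = (\<lambda>n (x, y). (\<zero>\<^bsub>proj_at k\<^esub>,
       if n = -1 then incoming_map k x else \<zero>\<^bsub>incoming_sum k\<^esub>))\<rparr>"

definition T_minus ::
  "'v \<Rightarrow> ((('v, 'a) path \<Rightarrow> 'k) set,
     ((('v, 'a) path \<Rightarrow> 'k) set \<times> ('a \<Rightarrow> (('v, 'a) path \<Rightarrow> 'k) set)) \<times>
     ('v \<Rightarrow> (('v, 'a) path \<Rightarrow> 'k) set)) cochain_complex" where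
  "T_minus k = complex_sum (L_complex k) (stalk (mod_bigsum (verts Q - {k}) proj_at))"

end

end

theory Submission
  imports Defs
begin

text \<open>
  The complex \<open>T = T\<^sub>k\<^sup>-\<close> has the two terms \<open>P\<^sub>k\<close> and \<open>T\<^sup>0 = \<Oplus>\<^bsub>t(\<alpha>)=k\<^esub> P\<^bsub>s(\<alpha>)\<^esub> \<oplus> \<Oplus>\<^bsub>i\<noteq>k\<^esub> P\<^sub>i\<close>,
  and as \<open>k\<close> has no loops, \<open>T\<^sup>0\<close> is a sum of modules \<open>P\<^sub>i\<close> with \<open>i \<noteq> k\<close>.  Since \<open>T\<close> is a bounded
  complex of projectives, morphisms \<open>T \<rightarrow> T[r]\<close> in the derived category are homotopy classes of chain
  maps.  For \<open>r = 1\<close> all of them vanish: the paths of positive length ending at \<open>k\<close> factor through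
  the arrows ending at \<open>k\<close>, so every map \<open>P\<^sub>k \<rightarrow> P\<^sub>i\<close> with \<open>i \<noteq> k\<close> factors through \<open>f\<close>.  For
  \<open>r = -1\<close> they correspond to maps \<open>T\<^sup>0 \<rightarrow> ker f\<close>, so all of them vanish iff \<open>(ker f) e\<^sub>i = 0\<close> for
  all \<open>i \<noteq> k\<close>, which means \<open>ker f \<simeq> S\<^sub>k\<^sup>m\<close>.  The summands of \<open>T\<close> always generate \<open>per A\<close>, because
  \<open>P\<^sub>k[1]\<close> is the cone of \<open>\<Oplus>\<^bsub>t(\<alpha>)=k\<^esub> P\<^bsub>s(\<alpha>)\<^esub> \<rightarrow> L\<^sub>k\<close> and every projective module is a sum of modules
  \<open>P\<^sub>i\<close>.  Finally \<open>T\<close> is isomorphic to a module iff its cohomology \<open>ker f\<close> in degree \<open>-1\<close> vanishes.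
\<close>

section \<open>Finite-dimensional modules\<close>

text \<open>Morphisms in the derived category are given as roofs whose apexes are complexes of
  lists, and they are handled asymmetrically. To show that a roof out of \<open>T\<close> is zero,
  it is straightened to a chain map by means of a right inverse, up to homotopy, of its
  quasi-isomorphism onto \<open>T\<close>; this right inverse is built by hand from the projectivity
  of the two terms. Conversely, a vanishing Hom or a derived isomorphism is exploited only through
  its effect on cycles modulo boundaries. Projectivity, triangulated subcategories and tilting
  modules all refer to the type of lists, so modules and complexes with other elements are copied
  there and the copies compared by degreewise isomorphisms.

  That \<open>(ker f) e_i = 0\<close> for all \<open>i \<noteq> k\<close> makes \<open>ker f\<close>
  semisimple has the same source as the vanishing for \<open>r = 1\<close>: if the character of
  \<open>S_k\<close> vanishes at \<open>b\<close>, then \<open>b e_k\<close> is a left combination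
  of arrows into \<open>k\<close>, and these start at vertices other than \<open>k\<close>, where
  \<open>ker f\<close> is zero. Hence \<open>A\<close> acts on \<open>ker f\<close> by scalars, and
  any basis over \<open>K\<close> gives the isomorphism with a power of \<open>S_k\<close>.\<close>

lemma mod_hom_closed: "f \<in> mod_hom A M N \<Longrightarrow> x \<in> carrier M \<Longrightarrow> f x \<in> carrier N"
  by (auto simp: mod_hom_def)

lemma mod_hom_add:
  "f \<in> mod_hom A M N \<Longrightarrow> x \<in> carrier M \<Longrightarrow> y \<in> carrier M \<Longrightarrow> f (x \<oplus>\<^bsub>M\<^esub> y) = f x \<oplus>\<^bsub>N\<^esub> f y"
  by (auto simp: mod_hom_def)

lemma mod_hom_act:
  "f \<in> mod_hom A M N \<Longrightarrow> x \<in> carrier M \<Longrightarrow> a \<in> carrier A \<Longrightarrow> f (act M x a) = act N (f x) a"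
  by (auto simp: mod_hom_def)

lemma mod_homI:
  assumes "\<And>x. x \<in> carrier M \<Longrightarrow> f x \<in> carrier N"
    and "\<And>x y. x \<in> carrier M \<Longrightarrow> y \<in> carrier M \<Longrightarrow> f (x \<oplus>\<^bsub>M\<^esub> y) = f x \<oplus>\<^bsub>N\<^esub> f y"
    and "\<And>x a. x \<in> carrier M \<Longrightarrow> a \<in> carrier A \<Longrightarrow> f (act M x a) = act N (f x) a"
  shows "f \<in> mod_hom A M N"
  using assms by (auto simp: mod_hom_def)

lemma mod_hom_comp:
  "g \<in> mod_hom A N L \<Longrightarrow> f \<in> mod_hom A M N \<Longrightarrow> (\<lambda>x. g (f x)) \<in> mod_hom A M L"
  by (auto simp: mod_hom_def Pi_iff)

lemma mod_hom_id: "(\<lambda>x. x) \<in> mod_hom A M M"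
  by (auto simp: mod_hom_def)

lemma right_module_group: "right_module A M \<Longrightarrow> abelian_group M"
  by (auto simp: right_module_def)

lemma mod_hom_zero:
  assumes "abelian_group M" "abelian_group N" "f \<in> mod_hom A M N"
  shows "f \<zero>\<^bsub>M\<^esub> = \<zero>\<^bsub>N\<^esub>"
proof -
  interpret M: abelian_group M by fact
  interpret N: abelian_group N by fact
  have "f \<zero>\<^bsub>M\<^esub> \<oplus>\<^bsub>N\<^esub> f \<zero>\<^bsub>M\<^esub> = f \<zero>\<^bsub>M\<^esub>"
    using mod_hom_add[OF assms(3), of "\<zero>\<^bsub>M\<^esub>" "\<zero>\<^bsub>M\<^esub>"] by simp
  moreover have "f \<zero>\<^bsub>M\<^esub> \<in> carrier N" by (rule mod_hom_closed[OF assms(3)]) simp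
  ultimately show ?thesis by (metis N.add.r_cancel_one')
qed

lemma mod_hom_inv:
  assumes "abelian_group M" "abelian_group N" "f \<in> mod_hom A M N" "x \<in> carrier M"
  shows "f (\<ominus>\<^bsub>M\<^esub> x) = \<ominus>\<^bsub>N\<^esub> f x"
proof -
  interpret M: abelian_group M by fact
  interpret N: abelian_group N by fact
  have "f (\<ominus>\<^bsub>M\<^esub> x) \<oplus>\<^bsub>N\<^esub> f x = \<zero>\<^bsub>N\<^esub>"
    using mod_hom_add[OF assms(3), of "\<ominus>\<^bsub>M\<^esub> x" x] assms(4) mod_hom_zero[OF assms(1-3)]
    by (simp add: M.l_neg)
  then show ?thesis using mod_hom_closed[OF assms(3)] assms(4)
    by (metis M.a_inv_closed N.minus_equality)
qed

lemma mod_hom_diff: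
  assumes "abelian_group M" "abelian_group N" "f \<in> mod_hom A M N" "x \<in> carrier M" "y \<in> carrier M"
  shows "f (x \<ominus>\<^bsub>M\<^esub> y) = f x \<ominus>\<^bsub>N\<^esub> f y"
proof -
  interpret M: abelian_group M by fact
  show ?thesis using assms by (simp add: a_minus_def mod_hom_add mod_hom_inv)
qed

context right_module
begin

lemma act_zero_left [simp]: "a \<in> carrier A \<Longrightarrow> act M \<zero>\<^bsub>M\<^esub> a = \<zero>\<^bsub>M\<^esub>"
  using act_add_left[of "\<zero>\<^bsub>M\<^esub>" "\<zero>\<^bsub>M\<^esub>" a] act_closed[of "\<zero>\<^bsub>M\<^esub>" a]
  by (metis M.add.r_cancel_one' M.zero_closed M.l_zero)

lemma act_zero_right [simp]: "m \<in> carrier M \<Longrightarrow> act M m \<zero>\<^bsub>A\<^esub> = \<zero>\<^bsub>M\<^esub>"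
  using act_add_right[of m "\<zero>\<^bsub>A\<^esub>" "\<zero>\<^bsub>A\<^esub>"] act_closed[of m "\<zero>\<^bsub>A\<^esub>"]
  by (metis M.add.r_cancel_one' A.zero_closed A.l_zero)

lemma act_inv_left: "m \<in> carrier M \<Longrightarrow> a \<in> carrier A \<Longrightarrow> act M (\<ominus>\<^bsub>M\<^esub> m) a = \<ominus>\<^bsub>M\<^esub> act M m a"
  using act_add_left[of "\<ominus>\<^bsub>M\<^esub> m" m a]
  by (metis M.a_inv_closed M.l_neg M.minus_equality act_closed act_zero_left)

lemma act_inv_right: "m \<in> carrier M \<Longrightarrow> a \<in> carrier A \<Longrightarrow> act M m (\<ominus>\<^bsub>A\<^esub> a) = \<ominus>\<^bsub>M\<^esub> act M m a"
  using act_add_right[of m "\<ominus>\<^bsub>A\<^esub> a" a]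
  by (metis A.a_inv_closed A.l_neg M.minus_equality act_closed act_zero_right)

lemma act_finsum_left:
  assumes "finite J" "f \<in> J \<rightarrow> carrier M" "a \<in> carrier A"
  shows "act M (\<Oplus>\<^bsub>M\<^esub>j\<in>J. f j) a = (\<Oplus>\<^bsub>M\<^esub>j\<in>J. act M (f j) a)"
  using assms(1,2)
proof (induction J)
  case empty
  then show ?case using assms by simp
next
  case (insert j J)
  then have "f \<in> J \<rightarrow> carrier M" "f j \<in> carrier M" "(\<lambda>j. act M (f j) a) \<in> J \<rightarrow> carrier M"
    using assms by (auto intro!: act_closed)
  with insert show ?case
    using assms by (simp add: M.finsum_insert act_add_left act_closed M.finsum_closed)
qed

lemma zero_hom: "(\<lambda>x. \<zero>\<^bsub>M\<^esub>) \<in> mod_hom A N M"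
  by (rule mod_homI) auto

end

lemma right_moduleI:
  fixes A :: "('k::field, 'r) module" and M :: "('r, 'm) rmodule"
  assumes "ring A" "abelian_group M"
    and "\<And>m a. \<lbrakk>m \<in> carrier M; a \<in> carrier A\<rbrakk> \<Longrightarrow> act M m a \<in> carrier M"
    and "\<And>m n a. \<lbrakk>m \<in> carrier M; n \<in> carrier M; a \<in> carrier A\<rbrakk>
      \<Longrightarrow> act M (m \<oplus>\<^bsub>M\<^esub> n) a = act M m a \<oplus>\<^bsub>M\<^esub> act M n a"
    and "\<And>m a b. \<lbrakk>m \<in> carrier M; a \<in> carrier A; b \<in> carrier A\<rbrakk>
      \<Longrightarrow> act M m (a \<oplus>\<^bsub>A\<^esub> b) = act M m a \<oplus>\<^bsub>M\<^esub> act M m b"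
    and "\<And>m a b. \<lbrakk>m \<in> carrier M; a \<in> carrier A; b \<in> carrier A\<rbrakk>
      \<Longrightarrow> act M m (a \<otimes>\<^bsub>A\<^esub> b) = act M (act M m a) b"
    and "\<And>m. m \<in> carrier M \<Longrightarrow> act M m \<one>\<^bsub>A\<^esub> = m"
  shows "right_module A M"
  using assms by (simp add: right_module_def right_module_axioms_def)

lemma abelian_group_restrict:
  assumes "abelian_group M" "H \<subseteq> carrier M" "\<zero>\<^bsub>M\<^esub> \<in> H"
    "\<And>x y. x \<in> H \<Longrightarrow> y \<in> H \<Longrightarrow> x \<oplus>\<^bsub>M\<^esub> y \<in> H" "\<And>x. x \<in> H \<Longrightarrow> \<ominus>\<^bsub>M\<^esub> x \<in> H"
  shows "abelian_group (M\<lparr>carrier := H\<rparr>)"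
proof -
  interpret M: abelian_group M by fact
  have in_M: "x \<in> carrier M" if "x \<in> H" for x using assms(2) that by blast
  show ?thesis
  proof (rule abelian_groupI)
    show "\<exists>y\<in>carrier (M\<lparr>carrier := H\<rparr>). y \<oplus>\<^bsub>M\<lparr>carrier := H\<rparr>\<^esub> x = \<zero>\<^bsub>M\<lparr>carrier := H\<rparr>\<^esub>"
      if "x \<in> carrier (M\<lparr>carrier := H\<rparr>)" for x
      using that assms(5)[of x] in_M[of x] M.l_neg[of x] by auto
  next
    show "x \<oplus>\<^bsub>M\<lparr>carrier := H\<rparr>\<^esub> y = y \<oplus>\<^bsub>M\<lparr>carrier := H\<rparr>\<^esub> x"
      if "x \<in> carrier (M\<lparr>carrier := H\<rparr>)" "y \<in> carrier (M\<lparr>carrier := H\<rparr>)" for x y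
      using that in_M M.a_comm by simp
  qed (use assms(3,4) in_M in \<open>simp_all add: M.a_assoc\<close>)
qed

text \<open>Additive inverses come for free: \<open>\<ominus> x\<close> is the action of
  \<open>\<ominus> \<one>\<close> on \<open>x\<close>, so closure under the action covers
  them.\<close>

lemma right_module_restrict:
  assumes "right_module A M" "H \<subseteq> carrier M" "\<zero>\<^bsub>M\<^esub> \<in> H"
    "\<And>x y. x \<in> H \<Longrightarrow> y \<in> H \<Longrightarrow> x \<oplus>\<^bsub>M\<^esub> y \<in> H" "\<And>x a. x \<in> H \<Longrightarrow> a \<in> carrier A \<Longrightarrow> act M x a \<in> H"
  shows "right_module A (M\<lparr>carrier := H\<rparr>)"
proof -
  interpret M: right_module A M by fact
  have in_M: "x \<in> carrier M" if "x \<in> H" for x using assms(2) that by blast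
  have neg: "\<ominus>\<^bsub>M\<^esub> x \<in> H" if "x \<in> H" for x
    using assms(5)[OF that, of "\<ominus>\<^bsub>A\<^esub> \<one>\<^bsub>A\<^esub>"] M.act_inv_right[OF in_M[OF that], of "\<one>\<^bsub>A\<^esub>"]
      M.act_one[OF in_M[OF that]] by simp
  show ?thesis
    by (rule right_moduleI)
      (use assms in_M neg in \<open>auto intro!: abelian_group_restrict M.A.ring_axioms
        simp: M.act_add_left M.act_add_right M.act_mult M.act_one right_module_group\<close>)
qed

text \<open>Scalars enter only through the elements \<open>c \<odot> \<one>\<close>, which is how
  they act on modules. The last axiom says that \<open>A\<close> is the span of a finite
  \<open>B\<close>, phrased as minimality among subspaces so that neither finite sums nor a module
  structure on \<open>A\<close> are presupposed.\<close>

locale fd_algebra = ring A for A :: "('k::field, 'r) module" (structure) +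
  assumes scalar_closed [simp]: "(c \<odot> \<one>) \<in> carrier A"
    and scalar_add: "((c + d) \<odot> \<one>) = (c \<odot> \<one>) \<oplus> (d \<odot> \<one>)"
    and scalar_mult: "((c * d) \<odot> \<one>) = (c \<odot> \<one>) \<otimes> (d \<odot> \<one>)"
    and scalar_one [simp]: "1 \<odot> \<one> = \<one>"
    and scalar_central: "a \<in> carrier A \<Longrightarrow> (c \<odot> \<one>) \<otimes> a = a \<otimes> (c \<odot> \<one>)"
    and finite_dim: "\<exists>B. finite B \<and> B \<subseteq> carrier A \<and>
      (\<forall>H. B \<subseteq> H \<and> \<zero> \<in> H \<and> (\<forall>x\<in>H. \<forall>y\<in>H. x \<oplus> y \<in> H) \<and>
        (\<forall>x\<in>H. \<forall>c. x \<otimes> (c \<odot> \<one>) \<in> H) \<longrightarrow> carrier A \<subseteq> H)"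
begin

lemma scalar_zero [simp]: "0 \<odot> \<one> = \<zero>"
  using scalar_add[of 0 0] scalar_closed[of 0] by (metis add.r_cancel_one' add_0)

lemma scalar_minus: "((- c) \<odot> \<one>) = \<ominus> (c \<odot> \<one>)"
  using scalar_add[of "-c" c] scalar_closed by (metis add.left_inverse minus_equality scalar_zero)

end

text \<open>The span grows by one scalar multiple at a time, so that facts about spans are plain
  inductions; \<open>kspan_iff_finsum\<close> links it to the linear combinations in
  \<open>fd_module\<close>.\<close>

inductive_set kspan :: "('k::field, 'r) module \<Rightarrow> ('r, 'm) rmodule \<Rightarrow> 'm set \<Rightarrow> 'm set"
  for A M B where
  zero: "\<zero>\<^bsub>M\<^esub> \<in> kspan A M B"
| step: "x \<in> kspan A M B \<Longrightarrow> b \<in> B \<Longrightarrow> x \<oplus>\<^bsub>M\<^esub> act M b (c \<odot>\<^bsub>A\<^esub> \<one>\<^bsub>A\<^esub>) \<in> kspan A M B"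

lemma kspan_mono: "B \<subseteq> C \<Longrightarrow> kspan A M B \<subseteq> kspan A M C"
proof
  fix x assume "B \<subseteq> C" "x \<in> kspan A M B"
  from this(2,1) show "x \<in> kspan A M C" by induction (auto intro: kspan.intros)
qed

section \<open>Linear algebra over the base field inside a module\<close>

context fd_algebra
begin

context
  fixes M :: "('r, 'm) rmodule"
  assumes M: "right_module A M"
begin

interpretation M: right_module A M by (rule M)

lemma kspan_closed:
  assumes "B \<subseteq> carrier M" "x \<in> kspan A M B"
  shows "x \<in> carrier M"
  using assms(2)
proof induction
  case (step x b c)
  then have "b \<in> carrier M" using assms(1) by blast
  then show ?case using step M.act_closed[of b "c \<odot> \<one>"] by simp
qed simp

lemma kspan_superset: "B \<subseteq> carrier M \<Longrightarrow> b \<in> B \<Longrightarrow> b \<in> kspan A M B"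
  using kspan.step[OF kspan.zero, where b = b and B = B and A = A and M = M and c = 1] by (auto simp: M.act_one subset_iff)

lemma kspan_add:
  assumes "B \<subseteq> carrier M" "x \<in> kspan A M B" "y \<in> kspan A M B"
  shows "x \<oplus>\<^bsub>M\<^esub> y \<in> kspan A M B"
  using assms(3)
proof induction
  case zero
  then show ?case using kspan_closed[OF assms(1,2)] assms by simp
next
  case (step y b c)
  have "x \<in> carrier M" "y \<in> carrier M" "act M b (c \<odot> \<one>) \<in> carrier M"
    using kspan_closed assms step by (auto intro!: M.act_closed)
  then show ?case using kspan.step[OF step(3) step(2)] by (simp flip: M.a_assoc)
qed

lemma kspan_scale:
  assumes "B \<subseteq> carrier M" "x \<in> kspan A M B"
  shows "act M x (d \<odot> \<one>) \<in> kspan A M B"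
  using assms(2)
proof induction
  case zero
  then show ?case by (simp add: kspan.zero)
next
  case (step x b c)
  have "x \<in> carrier M" "b \<in> carrier M"
    using kspan_closed assms step by (auto intro!: M.act_closed)
  then show ?case using kspan.step[OF step(3) step(2), of "c * d"]
    by (simp add: M.act_add_left M.act_closed M.act_mult scalar_mult)
qed

lemma kspan_inv:
  assumes "B \<subseteq> carrier M" "x \<in> kspan A M B"
  shows "\<ominus>\<^bsub>M\<^esub> x \<in> kspan A M B"
  using kspan_scale[OF assms, of "-1"] kspan_closed[OF assms]
  by (simp add: scalar_minus M.act_inv_right M.act_one)

lemma kspan_least:
  assumes "\<zero>\<^bsub>M\<^esub> \<in> H" "\<And>x y. x \<in> H \<Longrightarrow> y \<in> H \<Longrightarrow> x \<oplus>\<^bsub>M\<^esub> y \<in> H"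
    "\<And>x c. x \<in> H \<Longrightarrow> act M x (c \<odot> \<one>) \<in> H" "B \<subseteq> H"
  shows "kspan A M B \<subseteq> H"
proof
  fix x assume "x \<in> kspan A M B"
  then show "x \<in> H" by induction (use assms in auto)
qed

lemma kspan_finsum:
  assumes "finite J" "B \<subseteq> carrier M" "\<And>j. j \<in> J \<Longrightarrow> f j \<in> kspan A M B"
  shows "(\<Oplus>\<^bsub>M\<^esub>j\<in>J. f j) \<in> kspan A M B"
  using assms(1,3)
proof (induction J)
  case empty
  then show ?case by (simp add: kspan.zero)
next
  case (insert j J)
  then have "f \<in> J \<rightarrow> carrier M" "f j \<in> carrier M" using kspan_closed[OF assms(2)] by auto
  with insert show ?case by (auto simp: M.finsum_insert intro: kspan_add[OF assms(2)])
qed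

lemma kspan_iff_finsum:
  assumes "finite B" "B \<subseteq> carrier M"
  shows "x \<in> kspan A M B \<longleftrightarrow> (\<exists>c. x = (\<Oplus>\<^bsub>M\<^esub>b\<in>B. act M b (c b \<odot> \<one>)))"
proof
  assume "x \<in> kspan A M B"
  then show "\<exists>c. x = (\<Oplus>\<^bsub>M\<^esub>b\<in>B. act M b (c b \<odot> \<one>))"
  proof induction
    case zero
    have "\<zero>\<^bsub>M\<^esub> = (\<Oplus>\<^bsub>M\<^esub>b\<in>B. act M b (0 \<odot> \<one>))"
      using assms by (subst M.finsum_cong'[where g = "\<lambda>_. \<zero>\<^bsub>M\<^esub>"]) (auto simp: subset_iff)
    then show ?case by (rule exI[of _ "\<lambda>_. 0"])
  next
    case (step x b d)
    then obtain c where c: "x = (\<Oplus>\<^bsub>M\<^esub>b\<in>B. act M b (c b \<odot> \<one>))" by blast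
    have cl: "act M b' (c' \<odot> \<one>) \<in> carrier M" if "b' \<in> B" for b' c'
      using that assms by (auto intro!: M.act_closed)
    \<comment> \<open>The new summand is spread over \<open>B\<close> as a sum with a single nonzero
      term, so that coefficients can be added pointwise; this also covers a \<open>b\<close> that
      already occurs with a coefficient.\<close>
    have "x \<oplus>\<^bsub>M\<^esub> act M b (d \<odot> \<one>) = x \<oplus>\<^bsub>M\<^esub> (\<Oplus>\<^bsub>M\<^esub>b'\<in>B. if b = b' then act M b' (d \<odot> \<one>) else \<zero>\<^bsub>M\<^esub>)"
      using M.add.finprod_singleton[OF step(2) assms(1), of "\<lambda>b. act M b (d \<odot> \<one>)"] cl
      by (simp add: finsum_def)
    also have "\<dots> = (\<Oplus>\<^bsub>M\<^esub>b'\<in>B. act M b' (c b' \<odot> \<one>) \<oplus>\<^bsub>M\<^esub> (if b = b' then act M b' (d \<odot> \<one>) else \<zero>\<^bsub>M\<^esub>))"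
      unfolding c using cl by (intro M.finsum_addf[symmetric]) auto
    also have "\<dots> = (\<Oplus>\<^bsub>M\<^esub>b'\<in>B. act M b' ((c b' + (if b = b' then d else 0)) \<odot> \<one>))"
      using assms cl by (intro M.finsum_cong') (auto simp: scalar_add M.act_add_right subset_iff)
    finally show ?case by (rule exI[where x = "\<lambda>b'. c b' + (if b = b' then d else 0)"])
  qed
next
  assume "\<exists>c. x = (\<Oplus>\<^bsub>M\<^esub>b\<in>B. act M b (c b \<odot> \<one>))"
  then obtain c where "x = (\<Oplus>\<^bsub>M\<^esub>b\<in>B. act M b (c b \<odot> \<one>))" by blast
  then show "x \<in> kspan A M B"
    using assms by (auto intro!: kspan_finsum intro: kspan_scale kspan_superset)
qed

lemma kspan_insert:
  assumes "insert b B \<subseteq> carrier M" "x \<in> kspan A M (insert b B)"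
  shows "\<exists>u\<in>kspan A M B. \<exists>c. x = u \<oplus>\<^bsub>M\<^esub> act M b (c \<odot> \<one>)"
  using assms(2)
proof induction
  case zero
  show ?case using assms by (intro bexI[of _ "\<zero>\<^bsub>M\<^esub>"] exI[of _ 0]) (auto simp: kspan.zero)
next
  case (step x b' d)
  then obtain u c where u: "u \<in> kspan A M B" "x = u \<oplus>\<^bsub>M\<^esub> act M b (c \<odot> \<one>)" by blast
  have uM: "u \<in> carrier M" using u kspan_closed assms by auto
  have b: "b \<in> carrier M" "b' \<in> carrier M" using assms step by auto
  consider "b' = b" | "b' \<in> B" using step by blast
  then show ?case
  proof cases
    case 1
    have "x \<oplus>\<^bsub>M\<^esub> act M b' (d \<odot> \<one>) = u \<oplus>\<^bsub>M\<^esub> act M b ((c + d) \<odot> \<one>)"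
      using uM b by (simp add: u 1 scalar_add M.act_add_right M.a_assoc M.act_closed)
    then show ?thesis using u by blast
  next
    case 2
    have "x \<oplus>\<^bsub>M\<^esub> act M b' (d \<odot> \<one>) = (u \<oplus>\<^bsub>M\<^esub> act M b' (d \<odot> \<one>)) \<oplus>\<^bsub>M\<^esub> act M b (c \<odot> \<one>)"
      using uM b by (simp add: u M.a_ac M.act_closed)
    then show ?thesis using kspan.step[OF u(1) 2] by blast
  qed
qed

text \<open>Elimination: the part of \<open>W\<close> inside the span of \<open>B\<close> is covered
  by the induction hypothesis, and if \<open>W\<close> is not contained in that span, a single
  vector \<open>w\<close> of \<open>W\<close> with nonzero coefficient at \<open>b\<close> is enough
  to reach the rest.\<close>

lemma subspace_kspan:
  assumes "finite B" "B \<subseteq> carrier M" "W \<subseteq> kspan A M B" "\<zero>\<^bsub>M\<^esub> \<in> W"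
    "\<And>x y. x \<in> W \<Longrightarrow> y \<in> W \<Longrightarrow> x \<oplus>\<^bsub>M\<^esub> y \<in> W" "\<And>x c. x \<in> W \<Longrightarrow> act M x (c \<odot> \<one>) \<in> W"
  shows "\<exists>C. finite C \<and> C \<subseteq> W \<and> W \<subseteq> kspan A M C"
  using assms
proof (induction B arbitrary: W)
  case empty
  have "kspan A M {} = {\<zero>\<^bsub>M\<^esub>}" by (auto elim: kspan.cases intro: kspan.zero)
  with empty show ?case by (intro exI[of _ "{}"]) auto
next
  case (insert b B)
  have BM: "B \<subseteq> carrier M" and b: "b \<in> carrier M" using insert by auto
  have WM: "x \<in> carrier M" if "x \<in> W" for x
    using kspan_closed[OF insert.prems(1)] insert.prems(2) that by blast
  let ?U = "W \<inter> kspan A M B"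
  have "\<exists>C. finite C \<and> C \<subseteq> ?U \<and> ?U \<subseteq> kspan A M C"
  proof (rule insert.IH[OF BM])
    show "\<zero>\<^bsub>M\<^esub> \<in> ?U" using insert.prems(3) by (simp add: kspan.zero)
    show "x \<oplus>\<^bsub>M\<^esub> y \<in> ?U" if "x \<in> ?U" "y \<in> ?U" for x y
      using that insert.prems(4) kspan_add[OF BM] by simp
    show "act M x (c \<odot> \<one>) \<in> ?U" if "x \<in> ?U" for x c
      using that insert.prems(5) kspan_scale[OF BM] by simp
  qed simp
  then obtain C where C: "finite C" "C \<subseteq> ?U" "?U \<subseteq> kspan A M C" by blast
  show ?case
  proof (cases "W \<subseteq> kspan A M B")
    case True
    then show ?thesis using C by blast
  next
    case False
    then obtain w where w: "w \<in> W" "w \<notin> kspan A M B" by blast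
    then obtain u c where u: "u \<in> kspan A M B" "w = u \<oplus>\<^bsub>M\<^esub> act M b (c \<odot> \<one>)"
      using kspan_insert[OF insert.prems(1)] insert.prems(2) by blast
    have uM: "u \<in> carrier M" by (rule kspan_closed[OF BM u(1)])
    have c: "c \<noteq> 0" using w(2) u uM b by auto
    have ins: "insert w C \<subseteq> carrier M" using C w WM by auto
    have "W \<subseteq> kspan A M (insert w C)"
    proof
      fix x assume x: "x \<in> W"
      then obtain v d where v: "v \<in> kspan A M B" "x = v \<oplus>\<^bsub>M\<^esub> act M b (d \<odot> \<one>)"
        using kspan_insert[OF insert.prems(1)] insert.prems(2) by blast
      have vM: "v \<in> carrier M" by (rule kspan_closed[OF BM v(1)])
      \<comment> \<open>At \<open>b\<close> the vector \<open>x\<close> has coefficient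
        \<open>d\<close> and \<open>w\<close> has coefficient \<open>c\<close>, so adding this
        multiple of \<open>w\<close> to \<open>x\<close> cancels \<open>b\<close>.\<close>
      let ?y = "act M w ((- d / c) \<odot> \<one>)"
      have "act M b (d \<odot> \<one>) \<oplus>\<^bsub>M\<^esub> act M (act M b (c \<odot> \<one>)) ((- d / c) \<odot> \<one>)
          = act M b ((d + c * (- d / c)) \<odot> \<one>)"
        unfolding scalar_add scalar_mult using b by (simp add: M.act_add_right M.act_mult)
      also have "\<dots> = \<zero>\<^bsub>M\<^esub>" using c b by simp
      finally have "x \<oplus>\<^bsub>M\<^esub> ?y = v \<oplus>\<^bsub>M\<^esub> act M u ((- d / c) \<odot> \<one>)"
        unfolding v u(2) using uM vM b
        by (simp add: M.act_add_left M.act_closed M.a_ac)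
      also have "\<dots> \<in> kspan A M B" by (rule kspan_add[OF BM v(1) kspan_scale[OF BM u(1)]])
      finally have "x \<oplus>\<^bsub>M\<^esub> ?y \<in> ?U" using insert.prems(4,5) x w(1) by simp
      then have 1: "x \<oplus>\<^bsub>M\<^esub> ?y \<in> kspan A M (insert w C)" using C kspan_mono[of C "insert w C"] by blast
      have 2: "\<ominus>\<^bsub>M\<^esub> ?y \<in> kspan A M (insert w C)"
        by (rule kspan_inv[OF ins kspan_scale[OF ins kspan_superset[OF ins]]]) simp
      have "x = (x \<oplus>\<^bsub>M\<^esub> ?y) \<oplus>\<^bsub>M\<^esub> \<ominus>\<^bsub>M\<^esub> ?y"
        using WM x w by (simp add: M.a_assoc M.r_neg M.act_closed)
      then show "x \<in> kspan A M (insert w C)" using kspan_add[OF ins 1 2] by simp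
    qed
    moreover have "finite (insert w C)" "insert w C \<subseteq> W" using C(1,2) w(1) by auto
    ultimately show ?thesis by blast
  qed
qed

end

lemma fd_module_iff:
  "fd_module A M \<longleftrightarrow> right_module A M \<and> (\<exists>B. finite B \<and> B \<subseteq> carrier M \<and> carrier M \<subseteq> kspan A M B)"
proof (cases "right_module A M")
  case True
  have "carrier M \<subseteq> kspan A M B \<longleftrightarrow>
      (\<forall>m\<in>carrier M. \<exists>c. m = (\<Oplus>\<^bsub>M\<^esub>b\<in>B. act M b (c b \<odot> \<one>)))"
    if "finite B" "B \<subseteq> carrier M" for B
    using kspan_iff_finsum[OF True that] by blast
  then show ?thesis unfolding fd_module_def by (simp add: True cong: conj_cong)
qed (simp add: fd_module_def)

lemma fd_moduleI:
  assumes "right_module A M" "finite B" "B \<subseteq> carrier M" "carrier M \<subseteq> kspan A M B"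
  shows "fd_module A M"
  unfolding fd_module_iff using assms by blast

lemma fd_spanning:
  assumes "fd_module A M"
  obtains B where "finite B" "B \<subseteq> carrier M" "carrier M \<subseteq> kspan A M B"
  using assms unfolding fd_module_iff by blast

lemma fd_right_module: "fd_module A M \<Longrightarrow> right_module A M"
  by (simp add: fd_module_def)

text \<open>A submodule is in particular a subspace, so \<open>subspace_kspan\<close> supplies a
  finite spanning set inside \<open>H\<close>.\<close>

lemma fd_restrict:
  assumes "fd_module A M" "H \<subseteq> carrier M" "\<zero>\<^bsub>M\<^esub> \<in> H"
    "\<And>x y. x \<in> H \<Longrightarrow> y \<in> H \<Longrightarrow> x \<oplus>\<^bsub>M\<^esub> y \<in> H" "\<And>x a. x \<in> H \<Longrightarrow> a \<in> carrier A \<Longrightarrow> act M x a \<in> H"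
  shows "fd_module A (M\<lparr>carrier := H\<rparr>)"
proof -
  have M: "right_module A M" by (rule fd_right_module[OF assms(1)])
  have N: "right_module A (M\<lparr>carrier := H\<rparr>)" by (rule right_module_restrict[OF M assms(2-5)])
  obtain B where B: "finite B" "B \<subseteq> carrier M" "carrier M \<subseteq> kspan A M B"
    by (rule fd_spanning[OF assms(1)])
  obtain C where C: "finite C" "C \<subseteq> H" "H \<subseteq> kspan A M C"
    using subspace_kspan[OF M B(1,2) subset_trans[OF assms(2) B(3)] assms(3,4) assms(5)[OF _ scalar_closed]]
    by blast
  have "kspan A M C \<subseteq> kspan A (M\<lparr>carrier := H\<rparr>) C"
  proof
    fix x assume "x \<in> kspan A M C"
    then show "x \<in> kspan A (M\<lparr>carrier := H\<rparr>) C"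
    proof induction
      case zero
      then show ?case using kspan.zero[of "M\<lparr>carrier := H\<rparr>" A C] by simp
    next
      case (step x b c)
      then show ?case using kspan.step[of x A "M\<lparr>carrier := H\<rparr>" C b c] by simp
    qed
  qed
  then show ?thesis using C by (intro fd_moduleI[OF N C(1)]) auto
qed

lemma kspan_image:
  assumes "right_module A M" "right_module A N" "h \<in> mod_hom A M N" "B \<subseteq> carrier M" "x \<in> kspan A M B"
  shows "h x \<in> kspan A N (h ` B)"
  using assms(5)
proof induction
  case zero
  then show ?case using mod_hom_zero[OF _ _ assms(3)] assms by (simp add: right_module_group kspan.zero)
next
  case (step x b c)
  interpret M: right_module A M by fact
  have "x \<in> carrier M" "b \<in> carrier M" using kspan_closed[OF assms(1,4)] step assms by auto
  then show ?case
    using step kspan.step[of "h x" A N "h ` B" "h b" c] assms(3)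
    by (simp add: mod_hom_add[OF assms(3)] mod_hom_act[OF assms(3)] M.act_closed)
qed

lemma fd_image:
  assumes "fd_module A M" "right_module A N" "h \<in> mod_hom A M N" "h ` carrier M = carrier N"
  shows "fd_module A N"
proof -
  obtain B where B: "finite B" "B \<subseteq> carrier M" "carrier M \<subseteq> kspan A M B"
    by (rule fd_spanning[OF assms(1)])
  have "h x \<in> kspan A N (h ` B)" if "x \<in> carrier M" for x
    using kspan_image[OF fd_right_module[OF assms(1)] assms(2,3) B(2)] B(3) that by blast
  then have "carrier N \<subseteq> kspan A N (h ` B)" unfolding assms(4)[symmetric] by blast
  moreover have "h ` B \<subseteq> carrier N" using B(2) assms(4) by blast
  ultimately show ?thesis by (intro fd_moduleI[OF assms(2)]) (use B(1) in auto)
qed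

end

section \<open>Constructions on modules\<close>

lemma mod_hom_inverse:
  assumes "right_module A M" "f \<in> mod_hom A M N" "bij_betw f (carrier M) (carrier N)"
  shows "inv_into (carrier M) f \<in> mod_hom A N M"
proof -
  interpret M: right_module A M by fact
  have inj: "inj_on f (carrier M)" and im: "f ` carrier M = carrier N"
    using assms(3) by (auto simp: bij_betw_def)
  show ?thesis
  proof (rule mod_homI)
    fix x assume x: "x \<in> carrier N"
    then show "inv_into (carrier M) f x \<in> carrier M" using im by (metis inv_into_into)
  next
    fix x y assume "x \<in> carrier N" "y \<in> carrier N"
    then obtain u v where uv: "u \<in> carrier M" "v \<in> carrier M" "x = f u" "y = f v"
      using im by blast
    then have "f (u \<oplus>\<^bsub>M\<^esub> v) = x \<oplus>\<^bsub>N\<^esub> y" by (simp add: mod_hom_add[OF assms(2)])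
    then show "inv_into (carrier M) f (x \<oplus>\<^bsub>N\<^esub> y) =
        inv_into (carrier M) f x \<oplus>\<^bsub>M\<^esub> inv_into (carrier M) f y"
      using uv inj by (metis M.a_closed inv_into_f_f)
  next
    fix x a assume "x \<in> carrier N" and a: "a \<in> carrier A"
    then obtain u where u: "u \<in> carrier M" "x = f u" using im by blast
    then have "f (act M u a) = act N x a" using a by (simp add: mod_hom_act[OF assms(2)])
    then show "inv_into (carrier M) f (act N x a) = act M (inv_into (carrier M) f x) a"
      using u a inj by (metis M.act_closed inv_into_f_f)
  qed
qed

text \<open>Transport of structure along \<open>q\<close>, which need not be injective: operations
  are computed on chosen preimages. If the fibres of \<open>q\<close> form a congruence, this is the
  quotient module realised on the values of \<open>q\<close>. It serves for the copies by lists and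
  for the cokernel of \<open>f\<close>.\<close>

definition image_module :: "('m \<Rightarrow> 'n) \<Rightarrow> ('r, 'm) rmodule \<Rightarrow> ('r, 'n) rmodule" where
  "image_module q M =
    \<lparr>carrier = q ` carrier M, mult = undefined, one = undefined, zero = q \<zero>\<^bsub>M\<^esub>,
     add = (\<lambda>x y. q (inv_into (carrier M) q x \<oplus>\<^bsub>M\<^esub> inv_into (carrier M) q y)),
     act = (\<lambda>x a. q (act M (inv_into (carrier M) q x) a))\<rparr>"

lemma image_module_hom:
  assumes M: "right_module A M"
    and add: "\<And>x x' y y'. \<lbrakk>x \<in> carrier M; x' \<in> carrier M; y \<in> carrier M; y' \<in> carrier M;
      q x = q x'; q y = q y'\<rbrakk> \<Longrightarrow> q (x \<oplus>\<^bsub>M\<^esub> y) = q (x' \<oplus>\<^bsub>M\<^esub> y')"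
    and act: "\<And>x x' a. \<lbrakk>x \<in> carrier M; x' \<in> carrier M; q x = q x'; a \<in> carrier A\<rbrakk>
      \<Longrightarrow> q (act M x a) = q (act M x' a)"
  shows "right_module A (image_module q M)" and "q \<in> mod_hom A M (image_module q M)"
proof -
  interpret M: right_module A M by fact
  let ?N = "image_module q M"
  have inv: "inv_into (carrier M) q (q x) \<in> carrier M" "q (inv_into (carrier M) q (q x)) = q x"
    if "x \<in> carrier M" for x
    using that by (auto intro: inv_into_into f_inv_into_f)
  have car: "carrier ?N = q ` carrier M" and zero: "\<zero>\<^bsub>?N\<^esub> = q \<zero>\<^bsub>M\<^esub>"
    by (simp_all add: image_module_def)
  have add': "q x \<oplus>\<^bsub>?N\<^esub> q y = q (x \<oplus>\<^bsub>M\<^esub> y)" if "x \<in> carrier M" "y \<in> carrier M" for x y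
    unfolding image_module_def using add[OF inv(1) _ inv(1) _ inv(2) inv(2)] that by simp
  have act': "act ?N (q x) a = q (act M x a)" if "x \<in> carrier M" "a \<in> carrier A" for x a
    unfolding image_module_def using act[OF inv(1) _ inv(2)] that by simp
  show "q \<in> mod_hom A M ?N"
    by (rule mod_homI) (simp_all add: car add' act')
  have grp: "abelian_group ?N"
  proof (rule abelian_groupI)
    fix x y assume "x \<in> carrier ?N" "y \<in> carrier ?N"
    then obtain u v where uv: "u \<in> carrier M" "v \<in> carrier M" "x = q u" "y = q v"
      by (auto simp: car)
    then show "x \<oplus>\<^bsub>?N\<^esub> y \<in> carrier ?N" by (simp add: car add')
    show "x \<oplus>\<^bsub>?N\<^esub> y = y \<oplus>\<^bsub>?N\<^esub> x" using uv by (simp add: add' M.a_comm)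
    show "x \<oplus>\<^bsub>?N\<^esub> y \<oplus>\<^bsub>?N\<^esub> z = x \<oplus>\<^bsub>?N\<^esub> (y \<oplus>\<^bsub>?N\<^esub> z)" if z: "z \<in> carrier ?N" for z
    proof -
      obtain w where "w \<in> carrier M" "z = q w" using z unfolding car by blast
      then show ?thesis using uv by (simp add: add' M.a_assoc)
    qed
  next
    show "\<zero>\<^bsub>?N\<^esub> \<in> carrier ?N" by (simp add: car zero)
    fix x assume "x \<in> carrier ?N"
    then obtain u where u: "u \<in> carrier M" "x = q u" by (auto simp: car)
    then show "\<zero>\<^bsub>?N\<^esub> \<oplus>\<^bsub>?N\<^esub> x = x" by (simp add: zero add')
    have "q (\<ominus>\<^bsub>M\<^esub> u) \<oplus>\<^bsub>?N\<^esub> x = \<zero>\<^bsub>?N\<^esub>" using u by (simp add: zero add' M.l_neg)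
    then show "\<exists>y\<in>carrier ?N. y \<oplus>\<^bsub>?N\<^esub> x = \<zero>\<^bsub>?N\<^esub>" using u by (auto simp: car)
  qed
  show "right_module A ?N"
  proof (rule right_moduleI)
    show "ring A" by (rule M.A.ring_axioms)
    show "abelian_group ?N" by (rule grp)
  qed (auto simp: car add' act' M.act_add_left M.act_add_right M.act_mult M.act_one M.act_closed)
qed

text \<open>Any injection will do, since the module structure is transported along it; for
  finite-dimensional modules \<open>inj_on_list_embedding\<close> provides one.\<close>

definition list_embedding :: "('k::field, 'r) module \<Rightarrow> ('r, 'm) rmodule \<Rightarrow> 'm \<Rightarrow> 'k list" where
  "list_embedding A M = (SOME f. inj_on f (carrier M))"

definition list_copy :: "('k::field, 'r) module \<Rightarrow> ('r, 'm) rmodule \<Rightarrow> ('r, 'k list) rmodule" where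
  "list_copy A M = image_module (list_embedding A M) M"

section \<open>Direct sums and projective modules\<close>

lemma zero_submodule_simps [simp]:
  "carrier (zero_submodule M) = {\<zero>\<^bsub>M\<^esub>}" "\<zero>\<^bsub>zero_submodule M\<^esub> = \<zero>\<^bsub>M\<^esub>"
  "add (zero_submodule M) = add M" "act (zero_submodule M) = act M"
  by (simp_all add: zero_submodule_def)

lemma mod_sum_simps [simp]:
  "carrier (mod_sum M N) = carrier M \<times> carrier N"
  "\<zero>\<^bsub>mod_sum M N\<^esub> = (\<zero>\<^bsub>M\<^esub>, \<zero>\<^bsub>N\<^esub>)"
  "(x, y) \<oplus>\<^bsub>mod_sum M N\<^esub> (x', y') = (x \<oplus>\<^bsub>M\<^esub> x', y \<oplus>\<^bsub>N\<^esub> y')"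
  "act (mod_sum M N) (x, y) a = (act M x a, act N y a)"
  by (simp_all add: mod_sum_def)

lemma mod_bigsum_simps [simp]:
  "carrier (mod_bigsum J F) = (\<Pi>\<^sub>E i\<in>J. carrier (F i))"
  "\<zero>\<^bsub>mod_bigsum J F\<^esub> = (\<lambda>i\<in>J. \<zero>\<^bsub>F i\<^esub>)"
  "x \<oplus>\<^bsub>mod_bigsum J F\<^esub> y = (\<lambda>i\<in>J. x i \<oplus>\<^bsub>F i\<^esub> y i)"
  "act (mod_bigsum J F) x a = (\<lambda>i\<in>J. act (F i) (x i) a)"
  by (simp_all add: mod_bigsum_def)

lemma abelian_group_mod_sum:
  assumes "abelian_group M" "abelian_group N"
  shows "abelian_group (mod_sum M N)"
proof -
  interpret M: abelian_group M by fact
  interpret N: abelian_group N by fact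
  show ?thesis
  proof (rule abelian_groupI)
    fix x assume "x \<in> carrier (mod_sum M N)"
    then obtain u v where u: "x = (u, v)" "u \<in> carrier M" "v \<in> carrier N" by auto
    then have "(\<ominus>\<^bsub>M\<^esub> u, \<ominus>\<^bsub>N\<^esub> v) \<oplus>\<^bsub>mod_sum M N\<^esub> x = \<zero>\<^bsub>mod_sum M N\<^esub>" by (simp add: M.l_neg N.l_neg)
    then show "\<exists>y\<in>carrier (mod_sum M N). y \<oplus>\<^bsub>mod_sum M N\<^esub> x = \<zero>\<^bsub>mod_sum M N\<^esub>" using u by auto
  next
    fix x y assume "x \<in> carrier (mod_sum M N)" "y \<in> carrier (mod_sum M N)"
    then show "x \<oplus>\<^bsub>mod_sum M N\<^esub> y = y \<oplus>\<^bsub>mod_sum M N\<^esub> x" by (auto simp: M.a_comm N.a_comm)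
  qed (auto simp: M.a_assoc N.a_assoc)
qed

lemma right_module_mod_sum:
  assumes "right_module A M" "right_module A N"
  shows "right_module A (mod_sum M N)"
proof -
  interpret M: right_module A M by fact
  interpret N: right_module A N by fact
  show ?thesis
  proof (rule right_moduleI)
    show "ring A" by (rule M.A.ring_axioms)
    show "abelian_group (mod_sum M N)" using assms by (simp add: abelian_group_mod_sum right_module_group)
  qed (auto simp: M.act_add_left M.act_add_right M.act_mult M.act_one M.act_closed
      N.act_add_left N.act_add_right N.act_mult N.act_one N.act_closed)
qed

lemma right_module_mod_bigsum:
  assumes "ring A" "\<And>j. j \<in> J \<Longrightarrow> right_module A (F j)"
  shows "right_module A (mod_bigsum J F)"
proof (rule right_moduleI)
  have grp: "abelian_group (F j)" if "j \<in> J" for j using assms(2)[OF that] by (rule right_module_group)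
  have gm: "abelian_monoid (F j)" if "j \<in> J" for j using grp[OF that] by (simp add: abelian_group_def)
  show "ring A" by fact
  show "abelian_group (mod_bigsum J F)"
  proof (rule abelian_groupI)
    fix x assume x: "x \<in> carrier (mod_bigsum J F)"
    have "(\<lambda>j\<in>J. \<ominus>\<^bsub>F j\<^esub> x j) \<oplus>\<^bsub>mod_bigsum J F\<^esub> x = \<zero>\<^bsub>mod_bigsum J F\<^esub>"
      using x by (auto simp: PiE_iff intro!: restrict_ext abelian_group.l_neg[OF grp])
    moreover have "(\<lambda>j\<in>J. \<ominus>\<^bsub>F j\<^esub> x j) \<in> carrier (mod_bigsum J F)"
      using x by (auto simp: PiE_iff intro!: abelian_group.a_inv_closed[OF grp])
    ultimately show "\<exists>y\<in>carrier (mod_bigsum J F). y \<oplus>\<^bsub>mod_bigsum J F\<^esub> x = \<zero>\<^bsub>mod_bigsum J F\<^esub>" by blast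
    show "\<zero>\<^bsub>mod_bigsum J F\<^esub> \<oplus>\<^bsub>mod_bigsum J F\<^esub> x = x"
      using x by (auto simp: PiE_iff extensional_def intro!: ext abelian_monoid.l_zero[OF gm])
  next
    fix x y assume "x \<in> carrier (mod_bigsum J F)" "y \<in> carrier (mod_bigsum J F)"
    then show "x \<oplus>\<^bsub>mod_bigsum J F\<^esub> y = y \<oplus>\<^bsub>mod_bigsum J F\<^esub> x"
      by (auto simp: PiE_iff intro!: restrict_ext abelian_monoid.a_comm[OF gm])
  qed (auto simp: PiE_iff intro!: restrict_ext abelian_monoid.a_closed[OF gm]
      abelian_monoid.zero_closed[OF gm] abelian_monoid.a_assoc[OF gm])
qed (auto simp: PiE_iff extensional_def
    intro!: restrict_ext ext right_module.act_closed[OF assms(2)] right_module.act_add_left[OF assms(2)]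
      right_module.act_add_right[OF assms(2)] right_module.act_mult[OF assms(2)]
      right_module.act_one[OF assms(2)])

lemma mod_hom_pair:
  assumes "f \<in> mod_hom A L M" "g \<in> mod_hom A L N"
  shows "(\<lambda>x. (f x, g x)) \<in> mod_hom A L (mod_sum M N)"
  using assms by (auto simp: mod_hom_def Pi_iff)

lemma mod_hom_fst: "fst \<in> mod_hom A (mod_sum M N) M"
  and mod_hom_snd: "snd \<in> mod_hom A (mod_sum M N) N"
  by (auto simp: mod_hom_def)

lemma mod_hom_map_prod:
  assumes "f \<in> mod_hom A M M'" "g \<in> mod_hom A N N'"
  shows "(\<lambda>(x, y). (f x, g y)) \<in> mod_hom A (mod_sum M N) (mod_sum M' N')"
  using assms by (auto simp: mod_hom_def Pi_iff)

lemma mod_hom_plus: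
  assumes "right_module A N" "f \<in> mod_hom A M N" "g \<in> mod_hom A M N"
  shows "(\<lambda>x. f x \<oplus>\<^bsub>N\<^esub> g x) \<in> mod_hom A M N"
proof -
  interpret N: right_module A N by fact
  show ?thesis
    using mod_hom_closed[OF assms(2)] mod_hom_closed[OF assms(3)]
    by (intro mod_homI)
      (simp_all add: mod_hom_add[OF assms(2)] mod_hom_add[OF assms(3)] mod_hom_act[OF assms(2)]
        mod_hom_act[OF assms(3)] N.act_add_left N.a_ac)
qed

lemma mod_hom_neg:
  assumes "right_module A N" "f \<in> mod_hom A M N"
  shows "(\<lambda>x. \<ominus>\<^bsub>N\<^esub> f x) \<in> mod_hom A M N"
proof -
  interpret N: right_module A N by fact
  show ?thesis
    using mod_hom_closed[OF assms(2)]
    by (intro mod_homI)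
      (simp_all add: mod_hom_add[OF assms(2)] mod_hom_act[OF assms(2)] N.act_inv_left N.minus_add)
qed

lemma mod_hom_case_sum:
  assumes "right_module A L" "f \<in> mod_hom A M L" "g \<in> mod_hom A N L"
  shows "(\<lambda>(x, y). f x \<oplus>\<^bsub>L\<^esub> g y) \<in> mod_hom A (mod_sum M N) L"
  using mod_hom_plus[OF assms(1) mod_hom_comp[OF assms(2) mod_hom_fst] mod_hom_comp[OF assms(3) mod_hom_snd]]
  by (simp add: split_def)

lemma mod_hom_inl: "right_module A M \<Longrightarrow> right_module A N \<Longrightarrow>
    (\<lambda>x. (x, \<zero>\<^bsub>N\<^esub>)) \<in> mod_hom A M (mod_sum M N)"
  and mod_hom_inr: "right_module A M \<Longrightarrow> right_module A N \<Longrightarrow>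
    (\<lambda>y. (\<zero>\<^bsub>M\<^esub>, y)) \<in> mod_hom A N (mod_sum M N)"
  by (rule mod_hom_pair; intro mod_hom_id right_module.zero_hom; assumption)+

lemma mod_hom_bigsum:
  assumes "\<And>j. j \<in> J \<Longrightarrow> h j \<in> mod_hom A M (F j)"
  shows "(\<lambda>x. \<lambda>j\<in>J. h j x) \<in> mod_hom A M (mod_bigsum J F)"
proof (rule mod_homI)
  fix x y assume x: "x \<in> carrier M" and y: "y \<in> carrier M"
  show "(\<lambda>j\<in>J. h j x) \<in> carrier (mod_bigsum J F)"
    using mod_hom_closed[OF assms x] by auto
  show "(\<lambda>j\<in>J. h j (x \<oplus>\<^bsub>M\<^esub> y)) = (\<lambda>j\<in>J. h j x) \<oplus>\<^bsub>mod_bigsum J F\<^esub> (\<lambda>j\<in>J. h j y)"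
    using mod_hom_add[OF assms x y] by (auto intro!: restrict_ext)
next
  fix x a assume "x \<in> carrier M" "a \<in> carrier A"
  then show "(\<lambda>j\<in>J. h j (act M x a)) = act (mod_bigsum J F) (\<lambda>j\<in>J. h j x) a"
    using mod_hom_act[OF assms] by (auto intro!: restrict_ext)
qed

lemma mod_hom_component: "j \<in> J \<Longrightarrow> (\<lambda>y. y j) \<in> mod_hom A (mod_bigsum J F) (F j)"
  by (auto simp: mod_hom_def)

text \<open>The step of the inductions over index sets; it also splits a single \<open>P_i\<close>
  off the sum of all \<open>P_j\<close> with \<open>j \<noteq> k\<close>.\<close>

lemma bigsum_split:
  assumes "j \<notin> J"
  shows "(\<lambda>y. (y j, restrict y J)) \<in> mod_hom A (mod_bigsum (insert j J) F) (mod_sum (F j) (mod_bigsum J F))"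
    and "bij_betw (\<lambda>y. (y j, restrict y J)) (carrier (mod_bigsum (insert j J) F))
      (carrier (mod_sum (F j) (mod_bigsum J F)))"
proof -
  have "(\<lambda>y. restrict y J) \<in> mod_hom A (mod_bigsum (insert j J) F) (mod_bigsum J F)"
    by (rule mod_hom_bigsum[of J "\<lambda>i y. y i"]) (auto intro: mod_hom_component)
  then show "(\<lambda>y. (y j, restrict y J)) \<in> mod_hom A (mod_bigsum (insert j J) F) (mod_sum (F j) (mod_bigsum J F))"
    by (intro mod_hom_pair mod_hom_component) auto
  show "bij_betw (\<lambda>y. (y j, restrict y J)) (carrier (mod_bigsum (insert j J) F))
      (carrier (mod_sum (F j) (mod_bigsum J F)))"
  proof (rule bij_betwI)
    show "(\<lambda>(z, w). w(j := z)) \<in> carrier (mod_sum (F j) (mod_bigsum J F)) \<rightarrow> carrier (mod_bigsum (insert j J) F)"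
      by (auto simp: PiE_iff extensional_def split: if_splits)
    show "(case (y j, restrict y J) of (z, w) \<Rightarrow> w(j := z)) = y"
      if "y \<in> carrier (mod_bigsum (insert j J) F)" for y
      using that by (auto simp: PiE_iff extensional_def)
    show "((case y of (z, w) \<Rightarrow> w(j := z)) j, restrict (case y of (z, w) \<Rightarrow> w(j := z)) J) = y"
      if "y \<in> carrier (mod_sum (F j) (mod_bigsum J F))" for y
      using that assms by (auto simp: PiE_iff extensional_def)
  qed auto
qed

lemma mod_isoE:
  assumes "mod_iso A M N" "right_module A M"
  obtains f g where "f \<in> mod_hom A M N" "g \<in> mod_hom A N M" "bij_betw f (carrier M) (carrier N)"
    "\<And>x. x \<in> carrier M \<Longrightarrow> g (f x) = x" "\<And>y. y \<in> carrier N \<Longrightarrow> f (g y) = y"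
proof -
  obtain f where f: "f \<in> mod_hom A M N" "bij_betw f (carrier M) (carrier N)"
    using assms(1) by (auto simp: mod_iso_def)
  show ?thesis
    by (rule that[OF f(1) mod_hom_inverse[OF assms(2) f] f(2)])
      (use f(2) in \<open>auto simp: bij_betw_def intro: f_inv_into_f\<close>)
qed

lemma mod_iso_sym: "mod_iso A M N \<Longrightarrow> right_module A M \<Longrightarrow> mod_iso A N M"
  unfolding mod_iso_def using mod_hom_inverse bij_betw_inv_into by blast

lemma mod_iso_bigsum_insert:
  "j \<notin> J \<Longrightarrow> mod_iso A (mod_bigsum (insert j J) F) (mod_sum (F j) (mod_bigsum J F))"
  unfolding mod_iso_def by (intro bexI[where x = "\<lambda>y. (y j, restrict y J)"] bigsum_split)

lemma projective_iso:
  fixes A :: "('k::field, 'r) module" and P :: "('r, 'm) rmodule" and P' :: "('r, 'n) rmodule"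
  assumes "projective A P" "mod_iso A P P'" "right_module A P'"
  shows "projective A P'"
proof -
  have P: "right_module A P" using assms(1) by (simp add: projective_def)
  obtain f g where f: "f \<in> mod_hom A P P'" and g: "g \<in> mod_hom A P' P"
    and fg: "\<And>y. y \<in> carrier P' \<Longrightarrow> f (g y) = y"
    using mod_isoE[OF assms(2) P] by metis
  show ?thesis unfolding projective_def
  proof (intro conjI allI impI)
    show "right_module A P'" by fact
    fix M N :: "('r, 'k list) rmodule" and p h
    assume *: "fd_module A M \<and> fd_module A N \<and> p \<in> mod_hom A M N \<and>
       p ` carrier M = carrier N \<and> h \<in> mod_hom A P' N"
    then have "(\<lambda>x. h (f x)) \<in> mod_hom A P N" using mod_hom_comp f by blast
    with * assms(1) obtain l where l: "l \<in> mod_hom A P M" "\<forall>x\<in>carrier P. p (l x) = h (f x)"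
      unfolding projective_def by blast
    have "\<forall>x\<in>carrier P'. p (l (g x)) = h x" using l(2) fg mod_hom_closed[OF g] by simp
    then show "\<exists>l\<in>mod_hom A P' M. \<forall>x\<in>carrier P'. p (l x) = h x"
      by (rule bexI[OF _ mod_hom_comp[OF l(1) g]])
  qed
qed

lemma projective_mod_sum:
  fixes A :: "('k::field, 'r) module" and P :: "('r, 'm) rmodule" and P' :: "('r, 'n) rmodule"
  assumes "projective A P" "projective A P'"
  shows "projective A (mod_sum P P')"
proof -
  have P: "right_module A P" "right_module A P'" using assms by (simp_all add: projective_def)
  interpret P: right_module A P by fact
  interpret P': right_module A P' by fact
  show ?thesis unfolding projective_def
  proof (intro conjI allI impI)
    show "right_module A (mod_sum P P')" using P by (rule right_module_mod_sum)
    fix M N :: "('r, 'k list) rmodule" and p h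
    assume *: "fd_module A M \<and> fd_module A N \<and> p \<in> mod_hom A M N \<and>
       p ` carrier M = carrier N \<and> h \<in> mod_hom A (mod_sum P P') N"
    have M: "right_module A M" using * by (auto simp: fd_module_def)
    have p: "p \<in> mod_hom A M N" and h: "h \<in> mod_hom A (mod_sum P P') N" using * by auto
    obtain l where l: "l \<in> mod_hom A P M" "\<forall>x\<in>carrier P. p (l x) = h (x, \<zero>\<^bsub>P'\<^esub>)"
      using * assms(1) mod_hom_comp[OF h mod_hom_inl[OF P]] unfolding projective_def by blast
    obtain l' where l': "l' \<in> mod_hom A P' M" "\<forall>x\<in>carrier P'. p (l' x) = h (\<zero>\<^bsub>P\<^esub>, x)"
      using * assms(2) mod_hom_comp[OF h mod_hom_inr[OF P]] unfolding projective_def by blast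
    have "p (l x \<oplus>\<^bsub>M\<^esub> l' y) = h (x, y)" if "x \<in> carrier P" "y \<in> carrier P'" for x y
      using that l(2) l'(2) mod_hom_add[OF h, of "(x, \<zero>\<^bsub>P'\<^esub>)" "(\<zero>\<^bsub>P\<^esub>, y)"]
      by (simp add: mod_hom_add[OF p] mod_hom_closed[OF l(1)] mod_hom_closed[OF l'(1)])
    then show "\<exists>l\<in>mod_hom A (mod_sum P P') M. \<forall>x\<in>carrier (mod_sum P P'). p (l x) = h x"
      using mod_hom_case_sum[OF M l(1) l'(1)] by (intro bexI) auto
  qed
qed

lemma projective_trivial:
  fixes A :: "('k::field, 'r) module" and P :: "('r, 'm) rmodule"
  assumes "right_module A P" "carrier P = {\<zero>\<^bsub>P\<^esub>}"
  shows "projective A P"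
  unfolding projective_def
proof (intro conjI allI impI)
  show "right_module A P" by fact
  fix M N :: "('r, 'k list) rmodule" and p h
  assume *: "fd_module A M \<and> fd_module A N \<and> p \<in> mod_hom A M N \<and>
     p ` carrier M = carrier N \<and> h \<in> mod_hom A P N"
  then have M: "right_module A M" and N: "right_module A N" by (auto simp: fd_module_def)
  have "p \<zero>\<^bsub>M\<^esub> = \<zero>\<^bsub>N\<^esub>" "h \<zero>\<^bsub>P\<^esub> = \<zero>\<^bsub>N\<^esub>"
    using * by (auto intro!: mod_hom_zero right_module_group M N assms(1))
  then have "\<forall>x\<in>carrier P. p \<zero>\<^bsub>M\<^esub> = h x" by (simp add: assms(2))
  then show "\<exists>l\<in>mod_hom A P M. \<forall>x\<in>carrier P. p (l x) = h x"
    by (rule bexI[OF _ right_module.zero_hom[OF M]])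
qed

lemma right_module_zero_submodule:
  assumes "right_module A M"
  shows "right_module A (zero_submodule M)"
proof -
  interpret M: right_module A M by fact
  show ?thesis unfolding zero_submodule_def by (rule right_module_restrict[OF assms]) auto
qed

lemma projective_mod_bigsum:
  assumes "ring A" "finite J" "\<And>j. j \<in> J \<Longrightarrow> projective A (F j)"
  shows "projective A (mod_bigsum J F)"
  using assms(2,3)
proof (induction J)
  case empty
  then show ?case by (intro projective_trivial right_module_mod_bigsum[OF assms(1)]) auto
next
  case (insert j J)
  have R: "right_module A (mod_bigsum (insert j J) F)"
    using insert.prems by (intro right_module_mod_bigsum[OF assms(1)]) (simp add: projective_def)
  have "projective A (mod_sum (F j) (mod_bigsum J F))"
    using insert.IH insert.prems by (intro projective_mod_sum) simp_all
  then show ?case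
    by (rule projective_iso[OF _ mod_iso_sym[OF mod_iso_bigsum_insert[OF insert.hyps(2)] R] R])
qed

section \<open>Copies by lists of scalars, sums, and lifting against arbitrary modules\<close>

context fd_algebra
begin

text \<open>An element is recovered from the list of its coefficients with respect to a finite
  spanning set; one choice of coefficients per element is enough for that.\<close>

lemma inj_on_list_embedding:
  assumes "fd_module A M"
  shows "inj_on (list_embedding A M) (carrier M)"
proof -
  obtain B where B: "finite B" "B \<subseteq> carrier M" "carrier M \<subseteq> kspan A M B"
    by (rule fd_spanning[OF assms])
  obtain bs where bs: "set bs = B" using B(1) finite_list by blast
  have "\<exists>c. m = (\<Oplus>\<^bsub>M\<^esub>b\<in>B. act M b (c b \<odot> \<one>))" if "m \<in> carrier M" for m
    using that kspan_iff_finsum[OF fd_right_module[OF assms] B(1,2)] B(3) by blast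
  then obtain c where c: "\<And>m. m \<in> carrier M \<Longrightarrow> m = (\<Oplus>\<^bsub>M\<^esub>b\<in>B. act M b (c m b \<odot> \<one>))"
    by metis
  interpret M: right_module A M by (rule fd_right_module[OF assms])
  have "inj_on (\<lambda>m. map (c m) bs) (carrier M)"
  proof (rule inj_onI)
    fix x y assume xy: "x \<in> carrier M" "y \<in> carrier M" "map (c x) bs = map (c y) bs"
    then have eq: "c x b = c y b" if "b \<in> B" for b using that bs by auto
    have "x = (\<Oplus>\<^bsub>M\<^esub>b\<in>B. act M b (c x b \<odot> \<one>))" by (rule c[OF xy(1)])
    also have "\<dots> = (\<Oplus>\<^bsub>M\<^esub>b\<in>B. act M b (c y b \<odot> \<one>))"
      using eq B(2) by (intro M.finsum_cong') (auto intro!: M.act_closed)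
    also have "\<dots> = y" by (rule c[OF xy(2), symmetric])
    finally show "x = y" .
  qed
  then show ?thesis unfolding list_embedding_def by (rule someI[where P = "\<lambda>f. inj_on f (carrier M)"])
qed

lemma list_copy:
  assumes "fd_module A M"
  defines "f \<equiv> list_embedding A M"
  shows "fd_module A (list_copy A M)" "f \<in> mod_hom A M (list_copy A M)"
    "bij_betw f (carrier M) (carrier (list_copy A M))"
proof -
  note inj = inj_on_list_embedding[OF assms(1), folded f_def]
  have *: "right_module A (image_module f M)" "f \<in> mod_hom A M (image_module f M)"
    by (rule image_module_hom[OF fd_right_module[OF assms(1)]]; use inj in \<open>auto dest: inj_onD\<close>)+
  then show "f \<in> mod_hom A M (list_copy A M)" by (simp add: list_copy_def f_def)
  show "bij_betw f (carrier M) (carrier (list_copy A M))"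
    using inj by (simp add: list_copy_def f_def image_module_def bij_betw_def)
  show "fd_module A (list_copy A M)"
    using fd_image[OF assms(1) *] by (simp add: list_copy_def f_def image_module_def)
qed

lemma fd_iso:
  assumes "fd_module A M" "mod_iso A M N" "right_module A N"
  shows "fd_module A N"
  using assms fd_image[OF assms(1,3)] by (auto simp: mod_iso_def bij_betw_def)

lemma fd_mod_sum:
  assumes "fd_module A M" "fd_module A N"
  shows "fd_module A (mod_sum M N)"
proof -
  obtain B where B: "finite B" "B \<subseteq> carrier M" "carrier M \<subseteq> kspan A M B"
    by (rule fd_spanning[OF assms(1)])
  obtain C where C: "finite C" "C \<subseteq> carrier N" "carrier N \<subseteq> kspan A N C"
    by (rule fd_spanning[OF assms(2)])
  note M = fd_right_module[OF assms(1)] and N = fd_right_module[OF assms(2)]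
  interpret M: right_module A M by (rule M)
  interpret N: right_module A N by (rule N)
  note S = right_module_mod_sum[OF M N]
  let ?D = "(\<lambda>x. (x, \<zero>\<^bsub>N\<^esub>)) ` B \<union> (\<lambda>y. (\<zero>\<^bsub>M\<^esub>, y)) ` C"
  have D: "?D \<subseteq> carrier (mod_sum M N)" using B(2) C(2) by auto
  have "(x, y) \<in> kspan A (mod_sum M N) ?D" if "x \<in> carrier M" "y \<in> carrier N" for x y
  proof -
    have "(x, \<zero>\<^bsub>N\<^esub>) \<in> kspan A (mod_sum M N) ?D"
      using kspan_image[OF M S mod_hom_inl[OF M N] B(2)] B(3) that(1)
        kspan_mono[of "(\<lambda>x. (x, \<zero>\<^bsub>N\<^esub>)) ` B" ?D] by blast
    moreover have "(\<zero>\<^bsub>M\<^esub>, y) \<in> kspan A (mod_sum M N) ?D"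
      using kspan_image[OF N S mod_hom_inr[OF M N] C(2)] C(3) that(2)
        kspan_mono[of "(\<lambda>y. (\<zero>\<^bsub>M\<^esub>, y)) ` C" ?D] by blast
    ultimately show ?thesis using kspan_add[OF S D, of "(x, \<zero>\<^bsub>N\<^esub>)" "(\<zero>\<^bsub>M\<^esub>, y)"] that by simp
  qed
  then show ?thesis using B(1) C(1) D by (intro fd_moduleI[OF S, of ?D]) auto
qed

lemma fd_trivial:
  assumes "right_module A M" "carrier M = {\<zero>\<^bsub>M\<^esub>}"
  shows "fd_module A M"
  by (rule fd_moduleI[OF assms(1), of "{}"]) (use assms(2) in \<open>auto intro: kspan.zero\<close>)

lemma fd_zero_submodule: "right_module A M \<Longrightarrow> fd_module A (zero_submodule M)"
  by (rule fd_trivial[OF right_module_zero_submodule]) auto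

lemma fd_mod_bigsum:
  assumes "finite J" "\<And>j. j \<in> J \<Longrightarrow> fd_module A (F j)"
  shows "fd_module A (mod_bigsum J F)"
  using assms
proof (induction J)
  case empty
  then show ?case by (intro fd_trivial right_module_mod_bigsum ring_axioms) auto
next
  case (insert j J)
  have R: "right_module A (mod_bigsum (insert j J) F)"
    using insert.prems by (intro right_module_mod_bigsum ring_axioms) (simp add: fd_right_module)
  have "fd_module A (mod_sum (F j) (mod_bigsum J F))"
    using insert.IH insert.prems by (intro fd_mod_sum) simp_all
  then show ?case
    by (rule fd_iso[OF _ mod_iso_sym[OF mod_iso_bigsum_insert[OF insert.hyps(2)] R] R])
qed

text \<open>
  By definition a projective module lifts maps to modules of lists along surjections; it follows
  that it lifts maps to arbitrary modules, as soon as their image is contained in the image of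
  the map that one lifts along.
\<close>

lemma projective_lift:
  assumes P: "projective A P" "fd_module A P" and N: "fd_module A N" and V: "fd_module A V"
    and g: "g \<in> mod_hom A N V" and h: "h \<in> mod_hom A P V"
    and im: "h ` carrier P \<subseteq> g ` carrier N"
  shows "\<exists>l\<in>mod_hom A P N. \<forall>x\<in>carrier P. g (l x) = h x"
proof -
  \<comment> \<open>Cutting \<open>V\<close> down to the image of \<open>h\<close>, and
    \<open>N\<close> to the preimage of that image under \<open>g\<close>, makes \<open>g\<close>
    surjective; the lifting property is then applied to list copies of the two.\<close>
  let ?V = "V\<lparr>carrier := h ` carrier P\<rparr>"
  let ?N = "N\<lparr>carrier := {x \<in> carrier N. g x \<in> h ` carrier P}\<rparr>"
  interpret P: right_module A P by (rule fd_right_module[OF P(2)])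
  interpret N: right_module A N by (rule fd_right_module[OF N])
  interpret V: right_module A V by (rule fd_right_module[OF V])
  have h0: "h \<zero>\<^bsub>P\<^esub> = \<zero>\<^bsub>V\<^esub>" and g0: "g \<zero>\<^bsub>N\<^esub> = \<zero>\<^bsub>V\<^esub>"
    using mod_hom_zero[OF _ _ h] mod_hom_zero[OF _ _ g]
    by (simp_all add: P.M.abelian_group_axioms V.M.abelian_group_axioms N.M.abelian_group_axioms)
  have hP: "h x \<oplus>\<^bsub>V\<^esub> h y \<in> h ` carrier P" "act V (h x) a \<in> h ` carrier P"
    if "x \<in> carrier P" "y \<in> carrier P" "a \<in> carrier A" for x y a
    using that mod_hom_add[OF h] mod_hom_act[OF h] by (metis P.a_closed P.act_closed imageI)+
  have z: "\<zero>\<^bsub>V\<^esub> \<in> h ` carrier P" using h0 by (metis P.zero_closed imageI)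
  have hadd: "u \<oplus>\<^bsub>V\<^esub> v \<in> h ` carrier P" if "u \<in> h ` carrier P" "v \<in> h ` carrier P" for u v
    using that hP(1)[OF _ _ zero_closed] by blast
  have hact: "act V u a \<in> h ` carrier P" if "u \<in> h ` carrier P" "a \<in> carrier A" for u a
    using that hP(2) by blast
  have V': "fd_module A ?V"
    using mod_hom_closed[OF h] by (intro fd_restrict[OF V] z hadd hact) auto
  have N': "fd_module A ?N"
  proof (rule fd_restrict[OF N])
    show "\<zero>\<^bsub>N\<^esub> \<in> {x \<in> carrier N. g x \<in> h ` carrier P}" using g0 z by simp
    show "x \<oplus>\<^bsub>N\<^esub> y \<in> {x \<in> carrier N. g x \<in> h ` carrier P}"
      if "x \<in> {x \<in> carrier N. g x \<in> h ` carrier P}" "y \<in> {x \<in> carrier N. g x \<in> h ` carrier P}" for x y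
      using that hadd by (simp add: mod_hom_add[OF g])
    show "act N x a \<in> {x \<in> carrier N. g x \<in> h ` carrier P}"
      if "x \<in> {x \<in> carrier N. g x \<in> h ` carrier P}" "a \<in> carrier A" for x a
      using that hact by (simp add: mod_hom_act[OF g] N.act_closed)
  qed auto
  let ?i = "list_embedding A ?N" and ?j = "list_embedding A ?V"
  let ?k = "inv_into (carrier ?N) ?i"
  note cN = list_copy[OF N'] and cV = list_copy[OF V']
  have g': "g \<in> mod_hom A ?N ?V"
    by (rule mod_homI) (simp_all add: mod_hom_add[OF g] mod_hom_act[OF g])
  have h': "h \<in> mod_hom A P ?V"
    by (rule mod_homI) (simp_all add: mod_hom_add[OF h] mod_hom_act[OF h])
  have k: "?k \<in> mod_hom A (list_copy A ?N) ?N"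
    by (rule mod_hom_inverse[OF fd_right_module[OF N'] cN(2,3)])
  have G: "(\<lambda>x. ?j (g (?k x))) \<in> mod_hom A (list_copy A ?N) (list_copy A ?V)"
    by (rule mod_hom_comp[OF cV(2) mod_hom_comp[OF g' k]])
  have H: "(\<lambda>x. ?j (h x)) \<in> mod_hom A P (list_copy A ?V)" by (rule mod_hom_comp[OF cV(2) h'])
  have kim: "?k ` carrier (list_copy A ?N) = carrier ?N"
    using bij_betw_inv_into[OF cN(3)] by (rule bij_betw_imp_surj_on)
  have gim: "g ` carrier ?N = carrier ?V" using im by force
  have "(\<lambda>x. ?j (g (?k x))) ` carrier (list_copy A ?N) = ?j ` g ` ?k ` carrier (list_copy A ?N)"
    by (simp add: image_image)
  also have "\<dots> = carrier (list_copy A ?V)"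
    unfolding kim gim using cV(3) by (rule bij_betw_imp_surj_on)
  finally obtain l where l: "l \<in> mod_hom A P (list_copy A ?N)"
      "\<forall>x\<in>carrier P. ?j (g (?k (l x))) = ?j (h x)"
    using P(1) cN(1) cV(1) G H unfolding projective_def by blast
  have kl: "(\<lambda>x. ?k (l x)) \<in> mod_hom A P ?N" by (rule mod_hom_comp[OF k l(1)])
  have "g (?k (l x)) = h x" if x: "x \<in> carrier P" for x
    by (rule inj_onD[OF bij_betw_imp_inj_on[OF cV(3)] bspec[OF l(2) x]
      mod_hom_closed[OF mod_hom_comp[OF g' kl] x] mod_hom_closed[OF h' x]])
  then have "\<forall>x\<in>carrier P. g (?k (l x)) = h x" by blast
  moreover have "(\<lambda>x. ?k (l x)) \<in> mod_hom A P N"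
    using kl by (auto simp: mod_hom_def)
  ultimately show ?thesis by (rule bexI)
qed

end

section \<open>Complexes\<close>

text \<open>Serves both for the boundaries of a complex and for the ideal \<open>I\<close>.\<close>

lemma a_coset_eq_iff:
  assumes G: "abelian_group G" and H: "H \<subseteq> carrier G" "\<zero>\<^bsub>G\<^esub> \<in> H"
    "\<And>x y. x \<in> H \<Longrightarrow> y \<in> H \<Longrightarrow> x \<oplus>\<^bsub>G\<^esub> y \<in> H" "\<And>x. x \<in> H \<Longrightarrow> \<ominus>\<^bsub>G\<^esub> x \<in> H"
    and x: "x \<in> carrier G" and y: "y \<in> carrier G"
  shows "H +>\<^bsub>G\<^esub> x = H +>\<^bsub>G\<^esub> y \<longleftrightarrow> x \<ominus>\<^bsub>G\<^esub> y \<in> H"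
proof -
  interpret G: abelian_group G by fact
  have sub: "H +>\<^bsub>G\<^esub> u \<subseteq> H +>\<^bsub>G\<^esub> v" if uv: "u \<in> carrier G" "v \<in> carrier G" "u \<ominus>\<^bsub>G\<^esub> v \<in> H" for u v
  proof
    fix z assume "z \<in> H +>\<^bsub>G\<^esub> u"
    then obtain h where h: "h \<in> H" "z = h \<oplus>\<^bsub>G\<^esub> u" by (auto simp: a_r_coset_def')
    then have hG: "h \<in> carrier G" using H(1) by blast
    have "z = (h \<oplus>\<^bsub>G\<^esub> (u \<ominus>\<^bsub>G\<^esub> v)) \<oplus>\<^bsub>G\<^esub> v"
      using h hG uv by (simp add: a_minus_def G.a_assoc G.l_neg)
    then show "z \<in> H +>\<^bsub>G\<^esub> v" using H(3)[OF h(1) uv(3)] by (auto simp: a_r_coset_def')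
  qed
  show ?thesis
  proof
    assume eq: "H +>\<^bsub>G\<^esub> x = H +>\<^bsub>G\<^esub> y"
    have "\<zero>\<^bsub>G\<^esub> \<oplus>\<^bsub>G\<^esub> x \<in> H +>\<^bsub>G\<^esub> x" using H(2) by (auto simp: a_r_coset_def')
    then obtain h where h: "h \<in> H" "x = h \<oplus>\<^bsub>G\<^esub> y" using x unfolding eq by (auto simp: a_r_coset_def')
    then have "h \<in> carrier G" using H(1) by blast
    then have "x \<ominus>\<^bsub>G\<^esub> y = h" unfolding h(2) using y by (simp add: a_minus_def G.a_assoc G.r_neg)
    then show "x \<ominus>\<^bsub>G\<^esub> y \<in> H" using h by simp
  next
    assume xy: "x \<ominus>\<^bsub>G\<^esub> y \<in> H"
    have "y \<ominus>\<^bsub>G\<^esub> x = \<ominus>\<^bsub>G\<^esub> (x \<ominus>\<^bsub>G\<^esub> y)" using x y by (simp add: a_minus_def G.minus_add G.a_comm)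
    then have "y \<ominus>\<^bsub>G\<^esub> x \<in> H" using H(4)[OF xy] by simp
    then show "H +>\<^bsub>G\<^esub> x = H +>\<^bsub>G\<^esub> y" using sub xy x y by blast
  qed
qed

section \<open>Chain maps and isomorphisms of complexes\<close>

lemma chain_map_hom: "chain_map A X Y f \<Longrightarrow> f n \<in> mod_hom A (obj X n) (obj Y n)"
  by (simp add: chain_map_def)

lemma chain_map_closed: "chain_map A X Y f \<Longrightarrow> x \<in> carrier (obj X n) \<Longrightarrow> f n x \<in> carrier (obj Y n)"
  by (rule mod_hom_closed[OF chain_map_hom])

lemma chain_map_commute:
  "chain_map A X Y f \<Longrightarrow> x \<in> carrier (obj X n) \<Longrightarrow> f (n + 1) (diff X n x) = diff Y n (f n x)"
  by (simp add: chain_map_def)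

lemma chain_map_comp: "chain_map A Y Z g \<Longrightarrow> chain_map A X Y f \<Longrightarrow> chain_map A X Z (g \<circ>\<^sub>c f)"
  by (auto simp: chain_map_def chain_comp_def o_def intro: mod_hom_comp) (metis mod_hom_closed)

lemma chain_comp_id [simp]: "f \<circ>\<^sub>c (\<lambda>n x. x) = f"
  by (simp add: chain_comp_def o_def)

lemma chain_map_id: "chain_map A X X (\<lambda>n x. x)"
  by (simp add: chain_map_def mod_hom_id)

text \<open>Isomorphism in the category of complexes. Changes of element type are of this kind, and
  they can be composed with the legs of a roof directly.\<close>

definition chain_iso ::
  "('k::field, 'r) module \<Rightarrow> ('r, 'm) cochain_complex \<Rightarrow> ('r, 'n) cochain_complex
     \<Rightarrow> (int \<Rightarrow> 'm \<Rightarrow> 'n) \<Rightarrow> bool" where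
  "chain_iso A X Y f \<longleftrightarrow> chain_map A X Y f \<and>
     (\<forall>n. bij_betw (f n) (carrier (obj X n)) (carrier (obj Y n)))"

lemma chain_isoI:
  assumes "chain_map A X Y f" "\<And>n x. x \<in> carrier (obj X n) \<Longrightarrow> g n (f n x) = x"
    "\<And>n y. y \<in> carrier (obj Y n) \<Longrightarrow> f n (g n y) = y"
    "\<And>n y. y \<in> carrier (obj Y n) \<Longrightarrow> g n y \<in> carrier (obj X n)"
  shows "chain_iso A X Y f"
  unfolding chain_iso_def using assms chain_map_closed[OF assms(1)]
  by (auto intro!: bij_betwI[where g = "g n" for n])

lemma chain_iso_comp: "chain_iso A Y Z g \<Longrightarrow> chain_iso A X Y f \<Longrightarrow> chain_iso A X Z (g \<circ>\<^sub>c f)"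
  by (auto simp: chain_iso_def chain_comp_def intro: bij_betw_trans chain_map_comp[unfolded chain_comp_def])

lemma bounded_complexI:
  assumes "\<And>n. fd_module A (obj X n)" "\<And>n. diff X n \<in> mod_hom A (obj X n) (obj X (n + 1))"
    "\<And>n x. x \<in> carrier (obj X n) \<Longrightarrow> diff X (n + 1) (diff X n x) = \<zero>\<^bsub>obj X (n + 2)\<^esub>"
    "\<And>n. \<bar>n\<bar> > N \<Longrightarrow> carrier (obj X n) = {\<zero>\<^bsub>obj X n\<^esub>}"
  shows "bounded_complex A X"
  using assms unfolding bounded_complex_def by blast

section \<open>Cycles, boundaries and cohomology of one complex\<close>

context
  fixes A :: "('k::field, 'r) module" and X :: "('r, 'm) cochain_complex"
  assumes X: "bounded_complex A X"
begin

lemma complex_fd: "fd_module A (obj X n)"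
  using X by (simp add: bounded_complex_def)

lemma complex_right_module: "right_module A (obj X n)"
  using complex_fd by (simp add: fd_module_def)

lemma complex_group: "abelian_group (obj X n)"
  by (rule right_module_group[OF complex_right_module])

lemma complex_diff: "diff X n \<in> mod_hom A (obj X n) (obj X (n + 1))"
  using X by (simp add: bounded_complex_def)

lemma complex_diff': "diff X (n - 1) \<in> mod_hom A (obj X (n - 1)) (obj X n)"
  using complex_diff[of "n - 1"] by simp

lemma complex_diff_diff: "x \<in> carrier (obj X n) \<Longrightarrow> diff X (n + 1) (diff X n x) = \<zero>\<^bsub>obj X (n + 2)\<^esub>"
  using X by (simp add: bounded_complex_def)

lemma complex_diff_diff': "x \<in> carrier (obj X (n - 1)) \<Longrightarrow> diff X n (diff X (n - 1) x) = \<zero>\<^bsub>obj X (n + 1)\<^esub>"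
  using complex_diff_diff[of x "n - 1"] by (simp add: algebra_simps)

lemma boundaries_subset: "boundaries X n \<subseteq> carrier (obj X n)"
  unfolding boundaries_def using mod_hom_closed[OF complex_diff'] by blast

lemma boundariesI: "x \<in> carrier (obj X (n - 1)) \<Longrightarrow> y = diff X (n - 1) x \<Longrightarrow> y \<in> boundaries X n"
  by (simp add: boundaries_def)

lemma boundaries_zero: "\<zero>\<^bsub>obj X n\<^esub> \<in> boundaries X n"
proof (rule boundariesI)
  interpret M: abelian_group "obj X (n - 1)" by (rule complex_group)
  show "\<zero>\<^bsub>obj X (n - 1)\<^esub> \<in> carrier (obj X (n - 1))" by simp
  show "\<zero>\<^bsub>obj X n\<^esub> = diff X (n - 1) \<zero>\<^bsub>obj X (n - 1)\<^esub>"
    by (rule mod_hom_zero[OF complex_group complex_group complex_diff', symmetric])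
qed

lemma boundaries_add:
  assumes "x \<in> boundaries X n" "y \<in> boundaries X n"
  shows "x \<oplus>\<^bsub>obj X n\<^esub> y \<in> boundaries X n"
proof -
  interpret M: abelian_group "obj X (n - 1)" by (rule complex_group)
  obtain u v where uv: "u \<in> carrier (obj X (n - 1))" "v \<in> carrier (obj X (n - 1))"
    "x = diff X (n - 1) u" "y = diff X (n - 1) v"
    using assms by (auto simp: boundaries_def)
  then show ?thesis
    by (intro boundariesI[of "u \<oplus>\<^bsub>obj X (n - 1)\<^esub> v"]) (simp_all add: mod_hom_add[OF complex_diff'])
qed

lemma boundaries_inv:
  assumes "x \<in> boundaries X n"
  shows "\<ominus>\<^bsub>obj X n\<^esub> x \<in> boundaries X n"
proof -
  interpret M: abelian_group "obj X (n - 1)" by (rule complex_group)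
  obtain u where u: "u \<in> carrier (obj X (n - 1))" "x = diff X (n - 1) u"
    using assms by (auto simp: boundaries_def)
  then show ?thesis
    by (intro boundariesI[of "\<ominus>\<^bsub>obj X (n - 1)\<^esub> u"])
      (simp_all add: mod_hom_inv[OF complex_group complex_group complex_diff'])
qed

lemma cycles_carrier: "x \<in> cycles X n \<Longrightarrow> x \<in> carrier (obj X n)"
  by (simp add: cycles_def)

lemma boundaries_cycles: "x \<in> boundaries X n \<Longrightarrow> x \<in> cycles X n"
  using boundaries_subset[of n] by (auto simp: boundaries_def cycles_def complex_diff_diff')

lemma cycles_diff:
  assumes "x \<in> cycles X n" "y \<in> cycles X n"
  shows "x \<ominus>\<^bsub>obj X n\<^esub> y \<in> cycles X n"
proof -
  interpret M: abelian_group "obj X n" by (rule complex_group)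
  interpret N: abelian_group "obj X (n + 1)" by (rule complex_group)
  have "diff X n (x \<ominus>\<^bsub>obj X n\<^esub> y) = diff X n x \<ominus>\<^bsub>obj X (n + 1)\<^esub> diff X n y"
    by (rule mod_hom_diff[OF complex_group complex_group complex_diff])
      (use assms in \<open>simp_all add: cycles_def\<close>)
  then show ?thesis using assms by (simp add: cycles_def a_minus_def)
qed

lemma coboundary_mem:
  assumes "x \<ominus>\<^bsub>obj X n\<^esub> y \<in> boundaries X n" "y \<in> boundaries X n" "x \<in> carrier (obj X n)"
  shows "x \<in> boundaries X n"
proof -
  interpret M: abelian_group "obj X n" by (rule complex_group)
  have y: "y \<in> carrier (obj X n)" using assms boundaries_subset by blast
  have "x \<ominus>\<^bsub>obj X n\<^esub> y \<oplus>\<^bsub>obj X n\<^esub> y = x" using assms(3) y by (simp add: a_minus_def M.a_assoc M.l_neg)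
  then show ?thesis using boundaries_add[OF assms(1,2)] by simp
qed

lemma coboundary_sym:
  assumes "x \<ominus>\<^bsub>obj X n\<^esub> y \<in> boundaries X n" "x \<in> carrier (obj X n)" "y \<in> carrier (obj X n)"
  shows "y \<ominus>\<^bsub>obj X n\<^esub> x \<in> boundaries X n"
proof -
  interpret M: abelian_group "obj X n" by (rule complex_group)
  have "y \<ominus>\<^bsub>obj X n\<^esub> x = \<ominus>\<^bsub>obj X n\<^esub> (x \<ominus>\<^bsub>obj X n\<^esub> y)"
    using assms by (simp add: a_minus_def M.minus_add M.a_comm)
  then show ?thesis using boundaries_inv[OF assms(1)] by simp
qed

lemma coboundary_trans:
  assumes "x \<ominus>\<^bsub>obj X n\<^esub> y \<in> boundaries X n" "y \<ominus>\<^bsub>obj X n\<^esub> z \<in> boundaries X n"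
    "x \<in> carrier (obj X n)" "y \<in> carrier (obj X n)" "z \<in> carrier (obj X n)"
  shows "x \<ominus>\<^bsub>obj X n\<^esub> z \<in> boundaries X n"
proof -
  interpret M: abelian_group "obj X n" by (rule complex_group)
  have "(x \<ominus>\<^bsub>obj X n\<^esub> y) \<oplus>\<^bsub>obj X n\<^esub> (y \<ominus>\<^bsub>obj X n\<^esub> z) = x \<ominus>\<^bsub>obj X n\<^esub> z"
    using assms by (simp add: a_minus_def M.a_assoc M.r_neg1)
  then show ?thesis using boundaries_add[OF assms(1,2)] by simp
qed

lemma cohomology_class_eq_iff:
  assumes "x \<in> carrier (obj X n)" "y \<in> carrier (obj X n)"
  shows "boundaries X n +>\<^bsub>obj X n\<^esub> x = boundaries X n +>\<^bsub>obj X n\<^esub> y \<longleftrightarrow> x \<ominus>\<^bsub>obj X n\<^esub> y \<in> boundaries X n"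
  by (intro a_coset_eq_iff complex_group boundaries_subset boundaries_zero boundaries_add
      boundaries_inv assms)

end

section \<open>Quasi-isomorphisms and homotopies\<close>

context
  fixes A :: "('k::field, 'r) module"
    and X :: "('r, 'm) cochain_complex" and Y :: "('r, 'n) cochain_complex"
  assumes X: "bounded_complex A X" and Y: "bounded_complex A Y"
begin

lemma chain_map_boundaries:
  assumes "chain_map A X Y f" "x \<in> boundaries X n"
  shows "f n x \<in> boundaries Y n"
proof -
  obtain u where u: "u \<in> carrier (obj X (n - 1))" "x = diff X (n - 1) u"
    using assms by (auto simp: boundaries_def)
  then show ?thesis
    using chain_map_commute[OF assms(1) u(1)] chain_map_closed[OF assms(1) u(1)]
    by (intro boundariesI[OF Y]) simp_all
qed

lemma chain_map_diff:
  assumes "chain_map A X Y f" "x \<in> carrier (obj X n)" "y \<in> carrier (obj X n)"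
  shows "f n (x \<ominus>\<^bsub>obj X n\<^esub> y) = f n x \<ominus>\<^bsub>obj Y n\<^esub> f n y"
  by (rule mod_hom_diff[OF complex_group[OF X] complex_group[OF Y] chain_map_hom[OF assms(1)] assms(2,3)])

lemma chain_map_zero: "chain_map A X Y f \<Longrightarrow> f n \<zero>\<^bsub>obj X n\<^esub> = \<zero>\<^bsub>obj Y n\<^esub>"
  by (rule mod_hom_zero[OF complex_group[OF X] complex_group[OF Y] chain_map_hom])

lemma chain_map_cycles:
  assumes "chain_map A X Y f" "x \<in> cycles X n"
  shows "f n x \<in> cycles Y n"
  using assms chain_map_zero[OF assms(1), of "n + 1"] chain_map_commute[OF assms(1), of x n, symmetric]
  by (simp add: cycles_def chain_map_closed[OF assms(1)])

text \<open>On a cycle the term \<open>h d\<close> of the homotopy vanishes, and the term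
  \<open>d h\<close> is a boundary.\<close>

lemma homotopic_coboundary:
  assumes "homotopic A X Y f g" "x \<in> cycles X n"
  shows "f n x \<ominus>\<^bsub>obj Y n\<^esub> g n x \<in> boundaries Y n"
proof -
  obtain h where h: "\<And>n. h n \<in> mod_hom A (obj X n) (obj Y (n - 1))"
    "\<And>n x. x \<in> carrier (obj X n) \<Longrightarrow>
      f n x \<ominus>\<^bsub>obj Y n\<^esub> g n x = diff Y (n - 1) (h n x) \<oplus>\<^bsub>obj Y n\<^esub> h (n + 1) (diff X n x)"
    using assms(1) unfolding homotopic_def by blast
  interpret M: abelian_group "obj Y n" by (rule complex_group[OF Y])
  have x: "x \<in> carrier (obj X n)" "diff X n x = \<zero>\<^bsub>obj X (n + 1)\<^esub>" using assms(2) by (auto simp: cycles_def)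
  have "h (n + 1) \<zero>\<^bsub>obj X (n + 1)\<^esub> = \<zero>\<^bsub>obj Y n\<^esub>"
    using mod_hom_zero[OF complex_group[OF X] complex_group[OF Y] h(1)[of "n + 1"]] by simp
  then have "f n x \<ominus>\<^bsub>obj Y n\<^esub> g n x = diff Y (n - 1) (h n x)"
    using h(2)[OF x(1)] x mod_hom_closed[OF complex_diff'[OF Y] mod_hom_closed[OF h(1) x(1)]] by simp
  then show ?thesis using mod_hom_closed[OF h(1) x(1)] by (intro boundariesI[OF Y]) simp_all
qed

lemma cohomology_map_class:
  assumes f: "chain_map A X Y f" and x: "x \<in> carrier (obj X n)"
  shows "cohomology_map Y f n (boundaries X n +>\<^bsub>obj X n\<^esub> x) = boundaries Y n +>\<^bsub>obj Y n\<^esub> f n x"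
proof -
  interpret M: abelian_group "obj X n" by (rule complex_group[OF X])
  interpret N: abelian_group "obj Y n" by (rule complex_group[OF Y])
  have "boundaries Y n +>\<^bsub>obj Y n\<^esub> f n z = boundaries Y n +>\<^bsub>obj Y n\<^esub> f n x"
    if z: "z \<in> boundaries X n +>\<^bsub>obj X n\<^esub> x" for z
  proof -
    obtain b where b: "b \<in> boundaries X n" "z = b \<oplus>\<^bsub>obj X n\<^esub> x" using z by (auto simp: a_r_coset_def')
    have bX: "b \<in> carrier (obj X n)" using b boundaries_subset[OF X] by blast
    have "f n z \<ominus>\<^bsub>obj Y n\<^esub> f n x = f n (z \<ominus>\<^bsub>obj X n\<^esub> x)"
      using b bX x by (simp add: chain_map_diff[OF f])
    also have "z \<ominus>\<^bsub>obj X n\<^esub> x = b" using b(2) bX x by (simp add: a_minus_def M.a_assoc M.r_neg)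
    finally show ?thesis
      using b bX x chain_map_closed[OF f] chain_map_boundaries[OF f b(1)]
      by (subst cohomology_class_eq_iff[OF Y]) simp_all
  qed
  moreover have "x \<in> boundaries X n +>\<^bsub>obj X n\<^esub> x"
    using boundaries_zero[OF X, of n] x unfolding a_r_coset_def' by force
  ultimately show ?thesis unfolding cohomology_map_def by blast
qed

text \<open>Cosets are eliminated here. By additivity, injectivity on cohomology has to be tested
  only at the zero class, and surjectivity says that every cycle is an image up to a boundary. All
  later arguments use this form.\<close>

lemma quasi_iso_iff:
  "quasi_iso A X Y f \<longleftrightarrow> chain_map A X Y f \<and>
     (\<forall>n. \<forall>x\<in>cycles X n. f n x \<in> boundaries Y n \<longrightarrow> x \<in> boundaries X n) \<and>
     (\<forall>n. \<forall>y\<in>cycles Y n. \<exists>x\<in>cycles X n. y \<ominus>\<^bsub>obj Y n\<^esub> f n x \<in> boundaries Y n)"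
proof (cases "chain_map A X Y f")
  case f: True
  let ?c = "\<lambda>n x. boundaries X n +>\<^bsub>obj X n\<^esub> x" and ?d = "\<lambda>n x. boundaries Y n +>\<^bsub>obj Y n\<^esub> x"
  have map: "cohomology_map Y f n (?c n x) = ?d n (f n x)" if "x \<in> cycles X n" for n x
    using cohomology_map_class[OF f] that by (simp add: cycles_def)
  have eqX: "?c n x = ?c n y \<longleftrightarrow> x \<ominus>\<^bsub>obj X n\<^esub> y \<in> boundaries X n"
    if "x \<in> cycles X n" "y \<in> cycles X n" for n x y
    using cohomology_class_eq_iff[OF X] that by (simp add: cycles_def)
  have eqY: "?d n x = ?d n y \<longleftrightarrow> x \<ominus>\<^bsub>obj Y n\<^esub> y \<in> boundaries Y n"
    if "x \<in> cycles Y n" "y \<in> cycles Y n" for n x y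
    using cohomology_class_eq_iff[OF Y] that by (simp add: cycles_def)
  note fc = chain_map_cycles[OF f]
  have "inj_on (cohomology_map Y f n) (cohomology X n) \<longleftrightarrow>
      (\<forall>x\<in>cycles X n. f n x \<in> boundaries Y n \<longrightarrow> x \<in> boundaries X n)" for n
  proof -
    interpret M: abelian_group "obj X n" by (rule complex_group[OF X])
    interpret N: abelian_group "obj Y n" by (rule complex_group[OF Y])
    have z: "\<zero>\<^bsub>obj X n\<^esub> \<in> cycles X n" by (rule boundaries_cycles[OF X boundaries_zero[OF X]])
    have "inj_on (cohomology_map Y f n) (cohomology X n) \<longleftrightarrow>
      (\<forall>x\<in>cycles X n. \<forall>y\<in>cycles X n. f n x \<ominus>\<^bsub>obj Y n\<^esub> f n y \<in> boundaries Y n \<longrightarrow>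
         x \<ominus>\<^bsub>obj X n\<^esub> y \<in> boundaries X n)"
      unfolding inj_on_def cohomology_def by (simp add: map eqX eqY fc)
    also have "\<dots> \<longleftrightarrow> (\<forall>x\<in>cycles X n. f n x \<in> boundaries Y n \<longrightarrow> x \<in> boundaries X n)" (is "?L \<longleftrightarrow> ?R")
    proof
      assume L: ?L
      show ?R
      proof (intro ballI impI)
        fix x assume x: "x \<in> cycles X n" "f n x \<in> boundaries Y n"
        have "f n x \<ominus>\<^bsub>obj Y n\<^esub> f n \<zero>\<^bsub>obj X n\<^esub> = f n x" "x \<ominus>\<^bsub>obj X n\<^esub> \<zero>\<^bsub>obj X n\<^esub> = x"
          using cycles_carrier[OF X x(1)] chain_map_closed[OF f] by (simp_all add: chain_map_zero[OF f] a_minus_def)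
        then show "x \<in> boundaries X n" using L x z by metis
      qed
    next
      assume R: ?R
      show ?L
      proof (intro ballI impI)
        fix x y assume x: "x \<in> cycles X n" "y \<in> cycles X n" "f n x \<ominus>\<^bsub>obj Y n\<^esub> f n y \<in> boundaries Y n"
        then show "x \<ominus>\<^bsub>obj X n\<^esub> y \<in> boundaries X n"
          using R cycles_diff[OF X x(1,2)] by (simp add: chain_map_diff[OF f] cycles_carrier[OF X])
      qed
    qed
    finally show ?thesis .
  qed
  moreover have "cohomology_map Y f n ` cohomology X n = cohomology Y n \<longleftrightarrow>
      (\<forall>y\<in>cycles Y n. \<exists>x\<in>cycles X n. y \<ominus>\<^bsub>obj Y n\<^esub> f n x \<in> boundaries Y n)" for n
  proof -
    have im: "cohomology_map Y f n ` cohomology X n = (\<lambda>x. ?d n (f n x)) ` cycles X n"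
      unfolding cohomology_def image_image by (simp add: map cong: image_cong)
    have sub: "(\<lambda>x. ?d n (f n x)) ` cycles X n \<subseteq> cohomology Y n"
      using fc by (auto simp: cohomology_def)
    have "cohomology Y n \<subseteq> (\<lambda>x. ?d n (f n x)) ` cycles X n \<longleftrightarrow>
      (\<forall>y\<in>cycles Y n. \<exists>x\<in>cycles X n. ?d n y = ?d n (f n x))"
      by (auto simp: cohomology_def image_iff)
    also have "\<dots> \<longleftrightarrow> (\<forall>y\<in>cycles Y n. \<exists>x\<in>cycles X n. y \<ominus>\<^bsub>obj Y n\<^esub> f n x \<in> boundaries Y n)"
      by (intro ball_cong bex_cong refl eqY fc)
    finally show ?thesis using im sub by (metis subset_antisym order_refl)
  qed
  ultimately show ?thesis using f by (simp add: quasi_iso_def bij_betw_def all_conj_distrib)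
qed (simp add: quasi_iso_def)

lemma quasi_isoI:
  assumes "chain_map A X Y f"
    "\<And>n x. x \<in> cycles X n \<Longrightarrow> f n x \<in> boundaries Y n \<Longrightarrow> x \<in> boundaries X n"
    "\<And>n y. y \<in> cycles Y n \<Longrightarrow> \<exists>x\<in>cycles X n. y \<ominus>\<^bsub>obj Y n\<^esub> f n x \<in> boundaries Y n"
  shows "quasi_iso A X Y f"
  using assms quasi_iso_iff by simp

lemma quasi_iso_chain_map: "quasi_iso A X Y f \<Longrightarrow> chain_map A X Y f"
  by (simp add: quasi_iso_def)

lemma quasi_iso_inj:
  "quasi_iso A X Y f \<Longrightarrow> x \<in> cycles X n \<Longrightarrow> f n x \<in> boundaries Y n \<Longrightarrow> x \<in> boundaries X n"
  using quasi_iso_iff by simp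

lemma quasi_iso_surj:
  "quasi_iso A X Y f \<Longrightarrow> y \<in> cycles Y n \<Longrightarrow> \<exists>x\<in>cycles X n. y \<ominus>\<^bsub>obj Y n\<^esub> f n x \<in> boundaries Y n"
  using quasi_iso_iff by simp

lemma chain_iso_quasi_iso:
  assumes "chain_iso A X Y f"
  shows "quasi_iso A X Y f"
proof (rule quasi_isoI)
  show f: "chain_map A X Y f" using assms by (simp add: chain_iso_def)
  have bij: "bij_betw (f n) (carrier (obj X n)) (carrier (obj Y n))" for n
    using assms by (simp add: chain_iso_def)
  show "x \<in> boundaries X n" if x: "x \<in> cycles X n" "f n x \<in> boundaries Y n" for n x
  proof -
    obtain v where v: "v \<in> carrier (obj Y (n - 1))" "f n x = diff Y (n - 1) v"
      using x(2) by (auto simp: boundaries_def)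
    obtain u where u: "u \<in> carrier (obj X (n - 1))" "v = f (n - 1) u"
      using bij_betw_imp_surj_on[OF bij[of "n - 1"]] v(1) by blast
    have "f n x = f n (diff X (n - 1) u)" using v(2) u chain_map_commute[OF f u(1)] by simp
    then have "x = diff X (n - 1) u"
      using bij_betw_imp_inj_on[OF bij[of n]] cycles_carrier[OF X x(1)] mod_hom_closed[OF complex_diff'[OF X] u(1)]
      by (simp add: inj_onD)
    then show ?thesis by (rule boundariesI[OF X u(1)])
  qed
  show "\<exists>x\<in>cycles X n. y \<ominus>\<^bsub>obj Y n\<^esub> f n x \<in> boundaries Y n" if y: "y \<in> cycles Y n" for n y
  proof -
    interpret X: abelian_group "obj X (n + 1)" by (rule complex_group[OF X])
    interpret Y: abelian_group "obj Y n" by (rule complex_group[OF Y])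
    obtain x where x: "x \<in> carrier (obj X n)" "y = f n x"
      using bij_betw_imp_surj_on[OF bij[of n]] cycles_carrier[OF Y y] by blast
    have "f (n + 1) (diff X n x) = f (n + 1) \<zero>\<^bsub>obj X (n + 1)\<^esub>"
      using y x chain_map_commute[OF f x(1)] by (simp add: cycles_def chain_map_zero[OF f])
    then have "diff X n x = \<zero>\<^bsub>obj X (n + 1)\<^esub>"
      using bij_betw_imp_inj_on[OF bij[of "n + 1"]] mod_hom_closed[OF complex_diff[OF X] x(1)]
      by (simp add: inj_onD)
    then have "x \<in> cycles X n" using x by (simp add: cycles_def)
    moreover have "y \<ominus>\<^bsub>obj Y n\<^esub> f n x = \<zero>\<^bsub>obj Y n\<^esub>"
      using x cycles_carrier[OF Y y] by (simp add: a_minus_def Y.r_neg)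
    ultimately show ?thesis using boundaries_zero[OF Y, of n] by metis
  qed
qed

lemma homotopic_refl:
  assumes "chain_map A X Y f"
  shows "homotopic A X Y f f"
  unfolding homotopic_def
proof (intro exI[of _ "\<lambda>n x. \<zero>\<^bsub>obj Y (n - 1)\<^esub>"] conjI allI ballI)
  fix n x assume x: "x \<in> carrier (obj X n)"
  interpret Y: abelian_group "obj Y n" by (rule complex_group[OF Y])
  show "f n x \<ominus>\<^bsub>obj Y n\<^esub> f n x = diff Y (n - 1) \<zero>\<^bsub>obj Y (n - 1)\<^esub> \<oplus>\<^bsub>obj Y n\<^esub> \<zero>\<^bsub>obj Y (n + 1 - 1)\<^esub>"
    using chain_map_closed[OF assms x] mod_hom_zero[OF complex_group[OF Y] complex_group[OF Y] complex_diff'[OF Y]]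
    by (simp add: a_minus_def Y.r_neg)
qed (rule right_module.zero_hom[OF complex_right_module[OF Y]])

lemma homotopic_cong:
  assumes "homotopic A X Y f g" "\<And>n x. x \<in> carrier (obj X n) \<Longrightarrow> f n x = f' n x"
    "\<And>n x. x \<in> carrier (obj X n) \<Longrightarrow> g n x = g' n x"
  shows "homotopic A X Y f' g'"
  using assms unfolding homotopic_def by metis

lemma quasi_iso_cong:
  assumes "quasi_iso A X Y f" "chain_map A X Y f'" "\<And>n x. x \<in> carrier (obj X n) \<Longrightarrow> f n x = f' n x"
  shows "quasi_iso A X Y f'"
proof (rule quasi_isoI[OF assms(2)])
  show "x \<in> boundaries X n" if "x \<in> cycles X n" "f' n x \<in> boundaries Y n" for n x
    using that assms(3)[of x n] quasi_iso_inj[OF assms(1)] by (simp add: cycles_carrier[OF X])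
  show "\<exists>x\<in>cycles X n. y \<ominus>\<^bsub>obj Y n\<^esub> f' n x \<in> boundaries Y n" if "y \<in> cycles Y n" for n y
    using quasi_iso_surj[OF assms(1) that] assms(3) cycles_carrier[OF X] by metis
qed

lemma homotopic_quasi_iso:
  assumes "homotopic A X Y f g" "quasi_iso A X Y g" "chain_map A X Y f"
  shows "quasi_iso A X Y f"
proof (rule quasi_isoI[OF assms(3)])
  note g = quasi_iso_chain_map[OF assms(2)]
  show "x \<in> boundaries X n" if x: "x \<in> cycles X n" "f n x \<in> boundaries Y n" for n x
  proof -
    note xX = cycles_carrier[OF X x(1)]
    have "g n x \<ominus>\<^bsub>obj Y n\<^esub> f n x \<in> boundaries Y n"
      by (rule coboundary_sym[OF Y homotopic_coboundary[OF assms(1) x(1)]])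
        (simp_all add: chain_map_closed[OF assms(3) xX] chain_map_closed[OF g xX])
    then have "g n x \<in> boundaries Y n"
      by (rule coboundary_mem[OF Y _ x(2) chain_map_closed[OF g xX]])
    then show ?thesis by (rule quasi_iso_inj[OF assms(2) x(1)])
  qed
  show "\<exists>x\<in>cycles X n. y \<ominus>\<^bsub>obj Y n\<^esub> f n x \<in> boundaries Y n" if y: "y \<in> cycles Y n" for n y
  proof -
    obtain x where x: "x \<in> cycles X n" "y \<ominus>\<^bsub>obj Y n\<^esub> g n x \<in> boundaries Y n"
      using quasi_iso_surj[OF assms(2) y] by blast
    note xX = cycles_carrier[OF X x(1)]
    have "g n x \<ominus>\<^bsub>obj Y n\<^esub> f n x \<in> boundaries Y n"
      by (rule coboundary_sym[OF Y homotopic_coboundary[OF assms(1) x(1)]])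
        (simp_all add: chain_map_closed[OF assms(3) xX] chain_map_closed[OF g xX])
    then have "y \<ominus>\<^bsub>obj Y n\<^esub> f n x \<in> boundaries Y n"
      using chain_map_closed[OF assms(3) xX] chain_map_closed[OF g xX] cycles_carrier[OF Y y]
      by (intro coboundary_trans[OF Y x(2)])
    then show ?thesis using x(1) by blast
  qed
qed

end

lemma quasi_iso_comp:
  assumes "bounded_complex A X" "bounded_complex A Y" "bounded_complex A Z"
    and g: "quasi_iso A Y Z g" and f: "quasi_iso A X Y f"
  shows "quasi_iso A X Z (g \<circ>\<^sub>c f)"
proof (rule quasi_isoI[OF assms(1,3)])
  note g' = quasi_iso_chain_map[OF assms(2,3) g] and f' = quasi_iso_chain_map[OF assms(1,2) f]
  show "chain_map A X Z (g \<circ>\<^sub>c f)" by (rule chain_map_comp[OF g' f'])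
  show "x \<in> boundaries X n" if "x \<in> cycles X n" "(g \<circ>\<^sub>c f) n x \<in> boundaries Z n" for n x
    using quasi_iso_inj[OF assms(1,2) f that(1)] quasi_iso_inj[OF assms(2,3) g]
      chain_map_cycles[OF assms(1,2) f' that(1)] that(2)
    by (simp add: chain_comp_def)
  show "\<exists>x\<in>cycles X n. z \<ominus>\<^bsub>obj Z n\<^esub> (g \<circ>\<^sub>c f) n x \<in> boundaries Z n" if z: "z \<in> cycles Z n" for n z
  proof -
    obtain y where y: "y \<in> cycles Y n" "z \<ominus>\<^bsub>obj Z n\<^esub> g n y \<in> boundaries Z n"
      using quasi_iso_surj[OF assms(2,3) g z] by blast
    obtain x where x: "x \<in> cycles X n" "y \<ominus>\<^bsub>obj Y n\<^esub> f n x \<in> boundaries Y n"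
      using quasi_iso_surj[OF assms(1,2) f y(1)] by blast
    note xX = cycles_carrier[OF assms(1) x(1)] and yY = cycles_carrier[OF assms(2) y(1)]
    note fx = chain_map_closed[OF f' xX]
    have "g n y \<ominus>\<^bsub>obj Z n\<^esub> g n (f n x) \<in> boundaries Z n"
      using chain_map_boundaries[OF assms(2,3) g' x(2)] yY fx
      by (simp add: chain_map_diff[OF assms(2,3) g'])
    then have "z \<ominus>\<^bsub>obj Z n\<^esub> g n (f n x) \<in> boundaries Z n"
      using cycles_carrier[OF assms(3) z] chain_map_closed[OF g' yY] chain_map_closed[OF g' fx]
      by (intro coboundary_trans[OF assms(3) y(2)])
    then show ?thesis using x(1) by (auto simp: chain_comp_def)
  qed
qed

lemma homotopic_comp_left:
  assumes Y: "bounded_complex A Y" and k: "chain_map A Y Z k" and f: "homotopic A X Y f g"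
    and Z: "bounded_complex A Z" and X: "bounded_complex A X"
    and fc: "chain_map A X Y f" and gc: "chain_map A X Y g"
  shows "homotopic A X Z (k \<circ>\<^sub>c f) (k \<circ>\<^sub>c g)"
proof -
  obtain h where h: "\<And>n. h n \<in> mod_hom A (obj X n) (obj Y (n - 1))"
    "\<And>n x. x \<in> carrier (obj X n) \<Longrightarrow>
      f n x \<ominus>\<^bsub>obj Y n\<^esub> g n x = diff Y (n - 1) (h n x) \<oplus>\<^bsub>obj Y n\<^esub> h (n + 1) (diff X n x)"
    using f unfolding homotopic_def by blast
  show ?thesis unfolding homotopic_def
  proof (intro exI[of _ "\<lambda>n x. k (n - 1) (h n x)"] conjI allI ballI)
    show "(\<lambda>x. k (n - 1) (h n x)) \<in> mod_hom A (obj X n) (obj Z (n - 1))" for n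
      by (rule mod_hom_comp[OF chain_map_hom[OF k] h(1)])
    fix n x assume x: "x \<in> carrier (obj X n)"
    note hx = mod_hom_closed[OF h(1) x]
    have h': "h (n + 1) (diff X n x) \<in> carrier (obj Y n)"
      using mod_hom_closed[OF h(1)[of "n + 1"] mod_hom_closed[OF complex_diff[OF X] x]] by simp
    have "k n (f n x) \<ominus>\<^bsub>obj Z n\<^esub> k n (g n x) = k n (f n x \<ominus>\<^bsub>obj Y n\<^esub> g n x)"
      using chain_map_closed[OF fc x] chain_map_closed[OF gc x] by (simp add: chain_map_diff[OF Y Z k])
    also have "\<dots> = k n (diff Y (n - 1) (h n x)) \<oplus>\<^bsub>obj Z n\<^esub> k n (h (n + 1) (diff X n x))"
      unfolding h(2)[OF x]
      by (rule mod_hom_add[OF chain_map_hom[OF k] mod_hom_closed[OF complex_diff'[OF Y] hx] h'])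
    also have "k n (diff Y (n - 1) (h n x)) = diff Z (n - 1) (k (n - 1) (h n x))"
      using chain_map_commute[OF k hx] by simp
    finally show "(k \<circ>\<^sub>c f) n x \<ominus>\<^bsub>obj Z n\<^esub> (k \<circ>\<^sub>c g) n x =
        diff Z (n - 1) (k (n - 1) (h n x)) \<oplus>\<^bsub>obj Z n\<^esub> k (n + 1 - 1) (h (n + 1) (diff X n x))"
      by (simp add: chain_comp_def)
  qed
qed

lemma homotopic_comp_right:
  assumes f: "homotopic A X Y f g" and u: "chain_map A W X u"
  shows "homotopic A W Y (f \<circ>\<^sub>c u) (g \<circ>\<^sub>c u)"
proof -
  obtain h where h: "\<And>n. h n \<in> mod_hom A (obj X n) (obj Y (n - 1))"
    "\<And>n x. x \<in> carrier (obj X n) \<Longrightarrow>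
      f n x \<ominus>\<^bsub>obj Y n\<^esub> g n x = diff Y (n - 1) (h n x) \<oplus>\<^bsub>obj Y n\<^esub> h (n + 1) (diff X n x)"
    using f unfolding homotopic_def by blast
  show ?thesis unfolding homotopic_def
  proof (intro exI[of _ "\<lambda>n x. h n (u n x)"] conjI allI ballI)
    show "(\<lambda>x. h n (u n x)) \<in> mod_hom A (obj W n) (obj Y (n - 1))" for n
      by (rule mod_hom_comp[OF h(1) chain_map_hom[OF u]])
    fix n x assume x: "x \<in> carrier (obj W n)"
    show "(f \<circ>\<^sub>c u) n x \<ominus>\<^bsub>obj Y n\<^esub> (g \<circ>\<^sub>c u) n x =
        diff Y (n - 1) (h n (u n x)) \<oplus>\<^bsub>obj Y n\<^esub> h (n + 1) (u (n + 1) (diff W n x))"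
      using h(2)[OF chain_map_closed[OF u x]] chain_map_commute[OF u x] by (simp add: chain_comp_def)
  qed
qed

lemma chain_iso_inverse:
  assumes X: "bounded_complex A X" and f: "chain_iso A X Y f"
  shows "chain_iso A Y X (\<lambda>n. inv_into (carrier (obj X n)) (f n))"
  unfolding chain_iso_def chain_map_def
proof (intro conjI allI ballI)
  have f': "chain_map A X Y f" and bij: "\<And>n. bij_betw (f n) (carrier (obj X n)) (carrier (obj Y n))"
    using f by (auto simp: chain_iso_def)
  show "inv_into (carrier (obj X n)) (f n) \<in> mod_hom A (obj Y n) (obj X n)" for n
    by (rule mod_hom_inverse[OF complex_right_module[OF X] chain_map_hom[OF f'] bij])
  show "bij_betw (inv_into (carrier (obj X n)) (f n)) (carrier (obj Y n)) (carrier (obj X n))" for n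
    by (rule bij_betw_inv_into[OF bij])
  fix n y assume y: "y \<in> carrier (obj Y n)"
  then obtain x where x: "x \<in> carrier (obj X n)" "y = f n x"
    using bij_betw_imp_surj_on[OF bij] by blast
  show "inv_into (carrier (obj X (n + 1))) (f (n + 1)) (diff Y n y) = diff X n (inv_into (carrier (obj X n)) (f n) y)"
    using x mod_hom_closed[OF complex_diff[OF X] x(1)] bij_betw_imp_inj_on[OF bij]
    by (simp add: chain_map_commute[OF f', symmetric])
qed

lemma chain_isoE:
  assumes X: "bounded_complex A X" and f: "chain_iso A X Y f"
  obtains g where "chain_iso A Y X g" "\<And>n x. x \<in> carrier (obj X n) \<Longrightarrow> g n (f n x) = x"
    "\<And>n y. y \<in> carrier (obj Y n) \<Longrightarrow> f n (g n y) = y"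
  by (rule that[OF chain_iso_inverse[OF X f]])
    (use f in \<open>auto simp: chain_iso_def bij_betw_def intro: f_inv_into_f\<close>)

lemma chain_iso_map: "chain_iso A X Y f \<Longrightarrow> chain_map A X Y f"
  by (simp add: chain_iso_def)

definition complex_copy ::
  "('k::field, 'r) module \<Rightarrow> ('r, 'm) cochain_complex \<Rightarrow> ('r, 'k list) cochain_complex" where
  "complex_copy A X =
    \<lparr>obj = (\<lambda>n. list_copy A (obj X n)),
     diff = (\<lambda>n x. list_embedding A (obj X (n + 1))
       (diff X n (inv_into (carrier (obj X n)) (list_embedding A (obj X n)) x)))\<rparr>"

section \<open>Copies of complexes, and derived isomorphisms from quasi-isomorphisms\<close>

context fd_algebra
begin

lemma complex_copy:
  assumes X: "bounded_complex A X"
  shows "bounded_complex A (complex_copy A X)"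
    and "chain_iso A X (complex_copy A X) (\<lambda>n. list_embedding A (obj X n))"
proof -
  let ?j = "\<lambda>n. list_embedding A (obj X n)"
  let ?k = "\<lambda>n. inv_into (carrier (obj X n)) (?j n)"
  note c = list_copy[OF complex_fd[OF X]]
  have k: "?k n \<in> mod_hom A (list_copy A (obj X n)) (obj X n)" for n
    by (rule mod_hom_inverse[OF complex_right_module[OF X] c(2,3)])
  have kj: "?k n (?j n x) = x" if "x \<in> carrier (obj X n)" for n x
    using that c(3)[of n] by (simp add: bij_betw_def)
  have zero: "?j n \<zero>\<^bsub>obj X n\<^esub> = \<zero>\<^bsub>list_copy A (obj X n)\<^esub>" for n
    by (rule mod_hom_zero[OF complex_group[OF X] right_module_group[OF fd_right_module[OF c(1)]] c(2)])
  obtain N where N: "\<And>n. \<bar>n\<bar> > N \<Longrightarrow> carrier (obj X n) = {\<zero>\<^bsub>obj X n\<^esub>}"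
    using X by (auto simp: bounded_complex_def)
  show "bounded_complex A (complex_copy A X)"
  proof (rule bounded_complexI)
    show "fd_module A (obj (complex_copy A X) n)" for n by (simp add: complex_copy_def c(1))
    show "diff (complex_copy A X) n \<in> mod_hom A (obj (complex_copy A X) n) (obj (complex_copy A X) (n + 1))" for n
      unfolding complex_copy_def
      using mod_hom_comp[OF c(2) mod_hom_comp[OF complex_diff[OF X] k]] by simp
    show "diff (complex_copy A X) (n + 1) (diff (complex_copy A X) n x) = \<zero>\<^bsub>obj (complex_copy A X) (n + 2)\<^esub>"
      if "x \<in> carrier (obj (complex_copy A X) n)" for n x
    proof -
      have x: "?k n x \<in> carrier (obj X n)" using that mod_hom_closed[OF k] by (simp add: complex_copy_def)
      show ?thesis
        using complex_diff_diff[OF X x] mod_hom_closed[OF complex_diff[OF X] x] zero[of "n + 2"]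
        by (simp add: complex_copy_def kj add.commute[of 2 n])
    qed
    show "carrier (obj (complex_copy A X) n) = {\<zero>\<^bsub>obj (complex_copy A X) n\<^esub>}" if "\<bar>n\<bar> > N" for n
      using bij_betw_imp_surj_on[OF c(3)[of n]] zero[of n] N[OF that] by (simp add: complex_copy_def)
  qed
  show "chain_iso A X (complex_copy A X) ?j"
    unfolding chain_iso_def chain_map_def by (simp add: complex_copy_def c(2,3) kj)
qed

lemma quasi_iso_id: "bounded_complex A X \<Longrightarrow> quasi_iso A X X (\<lambda>n x. x)"
  by (rule chain_iso_quasi_iso) (auto simp: chain_iso_def chain_map_id bij_betw_def)

text \<open>A copy \<open>?Z\<close> of \<open>X\<close>, with its isomorphism \<open>?c\<close>
  onto \<open>X\<close>, is the apex of both roofs. The legs \<open>?c\<close> and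
  \<open>s \<circ>\<^sub>c ?c\<close> trade places in the inverse roof, and both composites have two
  equal legs.\<close>

lemma quasi_iso_derived_iso:
  assumes X: "bounded_complex A X" and Y: "bounded_complex A Y" and s: "quasi_iso A X Y s"
  shows "derived_iso A X Y"
proof -
  let ?Z = "complex_copy A X"
  note Z = complex_copy(1)[OF X]
  let ?c = "\<lambda>n. inv_into (carrier (obj X n)) (list_embedding A (obj X n))"
  have ci: "chain_iso A ?Z X ?c" by (rule chain_iso_inverse[OF X complex_copy(2)[OF X]])
  note c = chain_iso_quasi_iso[OF Z X ci]
  note sc = quasi_iso_comp[OF Z X Y s c]
  note cm = quasi_iso_chain_map[OF Z X c] and scm = quasi_iso_chain_map[OF Z Y sc]
  have 1: "is_roof A X Y (?Z, ?c, s \<circ>\<^sub>c ?c)" "is_roof A Y X (?Z, s \<circ>\<^sub>c ?c, ?c)"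
    using Z c sc cm scm by simp_all
  show ?thesis unfolding derived_iso_def
  proof (intro exI conjI)
    show "is_roof A X Y (?Z, ?c, s \<circ>\<^sub>c ?c)" "is_roof A Y X (?Z, s \<circ>\<^sub>c ?c, ?c)" by (fact 1)+
    show "roof_comp A Y (?Z, ?c, s \<circ>\<^sub>c ?c) (?Z, s \<circ>\<^sub>c ?c, ?c) (?Z, ?c, ?c)"
      unfolding roof_comp.simps
      by (intro conjI Z exI[of _ "\<lambda>n x. x"])
        (simp_all add: quasi_iso_id[OF Z] chain_map_id homotopic_refl[OF Z Y scm])
    show "roof_is_identity A X (?Z, ?c, ?c)"
      unfolding roof_is_identity.simps roof_equiv.simps
      by (intro exI[of _ ?Z] exI[of _ "\<lambda>n x. x"])
        (simp_all add: Z c chain_map_id homotopic_refl[OF Z X cm])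
    show "roof_comp A X (?Z, s \<circ>\<^sub>c ?c, ?c) (?Z, ?c, s \<circ>\<^sub>c ?c) (?Z, s \<circ>\<^sub>c ?c, s \<circ>\<^sub>c ?c)"
      unfolding roof_comp.simps
      by (intro conjI Z exI[of _ "\<lambda>n x. x"])
        (simp_all add: quasi_iso_id[OF Z] chain_map_id homotopic_refl[OF Z X cm])
    show "roof_is_identity A Y (?Z, s \<circ>\<^sub>c ?c, s \<circ>\<^sub>c ?c)"
      unfolding roof_is_identity.simps roof_equiv.simps
      by (intro exI[of _ ?Z] exI[of _ "\<lambda>n x. x"])
        (simp_all add: Z sc chain_map_id homotopic_refl[OF Z Y scm])
  qed
qed

lemma derived_iso_sym: "derived_iso A X Y \<Longrightarrow> derived_iso A Y X"
  unfolding derived_iso_def by blast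

lemma chain_iso_derived_iso:
  assumes "bounded_complex A X" "bounded_complex A Y" "chain_iso A X Y s"
  shows "derived_iso A X Y"
  by (rule quasi_iso_derived_iso[OF assms(1,2) chain_iso_quasi_iso[OF assms]])

end

section \<open>Morphisms in the derived category\<close>

lemma minus_zero_right:
  assumes "abelian_group G" "x \<in> carrier G"
  shows "x \<ominus>\<^bsub>G\<^esub> \<zero>\<^bsub>G\<^esub> = x"
proof -
  interpret G: abelian_group G by fact
  have "\<ominus>\<^bsub>G\<^esub> \<zero>\<^bsub>G\<^esub> = \<zero>\<^bsub>G\<^esub>" by (rule G.minus_equality) simp_all
  then show ?thesis using assms(2) by (simp add: a_minus_def)
qed

lemma eq_of_minus_eq_zero:
  assumes "abelian_group G" "x \<in> carrier G" "y \<in> carrier G" "x \<ominus>\<^bsub>G\<^esub> y = \<zero>\<^bsub>G\<^esub>"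
  shows "x = y"
proof -
  interpret G: abelian_group G by fact
  have "x = (x \<ominus>\<^bsub>G\<^esub> y) \<oplus>\<^bsub>G\<^esub> y" using assms(2,3) by (simp add: a_minus_def G.a_assoc G.l_neg)
  then show ?thesis using assms(3,4) by simp
qed

lemma chain_comp_assoc: "(h \<circ>\<^sub>c g) \<circ>\<^sub>c f = h \<circ>\<^sub>c (g \<circ>\<^sub>c f)"
  by (simp add: chain_comp_def o_assoc)

lemma shift_obj [simp]: "obj (shift X r) n = obj X (n + r)"
  by (simp add: shift_def)

lemma complex_sum_obj [simp]: "obj (complex_sum X Y) n = mod_sum (obj X n) (obj Y n)"
  by (simp add: complex_sum_def)

lemma complex_sum_diff [simp]: "diff (complex_sum X Y) n (x, y) = (diff X n x, diff Y n y)"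
  by (simp add: complex_sum_def)

lemma cone_obj [simp]: "obj (cone X Y f) n = mod_sum (obj X (n + 1)) (obj Y n)"
  by (simp add: cone_def)

lemma chain_map_shift:
  assumes X: "bounded_complex A X" and Y: "bounded_complex A Y" and f: "chain_map A X Y f"
  shows "chain_map A (shift X r) (shift Y r) (\<lambda>n. f (n + r))"
  unfolding chain_map_def
proof (intro conjI allI ballI)
  show "f (n + r) \<in> mod_hom A (obj (shift X r) n) (obj (shift Y r) n)" for n
    using chain_map_hom[OF f] by simp
  fix n x assume "x \<in> carrier (obj (shift X r) n)"
  then have x: "x \<in> carrier (obj X (n + r))" by simp
  have e: "n + 1 + r = n + r + 1" by simp
  show "f (n + 1 + r) (diff (shift X r) n x) = diff (shift Y r) n (f (n + r) x)"
    unfolding shift_def e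
    using x chain_map_commute[OF f x] mod_hom_closed[OF complex_diff[OF X] x]
      mod_hom_inv[OF complex_group[OF X] complex_group[OF Y] chain_map_hom[OF f, of "n + r + 1"]]
    by simp
qed

lemma chain_iso_shift:
  assumes X: "bounded_complex A X" and Y: "bounded_complex A Y" and f: "chain_iso A X Y f"
  shows "chain_iso A (shift X r) (shift Y r) (\<lambda>n. f (n + r))"
  using chain_map_shift[OF X Y chain_iso_map[OF f]] f by (simp add: chain_iso_def)

text \<open>The chain map \<open>g\<close> is turned into a roof over a copy of \<open>X\<close>.
  Its equivalence with the zero roof gives a quasi-isomorphism from some \<open>W\<close> to
  \<open>X\<close> after which \<open>g\<close> is null-homotopic; every cycle of \<open>X\<close>
  comes from a cycle of \<open>W\<close> up to a boundary, so \<open>g\<close> sends it to a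
  boundary.\<close>

lemma derived_hom_vanishes_boundaries:
  fixes A :: "('k::field, 'r) module"
    and X :: "('r, 'm) cochain_complex" and Y :: "('r, 'n) cochain_complex"
  assumes X: "bounded_complex A X" and Y: "bounded_complex A Y" and fd: "fd_algebra A"
    and van: "derived_hom_vanishes A X Y" and g: "chain_map A X Y g" and x: "x \<in> cycles X n"
  shows "g n x \<in> boundaries Y n"
proof -
  interpret fd_algebra A by (rule fd)
  let ?Z = "complex_copy A X"
  note Z = complex_copy(1)[OF X]
  obtain s where s: "chain_iso A ?Z X s" by (rule chain_isoE[OF X complex_copy(2)[OF X]])
  note sm = chain_iso_map[OF s]
  have "is_roof A X Y (?Z, s, g \<circ>\<^sub>c s)"
    using chain_iso_quasi_iso[OF Z X s] chain_map_comp[OF g sm] Z by simp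
  then have "roof_equiv A X Y (?Z, s, g \<circ>\<^sub>c s) (?Z, s, chain_zero Y)"
    using van unfolding derived_hom_vanishes_def by blast
  then obtain W :: "('r, 'k list) cochain_complex" and u u' where W: "bounded_complex A W" and u: "chain_map A W ?Z u"
    and u': "chain_map A W ?Z u'"
    and qi: "quasi_iso A W X (s \<circ>\<^sub>c u)"
    and ho: "homotopic A W Y ((g \<circ>\<^sub>c s) \<circ>\<^sub>c u) (chain_zero Y \<circ>\<^sub>c u')"
    unfolding roof_equiv.simps by blast
  note su = chain_map_comp[OF sm u]
  obtain w where w: "w \<in> cycles W n" "x \<ominus>\<^bsub>obj X n\<^esub> (s \<circ>\<^sub>c u) n w \<in> boundaries X n"
    using quasi_iso_surj[OF W X qi x] by blast
  let ?y = "(s \<circ>\<^sub>c u) n w"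
  note xX = cycles_carrier[OF X x]
  have y: "?y \<in> carrier (obj X n)" by (rule chain_map_closed[OF su cycles_carrier[OF W w(1)]])
  interpret Y: abelian_group "obj Y n" by (rule complex_group[OF Y])
  have "g n ?y \<ominus>\<^bsub>obj Y n\<^esub> \<zero>\<^bsub>obj Y n\<^esub> \<in> boundaries Y n"
    using homotopic_coboundary[OF W Y ho w(1)] by (simp add: chain_comp_def chain_zero_def)
  then have 1: "g n ?y \<in> boundaries Y n"
    using minus_zero_right[OF complex_group[OF Y] chain_map_closed[OF g y]] by simp
  have "g n x \<ominus>\<^bsub>obj Y n\<^esub> g n ?y \<in> boundaries Y n"
    using chain_map_boundaries[OF X Y g w(2)] by (simp add: chain_map_diff[OF X Y g xX y])
  then show ?thesis by (rule coboundary_mem[OF Y _ 1 chain_map_closed[OF g xX]])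
qed

text \<open>The identity of \<open>X\<close> is, up to equivalence of roofs, a composite through
  \<open>Y\<close>. A cycle of \<open>X\<close> can therefore be followed through \<open>Y\<close>,
  where every cycle in degree \<open>n\<close> is a boundary, and back.\<close>

lemma derived_iso_exact:
  fixes A :: "('k::field, 'r) module"
    and X :: "('r, 'm) cochain_complex" and Y :: "('r, 'n) cochain_complex"
  assumes X: "bounded_complex A X" and Y: "bounded_complex A Y" and iso: "derived_iso A X Y"
    and ex: "cycles Y n \<subseteq> boundaries Y n"
  shows "cycles X n \<subseteq> boundaries X n"
proof
  fix x assume x: "x \<in> cycles X n"
  obtain Z s f W t g P e h where r1: "is_roof A X Y (Z, s, f)" and r2: "is_roof A Y X (W, t, g)"
    and co: "roof_comp A Y (Z, s, f) (W, t, g) (P, e, h)"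
    and idn: "roof_is_identity A X (P, e, h)"
    using iso unfolding derived_iso_def by (metis prod_cases3)
  have W: "bounded_complex A W" and t: "quasi_iso A W Y t" and g: "chain_map A W X g"
    and P: "bounded_complex A P" and Z: "bounded_complex A Z" and s: "quasi_iso A Z X s"
    using r1 r2 co by auto
  obtain p q where p: "quasi_iso A P Z p" and q: "chain_map A P W q" and eh: "e = s \<circ>\<^sub>c p" "h = g \<circ>\<^sub>c q"
    using co by auto
  obtain V :: "('r, 'k list) cochain_complex" and u u' where V: "bounded_complex A V" and u: "chain_map A V P u" and u': "chain_map A V P u'"
    and qi: "quasi_iso A V X (e \<circ>\<^sub>c u)"
    and h1: "homotopic A V X (e \<circ>\<^sub>c u) (e \<circ>\<^sub>c u')" and h2: "homotopic A V X (h \<circ>\<^sub>c u) (e \<circ>\<^sub>c u')"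
    using idn unfolding roof_is_identity.simps roof_equiv.simps by blast
  obtain v where v: "v \<in> cycles V n" "x \<ominus>\<^bsub>obj X n\<^esub> (e \<circ>\<^sub>c u) n v \<in> boundaries X n"
    using quasi_iso_surj[OF V X qi x] by blast
  let ?w = "q n (u n v)"
  have e: "chain_map A P X e" unfolding eh
    by (rule chain_map_comp[OF quasi_iso_chain_map[OF Z X s] quasi_iso_chain_map[OF P Z p]])
  have h: "chain_map A P X h" unfolding eh by (rule chain_map_comp[OF g q])
  have w: "?w \<in> cycles W n"
    by (rule chain_map_cycles[OF P W q chain_map_cycles[OF V P u v(1)]])
  have "t n ?w \<in> boundaries Y n"
    using ex chain_map_cycles[OF W Y quasi_iso_chain_map[OF W Y t] w] by blast
  then have "g n ?w \<in> boundaries X n"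
    by (intro chain_map_boundaries[OF W X g] quasi_iso_inj[OF W Y t w])
  then have b: "(h \<circ>\<^sub>c u) n v \<in> boundaries X n" by (simp add: eh chain_comp_def)
  note c1 = chain_map_closed[OF chain_map_comp[OF e u] cycles_carrier[OF V v(1)]]
    and c2 = chain_map_closed[OF chain_map_comp[OF e u'] cycles_carrier[OF V v(1)]]
    and c3 = chain_map_closed[OF chain_map_comp[OF h u] cycles_carrier[OF V v(1)]]
  note c0 = cycles_carrier[OF X x]
  have 1: "(e \<circ>\<^sub>c u') n v \<in> boundaries X n"
    by (rule coboundary_mem[OF X coboundary_sym[OF X homotopic_coboundary[OF V X h2 v(1)] c3 c2] b c2])
  have 2: "(e \<circ>\<^sub>c u) n v \<in> boundaries X n"
    by (rule coboundary_mem[OF X homotopic_coboundary[OF V X h1 v(1)] 1 c1])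
  show "x \<in> boundaries X n" by (rule coboundary_mem[OF X v(2) 2 c0])
qed

lemma roof_equiv_identity_iso:
  fixes A :: "('k::field, 'r) module"
    and T :: "('r, 'm) cochain_complex" and T' :: "('r, 'n) cochain_complex"
  assumes T: "bounded_complex A T" and T': "bounded_complex A T'" and psi: "chain_iso A T T' \<psi>"
    and eq: "roof_equiv A T T (P, e, h) (P, e, e)"
    and P: "bounded_complex A P" and e: "chain_map A P T e" and h: "chain_map A P T h"
  shows "roof_equiv A T' T' (P, \<psi> \<circ>\<^sub>c e, \<psi> \<circ>\<^sub>c h) (P, \<psi> \<circ>\<^sub>c e, \<psi> \<circ>\<^sub>c e)"
proof -
  note pm = chain_iso_map[OF psi] and pq = chain_iso_quasi_iso[OF T T' psi]
  obtain V :: "('r, 'k list) cochain_complex" and u u' where V: "bounded_complex A V" and u: "chain_map A V P u" and u': "chain_map A V P u'"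
    and qi: "quasi_iso A V T (e \<circ>\<^sub>c u)"
    and h1: "homotopic A V T (e \<circ>\<^sub>c u) (e \<circ>\<^sub>c u')" and h2: "homotopic A V T (h \<circ>\<^sub>c u) (e \<circ>\<^sub>c u')"
    using eq unfolding roof_equiv.simps by blast
  note c = chain_map_comp[OF e u] chain_map_comp[OF e u'] chain_map_comp[OF h u]
  show ?thesis unfolding roof_equiv.simps chain_comp_assoc
    by (intro exI[of _ V] exI[of _ u] exI[of _ u'] conjI V u u' quasi_iso_comp[OF V T T' pq qi]
        homotopic_comp_left[OF T pm h1 T' V] homotopic_comp_left[OF T pm h2 T' V] c)
qed

text \<open>Only the legs that end in \<open>T\<close> are composed with \<open>\<psi>\<close>; the
  apexes and the other legs stay, so the given composites also witness the two identities for
  \<open>T'\<close>.\<close>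

lemma derived_iso_chain_iso:
  assumes T: "bounded_complex A T" and T': "bounded_complex A T'" and Y: "bounded_complex A Y"
    and psi: "chain_iso A T T' \<psi>" and iso: "derived_iso A T Y"
  shows "derived_iso A T' Y"
proof -
  obtain Z s f W t g P e h P2 e2 h2 where r1: "is_roof A T Y (Z, s, f)" and r2: "is_roof A Y T (W, t, g)"
    and co: "roof_comp A Y (Z, s, f) (W, t, g) (P, e, h)" "roof_is_identity A T (P, e, h)"
    and co2: "roof_comp A T (W, t, g) (Z, s, f) (P2, e2, h2)" "roof_is_identity A Y (P2, e2, h2)"
    using iso unfolding derived_iso_def by (metis prod_cases3)
  note pm = chain_iso_map[OF psi] and pq = chain_iso_quasi_iso[OF T T' psi]
  have W: "bounded_complex A W" and t: "quasi_iso A W Y t" and g: "chain_map A W T g"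
    and P: "bounded_complex A P" and P2: "bounded_complex A P2"
    and Z: "bounded_complex A Z" and s: "quasi_iso A Z T s" and f: "chain_map A Z Y f"
    using r1 r2 co co2 by auto
  obtain p q where p: "quasi_iso A P Z p" and q: "chain_map A P W q" and eh: "e = s \<circ>\<^sub>c p" "h = g \<circ>\<^sub>c q"
    and ho: "homotopic A P Y (f \<circ>\<^sub>c p) (t \<circ>\<^sub>c q)"
    using co by auto
  obtain p2 q2 where p2: "quasi_iso A P2 W p2" and q2: "chain_map A P2 Z q2"
    and eh2: "e2 = t \<circ>\<^sub>c p2" "h2 = f \<circ>\<^sub>c q2" and ho2: "homotopic A P2 T (g \<circ>\<^sub>c p2) (s \<circ>\<^sub>c q2)"
    using co2 by auto
  have ec: "chain_map A P T e" unfolding eh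
    by (rule chain_map_comp[OF quasi_iso_chain_map[OF Z T s] quasi_iso_chain_map[OF P Z p]])
  have hc: "chain_map A P T h" unfolding eh by (rule chain_map_comp[OF g q])
  show ?thesis unfolding derived_iso_def
  proof (intro exI conjI)
    show "is_roof A T' Y (Z, \<psi> \<circ>\<^sub>c s, f)"
      using Z f quasi_iso_comp[OF Z T T' pq s] by simp
    show "is_roof A Y T' (W, t, \<psi> \<circ>\<^sub>c g)"
      using W t chain_map_comp[OF pm g] by simp
    show "roof_comp A Y (Z, \<psi> \<circ>\<^sub>c s, f) (W, t, \<psi> \<circ>\<^sub>c g) (P, \<psi> \<circ>\<^sub>c e, \<psi> \<circ>\<^sub>c h)"
      unfolding roof_comp.simps eh chain_comp_assoc using P p q ho by blast
    show "roof_is_identity A T' (P, \<psi> \<circ>\<^sub>c e, \<psi> \<circ>\<^sub>c h)"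
      unfolding roof_is_identity.simps
      by (rule roof_equiv_identity_iso[OF T T' psi _ P ec hc]) (use co(2) in simp)
    show "roof_comp A T' (W, t, \<psi> \<circ>\<^sub>c g) (Z, \<psi> \<circ>\<^sub>c s, f) (P2, e2, h2)"
      unfolding roof_comp.simps eh2 chain_comp_assoc
      using P2 p2 q2 homotopic_comp_left[OF T pm ho2 T' P2
          chain_map_comp[OF g quasi_iso_chain_map[OF P2 W p2]] chain_map_comp[OF quasi_iso_chain_map[OF Z T s] q2]]
      by blast
    show "roof_is_identity A Y (P2, e2, h2)" by (rule co2(2))
  qed
qed

section \<open>Shifts, sums, cones and stalks as bounded complexes\<close>

lemma bounded_shift:
  assumes X: "bounded_complex A X"
  shows "bounded_complex A (shift X r)"
proof -
  obtain N where N: "\<And>n. \<bar>n\<bar> > N \<Longrightarrow> carrier (obj X n) = {\<zero>\<^bsub>obj X n\<^esub>}"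
    using X by (auto simp: bounded_complex_def)
  have e: "n + 1 + r = n + r + 1" "n + 2 + r = n + r + 2" "n + r + 1 + 1 = n + r + 2" for n by simp_all
  show ?thesis
  proof (rule bounded_complexI[where N = "N + \<bar>r\<bar>"])
    show "fd_module A (obj (shift X r) n)" for n by (simp add: complex_fd[OF X])
    show "diff (shift X r) n \<in> mod_hom A (obj (shift X r) n) (obj (shift X r) (n + 1))" for n
      unfolding shift_def
      using complex_diff[OF X, of "n + r"] mod_hom_neg[OF complex_right_module[OF X] complex_diff[OF X, of "n + r"]]
      by (cases "even r") (simp_all add: e)
    show "diff (shift X r) (n + 1) (diff (shift X r) n x) = \<zero>\<^bsub>obj (shift X r) (n + 2)\<^esub>"
      if "x \<in> carrier (obj (shift X r) n)" for n x
    proof -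
      have x: "x \<in> carrier (obj X (n + r))" using that by simp
      interpret M: abelian_group "obj X (n + r + 2)" by (rule complex_group[OF X])
      interpret M1: abelian_group "obj X (n + r + 1)" by (rule complex_group[OF X])
      have d: "diff X (n + r) x \<in> carrier (obj X (n + r + 1))"
        by (rule mod_hom_closed[OF complex_diff[OF X] x])
      have dd: "diff X (n + r + 1) (diff X (n + r) x) = \<zero>\<^bsub>obj X (n + r + 2)\<^esub>"
        by (rule complex_diff_diff[OF X x])
      have "diff X (n + r + 1) (\<ominus>\<^bsub>obj X (n + r + 1)\<^esub> diff X (n + r) x) = \<zero>\<^bsub>obj X (n + r + 2)\<^esub>"
        using mod_hom_inv[OF complex_group[OF X] complex_group[OF X] complex_diff[OF X] d] dd
        unfolding e by simp
      then show ?thesis using dd unfolding shift_def cochain_complex.simps e by simp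
    qed
    show "carrier (obj (shift X r) n) = {\<zero>\<^bsub>obj (shift X r) n\<^esub>}" if "\<bar>n\<bar> > N + \<bar>r\<bar>" for n
      using N[of "n + r"] that by simp
  qed
qed

text \<open>Settles the degrees in which the source or the target of a map is zero, which for
  two-term complexes are almost all.\<close>

lemma hom_eq_trivial:
  assumes "abelian_group M" "abelian_group N" "f \<in> mod_hom A M N" "g \<in> mod_hom A M N"
    "carrier M = {\<zero>\<^bsub>M\<^esub>} \<or> carrier N = {\<zero>\<^bsub>N\<^esub>}" "x \<in> carrier M"
  shows "f x = g x"
  using assms(5)
proof
  assume "carrier M = {\<zero>\<^bsub>M\<^esub>}"
  then show ?thesis using assms(6) mod_hom_zero[OF assms(1-3)] mod_hom_zero[OF assms(1,2,4)] by simp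
next
  assume "carrier N = {\<zero>\<^bsub>N\<^esub>}"
  then show ?thesis using mod_hom_closed[OF assms(3,6)] mod_hom_closed[OF assms(4,6)] by simp
qed

lemma chain_map_chain_zero:
  assumes "bounded_complex A Y"
  shows "chain_map A X Y (chain_zero Y)"
  unfolding chain_map_def chain_zero_def
  using mod_hom_zero[OF complex_group[OF assms] complex_group[OF assms] complex_diff[OF assms]]
  by (simp add: right_module.zero_hom[OF complex_right_module[OF assms]])

context fd_algebra
begin

lemma bounded_complex_sum:
  assumes X: "bounded_complex A X" and Y: "bounded_complex A Y"
  shows "bounded_complex A (complex_sum X Y)"
proof -
  obtain N where N: "\<And>n. \<bar>n\<bar> > N \<Longrightarrow> carrier (obj X n) = {\<zero>\<^bsub>obj X n\<^esub>}"
    using X by (auto simp: bounded_complex_def)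
  obtain N' where N': "\<And>n. \<bar>n\<bar> > N' \<Longrightarrow> carrier (obj Y n) = {\<zero>\<^bsub>obj Y n\<^esub>}"
    using Y by (auto simp: bounded_complex_def)
  show ?thesis
  proof (rule bounded_complexI[where N = "max N N'"])
    show "fd_module A (obj (complex_sum X Y) n)" for n
      by (simp add: fd_mod_sum complex_fd[OF X] complex_fd[OF Y])
    show "diff (complex_sum X Y) n \<in> mod_hom A (obj (complex_sum X Y) n) (obj (complex_sum X Y) (n + 1))" for n
      unfolding complex_sum_def by (simp add: mod_hom_map_prod complex_diff[OF X] complex_diff[OF Y])
    show "diff (complex_sum X Y) (n + 1) (diff (complex_sum X Y) n x) = \<zero>\<^bsub>obj (complex_sum X Y) (n + 2)\<^esub>"
      if "x \<in> carrier (obj (complex_sum X Y) n)" for n x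
      using that by (auto simp: complex_diff_diff[OF X] complex_diff_diff[OF Y])
    show "carrier (obj (complex_sum X Y) n) = {\<zero>\<^bsub>obj (complex_sum X Y) n\<^esub>}" if "\<bar>n\<bar> > max N N'" for n
      using N[of n] N'[of n] that by simp
  qed
qed

lemma bounded_cone:
  assumes X: "bounded_complex A X" and Y: "bounded_complex A Y" and f: "chain_map A X Y f"
  shows "bounded_complex A (cone X Y f)"
proof -
  obtain N where N: "\<And>n. \<bar>n\<bar> > N \<Longrightarrow> carrier (obj X n) = {\<zero>\<^bsub>obj X n\<^esub>}"
    using X by (auto simp: bounded_complex_def)
  obtain N' where N': "\<And>n. \<bar>n\<bar> > N' \<Longrightarrow> carrier (obj Y n) = {\<zero>\<^bsub>obj Y n\<^esub>}"
    using Y by (auto simp: bounded_complex_def)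
  have e: "n + 1 + 1 = n + 2" "n + 2 + 1 = n + 3" "n + 1 + 2 = n + 3" for n :: int by simp_all
  show ?thesis
  \<comment> \<open>The first component of the cone sits in degree \<open>n + 1\<close>, which costs
    one.\<close>
  proof (rule bounded_complexI[where N = "max (\<bar>N\<bar> + 1) N'"])
    show "fd_module A (obj (cone X Y f) n)" for n
      by (simp add: fd_mod_sum complex_fd[OF X] complex_fd[OF Y])
    show "diff (cone X Y f) n \<in> mod_hom A (obj (cone X Y f) n) (obj (cone X Y f) (n + 1))" for n
    proof -
      have 1: "(\<lambda>z. \<ominus>\<^bsub>obj X (n + 2)\<^esub> diff X (n + 1) (fst z)) \<in> mod_hom A (obj (cone X Y f) n) (obj X (n + 2))"
        using mod_hom_neg[OF complex_right_module[OF X]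
            mod_hom_comp[OF complex_diff[OF X, of "n + 1"] mod_hom_fst[of A "obj X (n + 1)" "obj Y n"]]]
        unfolding e cone_obj .
      have 2: "(\<lambda>z. f (n + 1) (fst z) \<oplus>\<^bsub>obj Y (n + 1)\<^esub> diff Y n (snd z)) \<in> mod_hom A (obj (cone X Y f) n) (obj Y (n + 1))"
        unfolding cone_obj
        by (rule mod_hom_plus[OF complex_right_module[OF Y] mod_hom_comp[OF chain_map_hom[OF f] mod_hom_fst]
              mod_hom_comp[OF complex_diff[OF Y] mod_hom_snd]])
      show ?thesis using mod_hom_pair[OF 1 2] unfolding cone_obj e by (simp add: cone_def split_def)
    qed
    show "diff (cone X Y f) (n + 1) (diff (cone X Y f) n z) = \<zero>\<^bsub>obj (cone X Y f) (n + 2)\<^esub>"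
      if z': "z \<in> carrier (obj (cone X Y f) n)" for n z
    proof -
      obtain x y where z: "z = (x, y)" and x: "x \<in> carrier (obj X (n + 1))" and y: "y \<in> carrier (obj Y n)"
        using z' by auto
      interpret X2: abelian_group "obj X (n + 2)" by (rule complex_group[OF X])
      interpret X3: abelian_group "obj X (n + 3)" by (rule complex_group[OF X])
      interpret Y1: abelian_group "obj Y (n + 1)" by (rule complex_group[OF Y])
      interpret Y2: abelian_group "obj Y (n + 2)" by (rule complex_group[OF Y])
      have dx: "diff X (n + 1) x \<in> carrier (obj X (n + 2))"
        using mod_hom_closed[OF complex_diff[OF X] x] unfolding e .
      have fx: "f (n + 1) x \<in> carrier (obj Y (n + 1))" by (rule chain_map_closed[OF f x])
      have dy: "diff Y n y \<in> carrier (obj Y (n + 1))" by (rule mod_hom_closed[OF complex_diff[OF Y] y])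
      have 1: "diff X (n + 2) (\<ominus>\<^bsub>obj X (n + 2)\<^esub> diff X (n + 1) x) = \<zero>\<^bsub>obj X (n + 3)\<^esub>"
        using mod_hom_inv[OF complex_group[OF X] complex_group[OF X] complex_diff[OF X, of "n + 2"] dx]
          complex_diff_diff[OF X x] unfolding e by simp
      have dfx: "diff Y (n + 1) (f (n + 1) x) \<in> carrier (obj Y (n + 2))"
        using mod_hom_closed[OF complex_diff[OF Y] fx] unfolding e .
      have "f (n + 2) (\<ominus>\<^bsub>obj X (n + 2)\<^esub> diff X (n + 1) x) = \<ominus>\<^bsub>obj Y (n + 2)\<^esub> diff Y (n + 1) (f (n + 1) x)"
        using mod_hom_inv[OF complex_group[OF X] complex_group[OF Y] chain_map_hom[OF f] dx]
          chain_map_commute[OF f x] unfolding e by simp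
      moreover have "diff Y (n + 1) (f (n + 1) x \<oplus>\<^bsub>obj Y (n + 1)\<^esub> diff Y n y) = diff Y (n + 1) (f (n + 1) x)"
        using mod_hom_add[OF complex_diff[OF Y] fx dy] complex_diff_diff[OF Y y] dfx unfolding e by simp
      \<comment> \<open>The sign in the differential of the cone makes the two mixed terms
        cancel.\<close>
      ultimately have 2: "f (n + 2) (\<ominus>\<^bsub>obj X (n + 2)\<^esub> diff X (n + 1) x) \<oplus>\<^bsub>obj Y (n + 2)\<^esub>
          diff Y (n + 1) (f (n + 1) x \<oplus>\<^bsub>obj Y (n + 1)\<^esub> diff Y n y) = \<zero>\<^bsub>obj Y (n + 2)\<^esub>"
        using dfx by (simp add: Y2.l_neg)
      show ?thesis unfolding z cone_def cochain_complex.simps prod.case e 1 2 by simp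
    qed
    show "carrier (obj (cone X Y f) n) = {\<zero>\<^bsub>obj (cone X Y f) n\<^esub>}" if "\<bar>n\<bar> > max (\<bar>N\<bar> + 1) N'" for n
    proof -
      have "\<bar>n + 1\<bar> > N" "\<bar>n\<bar> > N'" using that by linarith+
      then show ?thesis using N N' by simp
    qed
  qed
qed

lemma bounded_stalk:
  assumes "fd_module A M"
  shows "bounded_complex A (stalk M)"
proof -
  interpret M: right_module A M by (rule fd_right_module[OF assms])
  note Z = right_module_zero_submodule[OF fd_right_module[OF assms]]
  have zh: "(\<lambda>x. \<zero>\<^bsub>M\<^esub>) \<in> mod_hom A N M" "(\<lambda>x. \<zero>\<^bsub>M\<^esub>) \<in> mod_hom A N (zero_submodule M)"
    for N :: "('r, 'd) rmodule"
    using M.zero_hom right_module.zero_hom[OF Z, of N] by simp_all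
  show ?thesis
    by (rule bounded_complexI[where N = 0])
      (auto simp: stalk_def assms fd_zero_submodule fd_right_module zh)
qed

text \<open>\<open>tilting_module\<close> asks for a tilting complex of lists, while
  \<open>T\<close> may have elements of another type; the property is moved to a copy. Projectivity
  passes term by term, vanishing of Hom by conjugating roofs with \<open>\<psi>\<close>, and
  generation because every summand of \<open>T\<close> is one of \<open>T'\<close>.\<close>

lemma tilting_complex_chain_iso:
  assumes T': "bounded_complex A T'" and psi: "chain_iso A T T' \<psi>" and til: "tilting_complex A T"
  shows "tilting_complex A T'"
proof -
  have T: "bounded_complex A T" using til by (simp add: tilting_complex_def projective_complex_def)
  define \<phi> where "\<phi> = (\<lambda>n. inv_into (carrier (obj T n)) (\<psi> n))"
  have phi: "chain_iso A T' T \<phi>" unfolding \<phi>_def by (rule chain_iso_inverse[OF T psi])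
  have pp: "\<psi> n (\<phi> n x) = x" if "x \<in> carrier (obj T' n)" for n x
    using psi that by (auto simp: chain_iso_def bij_betw_def \<phi>_def intro: f_inv_into_f)
  note phm = chain_iso_map[OF phi] and psm = chain_iso_map[OF psi]
  have "projective A (obj T' n)" for n
  proof (rule projective_iso)
    show "projective A (obj T n)" using til by (simp add: tilting_complex_def projective_complex_def)
    show "mod_iso A (obj T n) (obj T' n)"
      using psi chain_map_hom[OF psm] unfolding chain_iso_def mod_iso_def by blast
    show "right_module A (obj T' n)" by (rule complex_right_module[OF T'])
  qed
  moreover have "derived_hom_vanishes A T' (shift T' r)" if "r \<noteq> 0" for r
    unfolding derived_hom_vanishes_def
  proof (intro allI impI)
    fix Z s f assume "is_roof A T' (shift T' r) (Z, s, f)"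
    then have Z: "bounded_complex A Z" and s: "quasi_iso A Z T' s" and f: "chain_map A Z (shift T' r) f"
      by auto
    note Sr = bounded_shift[OF T, of r] and Sr' = bounded_shift[OF T', of r]
    let ?\<phi> = "\<lambda>n. \<phi> (n + r)" and ?\<psi> = "\<lambda>n. \<psi> (n + r)"
    have phr: "chain_map A (shift T' r) (shift T r) ?\<phi>" by (rule chain_map_shift[OF T' T phm])
    have psr: "chain_map A (shift T r) (shift T' r) ?\<psi>" by (rule chain_map_shift[OF T T' psm])
    have sm: "chain_map A Z T' s" by (rule quasi_iso_chain_map[OF Z T' s])
    \<comment> \<open>The roof is carried back to \<open>T\<close> along the inverse
      \<open>\<phi>\<close>, is zero there because \<open>T\<close> is tilting, and the equivalence
      that shows it is carried forward again by \<open>\<psi>\<close>.\<close>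
    have "is_roof A T (shift T r) (Z, \<phi> \<circ>\<^sub>c s, ?\<phi> \<circ>\<^sub>c f)"
      using Z quasi_iso_comp[OF Z T' T chain_iso_quasi_iso[OF T' T phi] s] chain_map_comp[OF phr f] by simp
    then have "roof_equiv A T (shift T r) (Z, \<phi> \<circ>\<^sub>c s, ?\<phi> \<circ>\<^sub>c f) (Z, \<phi> \<circ>\<^sub>c s, chain_zero (shift T r))"
      using til that unfolding tilting_complex_def derived_hom_vanishes_def by blast
    then obtain W :: "('r, 'k list) cochain_complex" and u u' where W: "bounded_complex A W" and u: "chain_map A W Z u" and u': "chain_map A W Z u'"
      and qi: "quasi_iso A W T ((\<phi> \<circ>\<^sub>c s) \<circ>\<^sub>c u)"
      and h1: "homotopic A W T ((\<phi> \<circ>\<^sub>c s) \<circ>\<^sub>c u) ((\<phi> \<circ>\<^sub>c s) \<circ>\<^sub>c u')"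
      and h2: "homotopic A W (shift T r) ((?\<phi> \<circ>\<^sub>c f) \<circ>\<^sub>c u) (chain_zero (shift T r) \<circ>\<^sub>c u')"
      unfolding roof_equiv.simps by blast
    have c: "chain_map A W T ((\<phi> \<circ>\<^sub>c s) \<circ>\<^sub>c u)" "chain_map A W T ((\<phi> \<circ>\<^sub>c s) \<circ>\<^sub>c u')"
      by (intro chain_map_comp[OF chain_map_comp[OF phm sm]] u u')+
    \<comment> \<open>\<open>\<psi>\<close> and \<open>\<phi>\<close> cancel on the carriers only,
      hence the passage through pointwise equality.\<close>
    have eq: "(\<psi> \<circ>\<^sub>c ((\<phi> \<circ>\<^sub>c s) \<circ>\<^sub>c v)) n x = (s \<circ>\<^sub>c v) n x"
      if "chain_map A W Z v" "x \<in> carrier (obj W n)" for v n x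
      using pp chain_map_closed[OF chain_map_comp[OF sm that(1)] that(2)] by (simp add: chain_comp_def)
    have qi': "quasi_iso A W T' (s \<circ>\<^sub>c u)"
      by (rule quasi_iso_cong[OF W T' quasi_iso_comp[OF W T T' chain_iso_quasi_iso[OF T T' psi] qi]
            chain_map_comp[OF sm u] eq[OF u]])
    have h1': "homotopic A W T' (s \<circ>\<^sub>c u) (s \<circ>\<^sub>c u')"
      by (rule homotopic_cong[OF W T' homotopic_comp_left[OF T psm h1 T' W c] eq[OF u] eq[OF u']])
    have c': "chain_map A W (shift T r) ((?\<phi> \<circ>\<^sub>c f) \<circ>\<^sub>c u)"
      by (rule chain_map_comp[OF chain_map_comp[OF phr f] u])
    have cz: "chain_map A W (shift T r) (chain_zero (shift T r) \<circ>\<^sub>c u')"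
      by (rule chain_map_comp[OF chain_map_chain_zero[OF Sr] u'])
    have eq2: "(?\<psi> \<circ>\<^sub>c ((?\<phi> \<circ>\<^sub>c f) \<circ>\<^sub>c u)) n x = (f \<circ>\<^sub>c u) n x" if "x \<in> carrier (obj W n)" for n x
      using pp chain_map_closed[OF chain_map_comp[OF f u] that] by (simp add: chain_comp_def)
    have eq3: "(?\<psi> \<circ>\<^sub>c (chain_zero (shift T r) \<circ>\<^sub>c u')) n x = (chain_zero (shift T' r) \<circ>\<^sub>c u') n x"
      if "x \<in> carrier (obj W n)" for n x
      using chain_map_zero[OF T T' psm] by (simp add: chain_comp_def chain_zero_def)
    have h2': "homotopic A W (shift T' r) (f \<circ>\<^sub>c u) (chain_zero (shift T' r) \<circ>\<^sub>c u')"
      by (rule homotopic_cong[OF W Sr' homotopic_comp_left[OF Sr psr h2 Sr' W c' cz] eq2 eq3])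
    show "roof_equiv A T' (shift T' r) (Z, s, f) (Z, s, chain_zero (shift T' r))"
      unfolding roof_equiv.simps using W u u' qi' h1' h2' by blast
  qed
  moreover have "\<T> = per A" if "triangulated_subcategory A \<T>" "derived_summands A T' \<subseteq> \<T>" for \<T>
  proof -
    have "X \<in> derived_summands A T'" if X: "X \<in> derived_summands A T" for X
    proof -
      obtain Y :: "('r, 'k list) cochain_complex" where XY: "bounded_complex A X" "bounded_complex A Y"
        "derived_iso A T (complex_sum X Y)"
        using X unfolding derived_summands_def by blast
      have S: "bounded_complex A (complex_sum X Y)" by (rule bounded_complex_sum[OF XY(1,2)])
      show ?thesis unfolding derived_summands_def
        using XY derived_iso_chain_iso[OF T T' S psi XY(3)] by blast
    qed
    then show ?thesis using that til unfolding tilting_complex_def by (metis subset_iff)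
  qed
  ultimately show ?thesis using T' unfolding tilting_complex_def projective_complex_def by blast
qed

text \<open>Projectivity splits \<open>s\<close> one degree at a time. In degree 0 every
  \<open>x\<close> has the form \<open>s z + d t\<close> with a cycle \<open>z\<close>; the lift
  chooses \<open>z = u0 x\<close> and \<open>t = t0 x\<close> as module maps, and
  \<open>- t0\<close> becomes the homotopy. In degree -1 a single lift into the sum of
  \<open>obj Z 0\<close> and \<open>obj T (-1)\<close> makes \<open>u1\<close> commute with the
  differentials and satisfy the homotopy condition at once.\<close>

lemma two_term_lift:
  assumes T: "projective_complex A T" and triv: "\<And>n. n \<noteq> -1 \<Longrightarrow> n \<noteq> 0 \<Longrightarrow> carrier (obj T n) = {\<zero>\<^bsub>obj T n\<^esub>}"
    and Z: "bounded_complex A Z" and s: "quasi_iso A Z T s"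
  shows "\<exists>v. chain_map A T Z v \<and> homotopic A T T (s \<circ>\<^sub>c v) (\<lambda>n x. x)"
proof -
  have Tb: "bounded_complex A T" and pr: "\<And>n. projective A (obj T n)"
    using T by (auto simp: projective_complex_def)
  note sm = quasi_iso_chain_map[OF Z Tb s]
  interpret T0: right_module A "obj T 0" by (rule complex_right_module[OF Tb])
  interpret T1: right_module A "obj T (-1)" by (rule complex_right_module[OF Tb])
  interpret Z0: right_module A "obj Z 0" by (rule complex_right_module[OF Z])
  interpret Z1: right_module A "obj Z (-1)" by (rule complex_right_module[OF Z])
  let ?d = "diff T (-1)" and ?e = "diff Z (-1)"
  have d: "?d \<in> mod_hom A (obj T (-1)) (obj T 0)" and e: "?e \<in> mod_hom A (obj Z (-1)) (obj Z 0)"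
    using complex_diff[OF Tb, of "-1"] complex_diff[OF Z, of "-1"] by simp_all
  note s0 = chain_map_hom[OF sm, of 0] and s1 = chain_map_hom[OF sm, of "-1"]
  have se: "s 0 (?e z) = ?d (s (-1) z)" if "z \<in> carrier (obj Z (-1))" for z
    using chain_map_commute[OF sm that] by simp
  \<comment> \<open>Lifting into the cycles gives the chain map condition in degree 0:
    \<open>T\<close> is zero in degree 1, but \<open>Z\<close> may not be.\<close>
  let ?C = "(obj Z 0)\<lparr>carrier := cycles Z 0\<rparr>"
  note zz = mod_hom_zero[OF complex_group[OF Z] complex_group[OF Z] complex_diff[OF Z]]
  have C: "fd_module A ?C"
  proof (rule fd_restrict[OF complex_fd[OF Z]])
    interpret Z2: right_module A "obj Z (0 + 1)" by (rule complex_right_module[OF Z])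
    show "cycles Z 0 \<subseteq> carrier (obj Z 0)" by (auto simp: cycles_def)
    show "\<zero>\<^bsub>obj Z 0\<^esub> \<in> cycles Z 0" using zz by (simp add: cycles_def)
    show "x \<oplus>\<^bsub>obj Z 0\<^esub> y \<in> cycles Z 0" if "x \<in> cycles Z 0" "y \<in> cycles Z 0" for x y
      using that mod_hom_add[OF complex_diff[OF Z, of 0]] Z2.M.zero_closed Z2.M.l_zero by (simp add: cycles_def)
    show "act (obj Z 0) x a \<in> cycles Z 0" if "x \<in> cycles Z 0" "a \<in> carrier A" for x a
      using that mod_hom_act[OF complex_diff[OF Z, of 0]] Z2.act_zero_left Z0.act_closed by (simp add: cycles_def)
  qed
  let ?N = "mod_sum ?C (obj T (-1))"
  have inc: "(\<lambda>z. z) \<in> mod_hom A ?C (obj Z 0)"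
    by (rule mod_homI) (simp_all add: cycles_def)
  have g: "(\<lambda>(z, t). s 0 z \<oplus>\<^bsub>obj T 0\<^esub> ?d t) \<in> mod_hom A ?N (obj T 0)"
    by (rule mod_hom_case_sum[OF T0.right_module_axioms mod_hom_comp[OF s0 inc] d])
  have cyc: "x \<in> cycles T 0" if "x \<in> carrier (obj T 0)" for x
    using that mod_hom_closed[OF complex_diff[OF Tb] that] triv[of 1] by (simp add: cycles_def)
  have "(\<lambda>x. x) ` carrier (obj T 0) \<subseteq> (\<lambda>(z, t). s 0 z \<oplus>\<^bsub>obj T 0\<^esub> ?d t) ` carrier ?N"
  proof
    fix x assume "x \<in> (\<lambda>x. x) ` carrier (obj T 0)"
    then have x: "x \<in> carrier (obj T 0)" by simp
    obtain z where z: "z \<in> cycles Z 0" "x \<ominus>\<^bsub>obj T 0\<^esub> s 0 z \<in> boundaries T 0"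
      using quasi_iso_surj[OF Z Tb s cyc[OF x]] by blast
    then obtain t where t: "t \<in> carrier (obj T (-1))" "x \<ominus>\<^bsub>obj T 0\<^esub> s 0 z = ?d t"
      by (auto simp: boundaries_def)
    have "s 0 z \<in> carrier (obj T 0)" by (rule chain_map_closed[OF sm cycles_carrier[OF Z z(1)]])
    then have "x = s 0 z \<oplus>\<^bsub>obj T 0\<^esub> ?d t"
      unfolding t(2)[symmetric] using x by (simp add: a_minus_def T0.M.a_lcomm T0.M.r_neg)
    then show "x \<in> (\<lambda>(z, t). s 0 z \<oplus>\<^bsub>obj T 0\<^esub> ?d t) ` carrier ?N"
      using z(1) t(1) by (intro image_eqI[of _ _ "(z, t)"]) simp_all
  qed
  then obtain l where l: "l \<in> mod_hom A (obj T 0) ?N"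
    "\<forall>x\<in>carrier (obj T 0). (case l x of (z, t) \<Rightarrow> s 0 z \<oplus>\<^bsub>obj T 0\<^esub> ?d t) = x"
    using projective_lift[OF pr complex_fd[OF Tb] fd_mod_sum[OF C complex_fd[OF Tb]] complex_fd[OF Tb] g mod_hom_id]
    by blast
  define u0 where "u0 = (\<lambda>x. fst (l x))"
  define t0 where "t0 = (\<lambda>x. snd (l x))"
  have u0C: "u0 \<in> mod_hom A (obj T 0) ?C" unfolding u0_def by (rule mod_hom_comp[OF mod_hom_fst l(1)])
  have u0: "u0 \<in> mod_hom A (obj T 0) (obj Z 0)" using mod_hom_comp[OF inc u0C] .
  have u0c: "u0 x \<in> cycles Z 0" if "x \<in> carrier (obj T 0)" for x
    using mod_hom_closed[OF u0C that] by simp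
  have t0: "t0 \<in> mod_hom A (obj T 0) (obj T (-1))" unfolding t0_def by (rule mod_hom_comp[OF mod_hom_snd l(1)])
  have su: "s 0 (u0 x) \<oplus>\<^bsub>obj T 0\<^esub> ?d (t0 x) = x" if "x \<in> carrier (obj T 0)" for x
    using l(2) that by (simp add: u0_def t0_def split_def)
  \<comment> \<open>With the homotopy \<open>- t0\<close> in degree 0 and zero elsewhere, the
    condition in degree -1 reads \<open>s (u1 x) = x - t0 (d x)\<close>.\<close>
  let ?w = "\<lambda>x. x \<oplus>\<^bsub>obj T (-1)\<^esub> \<ominus>\<^bsub>obj T (-1)\<^esub> t0 (?d x)"
  have w: "?w \<in> mod_hom A (obj T (-1)) (obj T (-1))"
    by (rule mod_hom_plus[OF T1.right_module_axioms mod_hom_id mod_hom_neg[OF T1.right_module_axioms mod_hom_comp[OF t0 d]]])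
  let ?V = "mod_sum (obj Z 0) (obj T (-1))"
  have g1: "(\<lambda>z. (?e z, s (-1) z)) \<in> mod_hom A (obj Z (-1)) ?V" by (rule mod_hom_pair[OF e s1])
  have h1: "(\<lambda>x. (u0 (?d x), ?w x)) \<in> mod_hom A (obj T (-1)) ?V" by (rule mod_hom_pair[OF mod_hom_comp[OF u0 d] w])
  \<comment> \<open>For each \<open>x\<close> one element of \<open>Z\<close> must have both
    prescribed images. Injectivity on cohomology in degree 0 gives a \<open>z1\<close> with the
    right differential, and a cycle \<open>z2\<close> then corrects its image under
    \<open>s\<close>.\<close>
  have "(\<lambda>x. (u0 (?d x), ?w x)) ` carrier (obj T (-1)) \<subseteq> (\<lambda>z. (?e z, s (-1) z)) ` carrier (obj Z (-1))"
  proof (rule image_subsetI)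
    fix x assume x: "x \<in> carrier (obj T (-1))"
    note dx = mod_hom_closed[OF d x] and wx = mod_hom_closed[OF w x]
    note tdx = mod_hom_closed[OF t0 dx]
    have c: "u0 (?d x) \<in> cycles Z 0" by (rule u0c[OF dx])
    note cZ = cycles_carrier[OF Z c]
    have dw: "?d (?w x) = s 0 (u0 (?d x))"
    proof -
      have "?d (?w x) = ?d x \<oplus>\<^bsub>obj T 0\<^esub> \<ominus>\<^bsub>obj T 0\<^esub> ?d (t0 (?d x))"
        using x tdx by (simp add: mod_hom_add[OF d] mod_hom_inv[OF complex_group[OF Tb] complex_group[OF Tb] d])
      also have "\<dots> = (s 0 (u0 (?d x)) \<oplus>\<^bsub>obj T 0\<^esub> ?d (t0 (?d x))) \<oplus>\<^bsub>obj T 0\<^esub> \<ominus>\<^bsub>obj T 0\<^esub> ?d (t0 (?d x))"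
        by (simp add: su[OF dx])
      also have "\<dots> = s 0 (u0 (?d x))"
        using chain_map_closed[OF sm cZ] mod_hom_closed[OF d tdx] by (simp add: T0.M.a_assoc T0.M.r_neg)
      finally show ?thesis .
    qed
    have "s 0 (u0 (?d x)) \<in> boundaries T 0"
      by (rule boundariesI[OF Tb, of "?w x"]) (use wx dw in simp_all)
    then have "u0 (?d x) \<in> boundaries Z 0" by (rule quasi_iso_inj[OF Z Tb s c])
    then obtain z1 where z1: "z1 \<in> carrier (obj Z (-1))" "u0 (?d x) = ?e z1"
      by (auto simp: boundaries_def)
    note sz1 = mod_hom_closed[OF s1 z1(1)]
    let ?y = "?w x \<ominus>\<^bsub>obj T (-1)\<^esub> s (-1) z1"
    have y: "?y \<in> carrier (obj T (-1))" using wx sz1 by (simp add: a_minus_def)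
    have "?d ?y = ?d (?w x) \<ominus>\<^bsub>obj T 0\<^esub> ?d (s (-1) z1)"
      by (rule mod_hom_diff[OF complex_group[OF Tb] complex_group[OF Tb] d wx sz1])
    also have "\<dots> = \<zero>\<^bsub>obj T 0\<^esub>"
      unfolding dw z1(2) se[OF z1(1)] using mod_hom_closed[OF d sz1] by (simp add: a_minus_def T0.M.r_neg)
    finally have "?y \<in> cycles T (-1)" using y by (simp add: cycles_def)
    then obtain z2 where z2: "z2 \<in> cycles Z (-1)" "?y \<ominus>\<^bsub>obj T (-1)\<^esub> s (-1) z2 \<in> boundaries T (-1)"
      using quasi_iso_surj[OF Z Tb s] by blast
    have z2Z: "z2 \<in> carrier (obj Z (-1))" "?e z2 = \<zero>\<^bsub>obj Z 0\<^esub>" using z2(1) by (auto simp: cycles_def)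
    note sz2 = mod_hom_closed[OF s1 z2Z(1)]
    \<comment> \<open>As \<open>T\<close> is zero in degree -2, there are no nonzero boundaries in
      degree -1, and the correction is exact instead of up to a boundary.\<close>
    have "boundaries T (-1) = {\<zero>\<^bsub>obj T (-1)\<^esub>}"
      using mod_hom_zero[OF complex_group[OF Tb] complex_group[OF Tb] complex_diff'[OF Tb, of "-1"]] triv[of "-2"]
      by (simp add: boundaries_def)
    with z2(2) have 1: "?w x \<ominus>\<^bsub>obj T (-1)\<^esub> s (-1) z1 \<ominus>\<^bsub>obj T (-1)\<^esub> s (-1) z2 = \<zero>\<^bsub>obj T (-1)\<^esub>" by simp
    have 2: "?y = s (-1) z2" using 1 by (rule eq_of_minus_eq_zero[OF complex_group[OF Tb] y sz2]) 
    have "s (-1) z1 \<oplus>\<^bsub>obj T (-1)\<^esub> ?y = ?w x"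
      using wx sz1 T1.M.a_lcomm[of "s (-1) z1" "?w x"] T1.M.r_neg T1.M.r_zero
      by (simp add: a_minus_def)
    then have "?w x = s (-1) (z1 \<oplus>\<^bsub>obj Z (-1)\<^esub> z2)"
      unfolding 2 using z1(1) z2Z(1) by (simp add: mod_hom_add[OF s1])
    moreover have "u0 (?d x) = ?e (z1 \<oplus>\<^bsub>obj Z (-1)\<^esub> z2)"
      using z1 z2Z mod_hom_closed[OF e z1(1)] by (simp add: mod_hom_add[OF e])
    ultimately show "(u0 (?d x), ?w x) \<in> (\<lambda>z. (?e z, s (-1) z)) ` carrier (obj Z (-1))"
      using z1(1) z2Z(1) by (intro image_eqI[of _ _ "z1 \<oplus>\<^bsub>obj Z (-1)\<^esub> z2"]) auto
  qed
  then obtain u1 where u1: "u1 \<in> mod_hom A (obj T (-1)) (obj Z (-1))"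
    "\<forall>x\<in>carrier (obj T (-1)). (?e (u1 x), s (-1) (u1 x)) = (u0 (?d x), ?w x)"
    using projective_lift[OF pr complex_fd[OF Tb] complex_fd[OF Z] fd_mod_sum[OF complex_fd[OF Z] complex_fd[OF Tb]] g1 h1]
    by blast
  define v where "v = (\<lambda>n::int. if n = 0 then u0 else if n = -1 then u1 else (\<lambda>x. \<zero>\<^bsub>obj Z n\<^esub>))"
  have v: "v n \<in> mod_hom A (obj T n) (obj Z n)" for n
    unfolding v_def using u0 u1(1) by (simp add: right_module.zero_hom[OF complex_right_module[OF Z]])
  define h where "h = (\<lambda>n::int. if n = 0 then (\<lambda>x. \<ominus>\<^bsub>obj T (-1)\<^esub> t0 x) else (\<lambda>x. \<zero>\<^bsub>obj T (n - 1)\<^esub>))"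
  have h: "h n \<in> mod_hom A (obj T n) (obj T (n - 1))" for n
    unfolding h_def using mod_hom_neg[OF T1.right_module_axioms t0]
    by (simp add: right_module.zero_hom[OF complex_right_module[OF Tb]])
  have vm: "chain_map A T Z v"
    unfolding chain_map_def
  proof (intro conjI allI ballI v)
    fix n x assume x: "x \<in> carrier (obj T n)"
    consider "n = -1" | "n = 0" | "n \<noteq> -1" "n \<noteq> 0" by blast
    then show "v (n + 1) (diff T n x) = diff Z n (v n x)"
    proof cases
      case 1
      then show ?thesis using u1(2) x by (simp add: v_def)
    next
      case 2
      then show ?thesis using u0c[of x] x by (simp add: v_def cycles_def)
    next
      case 3
      show ?thesis
        using hom_eq_trivial[OF complex_group[OF Tb] complex_group[OF Z]
            mod_hom_comp[OF v complex_diff[OF Tb]] mod_hom_comp[OF complex_diff[OF Z] v] disjI1[OF triv[OF 3]] x] .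
    qed
  qed
  have "homotopic A T T (s \<circ>\<^sub>c v) (\<lambda>n x. x)"
    unfolding homotopic_def
  proof (intro exI[of _ h] conjI allI ballI h)
    fix n x assume x: "x \<in> carrier (obj T n)"
    note svx = chain_map_closed[OF chain_map_comp[OF sm vm] x]
    have h': "(\<lambda>x. h (n + 1) (diff T n x)) \<in> mod_hom A (obj T n) (obj T n)"
      using mod_hom_comp[OF h[of "n + 1"] complex_diff[OF Tb]] by simp
    consider "n = -1" | "n = 0" | "n \<noteq> -1" "n \<noteq> 0" by blast
    then show "(s \<circ>\<^sub>c v) n x \<ominus>\<^bsub>obj T n\<^esub> x = diff T (n - 1) (h n x) \<oplus>\<^bsub>obj T n\<^esub> h (n + 1) (diff T n x)"
    proof cases
      case 1
      have x1: "x \<in> carrier (obj T (-1))" using x 1 by simp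
      have td: "t0 (?d x) \<in> carrier (obj T (-1))" by (rule mod_hom_closed[OF t0 mod_hom_closed[OF d x1]])
      have dz: "diff T (-2) \<zero>\<^bsub>obj T (-2)\<^esub> = \<zero>\<^bsub>obj T (-1)\<^esub>"
        using mod_hom_zero[OF complex_group[OF Tb] complex_group[OF Tb] complex_diff[OF Tb, of "-2"]] by simp
      have "s (-1) (u1 x) \<ominus>\<^bsub>obj T (-1)\<^esub> x = \<ominus>\<^bsub>obj T (-1)\<^esub> t0 (?d x)"
        using u1(2) x1 td by (simp add: a_minus_def T1.M.a_ac T1.M.r_neg2)
      then show ?thesis unfolding 1 using td by (simp add: v_def h_def chain_comp_def dz)
    next
      case 2
      have x0: "x \<in> carrier (obj T 0)" using x 2 by simp
      note tx = mod_hom_closed[OF t0 x0]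
      note dtx = mod_hom_closed[OF d tx]
      have sux: "s 0 (u0 x) \<in> carrier (obj T 0)" by (rule mod_hom_closed[OF s0 mod_hom_closed[OF u0 x0]])
      have "\<ominus>\<^bsub>obj T 0\<^esub> x = \<ominus>\<^bsub>obj T 0\<^esub> ?d (t0 x) \<oplus>\<^bsub>obj T 0\<^esub> \<ominus>\<^bsub>obj T 0\<^esub> s 0 (u0 x)"
        using su[OF x0] sux dtx by (metis T0.M.minus_add T0.M.a_comm T0.M.a_inv_closed)
      then have "s 0 (u0 x) \<ominus>\<^bsub>obj T 0\<^esub> x = \<ominus>\<^bsub>obj T 0\<^esub> ?d (t0 x)"
        unfolding a_minus_def using sux dtx by (simp add: T0.M.a_ac T0.M.r_neg T0.M.r_neg2)
      then show ?thesis unfolding 2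
        using dtx tx by (simp add: v_def h_def chain_comp_def mod_hom_inv[OF complex_group[OF Tb] complex_group[OF Tb] d])
    next
      case 3
      have 1: "(\<lambda>x. (s \<circ>\<^sub>c v) n x \<oplus>\<^bsub>obj T n\<^esub> \<ominus>\<^bsub>obj T n\<^esub> x) \<in> mod_hom A (obj T n) (obj T n)"
        by (intro mod_hom_plus mod_hom_neg complex_right_module[OF Tb] mod_hom_id chain_map_hom chain_map_comp[OF sm vm])
      have 2: "(\<lambda>x. diff T (n - 1) (h n x) \<oplus>\<^bsub>obj T n\<^esub> h (n + 1) (diff T n x)) \<in> mod_hom A (obj T n) (obj T n)"
        by (rule mod_hom_plus[OF complex_right_module[OF Tb] mod_hom_comp[OF complex_diff'[OF Tb] h] h'])
      show ?thesis unfolding a_minus_def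
        using hom_eq_trivial[OF complex_group[OF Tb] complex_group[OF Tb] 1 2 disjI1[OF triv[OF 3]] x] .
    qed
  qed
  with vm show ?thesis by blast
qed

text \<open>As \<open>T\<close> lives in degrees -1 and 0, only \<open>r = 1\<close> and
  \<open>r = -1\<close> leave room for nonzero chain maps to \<open>T[r]\<close>; by
  \<open>ext\<close> those for \<open>r = 1\<close> are null-homotopic, by \<open>van\<close> those
  for \<open>r = -1\<close> are zero. A general roof is reduced to a chain map by the right inverse
  from \<open>two_term_lift\<close>.\<close>

lemma two_term_hom_vanishes:
  assumes T: "projective_complex A T" and triv: "\<And>n. n \<noteq> -1 \<Longrightarrow> n \<noteq> 0 \<Longrightarrow> carrier (obj T n) = {\<zero>\<^bsub>obj T n\<^esub>}"
    and ext: "\<And>\<phi>. \<phi> \<in> mod_hom A (obj T (-1)) (obj T 0) \<Longrightarrow>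
      \<exists>h\<in>mod_hom A (obj T 0) (obj T 0). \<forall>x\<in>carrier (obj T (-1)). \<phi> x = h (diff T (-1) x)"
    and van: "\<And>\<psi> x. \<psi> \<in> mod_hom A (obj T 0) (obj T (-1)) \<Longrightarrow>
      \<forall>y\<in>carrier (obj T 0). diff T (-1) (\<psi> y) = \<zero>\<^bsub>obj T 0\<^esub> \<Longrightarrow> x \<in> carrier (obj T 0) \<Longrightarrow> \<psi> x = \<zero>\<^bsub>obj T (-1)\<^esub>"
    and r: "r \<noteq> 0"
  shows "derived_hom_vanishes A T (shift T r)"
  unfolding derived_hom_vanishes_def
proof (intro allI impI)
  have Tb: "bounded_complex A T" using T by (simp add: projective_complex_def)
  note Sb = bounded_shift[OF Tb, of r]
  have null: "homotopic A T (shift T r) g (chain_zero (shift T r))" if g: "chain_map A T (shift T r) g" for g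
  proof (cases "r = 1")
    case True
    have "g (-1) \<in> mod_hom A (obj T (-1)) (obj T 0)" using chain_map_hom[OF g, of "-1"] by (simp add: True)
    then obtain H where H: "H \<in> mod_hom A (obj T 0) (obj T 0)"
      "\<forall>x\<in>carrier (obj T (-1)). g (-1) x = H (diff T (-1) x)"
      using ext by blast
    \<comment> \<open>An extension of \<open>g (-1)\<close> along the differential of
      \<open>T\<close> is a null homotopy concentrated in degree 0.\<close>
    define h where "h = (\<lambda>n::int. if n = 0 then H else (\<lambda>x. \<zero>\<^bsub>obj T n\<^esub>))"
    have h: "h n \<in> mod_hom A (obj T n) (obj (shift T r) (n - 1))" for n
      unfolding h_def True using H(1) by (simp add: right_module.zero_hom[OF complex_right_module[OF Tb]])
    show ?thesis unfolding homotopic_def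
    proof (intro exI[of _ h] conjI allI ballI h)
      fix n x assume x: "x \<in> carrier (obj T n)"
      interpret S: right_module A "obj (shift T r) n" by (rule complex_right_module[OF Sb])
      have h': "(\<lambda>x. h (n + 1) (diff T n x)) \<in> mod_hom A (obj T n) (obj (shift T r) n)"
        using mod_hom_comp[OF h[of "n + 1"] complex_diff[OF Tb]] by simp
      have rhs: "(\<lambda>x. diff (shift T r) (n - 1) (h n x) \<oplus>\<^bsub>obj (shift T r) n\<^esub> h (n + 1) (diff T n x))
          \<in> mod_hom A (obj T n) (obj (shift T r) n)"
        by (rule mod_hom_plus[OF S.right_module_axioms mod_hom_comp[OF complex_diff'[OF Sb] h] h'])
      have "g n x = diff (shift T r) (n - 1) (h n x) \<oplus>\<^bsub>obj (shift T r) n\<^esub> h (n + 1) (diff T n x)"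
      proof (cases "n = -1")
        case n: True
        have z: "diff (shift T r) (-2) \<zero>\<^bsub>obj T (-1)\<^esub> = \<zero>\<^bsub>obj T 0\<^esub>"
          using mod_hom_zero[OF complex_group[OF Sb] complex_group[OF Sb] complex_diff[OF Sb, of "-2"]]
          by (simp add: True)
        have x': "x \<in> carrier (obj T (-1))" using x n by simp
        have "H (diff T (-1) x) \<in> carrier (obj T 0)"
          using mod_hom_closed[OF complex_diff[OF Tb] x'] by (simp add: mod_hom_closed[OF H(1)])
        then show ?thesis using H(2) x' S.M.l_zero unfolding n by (simp add: h_def z[unfolded True] True n)
      next
        case False
        have "carrier (obj T n) = {\<zero>\<^bsub>obj T n\<^esub>} \<or> carrier (obj (shift T r) n) = {\<zero>\<^bsub>obj (shift T r) n\<^esub>}"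
          using triv[of n] triv[of "n + 1"] False by (cases "n = 0") (auto simp: True)
        from hom_eq_trivial[OF complex_group[OF Tb] complex_group[OF Sb] chain_map_hom[OF g] rhs this x]
        show ?thesis .
      qed
      then show "g n x \<ominus>\<^bsub>obj (shift T r) n\<^esub> chain_zero (shift T r) n x =
        diff (shift T r) (n - 1) (h n x) \<oplus>\<^bsub>obj (shift T r) n\<^esub> h (n + 1) (diff T n x)"
        using minus_zero_right[OF complex_group[OF Sb] chain_map_closed[OF g x]]
        by (simp add: chain_zero_def)
    qed
  next
    case False
    have "g n x = chain_zero (shift T r) n x" if x: "x \<in> carrier (obj T n)" for n x
    proof (cases "n = 0 \<and> r = -1")
      case True
      have n: "n = 0" and r': "r = -1" using True by auto
      have "diff T (-1) (g 0 y) = \<zero>\<^bsub>obj T 0\<^esub>" if y: "y \<in> carrier (obj T 0)" for y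
      proof -
        interpret T0: abelian_group "obj T 0" by (rule complex_group[OF Tb])
        have gy: "g 0 y \<in> carrier (obj T (-1))" using chain_map_closed[OF g y] by (simp add: r')
        have dg: "diff T (-1) (g 0 y) \<in> carrier (obj T 0)"
          using mod_hom_closed[OF complex_diff[OF Tb] gy] by simp
        have "diff T 0 y = \<zero>\<^bsub>obj T 1\<^esub>"
          using mod_hom_closed[OF complex_diff[OF Tb] y] triv[of 1] by simp
        moreover have "g 1 \<zero>\<^bsub>obj T 1\<^esub> = \<zero>\<^bsub>obj T 0\<^esub>" using chain_map_zero[OF Tb Sb g, of 1] by (simp add: r')
        \<comment> \<open>The minus sign is that of the differential of an odd shift.\<close>
        ultimately have "\<zero>\<^bsub>obj T 0\<^esub> = \<ominus>\<^bsub>obj T 0\<^esub> diff T (-1) (g 0 y)"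
          using chain_map_commute[OF g y] by (simp add: shift_def r')
        then have "diff T (-1) (g 0 y) = \<ominus>\<^bsub>obj T 0\<^esub> \<zero>\<^bsub>obj T 0\<^esub>" using dg by (metis T0.minus_minus)
        also have "\<dots> = \<zero>\<^bsub>obj T 0\<^esub>" by (rule T0.minus_equality) simp_all
        finally show ?thesis .
      qed
      moreover have "g 0 \<in> mod_hom A (obj T 0) (obj T (-1))" using chain_map_hom[OF g, of 0] by (simp add: r')
      ultimately show ?thesis using van[of "g 0" x] x by (simp add: n r' chain_zero_def)
    next
      case F: False
      have "carrier (obj T n) = {\<zero>\<^bsub>obj T n\<^esub>} \<or> carrier (obj (shift T r) n) = {\<zero>\<^bsub>obj (shift T r) n\<^esub>}"
        using triv[of n] triv[of "n + r"] False F r by (cases "n = 0"; cases "n = -1") auto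
      from hom_eq_trivial[OF complex_group[OF Tb] complex_group[OF Sb] chain_map_hom[OF g]
          chain_map_hom[OF chain_map_chain_zero[OF Sb]] this x]
      show ?thesis .
    qed
    then show ?thesis
      by (intro homotopic_cong[OF Tb Sb homotopic_refl[OF Tb Sb chain_map_chain_zero[OF Sb]]]) simp_all
  qed
  fix Z s f assume "is_roof A T (shift T r) (Z, s, f)"
  then have Z: "bounded_complex A Z" and s: "quasi_iso A Z T s" and f: "chain_map A Z (shift T r) f"
    by auto
  note sm = quasi_iso_chain_map[OF Z Tb s]
  obtain v where v: "chain_map A T Z v" "homotopic A T T (s \<circ>\<^sub>c v) (\<lambda>n x. x)"
    using two_term_lift[OF T triv Z s] by blast
  \<comment> \<open>A copy of \<open>T\<close>, mapped to \<open>Z\<close> through \<open>v\<close>,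
    witnesses the equivalence. Followed by \<open>s\<close> this map is homotopic to the
    identification of the copy with \<open>T\<close>, hence a quasi-isomorphism; followed by
    \<open>f\<close> it is null-homotopic. The same map serves for both roofs.\<close>
  let ?W = "complex_copy A T"
  note W = complex_copy(1)[OF Tb]
  obtain c where c: "chain_iso A ?W T c" by (rule chain_isoE[OF Tb complex_copy(2)[OF Tb]])
  note cm = chain_iso_map[OF c]
  have u: "chain_map A ?W Z (v \<circ>\<^sub>c c)" by (rule chain_map_comp[OF v(1) cm])
  have su: "chain_map A ?W T (s \<circ>\<^sub>c (v \<circ>\<^sub>c c))" by (rule chain_map_comp[OF sm u])
  have "homotopic A ?W T (s \<circ>\<^sub>c (v \<circ>\<^sub>c c)) c"
    using homotopic_comp_right[OF v(2) cm] by (simp add: chain_comp_def o_def)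
  then have qi: "quasi_iso A ?W T (s \<circ>\<^sub>c (v \<circ>\<^sub>c c))"
    by (rule homotopic_quasi_iso[OF W Tb _ chain_iso_quasi_iso[OF W Tb c] su])
  have "homotopic A ?W (shift T r) (f \<circ>\<^sub>c (v \<circ>\<^sub>c c)) (chain_zero (shift T r) \<circ>\<^sub>c (v \<circ>\<^sub>c c))"
    using homotopic_comp_right[OF null[OF chain_map_comp[OF f v(1)]] cm]
    by (simp add: chain_comp_def chain_zero_def o_def)
  then show "roof_equiv A T (shift T r) (Z, s, f) (Z, s, chain_zero (shift T r))"
    unfolding roof_equiv.simps using W u qi homotopic_refl[OF W Tb su] by blast
qed

end

section \<open>Triangulated subcategories\<close>

text \<open>
  Triangulated subcategories consist of complexes of lists, so membership of an arbitrary complex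
  is expressed through a copy of it.
\<close>

definition essentially_in ::
  "('k::field, 'r) module \<Rightarrow> ('r, 'k list) cochain_complex set \<Rightarrow> ('r, 'm) cochain_complex \<Rightarrow> bool" where
  "essentially_in A \<T> X \<longleftrightarrow> bounded_complex A X \<and> (\<exists>X'\<in>\<T>. \<exists>f. chain_iso A X' X f)"

lemma triangulated_subset: "triangulated_subcategory A \<T> \<Longrightarrow> \<T> \<subseteq> per A"
  unfolding triangulated_subcategory_def by (elim conjE)

lemma triangulated_bounded: "triangulated_subcategory A \<T> \<Longrightarrow> X \<in> \<T> \<Longrightarrow> bounded_complex A X"
  using triangulated_subset unfolding per_def by blast

lemma triangulated_iso:
  "triangulated_subcategory A \<T> \<Longrightarrow> X \<in> \<T> \<Longrightarrow> bounded_complex A Y \<Longrightarrow> derived_iso A X Y \<Longrightarrow> Y \<in> \<T>"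
  unfolding triangulated_subcategory_def by (elim conjE) blast

lemma triangulated_shift: "triangulated_subcategory A \<T> \<Longrightarrow> X \<in> \<T> \<Longrightarrow> shift X r \<in> \<T>"
  unfolding triangulated_subcategory_def by (elim conjE) blast

lemma triangulated_cone:
  "triangulated_subcategory A \<T> \<Longrightarrow> X \<in> \<T> \<Longrightarrow> Y \<in> \<T> \<Longrightarrow> chain_map A X Y f \<Longrightarrow>
     bounded_complex A Z \<Longrightarrow> derived_iso A Z (cone X Y f) \<Longrightarrow> Z \<in> \<T>"
  unfolding triangulated_subcategory_def by (elim conjE) blast

lemma triangulated_nonempty: "triangulated_subcategory A \<T> \<Longrightarrow> \<exists>X. X \<in> \<T>"
  unfolding triangulated_subcategory_def by (elim conjE) blast

section \<open>Isomorphisms of sums and cones, and truncations\<close>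

lemma chain_iso_complex_sum:
  assumes f: "chain_iso A X X' f" and g: "chain_iso A Y Y' g"
  shows "chain_iso A (complex_sum X Y) (complex_sum X' Y') (\<lambda>n (x, y). (f n x, g n y))"
  unfolding chain_iso_def chain_map_def
proof (intro conjI allI ballI)
  show "(\<lambda>(x, y). (f n x, g n y)) \<in> mod_hom A (obj (complex_sum X Y) n) (obj (complex_sum X' Y') n)" for n
    by (simp add: mod_hom_map_prod chain_map_hom[OF chain_iso_map[OF f]] chain_map_hom[OF chain_iso_map[OF g]])
  show "bij_betw (\<lambda>(x, y). (f n x, g n y)) (carrier (obj (complex_sum X Y) n)) (carrier (obj (complex_sum X' Y') n))" for n
  proof -
    have "bij_betw (f n) (carrier (obj X n)) (carrier (obj X' n))"
      "bij_betw (g n) (carrier (obj Y n)) (carrier (obj Y' n))"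
      using f g by (auto simp: chain_iso_def)
    from bij_betw_map_prod[OF this] show ?thesis by (simp add: map_prod_def)
  qed
  fix n z assume "z \<in> carrier (obj (complex_sum X Y) n)"
  then show "(case diff (complex_sum X Y) n z of (x, y) \<Rightarrow> (f (n + 1) x, g (n + 1) y)) =
      diff (complex_sum X' Y') n (case z of (x, y) \<Rightarrow> (f n x, g n y))"
    by (auto simp: chain_map_commute[OF chain_iso_map[OF f]] chain_map_commute[OF chain_iso_map[OF g]])
qed

lemma chain_iso_cone:
  assumes X: "bounded_complex A X" and Y: "bounded_complex A Y"
    and X': "bounded_complex A X'" and Y': "bounded_complex A Y'"
    and p: "chain_iso A X X' p" and q: "chain_iso A Y Y' q"
    and f: "chain_map A X Y f" and f': "chain_map A X' Y' f'"
    and comm: "\<And>n x. x \<in> carrier (obj X n) \<Longrightarrow> q n (f n x) = f' n (p n x)"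
  shows "chain_iso A (cone X Y f) (cone X' Y' f') (\<lambda>n (x, y). (p (n + 1) x, q n y))"
  unfolding chain_iso_def chain_map_def
proof (intro conjI allI ballI)
  note pm = chain_iso_map[OF p] and qm = chain_iso_map[OF q]
  have e: "n + 1 + 1 = n + 2" for n :: int by simp
  show "(\<lambda>(x, y). (p (n + 1) x, q n y)) \<in> mod_hom A (obj (cone X Y f) n) (obj (cone X' Y' f') n)" for n
    by (simp add: mod_hom_map_prod chain_map_hom[OF pm] chain_map_hom[OF qm])
  show "bij_betw (\<lambda>(x, y). (p (n + 1) x, q n y)) (carrier (obj (cone X Y f) n)) (carrier (obj (cone X' Y' f') n))" for n
  proof -
    have "bij_betw (p (n + 1)) (carrier (obj X (n + 1))) (carrier (obj X' (n + 1)))"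
      "bij_betw (q n) (carrier (obj Y n)) (carrier (obj Y' n))"
      using p q by (auto simp: chain_iso_def)
    from bij_betw_map_prod[OF this] show ?thesis by (simp add: map_prod_def)
  qed
  fix n z assume "z \<in> carrier (obj (cone X Y f) n)"
  then obtain x y where z: "z = (x, y)" and x: "x \<in> carrier (obj X (n + 1))" and y: "y \<in> carrier (obj Y n)"
    by auto
  have dx: "diff X (n + 1) x \<in> carrier (obj X (n + 2))"
    using mod_hom_closed[OF complex_diff[OF X] x] unfolding e .
  have "p (n + 2) (\<ominus>\<^bsub>obj X (n + 2)\<^esub> diff X (n + 1) x) = \<ominus>\<^bsub>obj X' (n + 2)\<^esub> diff X' (n + 1) (p (n + 1) x)"
    using mod_hom_inv[OF complex_group[OF X] complex_group[OF X'] chain_map_hom[OF pm] dx]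
      chain_map_commute[OF pm x] unfolding e by simp
  moreover have "q (n + 1) (f (n + 1) x \<oplus>\<^bsub>obj Y (n + 1)\<^esub> diff Y n y) =
      f' (n + 1) (p (n + 1) x) \<oplus>\<^bsub>obj Y' (n + 1)\<^esub> diff Y' n (q n y)"
    using mod_hom_add[OF chain_map_hom[OF qm] chain_map_closed[OF f x] mod_hom_closed[OF complex_diff[OF Y] y]]
    by (simp add: comm[OF x] chain_map_commute[OF qm y])
  ultimately show "(case diff (cone X Y f) n z of (x, y) \<Rightarrow> (p (n + 1 + 1) x, q (n + 1) y)) =
      diff (cone X' Y' f') n (case z of (x, y) \<Rightarrow> (p (n + 1) x, q n y))"
    unfolding z e by (simp add: cone_def)
qed

text \<open>The brutal truncation, not the one that preserves cohomology. Keeping the degrees from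
  \<open>n\<close> upwards gives a subcomplex, since differentials raise degrees.\<close>

definition truncation :: "('r, 'm) cochain_complex \<Rightarrow> int \<Rightarrow> ('r, 'm) cochain_complex" where
  "truncation X n =
    \<lparr>obj = (\<lambda>m. if n \<le> m then obj X m else zero_submodule (obj X m)), diff = diff X\<rparr>"

context fd_algebra
begin

lemma stalk_obj: "obj (stalk M) n = (if n = 0 then M else zero_submodule M)"
  by (simp add: stalk_def)

lemma chain_iso_stalk:
  assumes M: "right_module A M" and N: "right_module A N"
    and f: "f \<in> mod_hom A M N" "bij_betw f (carrier M) (carrier N)"
  shows "chain_iso A (stalk M) (stalk N) (\<lambda>n. f)"
proof -
  have z: "f \<zero>\<^bsub>M\<^esub> = \<zero>\<^bsub>N\<^esub>"
    by (rule mod_hom_zero[OF right_module_group[OF M] right_module_group[OF N] f(1)])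
  have "f \<in> mod_hom A (zero_submodule M) (zero_submodule N)"
    using f(1) z by (auto simp: mod_hom_def abelian_group_def)
      (metis (no_types) M right_module.axioms(2) abelian_group_def abelian_monoid.zero_closed)+
  then show ?thesis
    using f z by (auto simp: chain_iso_def chain_map_def stalk_def bij_betw_def)
qed

lemma bounded_truncation:
  assumes X: "bounded_complex A X"
  shows "bounded_complex A (truncation X n)"
proof -
  obtain N where N: "\<And>n. \<bar>n\<bar> > N \<Longrightarrow> carrier (obj X n) = {\<zero>\<^bsub>obj X n\<^esub>}"
    using X by (auto simp: bounded_complex_def)
  note z = mod_hom_zero[OF complex_group[OF X] complex_group[OF X] complex_diff[OF X]]
  have sub: "x \<in> carrier (obj X m)" if "x \<in> carrier (obj (truncation X n) m)" for x m
    using that abelian_monoid.zero_closed[of "obj X m"] complex_group[OF X, of m]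
    by (auto simp: truncation_def abelian_group_def split: if_splits)
  show ?thesis
  proof (rule bounded_complexI[where N = N])
    show "fd_module A (obj (truncation X n) m)" for m
      by (simp add: truncation_def complex_fd[OF X] fd_zero_submodule complex_right_module[OF X])
    show "diff (truncation X n) m \<in> mod_hom A (obj (truncation X n) m) (obj (truncation X n) (m + 1))" for m
    proof (rule mod_homI)
      show "diff (truncation X n) m x \<in> carrier (obj (truncation X n) (m + 1))"
        if "x \<in> carrier (obj (truncation X n) m)" for x
        using that mod_hom_closed[OF complex_diff[OF X] sub[OF that]] z[of m]
        by (auto simp: truncation_def split: if_splits)
      show "diff (truncation X n) m (x \<oplus>\<^bsub>obj (truncation X n) m\<^esub> y) =
          diff (truncation X n) m x \<oplus>\<^bsub>obj (truncation X n) (m + 1)\<^esub> diff (truncation X n) m y"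
        if "x \<in> carrier (obj (truncation X n) m)" "y \<in> carrier (obj (truncation X n) m)" for x y
        using mod_hom_add[OF complex_diff[OF X] sub[OF that(1)] sub[OF that(2)]]
        by (simp add: truncation_def)
      show "diff (truncation X n) m (act (obj (truncation X n) m) x a) =
          act (obj (truncation X n) (m + 1)) (diff (truncation X n) m x) a"
        if "x \<in> carrier (obj (truncation X n) m)" "a \<in> carrier A" for x a
        using mod_hom_act[OF complex_diff[OF X] sub[OF that(1)] that(2)]
        by (simp add: truncation_def)
    qed
    show "diff (truncation X n) (m + 1) (diff (truncation X n) m x) = \<zero>\<^bsub>obj (truncation X n) (m + 2)\<^esub>"
      if "x \<in> carrier (obj (truncation X n) m)" for m x
      using complex_diff_diff[OF X sub[OF that]] by (simp add: truncation_def)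
    show "carrier (obj (truncation X n) m) = {\<zero>\<^bsub>obj (truncation X n) m\<^esub>}" if "\<bar>m\<bar> > N" for m
      using N[OF that] by (simp add: truncation_def)
  qed
qed

section \<open>Closure properties of a triangulated subcategory\<close>

context
  fixes \<T> :: "('r, 'k list) cochain_complex set"
  assumes T: "triangulated_subcategory A \<T>"
begin

text \<open>The composite from \<open>X'\<close> over \<open>X\<close> and \<open>Y\<close> to the
  copy of \<open>Y\<close> is a single quasi-isomorphism between complexes of lists, so closure
  under derived isomorphism applies to it.\<close>

lemma essentially_in_quasi_iso:
  assumes X: "essentially_in A \<T> X" and Y: "bounded_complex A Y" and s: "quasi_iso A X Y s"
  shows "essentially_in A \<T> Y"
proof -
  obtain X' f where X': "X' \<in> \<T>" and f: "chain_iso A X' X f" and Xb: "bounded_complex A X"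
    using X unfolding essentially_in_def by blast
  note X'b = triangulated_bounded[OF T X'] and Y' = complex_copy[OF Y]
  note q = quasi_iso_comp[OF X'b Y Y'(1) chain_iso_quasi_iso[OF Y Y'] quasi_iso_comp[OF X'b Xb Y s
      chain_iso_quasi_iso[OF X'b Xb f]]]
  have "complex_copy A Y \<in> \<T>"
    by (rule triangulated_iso[OF T X' Y'(1) quasi_iso_derived_iso[OF X'b Y'(1) q]])
  then show ?thesis unfolding essentially_in_def using Y chain_iso_inverse[OF Y Y'(2)] by blast
qed

lemma essentially_in_chain_iso:
  assumes "essentially_in A \<T> X" "bounded_complex A Y" "chain_iso A X Y s"
  shows "essentially_in A \<T> Y"
  using essentially_in_quasi_iso[OF assms(1,2) chain_iso_quasi_iso[OF _ assms(2,3)]] assms(1)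
  by (simp add: essentially_in_def)

lemma essentially_in_shift:
  assumes X: "essentially_in A \<T> X"
  shows "essentially_in A \<T> (shift X r)"
proof -
  obtain X' f where X': "X' \<in> \<T>" and f: "chain_iso A X' X f" and Xb: "bounded_complex A X"
    using X unfolding essentially_in_def by blast
  have "shift X' r \<in> \<T>" by (rule triangulated_shift[OF T X'])
  then show ?thesis unfolding essentially_in_def
    using chain_iso_shift[OF triangulated_bounded[OF T X'] Xb f, of r] bounded_shift[OF Xb, of r] by blast
qed

text \<open>The map is conjugated to one between the members of \<open>\<T>\<close> that represent
  \<open>X\<close> and \<open>Y\<close>; \<open>chain_iso_cone\<close> compares the two
  cones.\<close>

lemma essentially_in_cone:
  assumes X: "essentially_in A \<T> X" and Y: "essentially_in A \<T> Y" and f: "chain_map A X Y f"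
  shows "essentially_in A \<T> (cone X Y f)"
proof -
  obtain X' p where X': "X' \<in> \<T>" and p: "chain_iso A X' X p" and Xb: "bounded_complex A X"
    using X unfolding essentially_in_def by blast
  obtain Y' q where Y': "Y' \<in> \<T>" and q: "chain_iso A Y' Y q" and Yb: "bounded_complex A Y"
    using Y unfolding essentially_in_def by blast
  note X'b = triangulated_bounded[OF T X'] and Y'b = triangulated_bounded[OF T Y']
  define q' where "q' = (\<lambda>n. inv_into (carrier (obj Y' n)) (q n))"
  have q': "chain_iso A Y Y' q'" unfolding q'_def by (rule chain_iso_inverse[OF Y'b q])
  have qq: "q n (q' n y) = y" if "y \<in> carrier (obj Y n)" for n y
    using q that by (auto simp: chain_iso_def bij_betw_def q'_def intro: f_inv_into_f)
  let ?f = "q' \<circ>\<^sub>c (f \<circ>\<^sub>c p)"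
  note fp = chain_map_comp[OF f chain_iso_map[OF p]]
  have f': "chain_map A X' Y' ?f" by (rule chain_map_comp[OF chain_iso_map[OF q'] fp])
  have comm: "q n (?f n x) = f n (p n x)" if "x \<in> carrier (obj X' n)" for n x
    using qq chain_map_closed[OF fp that] by (simp add: chain_comp_def)
  note ci = chain_iso_cone[OF X'b Y'b Xb Yb p q f' f comm]
  note C = bounded_cone[OF Xb Yb f] and C' = bounded_cone[OF X'b Y'b f']
  note ci' = chain_iso_comp[OF complex_copy(2)[OF C] ci]
  have "derived_iso A (complex_copy A (cone X Y f)) (cone X' Y' ?f)"
    by (rule derived_iso_sym[OF chain_iso_derived_iso[OF C' complex_copy(1)[OF C] ci']])
  then have "complex_copy A (cone X Y f) \<in> \<T>"
    by (rule triangulated_cone[OF T X' Y' f' complex_copy(1)[OF C]])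
  then show ?thesis unfolding essentially_in_def
    using C chain_iso_inverse[OF C complex_copy(2)[OF C]] by blast
qed

lemma essentially_in_summand:
  assumes S: "bounded_complex A S" and X: "bounded_complex A X" and Y: "bounded_complex A Y"
    and f: "chain_iso A S (complex_sum X Y) f" and sub: "derived_summands A S \<subseteq> \<T>"
  shows "essentially_in A \<T> X"
proof -
  note X' = complex_copy[OF X] and Y' = complex_copy[OF Y]
  have "derived_iso A S (complex_sum (complex_copy A X) (complex_copy A Y))"
    by (rule chain_iso_derived_iso[OF S bounded_complex_sum[OF X'(1) Y'(1)]
        chain_iso_comp[OF chain_iso_complex_sum[OF X'(2) Y'(2)] f]])
  then have "complex_copy A X \<in> derived_summands A S"
    unfolding derived_summands_def using X'(1) Y'(1) by blast
  then show ?thesis unfolding essentially_in_def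
    using X sub chain_iso_inverse[OF X X'(2)] by blast
qed

text \<open>The cone of the identity of any object of \<open>\<T>\<close> is acyclic, so the zero
  map from it to \<open>Z\<close> is a quasi-isomorphism.\<close>

lemma essentially_in_zero:
  assumes Z: "bounded_complex A Z" and triv: "\<And>n. carrier (obj Z n) = {\<zero>\<^bsub>obj Z n\<^esub>}"
  shows "essentially_in A \<T> Z"
proof -
  obtain X where X: "X \<in> \<T>" using triangulated_nonempty[OF T] by blast
  note Xb = triangulated_bounded[OF T X]
  have idi: "chain_iso A X X (\<lambda>n x. x)" by (auto simp: chain_iso_def chain_map_id bij_betw_def)
  have eX: "essentially_in A \<T> X" unfolding essentially_in_def using X Xb idi by blast
  let ?C = "cone X X (\<lambda>n x. x)"
  note C = bounded_cone[OF Xb Xb chain_map_id]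
  have "quasi_iso A ?C Z (chain_zero Z)"
  proof (rule quasi_isoI[OF C Z chain_map_chain_zero[OF Z]])
    fix n z assume z: "z \<in> cycles ?C n"
    interpret X1: abelian_group "obj X (n + 1)" by (rule complex_group[OF Xb])
    interpret X0: abelian_group "obj X n" by (rule complex_group[OF Xb])
    interpret Xm: abelian_group "obj X (n - 1)" by (rule complex_group[OF Xb])
    obtain x y where xy: "z = (x, y)" "x \<in> carrier (obj X (n + 1))" "y \<in> carrier (obj X n)"
      "x \<oplus>\<^bsub>obj X (n + 1)\<^esub> diff X n y = \<zero>\<^bsub>obj X (n + 1)\<^esub>"
      using z unfolding cycles_def by (auto simp: cone_def)
    have dy: "diff X n y \<in> carrier (obj X (n + 1))" by (rule mod_hom_closed[OF complex_diff[OF Xb] xy(3)])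
    \<comment> \<open>A cycle \<open>(x, y)\<close> of the cone has \<open>x = - d y\<close>, so it
      is the differential of \<open>(y, 0)\<close>.\<close>
    have "x = \<ominus>\<^bsub>obj X (n + 1)\<^esub> diff X n y" using X1.minus_equality[OF xy(4) dy xy(2)] by simp
    moreover have "diff X (n - 1) \<zero>\<^bsub>obj X (n - 1)\<^esub> = \<zero>\<^bsub>obj X n\<^esub>"
      by (rule mod_hom_zero[OF complex_group[OF Xb] complex_group[OF Xb] complex_diff'[OF Xb]])
    ultimately have "z = diff ?C (n - 1) (y, \<zero>\<^bsub>obj X (n - 1)\<^esub>)"
      using xy(1,3) by (simp add: cone_def add.commute[of 1 n])
    then show "z \<in> boundaries ?C n"
      by (rule boundariesI[OF C, rotated]) (use xy(3) in simp)
  next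
    fix n y assume "y \<in> cycles Z n"
    then have y: "y = \<zero>\<^bsub>obj Z n\<^esub>" using triv by (auto simp: cycles_def)
    have 1: "\<zero>\<^bsub>obj ?C n\<^esub> \<in> cycles ?C n" by (rule boundaries_cycles[OF C boundaries_zero[OF C]])
    have "y \<ominus>\<^bsub>obj Z n\<^esub> chain_zero Z n \<zero>\<^bsub>obj ?C n\<^esub> = \<zero>\<^bsub>obj Z n\<^esub>"
      unfolding y chain_zero_def
      by (rule minus_zero_right[OF complex_group[OF Z]]) (simp add: triv)
    then show "\<exists>x\<in>cycles ?C n. y \<ominus>\<^bsub>obj Z n\<^esub> chain_zero Z n x \<in> boundaries Z n"
      using 1 boundaries_zero[OF Z, of n] by (intro bexI[OF _ 1]) simp
  qed
  then show ?thesis by (rule essentially_in_quasi_iso[OF essentially_in_cone[OF eX eX chain_map_id] Z])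
qed

lemma essentially_in_stalk_iso:
  assumes X: "essentially_in A \<T> (stalk M)" and iso: "mod_iso A M N" and M: "fd_module A M"
    and N: "right_module A N"
  shows "essentially_in A \<T> (stalk N)"
proof -
  obtain f where f: "f \<in> mod_hom A M N" "bij_betw f (carrier M) (carrier N)"
    using iso by (auto simp: mod_iso_def)
  show ?thesis
    by (rule essentially_in_chain_iso[OF X bounded_stalk[OF fd_iso[OF M iso N]]
        chain_iso_stalk[OF fd_right_module[OF M] N f]])
qed

text \<open>The sum of \<open>M\<close> and \<open>N\<close> is the cone of the zero map from
  \<open>M[-1]\<close> to \<open>N\<close>; the shift compensates the one built into the
  cone.\<close>

lemma essentially_in_stalk_sum:
  assumes X: "essentially_in A \<T> (stalk M)" and Y: "essentially_in A \<T> (stalk N)"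
    and M: "fd_module A M" and N: "fd_module A N"
  shows "essentially_in A \<T> (stalk (mod_sum M N))"
proof -
  note Mb = bounded_stalk[OF M] and Nb = bounded_stalk[OF N]
  interpret M: right_module A M by (rule fd_right_module[OF M])
  interpret N: right_module A N by (rule fd_right_module[OF N])
  have mm: "\<ominus>\<^bsub>M\<^esub> \<zero>\<^bsub>M\<^esub> = \<zero>\<^bsub>M\<^esub>" by (rule M.M.minus_equality) simp_all
  \<comment> \<open>Additive inverses depend on the carrier of the record, so the inverse of zero is
    computed separately in the zero submodule.\<close>
  have mm': "\<ominus>\<^bsub>zero_submodule M\<^esub> \<zero>\<^bsub>M\<^esub> = \<zero>\<^bsub>M\<^esub>"
    using abelian_group.minus_equality[OF right_module_group[OF right_module_zero_submodule[OF fd_right_module[OF M]]],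
        of "\<zero>\<^bsub>M\<^esub>" "\<zero>\<^bsub>M\<^esub>"] by simp
  let ?S = "shift (stalk M) (-1)" and ?Z = "chain_zero (stalk N)"
  note cz = chain_map_chain_zero[OF Nb, of ?S]
  let ?C = "cone ?S (stalk N) ?Z"
  have "chain_iso A ?C (stalk (mod_sum M N)) (\<lambda>n x. x)"
  proof (rule chain_isoI[where g = "\<lambda>n x. x"])
    have car: "carrier (obj ?C n) = carrier (obj (stalk (mod_sum M N)) n)" for n
      by (auto simp: stalk_obj)
    then show "y \<in> carrier (obj ?C n)" if "y \<in> carrier (obj (stalk (mod_sum M N)) n)" for n y using that by simp
    show "chain_map A ?C (stalk (mod_sum M N)) (\<lambda>n x. x)"
      unfolding chain_map_def
    proof (intro conjI allI ballI)
      show "(\<lambda>x. x) \<in> mod_hom A (obj ?C n) (obj (stalk (mod_sum M N)) n)" for n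
        by (rule mod_homI) (auto simp: stalk_obj)
      show "diff ?C n z = diff (stalk (mod_sum M N)) n z" if "z \<in> carrier (obj ?C n)" for n z
        using that by (auto simp: cone_def shift_def stalk_def chain_zero_def mm mm')
    qed
  qed simp_all
  then show ?thesis
    by (rule essentially_in_chain_iso[OF essentially_in_cone[OF essentially_in_shift[OF X] Y cz]
        bounded_stalk[OF fd_mod_sum[OF M N]]])
qed

lemma essentially_in_stalk_bigsum:
  assumes "finite J" "\<And>j. j \<in> J \<Longrightarrow> fd_module A (F j)" "\<And>j. j \<in> J \<Longrightarrow> essentially_in A \<T> (stalk (F j))"
  shows "essentially_in A \<T> (stalk (mod_bigsum J F))"
  using assms
proof (induction J)
  case empty
  have "fd_module A (mod_bigsum {} F)" by (rule fd_mod_bigsum) simp_all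
  then show ?case
    by (intro essentially_in_zero bounded_stalk) (auto simp: stalk_obj)
next
  case (insert j J)
  have R: "right_module A (mod_bigsum (insert j J) F)"
    using insert.prems(1) by (intro right_module_mod_bigsum ring_axioms) (simp add: fd_right_module)
  have F: "fd_module A (F j)" "fd_module A (mod_bigsum J F)"
    using insert.prems(1) insert.hyps(1) by (auto intro: fd_mod_bigsum)
  have E: "essentially_in A \<T> (stalk (mod_sum (F j) (mod_bigsum J F)))"
    using insert.IH insert.prems F by (intro essentially_in_stalk_sum) simp_all
  show ?case
    by (rule essentially_in_stalk_iso[OF E mod_iso_sym[OF mod_iso_bigsum_insert[OF insert.hyps(2)] R] fd_mod_sum[OF F] R])
qed

text \<open>The truncation from \<open>n\<close> on is the cone of the differential of
  \<open>X\<close> in degree \<open>n\<close>, seen as a map from the stalk of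
  \<open>obj X n\<close> to the truncation from \<open>n + 1\<close> on. The shift by
  \<open>- n - 1\<close> puts the stalk into degree \<open>n + 1\<close>, where that differential
  lands, and the cone moves it back to degree \<open>n\<close>.\<close>

lemma essentially_in_truncation_step:
  assumes X: "bounded_complex A X" and S: "essentially_in A \<T> (stalk (obj X n))"
    and E: "essentially_in A \<T> (truncation X (n + 1))"
  shows "essentially_in A \<T> (truncation X n)"
proof -
  let ?M = "obj X n" and ?Y = "truncation X (n + 1)"
  let ?S = "shift (stalk ?M) (- n - 1)"
  let ?f = "\<lambda>m x. if m = n + 1 then diff X n x else \<zero>\<^bsub>obj X m\<^esub>"
  interpret M: right_module A ?M by (rule complex_right_module[OF X])
  note Sb = bounded_shift[OF bounded_stalk[OF complex_fd[OF X]], of n "- n - 1"]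
    and Yb = bounded_truncation[OF X, of "n + 1"] and Tb = bounded_truncation[OF X, of n]
  have mm: "\<ominus>\<^bsub>?M\<^esub> \<zero>\<^bsub>?M\<^esub> = \<zero>\<^bsub>?M\<^esub>" by (rule M.M.minus_equality) simp_all
  have mm': "\<ominus>\<^bsub>zero_submodule ?M\<^esub> \<zero>\<^bsub>?M\<^esub> = \<zero>\<^bsub>?M\<^esub>"
    using abelian_group.minus_equality[OF right_module_group[OF right_module_zero_submodule[OF complex_right_module[OF X, of n]]],
        of "\<zero>\<^bsub>?M\<^esub>" "\<zero>\<^bsub>?M\<^esub>"] by simp
  note z = mod_hom_zero[OF complex_group[OF X] complex_group[OF X] complex_diff[OF X]]
  have Sobj: "obj ?S m = (if m = n + 1 then ?M else zero_submodule ?M)" for m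
    by (simp add: stalk_obj)
  have Sdiff: "diff ?S m x = \<zero>\<^bsub>?M\<^esub>" for m x
    by (simp add: shift_def stalk_def mm mm')
  have Yobj: "obj ?Y m = (if n \<le> m \<and> m \<noteq> n then obj X m else zero_submodule (obj X m))" for m
    by (auto simp: truncation_def)
  have Ydiff: "diff ?Y = diff X" by (simp add: truncation_def)
  have zc: "\<zero>\<^bsub>obj X m\<^esub> \<in> carrier (obj X m)" "\<zero>\<^bsub>obj X m\<^esub> \<oplus>\<^bsub>obj X m\<^esub> \<zero>\<^bsub>obj X m\<^esub> = \<zero>\<^bsub>obj X m\<^esub>" for m
    using complex_group[OF X, of m] by (auto simp: abelian_group_def abelian_monoid.zero_closed abelian_monoid.l_zero)
  have za: "act (obj X m) \<zero>\<^bsub>obj X m\<^esub> a = \<zero>\<^bsub>obj X m\<^esub>" if "a \<in> carrier A" for m a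
    by (rule right_module.act_zero_left[OF complex_right_module[OF X] that])
  have f: "chain_map A ?S ?Y ?f"
    unfolding chain_map_def
  proof (intro conjI allI ballI)
    show "?f m \<in> mod_hom A (obj ?S m) (obj ?Y m)" for m
    proof (cases "m = n + 1")
      case True
      then show ?thesis using complex_diff[OF X, of n] by (simp add: stalk_obj truncation_def)
    next
      case False
      then show ?thesis
        using right_module.zero_hom[OF complex_right_module[OF Yb, of m], of "obj ?S m"]
        by (simp add: truncation_def split: if_splits)
    qed
    fix m x assume x: "x \<in> carrier (obj ?S m)"
    have "?f (m + 1) \<zero>\<^bsub>?M\<^esub> = \<zero>\<^bsub>obj X (m + 1)\<^esub>" using z[of n] by simp
    moreover have "diff X m (?f m x) = \<zero>\<^bsub>obj X (m + 1)\<^esub>"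
    proof (cases "m = n + 1")
      case True
      have "x \<in> carrier ?M" using x[unfolded Sobj] True by simp
      from complex_diff_diff[OF X this] show ?thesis using True by (simp add: add.commute[of 2])
    qed (simp add: z)
    ultimately show "?f (m + 1) (diff ?S m x) = diff ?Y m (?f m x)" unfolding Sdiff Ydiff by simp
  qed
  let ?C = "cone ?S ?Y ?f"
  note Cb = bounded_cone[OF Sb Yb f]
  have Cobj: "obj ?C m = mod_sum (if m = n then ?M else zero_submodule ?M) (obj ?Y m)" for m
    by (simp add: Sobj del: shift_obj)
  have inv0: "\<ominus>\<^bsub>obj ?S m\<^esub> \<zero>\<^bsub>?M\<^esub> = \<zero>\<^bsub>?M\<^esub>" for m unfolding Sobj using mm mm' by simp
  have Cdiff: "diff ?C m (x, y) = (\<zero>\<^bsub>?M\<^esub>, ?f (m + 1) x \<oplus>\<^bsub>obj X (m + 1)\<^esub> diff X m y)" for m x y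
  proof -
    have "add (obj ?Y (m + 1)) = add (obj X (m + 1))" unfolding Yobj by simp
    then show ?thesis
      by (simp only: cone_def cochain_complex.simps prod.case Sdiff inv0 Ydiff)
  qed
  have Tobj: "obj (truncation X n) m = (if n \<le> m then obj X m else zero_submodule (obj X m))" for m
    by (simp add: truncation_def)
  \<comment> \<open>In each degree at most one of the two components of the cone can be
    nonzero.\<close>
  let ?g = "\<lambda>m (x, y). if m = n then x else y"
  have ysub: "y \<in> carrier (obj X m)" if "y \<in> carrier (obj ?Y m)" for y m
    using that zc by (auto simp: Yobj split: if_splits)
  have "chain_iso A ?C (truncation X n) ?g"
  proof (rule chain_isoI[where g = "\<lambda>m x. if m = n then (x, \<zero>\<^bsub>?M\<^esub>) else (\<zero>\<^bsub>?M\<^esub>, x)"])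
    show "chain_map A ?C (truncation X n) ?g"
      unfolding chain_map_def
    proof (intro conjI allI ballI)
      show "?g m \<in> mod_hom A (obj ?C m) (obj (truncation X n) m)" for m
        unfolding Cobj by (rule mod_homI) (auto simp: Tobj Yobj)
      fix m u assume "u \<in> carrier (obj ?C m)"
      then obtain x y where u: "u = (x, y)" and x: "x \<in> carrier (if m = n then ?M else zero_submodule ?M)"
        and y: "y \<in> carrier (obj ?Y m)"
        unfolding Cobj by auto
      have dy: "diff X m y \<in> carrier (obj X (m + 1))" by (rule mod_hom_closed[OF complex_diff[OF X] ysub[OF y]])
      interpret X1: abelian_group "obj X (m + 1)" by (rule complex_group[OF X])
      show "?g (m + 1) (diff ?C m u) = diff (truncation X n) m (?g m u)"
      proof (cases "m = n")
        case True
        have x': "x \<in> carrier (obj X m)" using x True by simp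
        have "y = \<zero>\<^bsub>obj X m\<^esub>" using y True by (simp add: Yobj)
        moreover have "diff X m x \<oplus>\<^bsub>obj X (m + 1)\<^esub> \<zero>\<^bsub>obj X (m + 1)\<^esub> = diff X m x"
          using mod_hom_closed[OF complex_diff[OF X] x'] by simp
        ultimately show ?thesis using True z[of m]
          unfolding u Cdiff by (simp add: truncation_def)
      next
        case False
        have y0: "m + 1 = n \<Longrightarrow> y = \<zero>\<^bsub>obj X m\<^esub>" using y by (simp add: Yobj)
        show ?thesis using False z[of m] y0 dy unfolding u Cdiff
          by (auto simp: truncation_def)
      qed
    qed
    show "(if m = n then (?g m u, \<zero>\<^bsub>?M\<^esub>) else (\<zero>\<^bsub>?M\<^esub>, ?g m u)) = u" if "u \<in> carrier (obj ?C m)" for m u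
      using that unfolding Cobj by (auto simp: Yobj)
    show "?g m (if m = n then (x, \<zero>\<^bsub>?M\<^esub>) else (\<zero>\<^bsub>?M\<^esub>, x)) = x" for m x by simp
    show "(if m = n then (x, \<zero>\<^bsub>?M\<^esub>) else (\<zero>\<^bsub>?M\<^esub>, x)) \<in> carrier (obj ?C m)"
      if "x \<in> carrier (obj (truncation X n) m)" for m x
      using that unfolding Cobj by (auto simp: Yobj Tobj split: if_splits)
  qed
  then show ?thesis
    by (rule essentially_in_chain_iso[OF essentially_in_cone[OF essentially_in_shift[OF S] E f] Tb])
qed

text \<open>Starting from a truncation that is zero, finitely many steps of
  \<open>essentially_in_truncation_step\<close> reach all of \<open>X\<close>.\<close>

lemma essentially_in_complex:
  assumes X: "bounded_complex A X" and S: "\<And>n. essentially_in A \<T> (stalk (obj X n))"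
  shows "essentially_in A \<T> X"
proof -
  obtain N where N: "\<And>n. \<bar>n\<bar> > N \<Longrightarrow> carrier (obj X n) = {\<zero>\<^bsub>obj X n\<^esub>}"
    using X by (auto simp: bounded_complex_def)
  have "essentially_in A \<T> (truncation X (\<bar>N\<bar> + 1 - int j))" for j
  proof (induction j)
    case 0
    show ?case
    proof (rule essentially_in_zero[OF bounded_truncation[OF X]])
      fix m show "carrier (obj (truncation X (\<bar>N\<bar> + 1 - int 0)) m) = {\<zero>\<^bsub>obj (truncation X (\<bar>N\<bar> + 1 - int 0)) m\<^esub>}"
      proof (cases "\<bar>N\<bar> + 1 \<le> m")
        case True
        then have "\<bar>m\<bar> > N" by linarith
        then show ?thesis using N by (simp add: truncation_def)
      qed (simp add: truncation_def)
    qed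
  next
    case (Suc j)
    have "(\<bar>N\<bar> + 1 - int (Suc j)) + 1 = \<bar>N\<bar> + 1 - int j" by simp
    then have "essentially_in A \<T> (truncation X ((\<bar>N\<bar> + 1 - int (Suc j)) + 1))"
      using Suc by (simp only:)
    then show ?case by (rule essentially_in_truncation_step[OF X S])
  qed
  \<comment> \<open>These \<open>2 * \<bar>N\<bar> + 2\<close> steps lead from
    \<open>\<bar>N\<bar> + 1\<close> down to \<open>- \<bar>N\<bar> - 1\<close>, below which
    \<open>X\<close> vanishes.\<close>
  from this[of "nat (2 * \<bar>N\<bar> + 2)"] have E: "essentially_in A \<T> (truncation X (- \<bar>N\<bar> - 1))" by simp
  have eq: "carrier (obj (truncation X (- \<bar>N\<bar> - 1)) m) = carrier (obj X m)" for m
  proof (cases "- \<bar>N\<bar> - 1 \<le> m")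
    case False
    then have "\<bar>m\<bar> > N" by linarith
    then show ?thesis using N by (simp add: truncation_def)
  qed (simp add: truncation_def)
  have "chain_iso A (truncation X (- \<bar>N\<bar> - 1)) X (\<lambda>n x. x)"
    unfolding chain_iso_def chain_map_def
    using eq by (auto simp: truncation_def mod_hom_def bij_betw_def)
  then show ?thesis by (rule essentially_in_chain_iso[OF E X])
qed

end

text \<open>A perfect complex is isomorphic to a bounded complex of projectives, and such a complex
  is built from the stalks of its terms; so it is enough to reach single projective modules.\<close>

lemma generates_perI:
  assumes T: "triangulated_subcategory A \<T>"
    and P: "\<And>P :: ('r, 'k list) rmodule. projective A P \<Longrightarrow> fd_module A P \<Longrightarrow> essentially_in A \<T> (stalk P)"
  shows "\<T> = per A"
proof
  show "\<T> \<subseteq> per A" by (rule triangulated_subset[OF T])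
  show "per A \<subseteq> \<T>"
  proof
    fix X assume "X \<in> per A"
    then obtain P :: "('r, 'k list) cochain_complex"
      where X: "bounded_complex A X" and P': "projective_complex A P" "derived_iso A X P"
      by (auto simp: per_def)
    have Pb: "bounded_complex A P" and pr: "\<And>n. projective A (obj P n)"
      using P' by (auto simp: projective_complex_def)
    have "essentially_in A \<T> P"
      by (rule essentially_in_complex[OF T Pb P[OF pr complex_fd[OF Pb]]])
    then obtain Q f where Q: "Q \<in> \<T>" and f: "chain_iso A Q P f" by (auto simp: essentially_in_def)
    have "P \<in> \<T>"
      by (rule triangulated_iso[OF T Q Pb chain_iso_derived_iso[OF triangulated_bounded[OF T Q] Pb f]])
    then show "X \<in> \<T>" by (rule triangulated_iso[OF T _ X derived_iso_sym[OF P'(2)]])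
  qed
qed

end

section \<open>Algebras with a radical filtration\<close>

lemma mod_hom_finsum:
  assumes "abelian_group M" "abelian_group N" "h \<in> mod_hom A M N" "finite J" "u \<in> J \<rightarrow> carrier M"
  shows "h (\<Oplus>\<^bsub>M\<^esub>j\<in>J. u j) = (\<Oplus>\<^bsub>N\<^esub>j\<in>J. h (u j))"
  using assms(4,5)
proof (induction J)
  case empty
  interpret M: abelian_group M by fact
  interpret N: abelian_group N by fact
  show ?case by (simp add: mod_hom_zero[OF assms(1-3)])
next
  case (insert j J)
  interpret M: abelian_group M by fact
  interpret N: abelian_group N by fact
  have u: "u \<in> J \<rightarrow> carrier M" "u j \<in> carrier M" using insert.prems by auto
  moreover have "(\<lambda>j. h (u j)) \<in> J \<rightarrow> carrier N" "h (u j) \<in> carrier N"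
    using u mod_hom_closed[OF assms(3)] by auto
  ultimately show ?case
    using insert by (simp add: M.finsum_insert N.finsum_insert mod_hom_add[OF assms(3)] M.finsum_closed)
qed

text \<open>
  The properties of the algebra \<open>KQ/I\<close> at the vertex \<open>k\<close> on which the proof relies: the primitive
  idempotents \<open>e i\<close>, the characters \<open>\<chi> i\<close> of the simple modules, the filtration \<open>R\<close> by path
  length, and the arrows \<open>\<alpha> \<in> Arr\<close> ending at \<open>k\<close>, which generate the paths of positive
  length ending at \<open>k\<close> as a left ideal.
\<close>

locale basic_algebra = fd_algebra A
  for A :: "('k::field, 'r) module" (structure) +
  fixes V :: "'v set" and e :: "'v \<Rightarrow> 'r" and \<chi> :: "'v \<Rightarrow> 'r \<Rightarrow> 'k" and R :: "nat \<Rightarrow> 'r set"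
    and k :: 'v and Arr :: "'a set" and src :: "'a \<Rightarrow> 'v" and arr :: "'a \<Rightarrow> 'r"
  assumes finite_V: "finite V" and k: "k \<in> V"
    and e_closed [simp]: "i \<in> V \<Longrightarrow> e i \<in> carrier A"
    and e_mult: "i \<in> V \<Longrightarrow> j \<in> V \<Longrightarrow> e i \<otimes> e j = (if i = j then e i else \<zero>)"
    and e_sum: "(\<Oplus>i\<in>V. e i) = \<one>"
    and char_add: "i \<in> V \<Longrightarrow> a \<in> carrier A \<Longrightarrow> b \<in> carrier A \<Longrightarrow> \<chi> i (a \<oplus> b) = \<chi> i a + \<chi> i b"
    and char_mult: "i \<in> V \<Longrightarrow> a \<in> carrier A \<Longrightarrow> b \<in> carrier A \<Longrightarrow> \<chi> i (a \<otimes> b) = \<chi> i a * \<chi> i b"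
    and char_scalar: "i \<in> V \<Longrightarrow> \<chi> i (c \<odot> \<one>) = c"
    and char_e: "i \<in> V \<Longrightarrow> j \<in> V \<Longrightarrow> \<chi> i (e j) = (if i = j then 1 else 0)"
    and R_0: "R 0 = carrier A"
    and R_1: "a \<in> carrier A \<Longrightarrow> (\<And>i. i \<in> V \<Longrightarrow> \<chi> i a = 0) \<Longrightarrow> a \<in> R 1"
    and R_subset: "R n \<subseteq> carrier A"
    and R_zero: "\<zero> \<in> R n"
    and R_add: "a \<in> R n \<Longrightarrow> b \<in> R n \<Longrightarrow> a \<oplus> b \<in> R n"
    and R_mult: "a \<in> R 1 \<Longrightarrow> b \<in> R n \<Longrightarrow> a \<otimes> b \<in> R (Suc n)"
    and R_nilpotent: "\<exists>n. R n \<subseteq> {\<zero>}"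
    and finite_Arr: "finite Arr"
    and src: "\<alpha> \<in> Arr \<Longrightarrow> src \<alpha> \<in> V" "\<alpha> \<in> Arr \<Longrightarrow> src \<alpha> \<noteq> k"
    and arr_closed [simp]: "\<alpha> \<in> Arr \<Longrightarrow> arr \<alpha> \<in> carrier A"
    and e_arr: "\<alpha> \<in> Arr \<Longrightarrow> e (src \<alpha>) \<otimes> arr \<alpha> = arr \<alpha>"
    and arr_generate: "a \<in> carrier A \<Longrightarrow> \<chi> k a = 0 \<Longrightarrow>
      \<exists>b\<in>Arr \<rightarrow> carrier A. a \<otimes> e k = (\<Oplus>\<alpha>\<in>Arr. b \<alpha> \<otimes> arr \<alpha>)"
begin

section \<open>The projective modules \<open>e_i A\<close>\<close>

definition proj :: "'v \<Rightarrow> ('r, 'r) rmodule" where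
  "proj i = \<lparr>carrier = (\<lambda>x. e i \<otimes> x) ` carrier A, mult = undefined, one = undefined,
     zero = \<zero>, add = add A, act = mult A\<rparr>"

definition regular :: "('r, 'r) rmodule" where
  "regular = \<lparr>carrier = carrier A, mult = undefined, one = undefined,
     zero = \<zero>, add = add A, act = mult A\<rparr>"

lemma proj_simps [simp]:
  "\<zero>\<^bsub>proj i\<^esub> = \<zero>" "x \<oplus>\<^bsub>proj i\<^esub> y = x \<oplus> y" "act (proj i) x a = x \<otimes> a"
  by (simp_all add: proj_def)

lemma regular_simps [simp]: "carrier regular = carrier A"
  "\<zero>\<^bsub>regular\<^esub> = \<zero>" "x \<oplus>\<^bsub>regular\<^esub> y = x \<oplus> y" "act regular x a = x \<otimes> a"
  by (simp_all add: regular_def)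

text \<open>As \<open>e i\<close> is idempotent, \<open>e_i A\<close> consists of the fixed points
  of left multiplication by \<open>e i\<close>; membership is used in this form throughout.\<close>

lemma mem_proj:
  assumes "i \<in> V"
  shows "x \<in> carrier (proj i) \<longleftrightarrow> x \<in> carrier A \<and> e i \<otimes> x = x"
proof -
  have "e i \<otimes> (e i \<otimes> y) = e i \<otimes> y" if "y \<in> carrier A" for y
    using assms that by (simp add: e_mult flip: m_assoc)
  then show ?thesis using assms by (force simp: proj_def)
qed

lemma proj_closed: "i \<in> V \<Longrightarrow> x \<in> carrier (proj i) \<Longrightarrow> x \<in> carrier A"
  by (simp add: mem_proj)

lemma e_mem_proj: "i \<in> V \<Longrightarrow> e i \<in> carrier (proj i)"
  by (simp add: mem_proj e_mult)

lemma mult_mem_proj: "i \<in> V \<Longrightarrow> x \<in> carrier (proj i) \<Longrightarrow> a \<in> carrier A \<Longrightarrow> x \<otimes> a \<in> carrier (proj i)"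
  by (simp add: mem_proj flip: m_assoc)

lemma right_module_regular: "right_module A regular"
proof (rule right_moduleI)
  show "abelian_group regular"
  proof (rule abelian_groupI)
    show "\<exists>y\<in>carrier regular. y \<oplus>\<^bsub>regular\<^esub> x = \<zero>\<^bsub>regular\<^esub>" if "x \<in> carrier regular" for x
      using that l_neg[of x] by auto
    show "x \<oplus>\<^bsub>regular\<^esub> y = y \<oplus>\<^bsub>regular\<^esub> x" if "x \<in> carrier regular" "y \<in> carrier regular" for x y
      using that a_comm by simp
  qed (simp_all add: a_assoc)
qed (simp_all add: ring_axioms l_distr r_distr m_assoc)

lemma finsum_regular:
  assumes "finite J" "u \<in> J \<rightarrow> carrier A"
  shows "(\<Oplus>\<^bsub>regular\<^esub>j\<in>J. u j) = (\<Oplus>j\<in>J. u j)"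
proof -
  interpret reg: right_module A regular by (rule right_module_regular)
  show ?thesis using assms
  proof (induction J)
    case empty
    show ?case using reg.M.finsum_empty by simp
  next
    case (insert j J)
    have u: "u \<in> J \<rightarrow> carrier A" "u j \<in> carrier A" using insert.prems by auto
    then have "(\<Oplus>\<^bsub>regular\<^esub>j\<in>insert j J. u j) = u j \<oplus>\<^bsub>regular\<^esub> (\<Oplus>\<^bsub>regular\<^esub>j\<in>J. u j)"
      using insert.hyps by (intro reg.M.finsum_insert) simp_all
    then show ?case using insert u by (simp add: finsum_insert)
  qed
qed

lemma fd_regular: "fd_module A regular"
proof -
  obtain B where B: "finite B" "B \<subseteq> carrier A"
    and span: "\<forall>H. B \<subseteq> H \<and> \<zero> \<in> H \<and> (\<forall>x\<in>H. \<forall>y\<in>H. x \<oplus> y \<in> H) \<and>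
        (\<forall>x\<in>H. \<forall>c. x \<otimes> (c \<odot> \<one>) \<in> H) \<longrightarrow> carrier A \<subseteq> H"
    using finite_dim by (elim exE conjE) (rule that)
  let ?H = "kspan A regular B"
  have B': "B \<subseteq> carrier regular" using B(2) by simp
  have "B \<subseteq> ?H" by (rule subsetI) (rule kspan_superset[OF right_module_regular B'])
  moreover have "\<zero> \<in> ?H" using kspan.zero[of regular A B] by simp
  moreover have "\<forall>x\<in>?H. \<forall>y\<in>?H. x \<oplus> y \<in> ?H" using kspan_add[OF right_module_regular B'] by simp
  moreover have "\<forall>x\<in>?H. \<forall>c. x \<otimes> (c \<odot> \<one>) \<in> ?H" using kspan_scale[OF right_module_regular B'] by simp
  ultimately have "carrier A \<subseteq> ?H" by (intro mp[OF spec[OF span]] conjI)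
  then show ?thesis using B(1) B' by (intro fd_moduleI[OF right_module_regular]) simp_all
qed

lemma right_module_proj:
  assumes "i \<in> V"
  shows "right_module A (proj i)"
proof -
  have "right_module A (regular\<lparr>carrier := carrier (proj i)\<rparr>)"
    by (rule right_module_restrict[OF right_module_regular])
      (use assms in \<open>auto simp: mem_proj r_distr simp flip: m_assoc\<close>)
  then show ?thesis by (simp add: proj_def regular_def)
qed

lemma fd_proj:
  assumes "i \<in> V"
  shows "fd_module A (proj i)"
proof (rule fd_image[OF fd_regular right_module_proj[OF assms]])
  show "(\<lambda>x. e i \<otimes> x) \<in> mod_hom A regular (proj i)"
    by (rule mod_homI) (use assms in \<open>simp_all add: proj_def r_distr m_assoc\<close>)
  show "(\<lambda>x. e i \<otimes> x) ` carrier regular = carrier (proj i)" by (simp add: proj_def)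
qed

text \<open>The restriction to \<open>e_i A\<close> of the map from \<open>A\<close> to
  \<open>M\<close> that sends \<open>\<one>\<close> to \<open>m\<close>.\<close>

lemma proj_hom:
  assumes "i \<in> V" "right_module A M" "m \<in> carrier M"
  shows "(\<lambda>x. act M m x) \<in> mod_hom A (proj i) M"
proof -
  interpret M: right_module A M by fact
  show ?thesis
    by (rule mod_homI) (use assms(1,3) in \<open>simp_all add: mem_proj M.act_closed M.act_add_right M.act_mult\<close>)
qed

lemma proj_hom_eq:
  assumes "i \<in> V" "h \<in> mod_hom A (proj i) M" "x \<in> carrier (proj i)"
  shows "h x = act M (h (e i)) x"
  using mod_hom_act[OF assms(2) e_mem_proj[OF assms(1)], of x] assms by (simp add: mem_proj)

lemma projective_proj:
  assumes "i \<in> V"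
  shows "projective A (proj i)"
  unfolding projective_def
proof (intro conjI allI impI)
  show "right_module A (proj i)" by (rule right_module_proj[OF assms])
  fix M N :: "('r, 'k list) rmodule" and g h
  assume *: "fd_module A M \<and> fd_module A N \<and> g \<in> mod_hom A M N \<and>
     g ` carrier M = carrier N \<and> h \<in> mod_hom A (proj i) N"
  then have M: "right_module A M" and g: "g \<in> mod_hom A M N" and h: "h \<in> mod_hom A (proj i) N"
    by (auto simp: fd_module_def)
  have "h (e i) \<in> g ` carrier M" using * mod_hom_closed[OF h e_mem_proj[OF assms]] by simp
  then obtain m where m: "m \<in> carrier M" "g m = h (e i)" by auto
  have "\<forall>x\<in>carrier (proj i). g (act M m x) = h x"
    using m by (simp add: mod_hom_act[OF g] proj_closed[OF assms] proj_hom_eq[OF assms h])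
  then show "\<exists>l\<in>mod_hom A (proj i) M. \<forall>x\<in>carrier (proj i). g (l x) = h x"
    by (rule bexI[OF _ proj_hom[OF assms M m(1)]])
qed

lemma act_decompose:
  assumes "right_module A M" "m \<in> carrier M"
  shows "m = (\<Oplus>\<^bsub>M\<^esub>i\<in>V. act M m (e i))"
proof -
  interpret M: right_module A M by fact
  have "(\<lambda>a. act M m a) \<in> mod_hom A regular M"
    by (rule mod_homI) (use assms(2) in \<open>simp_all add: M.act_closed M.act_add_right M.act_mult\<close>)
  from mod_hom_finsum[OF right_module_group[OF right_module_regular] M.M.abelian_group_axioms this finite_V, of e]
  have "act M m (\<Oplus>\<^bsub>regular\<^esub>i\<in>V. e i) = (\<Oplus>\<^bsub>M\<^esub>i\<in>V. act M m (e i))" by simp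
  moreover have "(\<Oplus>\<^bsub>regular\<^esub>i\<in>V. e i) = \<one>"
    using e_sum finsum_regular[OF finite_V, of e] by simp
  ultimately show ?thesis using M.act_one[OF assms(2)] by simp
qed

lemma act_decompose_single:
  assumes "right_module A M" "m \<in> carrier M" "j \<in> V" "\<And>i. i \<in> V \<Longrightarrow> i \<noteq> j \<Longrightarrow> act M m (e i) = \<zero>\<^bsub>M\<^esub>"
  shows "m = act M m (e j)"
proof -
  interpret M: right_module A M by fact
  have "m = (\<Oplus>\<^bsub>M\<^esub>i\<in>V. act M m (e i))" by (rule act_decompose[OF assms(1,2)])
  also have "\<dots> = (\<Oplus>\<^bsub>M\<^esub>i\<in>V. if j = i then act M m (e i) else \<zero>\<^bsub>M\<^esub>)"
    using assms by (intro M.finsum_cong') (auto simp: M.act_closed)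
  also have "\<dots> = act M m (e j)"
    using M.M.add.finprod_singleton[OF assms(3) finite_V, of "\<lambda>i. act M m (e i)"] assms(2)
    by (simp add: finsum_def M.act_closed)
  finally show ?thesis .
qed

section \<open>Inverses modulo the filtration\<close>

lemma char_minus:
  assumes "i \<in> V" "a \<in> carrier A" "b \<in> carrier A"
  shows "\<chi> i (a \<ominus> b) = \<chi> i a - \<chi> i b"
proof -
  have "\<chi> i (a \<ominus> b) + \<chi> i b = \<chi> i a"
    using assms by (simp add: minus_eq a_assoc l_neg flip: char_add)
  then show ?thesis by (simp add: eq_diff_eq)
qed

lemma add_minus_cancel:
  assumes "x \<in> carrier A" "y \<in> carrier A"
  shows "x \<oplus> y \<ominus> x = y"
  using assms by (simp add: a_comm[of x y] minus_eq a_assoc r_neg)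

text \<open>The inverse of \<open>1 - t\<close> is a partial sum of the geometric series. Passing
  from \<open>z\<close> to \<open>1 + t z\<close> multiplies the error by \<open>t\<close>, so after
  \<open>n\<close> steps starting at zero the error lies in \<open>R n\<close>, which is zero for
  some \<open>n\<close>.\<close>

lemma geometric_inverse:
  assumes t: "t \<in> R 1"
  shows "\<exists>z\<in>carrier A. z \<ominus> t \<otimes> z = \<one>"
proof -
  have tA: "t \<in> carrier A" using t R_subset by blast
  have "\<exists>z\<in>carrier A. z \<ominus> t \<otimes> z \<ominus> \<one> \<in> R n" for n
  proof (induction n)
    case 0
    show ?case using tA by (intro bexI[of _ \<zero>]) (simp_all add: R_0)
  next
    case (Suc n)
    then obtain z where z: "z \<in> carrier A" "z \<ominus> t \<otimes> z \<ominus> \<one> \<in> R n" by blast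
    let ?y = "\<one> \<oplus> t \<otimes> z"
    have "t \<otimes> (z \<ominus> t \<otimes> z \<ominus> \<one>) = t \<otimes> z \<ominus> t \<otimes> (t \<otimes> z) \<ominus> t"
      using tA z(1) by (simp add: minus_eq r_distr r_minus)
    also have "\<dots> = \<one> \<oplus> (t \<otimes> z \<ominus> t \<otimes> (t \<otimes> z) \<ominus> t) \<ominus> \<one>"
      by (rule add_minus_cancel[symmetric]) (use tA z(1) in simp_all)
    also have "\<one> \<oplus> (t \<otimes> z \<ominus> t \<otimes> (t \<otimes> z) \<ominus> t) = ?y \<ominus> t \<otimes> ?y"
      using tA z(1) by (simp add: minus_eq r_distr minus_add a_ac)
    finally have "?y \<ominus> t \<otimes> ?y \<ominus> \<one> \<in> R (Suc n)" using R_mult[OF t z(2)] by simp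
    then show ?case using tA z(1) by (intro bexI[of _ ?y]) simp_all
  qed
  then obtain z where z: "z \<in> carrier A" "z \<ominus> t \<otimes> z \<ominus> \<one> = \<zero>" using R_nilpotent by blast
  have "z \<ominus> t \<otimes> z = \<one>"
    by (rule eq_of_minus_eq_zero[OF abelian_group_axioms _ _ z(2)]) (use tA z(1) in simp_all)
  then show ?thesis using z(1) by blast
qed

text \<open>Scaled by its character, \<open>a e_i\<close> differs from \<open>e i\<close> by an
  element \<open>?t\<close> on which all characters vanish, so that \<open>1 - ?t\<close> has a
  right inverse \<open>z\<close>. Since \<open>e_i ?t = ?t\<close>, multiplying by
  \<open>e i\<close> from the left turns this into \<open>(e_i - ?t) z = e_i\<close>, and
  \<open>e_i - ?t\<close> is the scaled \<open>a e_i\<close>.\<close>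

lemma right_inverse_at_vertex:
  assumes i: "i \<in> V" and a: "a \<in> carrier (proj i)" and c: "\<chi> i a \<noteq> 0"
  shows "\<exists>z\<in>carrier A. a \<otimes> z = e i"
proof -
  have aA: "a \<in> carrier A" and ea: "e i \<otimes> a = a" using a i by (auto simp: mem_proj)
  let ?s = "inverse (\<chi> i a) \<odot> \<one>"
  let ?b = "a \<otimes> e i \<otimes> ?s"
  let ?t = "e i \<ominus> ?b"
  have bA: "?b \<in> carrier A" using aA i by simp
  have "?t \<in> R 1"
  proof (rule R_1)
    show "?t \<in> carrier A" using bA i by simp
    show "\<chi> j ?t = 0" if "j \<in> V" for j
      using that i aA bA c by (simp add: char_minus char_mult char_scalar char_e)
  qed
  then obtain z where z: "z \<in> carrier A" "z \<ominus> ?t \<otimes> z = \<one>" using geometric_inverse by blast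
  have eb: "e i \<otimes> ?b = ?b" using ea aA i by (simp flip: m_assoc)
  have "e i \<otimes> ?t = ?t" using bA i eb by (simp add: minus_eq r_distr r_minus e_mult)
  then have "e i \<otimes> (?t \<otimes> z) = ?t \<otimes> z" using bA i z(1) by (simp flip: m_assoc)
  have "e i = e i \<otimes> (z \<ominus> ?t \<otimes> z)" using z(2) i by simp
  also have "\<dots> = e i \<otimes> z \<ominus> ?t \<otimes> z"
    using i z(1) bA \<open>e i \<otimes> (?t \<otimes> z) = ?t \<otimes> z\<close> by (simp add: minus_eq r_distr r_minus)
  also have "\<dots> = (e i \<ominus> ?t) \<otimes> z"
    using i z(1) bA by (simp add: minus_eq l_distr l_minus)
  also have "e i \<ominus> ?t = ?b"
    using i bA by (simp add: minus_eq minus_add r_neg2 r_neg1)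
  finally have "a \<otimes> (e i \<otimes> ?s \<otimes> z) = e i" using aA i z(1) by (simp add: m_assoc)
  then show ?thesis using i z(1) by (intro bexI[of _ "e i \<otimes> ?s \<otimes> z"]) auto
qed

section \<open>Direct sums of the modules \<open>e_i A\<close>, and the decomposition of projective
  modules\<close>

definition unit_vector :: "'j set \<Rightarrow> ('j \<Rightarrow> 'v) \<Rightarrow> 'j \<Rightarrow> 'j \<Rightarrow> 'r" where
  "unit_vector J \<iota> j = (\<lambda>i\<in>J. if i = j then e (\<iota> j) else \<zero>)"

context
  fixes J :: "'j set" and \<iota> :: "'j \<Rightarrow> 'v"
  assumes J: "finite J" and \<iota>: "\<And>j. j \<in> J \<Longrightarrow> \<iota> j \<in> V"
begin

lemma unit_vector_closed: "j \<in> J \<Longrightarrow> unit_vector J \<iota> j \<in> carrier (mod_bigsum J (\<lambda>j. proj (\<iota> j)))"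
  using \<iota> by (auto simp: unit_vector_def mem_proj e_mult)

lemma right_module_free: "right_module A (mod_bigsum J (\<lambda>j. proj (\<iota> j)))"
  by (rule right_module_mod_bigsum[OF ring_axioms]) (simp add: right_module_proj \<iota>)

lemma fd_free: "fd_module A (mod_bigsum J (\<lambda>j. proj (\<iota> j)))"
  by (rule fd_mod_bigsum[OF J]) (simp add: fd_proj \<iota>)

lemma free_decompose:
  assumes y: "y \<in> carrier (mod_bigsum J (\<lambda>j. proj (\<iota> j)))"
  defines "F \<equiv> mod_bigsum J (\<lambda>j. proj (\<iota> j))"
  shows "y = (\<Oplus>\<^bsub>F\<^esub>j\<in>J. act F (unit_vector J \<iota> j) (y j))"
proof -
  interpret F: right_module A F unfolding F_def by (rule right_module_free)
  have yj: "y j \<in> carrier A" "e (\<iota> j) \<otimes> y j = y j" if "j \<in> J" for j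
    using y that \<iota>[OF that] by (auto simp: PiE_iff mem_proj)
  have cl: "(\<lambda>j. act F (unit_vector J \<iota> j) (y j)) \<in> J \<rightarrow> carrier F"
    using unit_vector_closed yj(1) F.act_closed unfolding F_def by blast
  let ?s = "\<Oplus>\<^bsub>F\<^esub>j\<in>J. act F (unit_vector J \<iota> j) (y j)"
  have s: "?s \<in> carrier F" by (rule F.M.finsum_closed[OF cl])
  have "?s i = y i" if i: "i \<in> J" for i
  proof -
    interpret P: right_module A "proj (\<iota> i)" by (rule right_module_proj[OF \<iota>[OF i]])
    have "?s i = (\<Oplus>\<^bsub>proj (\<iota> i)\<^esub>j\<in>J. act F (unit_vector J \<iota> j) (y j) i)"
      by (rule mod_hom_finsum[OF F.M.abelian_group_axioms P.M.abelian_group_axioms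
            mod_hom_component[OF i, of A "\<lambda>j. proj (\<iota> j)", folded F_def] J cl])
    also have "\<dots> = (\<Oplus>\<^bsub>proj (\<iota> i)\<^esub>j\<in>J. if i = j then y j else \<zero>\<^bsub>proj (\<iota> i)\<^esub>)"
      using i yj \<iota>[OF i] by (intro P.M.finsum_cong') (auto simp: F_def unit_vector_def mem_proj)
    also have "\<dots> = y i"
      using P.M.add.finprod_singleton_swap[OF i J, of y] yj i \<iota>
      using P.M.add.finprod_singleton[OF i J, of "\<lambda>j. if i = j then y j else \<zero>\<^bsub>proj (\<iota> i)\<^esub>"]
      by (simp add: finsum_def mem_proj cong: if_cong)
    finally show ?thesis .
  qed
  then show ?thesis using y s unfolding F_def by (intro PiE_ext[of y J "\<lambda>j. carrier (proj (\<iota> j))"]) auto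
qed

lemma free_hom_eq:
  assumes M: "right_module A M" and h: "h \<in> mod_hom A (mod_bigsum J (\<lambda>j. proj (\<iota> j))) M"
    and y: "y \<in> carrier (mod_bigsum J (\<lambda>j. proj (\<iota> j)))"
  shows "h y = (\<Oplus>\<^bsub>M\<^esub>j\<in>J. act M (h (unit_vector J \<iota> j)) (y j))"
proof -
  let ?F = "mod_bigsum J (\<lambda>j. proj (\<iota> j))"
  interpret F: right_module A ?F by (rule right_module_free)
  interpret M: right_module A M by fact
  have yj: "y j \<in> carrier A" if "j \<in> J" for j
    using y that proj_closed[OF \<iota>[OF that]] by (auto simp: PiE_iff)
  have cl: "(\<lambda>j. act ?F (unit_vector J \<iota> j) (y j)) \<in> J \<rightarrow> carrier ?F"
    using unit_vector_closed yj F.act_closed by blast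
  have "h y = h (\<Oplus>\<^bsub>?F\<^esub>j\<in>J. act ?F (unit_vector J \<iota> j) (y j))"
    using free_decompose[OF y] by simp
  also have "\<dots> = (\<Oplus>\<^bsub>M\<^esub>j\<in>J. h (act ?F (unit_vector J \<iota> j) (y j)))"
    by (rule mod_hom_finsum[OF F.M.abelian_group_axioms M.M.abelian_group_axioms h J cl])
  also have "\<dots> = (\<Oplus>\<^bsub>M\<^esub>j\<in>J. act M (h (unit_vector J \<iota> j)) (y j))"
  proof (rule M.finsum_cong'[OF refl])
    show "(\<lambda>j. act M (h (unit_vector J \<iota> j)) (y j)) \<in> J \<rightarrow> carrier M"
      using unit_vector_closed yj mod_hom_closed[OF h] M.act_closed by blast
    show "h (act ?F (unit_vector J \<iota> j) (y j)) = act M (h (unit_vector J \<iota> j)) (y j)" if "j \<in> J" for j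
      by (rule mod_hom_act[OF h unit_vector_closed[OF that] yj[OF that]])
  qed
  finally show ?thesis .
qed

lemma free_hom:
  assumes M: "right_module A M" and x: "x \<in> J \<rightarrow> carrier M"
  shows "(\<lambda>y. \<Oplus>\<^bsub>M\<^esub>j\<in>J. act M (x j) (y j)) \<in> mod_hom A (mod_bigsum J (\<lambda>j. proj (\<iota> j))) M"
proof -
  interpret M: right_module A M by fact
  have cl: "act M (x j) (y j) \<in> carrier M" "y j \<in> carrier A"
    if "y \<in> carrier (mod_bigsum J (\<lambda>j. proj (\<iota> j)))" "j \<in> J" for y j
    using that x proj_closed[OF \<iota>[OF that(2)]] by (auto simp: PiE_iff intro!: M.act_closed)
  show ?thesis
  proof (rule mod_homI)
    fix y assume y: "y \<in> carrier (mod_bigsum J (\<lambda>j. proj (\<iota> j)))"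
    show "(\<Oplus>\<^bsub>M\<^esub>j\<in>J. act M (x j) (y j)) \<in> carrier M"
      using cl[OF y] by (intro M.finsum_closed) auto
    show "(\<Oplus>\<^bsub>M\<^esub>j\<in>J. act M (x j) (act (mod_bigsum J (\<lambda>j. proj (\<iota> j))) y a j)) =
        act M (\<Oplus>\<^bsub>M\<^esub>j\<in>J. act M (x j) (y j)) a" if a: "a \<in> carrier A" for a
      using x cl[OF y] a by (subst M.act_finsum_left[OF J _ a])
        (auto simp: M.act_mult Pi_iff M.act_closed intro!: M.finsum_cong')
    fix z assume z: "z \<in> carrier (mod_bigsum J (\<lambda>j. proj (\<iota> j)))"
    have "(\<Oplus>\<^bsub>M\<^esub>j\<in>J. act M (x j) ((y \<oplus>\<^bsub>mod_bigsum J (\<lambda>j. proj (\<iota> j))\<^esub> z) j)) =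
        (\<Oplus>\<^bsub>M\<^esub>j\<in>J. act M (x j) (y j) \<oplus>\<^bsub>M\<^esub> act M (x j) (z j))"
      using x cl[OF y] cl[OF z] by (intro M.finsum_cong') (auto simp: M.act_add_right Pi_iff)
    also have "\<dots> = (\<Oplus>\<^bsub>M\<^esub>j\<in>J. act M (x j) (y j)) \<oplus>\<^bsub>M\<^esub> (\<Oplus>\<^bsub>M\<^esub>j\<in>J. act M (x j) (z j))"
      using cl[OF y] cl[OF z] by (intro M.finsum_addf) auto
    finally show "(\<Oplus>\<^bsub>M\<^esub>j\<in>J. act M (x j) ((y \<oplus>\<^bsub>mod_bigsum J (\<lambda>j. proj (\<iota> j))\<^esub> z) j)) =
        (\<Oplus>\<^bsub>M\<^esub>j\<in>J. act M (x j) (y j)) \<oplus>\<^bsub>M\<^esub> (\<Oplus>\<^bsub>M\<^esub>j\<in>J. act M (x j) (z j))" .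
  qed
qed

end

text \<open>
  A set \<open>J\<close> of pairs \<open>(x, i)\<close> with \<open>x e\<^sub>i = x\<close> defines a map \<open>\<Oplus>\<^bsub>(x,i)\<in>J\<^esub> P\<^sub>i \<rightarrow> M\<close>.  If \<open>M\<close> is
  projective and \<open>J\<close> is a generating set of least cardinality, then this map is an isomorphism:
  it splits, and by minimality its kernel has coordinates in the radical, so that the kernel is
  zero by nilpotency.
\<close>

definition cover :: "('r, 'm) rmodule \<Rightarrow> ('m \<times> 'v) set \<Rightarrow> ('m \<times> 'v \<Rightarrow> 'r) \<Rightarrow> 'm" where
  "cover M J y = (\<Oplus>\<^bsub>M\<^esub>j\<in>J. act M (fst j) (y j))"

definition generating :: "('r, 'm) rmodule \<Rightarrow> ('m \<times> 'v) set \<Rightarrow> bool" where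
  "generating M J \<longleftrightarrow> finite J \<and> J \<subseteq> carrier M \<times> V \<and> (\<forall>(x, i)\<in>J. act M x (e i) = x) \<and>
     cover M J ` carrier (mod_bigsum J (\<lambda>j. proj (snd j))) = carrier M"

lemma cover_hom:
  assumes "right_module A M" "finite J" "J \<subseteq> carrier M \<times> V"
  shows "cover M J \<in> mod_hom A (mod_bigsum J (\<lambda>j. proj (snd j))) M"
  unfolding cover_def[abs_def] by (rule free_hom[OF assms(2) _ assms(1)]) (use assms(3) in auto)

lemma cover_unit_vector:
  assumes M: "right_module A M" and J: "finite J" "J \<subseteq> carrier M \<times> V" "\<forall>(x, i)\<in>J. act M x (e i) = x"
    and j: "j \<in> J"
  shows "cover M J (unit_vector J snd j) = fst j"
proof -
  interpret M: right_module A M by fact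
  have JM: "fst i \<in> carrier M" "snd i \<in> V" "act M (fst i) (e (snd i)) = fst i" if "i \<in> J" for i
    using that J(2,3) by auto
  have "cover M J (unit_vector J snd j) = (\<Oplus>\<^bsub>M\<^esub>i\<in>J. if j = i then fst i else \<zero>\<^bsub>M\<^esub>)"
    unfolding cover_def using JM by (intro M.finsum_cong') (auto simp: unit_vector_def)
  also have "\<dots> = fst j"
    using M.M.add.finprod_singleton[OF j J(1), of fst] JM(1) by (simp add: finsum_def)
  finally show ?thesis .
qed

lemma image_submodule:
  assumes M: "right_module A M" and N: "right_module A N" and h: "h \<in> mod_hom A M N"
  shows "\<zero>\<^bsub>N\<^esub> \<in> h ` carrier M" "u \<in> h ` carrier M \<Longrightarrow> v \<in> h ` carrier M \<Longrightarrow> u \<oplus>\<^bsub>N\<^esub> v \<in> h ` carrier M"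
    "u \<in> h ` carrier M \<Longrightarrow> a \<in> carrier A \<Longrightarrow> act N u a \<in> h ` carrier M"
    "u \<in> h ` carrier M \<Longrightarrow> u \<in> carrier N"
proof -
  interpret M: right_module A M by fact
  show "\<zero>\<^bsub>N\<^esub> \<in> h ` carrier M"
    using mod_hom_zero[OF right_module_group[OF M] right_module_group[OF N] h]
    by (intro image_eqI[of _ _ "\<zero>\<^bsub>M\<^esub>"]) simp_all
  show "u \<oplus>\<^bsub>N\<^esub> v \<in> h ` carrier M" if uv: "u \<in> h ` carrier M" "v \<in> h ` carrier M"
  proof -
    obtain x y where "x \<in> carrier M" "y \<in> carrier M" "u = h x" "v = h y" using uv by blast
    then show ?thesis by (intro image_eqI[of _ _ "x \<oplus>\<^bsub>M\<^esub> y"]) (simp_all add: mod_hom_add[OF h])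
  qed
  show "act N u a \<in> h ` carrier M" if ua: "u \<in> h ` carrier M" "a \<in> carrier A"
  proof -
    obtain x where "x \<in> carrier M" "u = h x" using ua by blast
    then show ?thesis using ua(2)
      by (intro image_eqI[of _ _ "act M x a"]) (simp_all add: mod_hom_act[OF h] M.act_closed)
  qed
  show "u \<in> carrier N" if "u \<in> h ` carrier M" using that mod_hom_closed[OF h] by blast
qed

lemma generating_exists:
  assumes "fd_module A M"
  shows "\<exists>J. generating M J"
proof -
  interpret M: right_module A M by (rule fd_right_module[OF assms])
  note Mr = fd_right_module[OF assms]
  obtain B where B: "finite B" "B \<subseteq> carrier M" "carrier M \<subseteq> kspan A M B"
    by (rule fd_spanning[OF assms])
  \<comment> \<open>Each \<open>b\<close> is the sum of the elements \<open>b e_i\<close>; the label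
    \<open>i\<close> records which \<open>P_i\<close> is to be mapped to such an element.\<close>
  let ?J = "(\<lambda>(b, i). (act M b (e i), i)) ` (B \<times> V)"
  have fin: "finite ?J" using B(1) finite_V by simp
  have sub: "?J \<subseteq> carrier M \<times> V" using B(2) by (auto intro!: M.act_closed)
  have ei: "\<forall>(x, i)\<in>?J. act M x (e i) = x"
    using B(2) by (auto simp: subset_iff e_mult M.act_closed simp flip: M.act_mult)
  note hom = cover_hom[OF Mr fin sub]
  have F: "right_module A (mod_bigsum ?J (\<lambda>j. proj (snd j)))"
    by (rule right_module_free) (use sub fin in auto)
  let ?I = "cover M ?J ` carrier (mod_bigsum ?J (\<lambda>j. proj (snd j)))"
  note im = image_submodule[OF F Mr hom]
  have JV: "snd j \<in> V" if "j \<in> ?J" for j using that by auto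
  have gen: "fst j \<in> ?I" if "j \<in> ?J" for j
    by (rule image_eqI[where x = "unit_vector ?J snd j"])
      (simp_all only: cover_unit_vector[OF Mr fin sub ei that] unit_vector_closed[OF fin JV that])
  have "b \<in> ?I" if b: "b \<in> B" for b
  proof -
    have be: "act M b (e i) \<in> ?I" if "i \<in> V" for i
    proof -
      have "(act M b (e i), i) \<in> ?J" using b that by (intro image_eqI[of _ _ "(b, i)"]) simp_all
      from gen[OF this] show ?thesis by (simp only: fst_conv)
    qed
    have "(\<Oplus>\<^bsub>M\<^esub>i\<in>W. act M b (e i)) \<in> ?I" if "W \<subseteq> V" for W
      using finite_subset[OF that finite_V] that
    proof (induction W)
      case empty
      then show ?case using im(1) by simp
    next
      case (insert w W)
      have "act M b (e i) \<in> carrier M" if "i \<in> V" for i using b B(2) that by (auto intro!: M.act_closed)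
      then have "(\<Oplus>\<^bsub>M\<^esub>i\<in>insert w W. act M b (e i)) = act M b (e w) \<oplus>\<^bsub>M\<^esub> (\<Oplus>\<^bsub>M\<^esub>i\<in>W. act M b (e i))"
        using insert.hyps insert.prems by (intro M.finsum_insert) auto
      then show ?case using insert.IH insert.prems im(2)[OF be[of w]] by simp
    qed
    from this[OF subset_refl] show ?thesis
      by (simp only: act_decompose[OF Mr subsetD[OF B(2) b], symmetric])
  qed
  then have "kspan A M B \<subseteq> ?I"
    using im(1-3) by (intro kspan_least[OF Mr]) auto
  then have "?I = carrier M" using B(3) im(4) by blast
  then show ?thesis unfolding generating_def using fin sub ei by blast
qed

lemma cover_remove:
  assumes M: "right_module A M" and J: "finite J" "J \<subseteq> carrier M \<times> V" and j: "j \<in> J"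
    and y: "y \<in> carrier (mod_bigsum J (\<lambda>j. proj (snd j)))"
  shows "cover M J y = act M (fst j) (y j) \<oplus>\<^bsub>M\<^esub> cover M (J - {j}) (restrict y (J - {j}))"
proof -
  interpret M: right_module A M by fact
  have cl: "act M (fst i) (y i) \<in> carrier M" if "i \<in> J" for i
  proof -
    have "snd i \<in> V" "fst i \<in> carrier M" "y i \<in> carrier (proj (snd i))" using that J(2) y by (auto simp: PiE_iff)
    then show ?thesis by (intro M.act_closed) (auto simp: mem_proj)
  qed
  have "cover M J y = (\<Oplus>\<^bsub>M\<^esub>i\<in>insert j (J - {j}). act M (fst i) (y i))"
    unfolding cover_def using j by (simp add: insert_absorb)
  also have "\<dots> = act M (fst j) (y j) \<oplus>\<^bsub>M\<^esub> (\<Oplus>\<^bsub>M\<^esub>i\<in>J - {j}. act M (fst i) (y i))"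
    using cl J(1) j by (intro M.finsum_insert) auto
  also have "(\<Oplus>\<^bsub>M\<^esub>i\<in>J - {j}. act M (fst i) (y i)) = cover M (J - {j}) (restrict y (J - {j}))"
    unfolding cover_def using cl by (intro M.finsum_cong') auto
  finally show ?thesis .
qed

text \<open>If the coordinate \<open>y j\<close> were outside \<open>R 1\<close>, it would have a
  right inverse at its vertex, and the relation \<open>cover M J y = 0\<close> would express the
  generator \<open>fst j\<close> through the others, so that \<open>J\<close> without
  \<open>j\<close> would still generate.\<close>

lemma minimal_generating_kernel:
  assumes M: "right_module A M" and g: "generating M J"
    and min: "\<And>J'. generating M J' \<Longrightarrow> card J \<le> card J'"
    and y: "y \<in> carrier (mod_bigsum J (\<lambda>j. proj (snd j)))" "cover M J y = \<zero>\<^bsub>M\<^esub>" and j: "j \<in> J"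
  shows "y j \<in> R 1"
proof (rule ccontr)
  assume contra: "y j \<notin> R 1"
  interpret M: right_module A M by fact
  have J: "finite J" "J \<subseteq> carrier M \<times> V" "\<forall>(x, i)\<in>J. act M x (e i) = x"
    and surj: "cover M J ` carrier (mod_bigsum J (\<lambda>j. proj (snd j))) = carrier M"
    using g by (auto simp: generating_def)
  have i: "snd j \<in> V" and x: "fst j \<in> carrier M" "act M (fst j) (e (snd j)) = fst j"
    using j J(2,3) by auto
  have yj: "y j \<in> carrier (proj (snd j))" using y(1) j by (auto simp: PiE_iff)
  then have yA: "y j \<in> carrier A" "e (snd j) \<otimes> y j = y j" using i by (auto simp: mem_proj)
  \<comment> \<open>\<open>y j\<close> lies in \<open>e_i A\<close> for \<open>i = snd j\<close>, so
    only its character at \<open>i\<close> can be nonzero.\<close>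
  have "\<chi> v (y j) = 0" if "v \<in> V" "v \<noteq> snd j" for v
    using char_mult[OF that(1) e_closed[OF i] yA(1)] that yA(2) i by (simp add: char_e)
  then have "\<chi> (snd j) (y j) \<noteq> 0" using contra R_1[OF yA(1)] by metis
  then obtain z where z: "z \<in> carrier A" "y j \<otimes> z = e (snd j)"
    using right_inverse_at_vertex[OF i yj] by blast
  let ?J = "J - {j}"
  have J': "finite ?J" "?J \<subseteq> carrier M \<times> V" using J by auto
  have F: "right_module A (mod_bigsum ?J (\<lambda>j. proj (snd j)))"
    by (rule right_module_free) (use J' in auto)
  note hom = cover_hom[OF M J']
  let ?I = "cover M ?J ` carrier (mod_bigsum ?J (\<lambda>j. proj (snd j)))"
  note im = image_submodule[OF F M hom]
  have res: "restrict w ?J \<in> carrier (mod_bigsum ?J (\<lambda>j. proj (snd j)))"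
    if "w \<in> carrier (mod_bigsum J (\<lambda>j. proj (snd j)))" for w
    using that by (auto simp: PiE_iff)
  let ?u = "cover M ?J (restrict y ?J)"
  have u: "?u \<in> ?I" using res[OF y(1)] by blast
  have "act M (fst j) (y j) \<oplus>\<^bsub>M\<^esub> ?u = \<zero>\<^bsub>M\<^esub>"
    using cover_remove[OF M J(1,2) j y(1)] y(2) by simp
  then have "act M (fst j) (y j) = \<ominus>\<^bsub>M\<^esub> ?u"
    using M.minus_equality im(4)[OF u] M.act_closed[OF x(1) yA(1)] by simp
  then have "act M (act M (fst j) (y j)) z = act M ?u (\<ominus> z)"
    using im(4)[OF u] z(1) by (simp add: M.act_inv_left M.act_inv_right)
  moreover have "act M (act M (fst j) (y j)) z = fst j"
    using z x yA by (simp flip: M.act_mult)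
  ultimately have xI: "fst j \<in> ?I" using im(3)[OF u, of "\<ominus> z"] z(1) by simp
  have "carrier M \<subseteq> ?I"
  proof
    fix m assume "m \<in> carrier M"
    then obtain w where w: "w \<in> carrier (mod_bigsum J (\<lambda>j. proj (snd j)))" "m = cover M J w"
      using surj by blast
    have "w j \<in> carrier A" using w(1) j i by (auto simp: PiE_iff mem_proj)
    then show "m \<in> ?I"
      unfolding w(2) cover_remove[OF M J(1,2) j w(1)]
      by (intro im(2) im(3)[OF xI] imageI res[OF w(1)])
  qed
  then have "generating M ?J"
    unfolding generating_def using J' J(3) im(4) by blast
  then show False using min card_Diff1_less[OF J(1) j] by (metis linorder_not_less)
qed

lemma projective_decompose:
  assumes M: "projective A M" "fd_module A M"
  shows "\<exists>J. finite J \<and> J \<subseteq> carrier M \<times> V \<and> mod_iso A (mod_bigsum J (\<lambda>j. proj (snd j))) M"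
proof -
  note Mr = fd_right_module[OF M(2)]
  obtain J where g: "generating M J" and min: "\<And>J'. generating M J' \<Longrightarrow> card J \<le> card J'"
    using generating_exists[OF M(2)] ex_has_least_nat[of "generating M" _ card] by blast
  have J: "finite J" "J \<subseteq> carrier M \<times> V"
    and surj: "cover M J ` carrier (mod_bigsum J (\<lambda>j. proj (snd j))) = carrier M"
    using g by (auto simp: generating_def)
  have JV: "\<And>j. j \<in> J \<Longrightarrow> snd j \<in> V" using J(2) by auto
  let ?F = "mod_bigsum J (\<lambda>j. proj (snd j))"
  note hom = cover_hom[OF Mr J]
  note Fd = fd_free[OF J(1) JV]
  interpret F: right_module A ?F by (rule fd_right_module[OF Fd])
  interpret M: right_module A M by (rule Mr)
  obtain s where s: "s \<in> mod_hom A M ?F" "\<forall>x\<in>carrier M. cover M J (s x) = x"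
    using projective_lift[OF M Fd M(2) hom mod_hom_id] surj by auto
  \<comment> \<open>The projection onto the kernel of the cover, along the splitting
    \<open>s\<close>.\<close>
  define \<pi> where "\<pi> = (\<lambda>u. u \<oplus>\<^bsub>?F\<^esub> \<ominus>\<^bsub>?F\<^esub> s (cover M J u))"
  have pi: "\<pi> \<in> mod_hom A ?F ?F" unfolding \<pi>_def
    by (rule mod_hom_plus[OF F.right_module_axioms mod_hom_id mod_hom_neg[OF F.right_module_axioms mod_hom_comp[OF s(1) hom]]])
  have cpi: "cover M J (\<pi> u) = \<zero>\<^bsub>M\<^esub>" if u: "u \<in> carrier ?F" for u
  proof -
    note cu = mod_hom_closed[OF hom u]
    have "cover M J (\<pi> u) = cover M J u \<oplus>\<^bsub>M\<^esub> \<ominus>\<^bsub>M\<^esub> cover M J (s (cover M J u))"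
      unfolding \<pi>_def using u mod_hom_closed[OF s(1) cu] F.M.a_inv_closed
      by (subst mod_hom_add[OF hom])
        (simp_all add: mod_hom_inv[OF F.M.abelian_group_axioms M.M.abelian_group_axioms hom] del: mod_bigsum_simps)
    then show ?thesis using s(2) cu by (simp add: M.r_neg)
  qed
  \<comment> \<open>A kernel element satisfies \<open>y = \<pi> y\<close>. Expanding
    \<open>y\<close> in unit vectors, each coordinate of \<open>y\<close> becomes a sum of products
    of a coordinate of \<open>\<pi>\<close> at a unit vector, which is in \<open>R 1\<close> by
    minimality, with a coordinate of \<open>y\<close>. So the depth of all coordinates rises by one
    at each step.\<close>
  have "\<forall>y\<in>carrier ?F. cover M J y = \<zero>\<^bsub>M\<^esub> \<longrightarrow> (\<forall>j\<in>J. y j \<in> R n)" for n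
  proof (induction n)
    case 0
    then show ?case using J(2) by (auto simp: R_0 PiE_iff mem_proj) (metis mem_proj JV snd_conv)
  next
    case (Suc n)
    show ?case
    proof (intro ballI impI)
      fix y j assume y: "y \<in> carrier ?F" "cover M J y = \<zero>\<^bsub>M\<^esub>" and j: "j \<in> J"
      have s0: "s \<zero>\<^bsub>M\<^esub> = \<zero>\<^bsub>?F\<^esub>"
        by (rule mod_hom_zero[OF M.M.abelian_group_axioms F.M.abelian_group_axioms s(1)])
      have "\<ominus>\<^bsub>?F\<^esub> \<zero>\<^bsub>?F\<^esub> = \<zero>\<^bsub>?F\<^esub>"
        by (rule F.M.minus_equality) (simp_all del: mod_bigsum_simps)
      then have "\<pi> y = y" unfolding \<pi>_def y(2) s0 using F.M.r_zero[OF y(1)] by simp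
      moreover have "(\<lambda>u. \<pi> u j) \<in> mod_hom A ?F regular"
        using mod_hom_comp[OF mod_hom_component[OF j, of A "\<lambda>j. proj (snd j)"] pi] proj_closed[OF JV[OF j]]
        by (auto simp: mod_hom_def simp del: mod_bigsum_simps)
      from free_hom_eq[OF J(1) JV right_module_regular this y(1)]
      have "\<pi> y j = (\<Oplus>\<^bsub>regular\<^esub>i\<in>J. \<pi> (unit_vector J snd i) j \<otimes> y i)" by simp
      moreover have "(\<Oplus>\<^bsub>regular\<^esub>i\<in>W. \<pi> (unit_vector J snd i) j \<otimes> y i) \<in> R (Suc n)" if "W \<subseteq> J" for W
        using finite_subset[OF that J(1)] that
      proof (induction W)
        case empty
        interpret reg: right_module A regular by (rule right_module_regular)
        show ?case using reg.M.finsum_empty R_zero by simp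
      next
        case (insert w W)
        interpret reg: right_module A regular by (rule right_module_regular)
        have mem: "\<pi> (unit_vector J snd i) j \<otimes> y i \<in> R (Suc n)" if "i \<in> J" for i
        proof (rule R_mult)
          note uv = unit_vector_closed[OF J(1) JV that]
          show "\<pi> (unit_vector J snd i) j \<in> R 1"
            by (rule minimal_generating_kernel[OF Mr g min mod_hom_closed[OF pi uv] cpi[OF uv] j])
          show "y i \<in> R n" using Suc.IH y that by blast
        qed
        have mem': "\<pi> (unit_vector J snd i) j \<otimes> y i \<in> carrier A" if "i \<in> J" for i
          using mem[OF that] R_subset by auto
        have "(\<Oplus>\<^bsub>regular\<^esub>i\<in>insert w W. \<pi> (unit_vector J snd i) j \<otimes> y i) =
          \<pi> (unit_vector J snd w) j \<otimes> y w \<oplus>\<^bsub>regular\<^esub> (\<Oplus>\<^bsub>regular\<^esub>i\<in>W. \<pi> (unit_vector J snd i) j \<otimes> y i)"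
          using insert.hyps insert.prems by (intro reg.M.finsum_insert) (auto intro!: mem')
        then show ?case using insert.IH insert.prems mem R_add by simp
      qed
      ultimately show "y j \<in> R (Suc n)" by simp
    qed
  qed
  moreover obtain n where "R n \<subseteq> {\<zero>}" using R_nilpotent by blast
  ultimately have ker: "y = \<zero>\<^bsub>?F\<^esub>" if "y \<in> carrier ?F" "cover M J y = \<zero>\<^bsub>M\<^esub>" for y
  proof -
    have "y j = \<zero>\<^bsub>?F\<^esub> j" if "j \<in> J" for j
      using \<open>R n \<subseteq> {\<zero>}\<close> \<open>\<And>n. \<forall>y\<in>carrier ?F. cover M J y = \<zero>\<^bsub>M\<^esub> \<longrightarrow> (\<forall>j\<in>J. y j \<in> R n)\<close>[of n]
        \<open>y \<in> carrier ?F\<close> \<open>cover M J y = \<zero>\<^bsub>M\<^esub>\<close> that by auto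
    then show ?thesis using \<open>y \<in> carrier ?F\<close> F.M.zero_closed
      unfolding mod_bigsum_simps(1) by (rule PiE_ext[rotated 2])
  qed
  have "inj_on (cover M J) (carrier ?F)"
  proof (rule inj_onI)
    fix x y assume xy: "x \<in> carrier ?F" "y \<in> carrier ?F" "cover M J x = cover M J y"
    have "cover M J (x \<ominus>\<^bsub>?F\<^esub> y) = \<zero>\<^bsub>M\<^esub>"
      using mod_hom_diff[OF F.M.abelian_group_axioms M.M.abelian_group_axioms hom xy(1,2)] xy(3)
        mod_hom_closed[OF hom xy(2)] by (simp add: a_minus_def M.r_neg)
    moreover have "x \<ominus>\<^bsub>?F\<^esub> y \<in> carrier ?F"
      unfolding a_minus_def by (rule F.M.a_closed[OF xy(1) F.M.a_inv_closed[OF xy(2)]])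
    ultimately show "x = y"
      using eq_of_minus_eq_zero[OF F.M.abelian_group_axioms xy(1,2)] ker by blast
  qed
  then have "mod_iso A ?F M"
    unfolding mod_iso_def using hom surj by (intro bexI[of _ "cover M J"]) (auto simp: bij_betw_def)
  then show ?thesis using J by blast
qed

end

section \<open>The complex \<open>T\<^sub>k\<^sup>-\<close> over such an algebra\<close>

lemma chain_iso_id: "chain_iso A X X (\<lambda>n x. x)"
  by (auto simp: chain_iso_def chain_map_id bij_betw_def)

context fd_algebra
begin

text \<open>Moves a summand of the stalk to the front, the shape in which
  \<open>derived_summands\<close> recognises it.\<close>

lemma chain_iso_sum_stalk_sum:
  assumes M: "right_module A M" and N: "right_module A N"
  shows "chain_iso A (complex_sum X (stalk (mod_sum M N))) (complex_sum (stalk M) (complex_sum X (stalk N)))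
    (\<lambda>n (x, y, z). (y, x, z))"
proof (rule chain_isoI[where g = "\<lambda>n (y, x, z). (x, y, z)"])
  show "chain_map A (complex_sum X (stalk (mod_sum M N))) (complex_sum (stalk M) (complex_sum X (stalk N)))
    (\<lambda>n (x, y, z). (y, x, z))"
    unfolding chain_map_def
  proof (intro conjI allI ballI)
    show "(\<lambda>(x, y, z). (y, x, z)) \<in> mod_hom A (obj (complex_sum X (stalk (mod_sum M N))) n)
        (obj (complex_sum (stalk M) (complex_sum X (stalk N))) n)" for n
      by (rule mod_homI) (auto simp: stalk_obj)
  qed (auto simp: stalk_def)
qed (auto simp: stalk_obj)

end

context basic_algebra
begin

text \<open>This and the next definitions restate the constructions of the theorem for an abstract
  algebra; for the algebra \<open>KQ/I\<close> they become equal to the original ones.\<close>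

definition incoming :: "('r, 'a \<Rightarrow> 'r) rmodule" where
  "incoming = mod_bigsum Arr (\<lambda>\<alpha>. proj (src \<alpha>))"

definition inmap :: "'r \<Rightarrow> 'a \<Rightarrow> 'r" where
  "inmap x = (\<lambda>\<alpha>\<in>Arr. arr \<alpha> \<otimes> x)"

definition others :: "('r, 'v \<Rightarrow> 'r) rmodule" where
  "others = mod_bigsum (V - {k}) proj"

definition simple :: "('r, 'k) rmodule" where
  "simple = \<lparr>carrier = UNIV, mult = undefined, one = undefined, zero = 0, add = (+),
     act = (\<lambda>c a. c * \<chi> k a)\<rparr>"

definition Lk :: "('r, 'r \<times> ('a \<Rightarrow> 'r)) cochain_complex" where
  "Lk =
    \<lparr>obj = (\<lambda>n. mod_sum
       (if n = -1 then proj k else zero_submodule (proj k))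
       (if n = 0 then incoming else zero_submodule incoming)),
     diff = (\<lambda>n (x, y). (\<zero>\<^bsub>proj k\<^esub>, if n = -1 then inmap x else \<zero>\<^bsub>incoming\<^esub>))\<rparr>"

definition Tk :: "('r, ('r \<times> ('a \<Rightarrow> 'r)) \<times> ('v \<Rightarrow> 'r)) cochain_complex" where
  "Tk = complex_sum Lk (stalk others)"

section \<open>The two terms of the complex\<close>

lemma right_module_incoming: "right_module A incoming"
  and fd_incoming: "fd_module A incoming"
  and projective_incoming: "projective A incoming"
  unfolding incoming_def using src(1)
  by (auto intro!: right_module_mod_bigsum ring_axioms right_module_proj fd_mod_bigsum fd_proj
      projective_mod_bigsum projective_proj finite_Arr)

lemma right_module_others: "right_module A others"
  and fd_others: "fd_module A others"
  and projective_others: "projective A others"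
  unfolding others_def using finite_V
  by (auto intro!: right_module_mod_bigsum ring_axioms right_module_proj fd_mod_bigsum fd_proj
      projective_mod_bigsum projective_proj)

sublocale inc: right_module A incoming by (rule right_module_incoming)
sublocale oth: right_module A others by (rule right_module_others)
sublocale pk: right_module A "proj k" by (rule right_module_proj[OF k])

lemma inmap_hom: "inmap \<in> mod_hom A (proj k) incoming"
proof -
  have "(\<lambda>x. arr \<alpha> \<otimes> x) \<in> mod_hom A (proj k) (proj (src \<alpha>))" if "\<alpha> \<in> Arr" for \<alpha>
  proof -
    have "arr \<alpha> \<in> carrier (proj (src \<alpha>))" using that src(1) e_arr by (simp add: mem_proj)
    from proj_hom[OF k right_module_proj[OF src(1)[OF that]] this] show ?thesis by simp
  qed
  then show ?thesis unfolding incoming_def inmap_def[abs_def] by (rule mod_hom_bigsum)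
qed

lemma inmap_zero: "inmap \<zero> = \<zero>\<^bsub>incoming\<^esub>"
  using mod_hom_zero[OF pk.M.abelian_group_axioms inc.M.abelian_group_axioms inmap_hom] by simp

lemma Lk_obj: "obj Lk n = mod_sum (if n = -1 then proj k else zero_submodule (proj k))
    (if n = 0 then incoming else zero_submodule incoming)"
  by (simp add: Lk_def)

lemma Lk_diff: "diff Lk n (x, y) = (\<zero>, if n = -1 then inmap x else \<zero>\<^bsub>incoming\<^esub>)"
  by (simp add: Lk_def)

lemma bounded_Lk: "bounded_complex A Lk"
proof (rule bounded_complexI[where N = 1])
  show "fd_module A (obj Lk n)" for n
    by (simp add: Lk_obj fd_mod_sum fd_proj k fd_incoming fd_zero_submodule right_module_incoming right_module_proj)
  show "diff Lk n \<in> mod_hom A (obj Lk n) (obj Lk (n + 1))" for n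
  proof (cases "n = -1")
    case True
    have "(\<lambda>z. (\<zero>\<^bsub>zero_submodule (proj k)\<^esub>, inmap (fst z))) \<in>
        mod_hom A (obj Lk (-1)) (mod_sum (zero_submodule (proj k)) incoming)"
      unfolding Lk_obj
      by (intro mod_hom_pair right_module.zero_hom right_module_zero_submodule right_module_proj k)
        (simp add: mod_hom_comp[OF inmap_hom mod_hom_fst])
    then show ?thesis using True by (simp add: Lk_def split_def)
  next
    case False
    have "(\<lambda>z. \<zero>\<^bsub>obj Lk (n + 1)\<^esub>) \<in> mod_hom A (obj Lk n) (obj Lk (n + 1))"
      by (rule right_module.zero_hom) (simp add: Lk_obj right_module_mod_sum right_module_zero_submodule
          right_module_incoming right_module_proj k)
    moreover have "\<zero>\<^bsub>obj Lk (n + 1)\<^esub> = (\<zero>, \<zero>\<^bsub>incoming\<^esub>)" by (simp add: Lk_obj)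
    moreover have "diff Lk n = (\<lambda>z. (\<zero>, \<zero>\<^bsub>incoming\<^esub>))" using False by (simp add: Lk_def split_def)
    ultimately show ?thesis by simp
  qed
  show "diff Lk (n + 1) (diff Lk n x) = \<zero>\<^bsub>obj Lk (n + 2)\<^esub>" if "x \<in> carrier (obj Lk n)" for n x
    by (cases x) (simp add: Lk_obj Lk_diff inmap_zero)
qed (auto simp: Lk_obj)

lemma bounded_Tk: "bounded_complex A Tk"
  unfolding Tk_def by (intro bounded_complex_sum bounded_Lk bounded_stalk fd_others)

lemma Tk_obj: "obj Tk n = mod_sum (obj Lk n) (if n = 0 then others else zero_submodule others)"
  by (simp add: Tk_def stalk_obj)

lemma Tk_diff: "diff Tk n ((x, y), z) = ((\<zero>, if n = -1 then inmap x else \<zero>\<^bsub>incoming\<^esub>), \<zero>\<^bsub>others\<^esub>)"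
  by (simp add: Tk_def Lk_diff stalk_def)

lemma Tk_trivial: "n \<noteq> -1 \<Longrightarrow> n \<noteq> 0 \<Longrightarrow> carrier (obj Tk n) = {\<zero>\<^bsub>obj Tk n\<^esub>}"
  by (simp add: Tk_obj Lk_obj)

lemma projective_zero_submodule: "right_module A M \<Longrightarrow> projective A (zero_submodule M)"
  by (rule projective_trivial[OF right_module_zero_submodule]) simp_all

lemma projective_Tk: "projective_complex A Tk"
  unfolding projective_complex_def
proof (intro conjI allI bounded_Tk)
  show "projective A (obj Tk n)" for n
    unfolding Tk_obj Lk_obj
    by (auto intro!: projective_mod_sum projective_proj projective_incoming projective_others
        projective_zero_submodule right_module_incoming right_module_others right_module_proj k)
qed

text \<open>In the language of approximations: with respect to such \<open>N\<close>, the map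
  \<open>inmap\<close> has the property of a left approximation of \<open>P_k\<close>.\<close>

definition extends_along_inmap :: "('r, 'm) rmodule \<Rightarrow> bool" where
  "extends_along_inmap N \<longleftrightarrow> (\<forall>\<phi>\<in>mod_hom A (proj k) N. \<exists>h\<in>mod_hom A incoming N.
     \<forall>x\<in>carrier (proj k). \<phi> x = h (inmap x))"

text \<open>A map from \<open>P_k\<close> to \<open>P_i\<close> is left multiplication by some
  \<open>y\<close> in \<open>e_i A e_k\<close>. The factor \<open>e_i\<close> with
  \<open>i \<noteq> k\<close> makes the character of \<open>y\<close> at \<open>k\<close> vanish, so
  \<open>y\<close> is a left combination of arrows into \<open>k\<close>, and its coefficients
  define the extension.\<close>

lemma extends_along_inmap_proj:
  assumes i: "i \<in> V" "i \<noteq> k"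
  shows "extends_along_inmap (proj i)"
  unfolding extends_along_inmap_def
proof
  fix \<phi> assume phi: "\<phi> \<in> mod_hom A (proj k) (proj i)"
  let ?y = "\<phi> (e k)"
  have y: "?y \<in> carrier (proj i)" by (rule mod_hom_closed[OF phi e_mem_proj[OF k]])
  then have yA: "?y \<in> carrier A" "e i \<otimes> ?y = ?y" using i(1) by (auto simp: mem_proj)
  have yk: "?y \<otimes> e k = ?y"
    using proj_hom_eq[OF k phi e_mem_proj[OF k]] by simp
  have "\<chi> k ?y = \<chi> k (e i) * \<chi> k ?y" using char_mult[OF k e_closed[OF i(1)] yA(1)] yA(2) by simp
  then have "\<chi> k ?y = 0" using char_e[OF k i(1)] i(2) by simp
  then obtain b where b: "b \<in> Arr \<rightarrow> carrier A" "?y \<otimes> e k = (\<Oplus>\<alpha>\<in>Arr. b \<alpha> \<otimes> arr \<alpha>)"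
    using arr_generate[OF yA(1)] by blast
  \<comment> \<open>The factor \<open>e i\<close> moves the coefficients into \<open>e_i A\<close>,
    and it leaves the combination unchanged because \<open>e i \<otimes> ?y = ?y\<close>.\<close>
  let ?h = "\<lambda>z. \<Oplus>\<^bsub>proj i\<^esub>\<alpha>\<in>Arr. act (proj i) (e i \<otimes> b \<alpha>) (z \<alpha>)"
  have eb: "(\<lambda>\<alpha>. e i \<otimes> b \<alpha>) \<in> Arr \<rightarrow> carrier (proj i)"
    using b(1) i(1) by (auto simp: Pi_iff mem_proj e_mult simp flip: m_assoc)
  have h: "?h \<in> mod_hom A incoming (proj i)"
    unfolding incoming_def by (rule free_hom[OF finite_Arr src(1) right_module_proj[OF i(1)] eb])
  have "\<phi> x = ?h (inmap x)" if x: "x \<in> carrier (proj k)" for x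
  proof -
    interpret P: right_module A "proj i" by (rule right_module_proj[OF i(1)])
    have xA: "x \<in> carrier A" using x k by (simp add: mem_proj)
    have ebA: "e i \<otimes> b \<alpha> \<in> carrier A" "b \<alpha> \<in> carrier A" if "\<alpha> \<in> Arr" for \<alpha> using b(1) i(1) that by auto
    have inc_hom: "(\<lambda>z. z) \<in> mod_hom A (proj i) regular"
      by (rule mod_homI) (use i(1) in \<open>simp_all add: mem_proj\<close>)
    have cl: "(\<lambda>\<alpha>. act (proj i) (e i \<otimes> b \<alpha>) (inmap x \<alpha>)) \<in> Arr \<rightarrow> carrier (proj i)"
    proof (rule Pi_I)
      fix \<alpha> assume "\<alpha> \<in> Arr"
      then show "act (proj i) (e i \<otimes> b \<alpha>) (inmap x \<alpha>) \<in> carrier (proj i)"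
        using mult_mem_proj[OF i(1) Pi_mem[OF eb], of \<alpha> "arr \<alpha> \<otimes> x"] xA by (simp add: inmap_def)
    qed
    have "?h (inmap x) = (\<Oplus>\<^bsub>regular\<^esub>\<alpha>\<in>Arr. act (proj i) (e i \<otimes> b \<alpha>) (inmap x \<alpha>))"
      by (rule mod_hom_finsum[OF P.M.abelian_group_axioms right_module_group[OF right_module_regular] inc_hom finite_Arr cl])
    also have "\<dots> = (\<Oplus>\<alpha>\<in>Arr. act (proj i) (e i \<otimes> b \<alpha>) (inmap x \<alpha>))"
      using ebA xA by (intro finsum_regular finite_Arr) (auto simp: inmap_def)
    also have "\<dots> = (\<Oplus>\<alpha>\<in>Arr. (e i \<otimes> (b \<alpha> \<otimes> arr \<alpha>)) \<otimes> x)"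
      using ebA xA i(1) by (intro finsum_cong') (auto simp: inmap_def m_assoc)
    also have "\<dots> = (\<Oplus>\<alpha>\<in>Arr. e i \<otimes> (b \<alpha> \<otimes> arr \<alpha>)) \<otimes> x"
      using ebA xA i(1) by (intro finsum_ldistr[symmetric] finite_Arr) auto
    also have "(\<Oplus>\<alpha>\<in>Arr. e i \<otimes> (b \<alpha> \<otimes> arr \<alpha>)) = e i \<otimes> (\<Oplus>\<alpha>\<in>Arr. b \<alpha> \<otimes> arr \<alpha>)"
      using ebA i(1) by (intro finsum_rdistr[symmetric] finite_Arr) auto
    also have "\<dots> = ?y" using b(2) yk yA(2) by simp
    also have "?y \<otimes> x = \<phi> x" using proj_hom_eq[OF k phi x] by simp
    finally show ?thesis by simp
  qed
  then show "\<exists>h\<in>mod_hom A incoming (proj i). \<forall>x\<in>carrier (proj k). \<phi> x = h (inmap x)"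
    by (intro bexI[OF _ h]) simp
qed

lemma extends_along_inmap_trivial:
  assumes "right_module A N" "carrier N = {\<zero>\<^bsub>N\<^esub>}"
  shows "extends_along_inmap N"
  unfolding extends_along_inmap_def
proof
  fix \<phi> assume "\<phi> \<in> mod_hom A (proj k) N"
  from mod_hom_closed[OF this] assms(2) have "\<forall>x\<in>carrier (proj k). \<phi> x = \<zero>\<^bsub>N\<^esub>" by simp
  then show "\<exists>h\<in>mod_hom A incoming N. \<forall>x\<in>carrier (proj k). \<phi> x = h (inmap x)"
    by (rule bexI[OF _ right_module.zero_hom[OF assms(1)]])
qed

lemma extends_along_inmap_sum:
  assumes "extends_along_inmap M" "extends_along_inmap N"
  shows "extends_along_inmap (mod_sum M N)"
  unfolding extends_along_inmap_def
proof
  fix \<phi> assume phi: "\<phi> \<in> mod_hom A (proj k) (mod_sum M N)"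
  obtain h where h: "h \<in> mod_hom A incoming M" "\<forall>x\<in>carrier (proj k). fst (\<phi> x) = h (inmap x)"
    using bspec[OF assms(1)[unfolded extends_along_inmap_def] mod_hom_comp[OF mod_hom_fst phi]] by blast
  obtain h' where h': "h' \<in> mod_hom A incoming N" "\<forall>x\<in>carrier (proj k). snd (\<phi> x) = h' (inmap x)"
    using bspec[OF assms(2)[unfolded extends_along_inmap_def] mod_hom_comp[OF mod_hom_snd phi]] by blast
  have "\<forall>x\<in>carrier (proj k). \<phi> x = (h (inmap x), h' (inmap x))"
    using h(2) h'(2) by (metis prod.collapse)
  then show "\<exists>h\<in>mod_hom A incoming (mod_sum M N). \<forall>x\<in>carrier (proj k). \<phi> x = h (inmap x)"
    by (rule bexI[OF _ mod_hom_pair[OF h(1) h'(1)]])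
qed

lemma extends_along_inmap_bigsum:
  assumes "\<And>j. j \<in> J \<Longrightarrow> extends_along_inmap (F j)"
  shows "extends_along_inmap (mod_bigsum J F)"
  unfolding extends_along_inmap_def
proof
  fix \<phi> assume phi: "\<phi> \<in> mod_hom A (proj k) (mod_bigsum J F)"
  have "\<exists>h\<in>mod_hom A incoming (F j). \<forall>x\<in>carrier (proj k). \<phi> x j = h (inmap x)" if "j \<in> J" for j
    using bspec[OF assms[OF that, unfolded extends_along_inmap_def] mod_hom_comp[OF mod_hom_component[OF that] phi]] by blast
  then obtain h where h: "\<And>j. j \<in> J \<Longrightarrow> h j \<in> mod_hom A incoming (F j)"
    "\<And>j x. j \<in> J \<Longrightarrow> x \<in> carrier (proj k) \<Longrightarrow> \<phi> x j = h j (inmap x)"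
    by metis
  have "\<phi> x = (\<lambda>j\<in>J. h j (inmap x))" if "x \<in> carrier (proj k)" for x
  proof
    fix j show "\<phi> x j = (\<lambda>j\<in>J. h j (inmap x)) j"
      using h(2) that mod_hom_closed[OF phi that] by (cases "j \<in> J") (auto simp: PiE_iff extensional_def)
  qed
  then have "\<forall>x\<in>carrier (proj k). \<phi> x = (\<lambda>j\<in>J. h j (inmap x))" by blast
  then show "\<exists>h\<in>mod_hom A incoming (mod_bigsum J F). \<forall>x\<in>carrier (proj k). \<phi> x = h (inmap x)"
    by (rule bexI[where x = "\<lambda>z. \<lambda>j\<in>J. h j z", OF _ mod_hom_bigsum[OF h(1)]])
qed

text \<open>Since \<open>x e_i\<close> is the image of \<open>e_i\<close> under the map from
  \<open>P_i\<close> given by \<open>x\<close>, this says that there are no nonzero maps from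
  \<open>P_i\<close> to \<open>ker f\<close> for \<open>i \<noteq> k\<close>.\<close>

definition kernel_at_k :: bool where
  "kernel_at_k \<longleftrightarrow> (\<forall>x\<in>carrier (proj k). inmap x = \<zero>\<^bsub>incoming\<^esub> \<longrightarrow> (\<forall>i\<in>V - {k}. x \<otimes> e i = \<zero>))"

text \<open>The unit vector at \<open>j\<close> is fixed by the action of
  \<open>e (\<iota> j)\<close>, hence so is its image in the kernel, which that idempotent
  annihilates; and the unit vectors generate.\<close>

lemma hom_to_kernel_zero:
  assumes ker: kernel_at_k and J: "finite J" "\<And>j. j \<in> J \<Longrightarrow> \<iota> j \<in> V - {k}"
    and h: "h \<in> mod_hom A (mod_bigsum J (\<lambda>j. proj (\<iota> j))) (proj k)"
    and fh: "\<And>y. y \<in> carrier (mod_bigsum J (\<lambda>j. proj (\<iota> j))) \<Longrightarrow> inmap (h y) = \<zero>\<^bsub>incoming\<^esub>"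
    and y: "y \<in> carrier (mod_bigsum J (\<lambda>j. proj (\<iota> j)))"
  shows "h y = \<zero>"
proof -
  have JV: "\<And>j. j \<in> J \<Longrightarrow> \<iota> j \<in> V" using J(2) by blast
  have 0: "h (unit_vector J \<iota> j) = \<zero>" if j: "j \<in> J" for j
  proof -
    note uv = unit_vector_closed[OF J(1) JV j]
    have "act (mod_bigsum J (\<lambda>j. proj (\<iota> j))) (unit_vector J \<iota> j) (e (\<iota> j)) = unit_vector J \<iota> j"
      using JV JV[OF j] by (auto simp: unit_vector_def e_mult intro!: restrict_ext)
    then have "h (unit_vector J \<iota> j) = h (unit_vector J \<iota> j) \<otimes> e (\<iota> j)"
      using mod_hom_act[OF h uv e_closed[OF JV[OF j]]] by simp
    also have "\<dots> = \<zero>"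
      using ker mod_hom_closed[OF h uv] fh[OF uv] J(2)[OF j] unfolding kernel_at_k_def by blast
    finally show ?thesis .
  qed
  have yA: "y j \<in> carrier A" if "j \<in> J" for j using y that proj_closed[OF JV[OF that]] by (auto simp: PiE_iff)
  have "h y = (\<Oplus>\<^bsub>proj k\<^esub>j\<in>J. act (proj k) (h (unit_vector J \<iota> j)) (y j))"
    by (rule free_hom_eq[OF J(1) JV right_module_proj[OF k] h y])
  also have "\<dots> = (\<Oplus>\<^bsub>proj k\<^esub>j\<in>J. \<zero>\<^bsub>proj k\<^esub>)"
    using 0 yA pk.M.zero_closed by (intro pk.M.finsum_cong') auto
  also have "\<dots> = \<zero>" using pk.M.add.finprod_one_eqI[of J "\<lambda>_. \<zero>"] by (simp add: finsum_def)
  finally show ?thesis .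
qed

lemma Tk_hom_vanishes:
  assumes ker: kernel_at_k and r: "r \<noteq> 0"
  shows "derived_hom_vanishes A Tk (shift Tk r)"
proof (rule two_term_hom_vanishes[OF projective_Tk Tk_trivial _ _ r])
  have T1: "obj Tk (-1) = mod_sum (mod_sum (proj k) (zero_submodule incoming)) (zero_submodule others)"
    and T0: "obj Tk 0 = mod_sum (mod_sum (zero_submodule (proj k)) incoming) others"
    by (simp_all add: Tk_obj Lk_obj)
  note Z = right_module_zero_submodule[OF right_module_incoming] right_module_zero_submodule[OF right_module_others]
    right_module_zero_submodule[OF right_module_proj[OF k]]
  show "\<exists>h\<in>mod_hom A (obj Tk 0) (obj Tk 0). \<forall>x\<in>carrier (obj Tk (-1)). \<phi> x = h (diff Tk (-1) x)"
    if phi: "\<phi> \<in> mod_hom A (obj Tk (-1)) (obj Tk 0)" for \<phi>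
  proof -
    \<comment> \<open>All nonzero summands of the degree 0 term are modules \<open>P_i\<close> with
      \<open>i \<noteq> k\<close>; for the sources of the arrows into \<open>k\<close> this is the
      absence of loops.\<close>
    have "extends_along_inmap (obj Tk 0)" unfolding T0 incoming_def others_def
      by (rule extends_along_inmap_sum[OF extends_along_inmap_sum[OF extends_along_inmap_trivial[OF Z(3)]
              extends_along_inmap_bigsum[OF extends_along_inmap_proj]]
            extends_along_inmap_bigsum[OF extends_along_inmap_proj]])
        (auto simp: src)
    moreover have "(\<lambda>x. \<phi> ((x, \<zero>\<^bsub>incoming\<^esub>), \<zero>\<^bsub>others\<^esub>)) \<in> mod_hom A (proj k) (obj Tk 0)"
    proof -
      have "(\<lambda>x. ((x, \<zero>\<^bsub>zero_submodule incoming\<^esub>), \<zero>\<^bsub>zero_submodule others\<^esub>)) \<in> mod_hom A (proj k) (obj Tk (-1))"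
        unfolding T1 by (intro mod_hom_pair mod_hom_id right_module.zero_hom Z)
      from mod_hom_comp[OF phi this] show ?thesis by simp
    qed
    ultimately have "\<exists>h\<in>mod_hom A incoming (obj Tk 0).
        \<forall>x\<in>carrier (proj k). \<phi> ((x, \<zero>\<^bsub>incoming\<^esub>), \<zero>\<^bsub>others\<^esub>) = h (inmap x)"
      unfolding extends_along_inmap_def by (rule bspec)
    then obtain h where h: "h \<in> mod_hom A incoming (obj Tk 0)"
      "\<forall>x\<in>carrier (proj k). \<phi> ((x, \<zero>\<^bsub>incoming\<^esub>), \<zero>\<^bsub>others\<^esub>) = h (inmap x)"
      by blast
    have "(\<lambda>z. h (snd (fst z))) \<in> mod_hom A (obj Tk 0) (obj Tk 0)"
      using mod_hom_comp[OF h(1) mod_hom_comp[OF mod_hom_snd mod_hom_fst]] unfolding T0 .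
    moreover have "\<forall>x\<in>carrier (obj Tk (-1)). \<phi> x = h (snd (fst (diff Tk (-1) x)))"
      using h(2) by (auto simp: T1 Tk_diff)
    ultimately show ?thesis by (intro bexI[of _ "\<lambda>z. h (snd (fst z))"])
  qed
  show "\<psi> y = \<zero>\<^bsub>obj Tk (-1)\<^esub>"
    if psi: "\<psi> \<in> mod_hom A (obj Tk 0) (obj Tk (-1))"
      and d: "\<forall>y\<in>carrier (obj Tk 0). diff Tk (-1) (\<psi> y) = \<zero>\<^bsub>obj Tk 0\<^esub>" and y: "y \<in> carrier (obj Tk 0)" for \<psi> y
  proof -
    \<comment> \<open>Only the component in \<open>P_k\<close> of the degree -1 term can be
      nonzero.\<close>
    let ?p = "\<lambda>y. fst (fst (\<psi> y))"
    have p: "?p \<in> mod_hom A (obj Tk 0) (proj k)"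
      using mod_hom_comp[OF mod_hom_comp[OF mod_hom_fst mod_hom_fst] psi[unfolded T1]] .
    have psi_eq: "\<psi> z = ((?p z, \<zero>\<^bsub>incoming\<^esub>), \<zero>\<^bsub>others\<^esub>)" if "z \<in> carrier (obj Tk 0)" for z
      using mod_hom_closed[OF psi that] by (auto simp: T1 prod_eq_iff)
    have fp: "inmap (?p z) = \<zero>\<^bsub>incoming\<^esub>" if "z \<in> carrier (obj Tk 0)" for z
    proof -
      have "diff Tk (-1) u = ((\<zero>, inmap (fst (fst u))), \<zero>\<^bsub>others\<^esub>)" for u
        using Tk_diff[of "-1" "fst (fst u)" "snd (fst u)" "snd u"] by simp
      from this[of "\<psi> z"] show ?thesis using bspec[OF d that] by (simp add: T0)
    qed
    \<comment> \<open>The inclusions of the two summands of the degree 0 term. Each of these is a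
      sum of modules \<open>P_i\<close> with \<open>i \<noteq> k\<close>, so
      \<open>hom_to_kernel_zero\<close> applies to both.\<close>
    let ?i = "\<lambda>u. ((\<zero>, u), \<zero>\<^bsub>others\<^esub>)" and ?j = "\<lambda>v. ((\<zero>, \<zero>\<^bsub>incoming\<^esub>), v)"
    have i: "?i \<in> mod_hom A incoming (obj Tk 0)"
    proof -
      have "(\<lambda>x. ((\<zero>\<^bsub>zero_submodule (proj k)\<^esub>, x), \<zero>\<^bsub>others\<^esub>)) \<in> mod_hom A incoming (obj Tk 0)"
        unfolding T0 by (intro mod_hom_pair mod_hom_id right_module.zero_hom Z right_module_others)
      then show ?thesis by simp
    qed
    have j: "?j \<in> mod_hom A others (obj Tk 0)"
    proof -
      have "(\<lambda>x. ((\<zero>\<^bsub>zero_submodule (proj k)\<^esub>, \<zero>\<^bsub>incoming\<^esub>), x)) \<in> mod_hom A others (obj Tk 0)"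
        unfolding T0 by (intro mod_hom_pair mod_hom_id right_module.zero_hom Z right_module_incoming)
      then show ?thesis by simp
    qed
    have 1: "?p (?i u) = \<zero>" if u: "u \<in> carrier incoming" for u
      using hom_to_kernel_zero[OF ker finite_Arr _ mod_hom_comp[OF p i, unfolded incoming_def] _ u[unfolded incoming_def]]
        fp mod_hom_closed[OF i] src unfolding incoming_def by blast
    have 2: "?p (?j v) = \<zero>" if v: "v \<in> carrier others" for v
      using hom_to_kernel_zero[OF ker _ _ mod_hom_comp[OF p j, unfolded others_def] _ v[unfolded others_def]]
        fp mod_hom_closed[OF j] finite_V unfolding others_def by blast
    obtain u v where uv: "u \<in> carrier incoming" "v \<in> carrier others" "y = ((\<zero>, u), v)"
      using y by (auto simp: T0)
    then have "y = ?i u \<oplus>\<^bsub>obj Tk 0\<^esub> ?j v" by (simp add: T0)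
    then have "?p y = ?p (?i u) \<oplus>\<^bsub>proj k\<^esub> ?p (?j v)"
      using mod_hom_add[OF p mod_hom_closed[OF i uv(1)] mod_hom_closed[OF j uv(2)]] by simp
    then have "?p y = \<zero>" using 1[OF uv(1)] 2[OF uv(2)] by simp
    then show ?thesis using psi_eq[OF y] by (simp add: T1)
  qed
qed

lemma Tk_generates:
  assumes T: "triangulated_subcategory A \<T>" and sub: "derived_summands A Tk \<subseteq> \<T>"
  shows "\<T> = per A"
proof -
  note O = bounded_stalk[OF fd_others]
  have L: "essentially_in A \<T> Lk"
    by (rule essentially_in_summand[OF T bounded_Tk bounded_Lk O _ sub, of "\<lambda>n x. x"])
      (unfold Tk_def, rule chain_iso_id)
  have P: "essentially_in A \<T> (stalk (proj i))" if i: "i \<in> V" "i \<noteq> k" for i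
  proof -
    let ?W = "V - {k} - {i}"
    let ?N = "mod_bigsum ?W proj"
    have ins: "insert i ?W = V - {k}" using i by blast
    have N: "fd_module A ?N" using finite_V by (intro fd_mod_bigsum fd_proj) auto
    note split = bigsum_split(1)[of i ?W A proj, unfolded ins, folded others_def]
      bigsum_split(2)[of i ?W proj, unfolded ins, folded others_def]
    have "chain_iso A (stalk others) (stalk (mod_sum (proj i) ?N)) (\<lambda>n y. (y i, restrict y ?W))"
      by (rule chain_iso_stalk[OF right_module_others
            right_module_mod_sum[OF right_module_proj[OF i(1)] fd_right_module[OF N]] split]) simp_all
    from chain_iso_comp[OF chain_iso_sum_stalk_sum[OF right_module_proj[OF i(1)] fd_right_module[OF N]]
        chain_iso_complex_sum[OF chain_iso_id[of A Lk] this]]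
    show ?thesis
      by (intro essentially_in_summand[OF T bounded_Tk bounded_stalk[OF fd_proj[OF i(1)]]
          bounded_complex_sum[OF bounded_Lk bounded_stalk[OF N]] _ sub]) (simp add: Tk_def)
  qed
  have I: "essentially_in A \<T> (stalk incoming)"
    unfolding incoming_def
    by (rule essentially_in_stalk_bigsum[OF T finite_Arr]) (simp_all add: fd_proj P src)
  have zk: "\<zero> \<in> carrier (proj k)" using k by (simp add: mem_proj)
  let ?S = "stalk incoming" and ?i = "\<lambda>(n::int) z. (\<zero>, z)"
  note Sb = bounded_stalk[OF fd_incoming]
  have Sobj: "obj ?S n = (if n = 0 then incoming else zero_submodule incoming)" for n by (simp add: stalk_obj)
  have im: "chain_map A ?S Lk ?i"
    unfolding chain_map_def
  proof (intro conjI allI ballI)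
    show "(\<lambda>z. (\<zero>, z)) \<in> mod_hom A (obj ?S n) (obj Lk n)" for n
      by (rule mod_homI) (auto simp: Sobj Lk_obj zk)
    show "(\<zero>, diff ?S n z) = diff Lk n (\<zero>, z)" for n z
      by (simp add: Lk_diff stalk_def inmap_zero)
  qed
  let ?C = "cone ?S Lk ?i" and ?Pk = "shift (stalk (proj k)) 1"
  note Cb = bounded_cone[OF Sb bounded_Lk im]
  note Pb = bounded_shift[OF bounded_stalk[OF fd_proj[OF k]], of 1]
  have pz: "\<ominus>\<^bsub>obj ?Pk n\<^esub> \<zero> = \<zero>" for n
  proof -
    interpret G: abelian_group "obj ?Pk n" by (rule complex_group[OF Pb])
    have "\<zero>\<^bsub>obj ?Pk n\<^esub> = \<zero>" by (simp add: stalk_obj)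
    then show ?thesis using G.minus_equality[of "\<zero>\<^bsub>obj ?Pk n\<^esub>" "\<zero>\<^bsub>obj ?Pk n\<^esub>"] G.zero_closed G.l_zero by metis
  qed
  have Pdiff: "diff ?Pk n x = \<zero>" for n x
    using pz[of "n + 1"] by (simp add: shift_def stalk_def)
  have Pobj: "obj ?Pk n = (if n = -1 then proj k else zero_submodule (proj k))" for n
    by (auto simp: stalk_obj)
  have Cobj: "obj ?C n = mod_sum (if n = -1 then incoming else zero_submodule incoming) (obj Lk n)" for n
    by (auto simp: stalk_obj)
  have zi: "\<ominus>\<^bsub>obj ?S n\<^esub> \<zero>\<^bsub>incoming\<^esub> = \<zero>\<^bsub>incoming\<^esub>" for n
  proof -
    interpret G: abelian_group "obj ?S n" by (rule complex_group[OF Sb])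
    have "\<zero>\<^bsub>obj ?S n\<^esub> = \<zero>\<^bsub>incoming\<^esub>" by (simp add: stalk_obj)
    then show ?thesis using G.minus_equality[of "\<zero>\<^bsub>obj ?S n\<^esub>" "\<zero>\<^bsub>obj ?S n\<^esub>"] G.zero_closed G.l_zero by metis
  qed
  have Cdiff: "diff ?C n (z, (x, y)) = (\<zero>\<^bsub>incoming\<^esub>,
      (\<zero> \<oplus> \<zero>, z \<oplus>\<^bsub>incoming\<^esub> (if n = -1 then inmap x else \<zero>\<^bsub>incoming\<^esub>)))" for n x y z
  proof -
    have "diff ?S m u = \<zero>\<^bsub>incoming\<^esub>" for m u by (simp add: stalk_def)
    then show ?thesis
      by (simp only: cone_def cochain_complex.simps prod.case zi) (simp add: Lk_obj Lk_diff)
  qed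
  \<comment> \<open>The projection onto \<open>P_k\<close> discards two copies of
    \<open>incoming\<close>, one in degree -1 from the cone and one in degree 0 from
    \<open>Lk\<close>, which the differential of the cone identifies.\<close>
  have "quasi_iso A ?C ?Pk (\<lambda>n z. fst (snd z))"
  proof (rule quasi_isoI[OF Cb Pb])
    show "chain_map A ?C ?Pk (\<lambda>n z. fst (snd z))"
      unfolding chain_map_def
    proof (intro conjI allI ballI)
      show "(\<lambda>z. fst (snd z)) \<in> mod_hom A (obj ?C n) (obj ?Pk n)" for n
        unfolding Cobj Lk_obj Pobj using mod_hom_comp[OF mod_hom_fst mod_hom_snd] .
      show "fst (snd (diff ?C n z)) = diff ?Pk n (fst (snd z))" for n z
        unfolding Pdiff by (cases z) (auto simp: Cdiff)
    qed
    show "z \<in> boundaries ?C n" if z: "z \<in> cycles ?C n" "fst (snd z) \<in> boundaries ?Pk n" for n z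
    proof -
      obtain w x y where zz: "z = (w, (x, y))" by (cases z) auto
      have x0: "x = \<zero>" using z(2) by (auto simp: zz boundaries_def Pdiff)
      have zC: "z \<in> carrier (obj ?C n)" by (rule cycles_carrier[OF Cb z(1)])
      show ?thesis
      proof (cases "n = 0")
        case True
        have w: "w = \<zero>\<^bsub>incoming\<^esub>" and y: "y \<in> carrier incoming" using zC True by (auto simp: zz Cobj Lk_obj simp del: cone_obj)
        show ?thesis
        proof (rule boundariesI[OF Cb])
          show "(y, (\<zero>, \<zero>\<^bsub>incoming\<^esub>)) \<in> carrier (obj ?C (n - 1))"
            using y True inmap_zero pk.M.zero_closed inc.M.zero_closed by (simp add: Cobj Lk_obj del: cone_obj)
          show "z = diff ?C (n - 1) (y, (\<zero>, \<zero>\<^bsub>incoming\<^esub>))"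
            using y True inmap_zero w x0 inc.M.r_zero by (simp add: Cdiff zz)
        qed
      next
        case False
        have y: "y = \<zero>\<^bsub>incoming\<^esub>" using zC False by (auto simp: zz Cobj Lk_obj simp del: cone_obj)
        have "w = \<zero>\<^bsub>incoming\<^esub>"
        proof (cases "n = -1")
          case True
          have w: "w \<in> carrier incoming" using zC True by (simp add: zz Cobj del: cone_obj)
          have "diff ?C n z = \<zero>\<^bsub>obj ?C (n + 1)\<^esub>" using z(1) by (simp add: cycles_def)
          then have "w \<oplus>\<^bsub>incoming\<^esub> inmap \<zero> = \<zero>\<^bsub>incoming\<^esub>"
            using True unfolding zz Cdiff x0 by (simp add: Lk_obj)
          then show ?thesis using w inc.M.r_zero by (simp add: inmap_zero)
        next
          case False
          then show ?thesis using zC by (auto simp: zz Cobj simp del: cone_obj)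
        qed
        then have "z = \<zero>\<^bsub>obj ?C n\<^esub>" using zz x0 y by (simp add: Cobj Lk_obj del: cone_obj)
        then show ?thesis using boundaries_zero[OF Cb, of n] by simp
      qed
    qed
    show "\<exists>z\<in>cycles ?C n. x \<ominus>\<^bsub>obj ?Pk n\<^esub> fst (snd z) \<in> boundaries ?Pk n" if x: "x \<in> cycles ?Pk n" for n x
    proof -
      interpret G: abelian_group "obj ?Pk n" by (rule complex_group[OF Pb])
      have xP: "x \<in> carrier (obj ?Pk n)" by (rule cycles_carrier[OF Pb x])
      have z0: "x \<ominus>\<^bsub>obj ?Pk n\<^esub> x = \<zero>\<^bsub>obj ?Pk n\<^esub>" using xP by (simp add: a_minus_def G.r_neg del: shift_obj)
      show ?thesis
      proof (cases "n = -1")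
        case True
        have xk: "x \<in> carrier (proj k)" using xP unfolding Pobj True by simp
        note fx = mod_hom_closed[OF inmap_hom xk]
        \<comment> \<open>The first component cancels \<open>inmap x\<close>, so that this preimage
          of \<open>x\<close> is a cycle.\<close>
        let ?z = "(\<ominus>\<^bsub>incoming\<^esub> inmap x, (x, \<zero>\<^bsub>incoming\<^esub>))"
        have "?z \<in> carrier (obj ?C n)" using True xk fx by (simp add: Cobj Lk_obj del: cone_obj)
        moreover have "diff ?C n ?z = \<zero>\<^bsub>obj ?C (n + 1)\<^esub>"
          using True fx inc.M.l_neg[OF fx] by (simp add: Cdiff Cobj Lk_obj del: cone_obj)
        ultimately have "?z \<in> cycles ?C n" by (simp add: cycles_def del: cone_obj)
        then show ?thesis using z0 boundaries_zero[OF Pb, of n] by (intro bexI[of _ ?z]) simp_all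
      next
        case False
        have "x = \<zero>" using xP False unfolding Pobj by simp
        then have "x = fst (snd \<zero>\<^bsub>obj ?C n\<^esub>)" by (simp add: Lk_obj)
        then show ?thesis
          using z0 boundaries_zero[OF Pb, of n] boundaries_cycles[OF Cb boundaries_zero[OF Cb, of n]]
          by (intro bexI[of _ "\<zero>\<^bsub>obj ?C n\<^esub>"]) (simp_all del: cone_obj shift_obj)
      qed
    qed
  qed
  from essentially_in_quasi_iso[OF T essentially_in_cone[OF T I L im] Pb this]
  have "essentially_in A \<T> (shift ?Pk (-1))" by (rule essentially_in_shift[OF T])
  moreover have "chain_iso A (shift ?Pk (-1)) (stalk (proj k)) (\<lambda>n x. x)"
  proof -
    have "diff (shift ?Pk (-1)) n x = \<zero>" for n x
      using pz[of n] Pdiff by (simp add: shift_def[of ?Pk])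
    then show ?thesis
      unfolding chain_iso_def chain_map_def by (simp add: mod_hom_id bij_betw_def stalk_def)
  qed
  ultimately have "essentially_in A \<T> (stalk (proj k))"
    by (rule essentially_in_chain_iso[OF T _ bounded_stalk[OF fd_proj[OF k]]])
  with P have P': "essentially_in A \<T> (stalk (proj i))" if "i \<in> V" for i using that by (cases "i = k") auto
  show ?thesis
  proof (rule generates_perI[OF T])
    fix M :: "('r, 'k list) rmodule" assume M: "projective A M" "fd_module A M"
    obtain J where J: "finite J" "J \<subseteq> carrier M \<times> V" "mod_iso A (mod_bigsum J (\<lambda>j. proj (snd j))) M"
      using projective_decompose[OF M] by blast
    have JV: "\<And>j. j \<in> J \<Longrightarrow> snd j \<in> V" using J(2) by auto
    have "essentially_in A \<T> (stalk (mod_bigsum J (\<lambda>j. proj (snd j))))"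
      by (rule essentially_in_stalk_bigsum[OF T J(1)]) (simp_all add: fd_proj P' JV)
    then show "essentially_in A \<T> (stalk M)"
      by (rule essentially_in_stalk_iso[OF T _ J(3) fd_free[OF J(1) JV] fd_right_module[OF M(2)]])
  qed
qed

lemma tilting_complex_Tk: "kernel_at_k \<Longrightarrow> tilting_complex A Tk"
  unfolding tilting_complex_def using projective_Tk Tk_hom_vanishes Tk_generates by blast

end

section \<open>The kernel of the map \<open>f\<close>, and its cokernel as a module\<close>

context basic_algebra
begin

text \<open>An element \<open>x\<close> of \<open>ker f\<close> and a vertex
  \<open>i \<noteq> k\<close> define a map from \<open>P_i\<close> to \<open>ker f\<close>, hence a
  chain map from \<open>T\<close> to \<open>T[-1]\<close>. This chain map sends the cycle
  \<open>e_i\<close> to \<open>x e_i\<close>, and since \<open>T[-1]\<close> has no nonzero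
  boundaries in degree 0, vanishing in the derived category forces \<open>x e_i = 0\<close>.\<close>

lemma kernel_at_k_of_tilting:
  assumes til: "tilting_complex A Tk"
  shows kernel_at_k
  unfolding kernel_at_k_def
proof (intro ballI impI)
  fix x i assume x: "x \<in> carrier (proj k)" and fx: "inmap x = \<zero>\<^bsub>incoming\<^esub>" and i: "i \<in> V - {k}"
  have iV: "i \<in> V" using i by simp
  note xA = proj_closed[OF k x]
  let ?S = "shift Tk (-1)"
  note Sb = bounded_shift[OF bounded_Tk, of "-1"]
  \<comment> \<open>One formula for all degrees: outside degree 0 the coordinate
    \<open>snd u i\<close> is zero.\<close>
  let ?g = "\<lambda>(n::int) u. ((x \<otimes> snd u i, \<zero>\<^bsub>incoming\<^esub>), \<zero>\<^bsub>others\<^esub>)"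
  have w: "w i \<in> carrier (proj i)" if "w \<in> carrier others" for w
    using that i by (auto simp: others_def PiE_iff)
  have w0: "\<zero>\<^bsub>others\<^esub> i = \<zero>" using i by (simp add: others_def)
  have zk: "\<zero> \<in> carrier (proj k)" using k by (simp add: mem_proj)
  have comp: "(\<lambda>w. x \<otimes> w i) \<in> mod_hom A others (proj k)"
  proof -
    have "(\<lambda>w. w i) \<in> mod_hom A others (proj i)"
      unfolding others_def by (rule mod_hom_component) (use i in simp)
    moreover have "(\<lambda>z. x \<otimes> z) \<in> mod_hom A (proj i) (proj k)"
      using proj_hom[OF iV right_module_proj[OF k] x] by simp
    ultimately show ?thesis by (rule mod_hom_comp[rotated])
  qed
  have g: "chain_map A Tk ?S ?g"
    unfolding chain_map_def
  proof (intro conjI allI ballI)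
    fix n
    have Sobj: "obj ?S n = mod_sum (mod_sum (if n = 0 then proj k else zero_submodule (proj k))
        (if n = 1 then incoming else zero_submodule incoming)) (if n = 1 then others else zero_submodule others)"
      by (simp add: Tk_obj Lk_obj)
    show "?g n \<in> mod_hom A (obj Tk n) (obj ?S n)"
    proof (cases "n = 0")
      case True
      have "(\<lambda>u. ((x \<otimes> snd u i, \<zero>\<^bsub>zero_submodule incoming\<^esub>), \<zero>\<^bsub>zero_submodule others\<^esub>)) \<in>
          mod_hom A (obj Tk 0) (mod_sum (mod_sum (proj k) (zero_submodule incoming)) (zero_submodule others))"
        using mod_hom_comp[OF comp mod_hom_snd, of "obj Lk 0"]
        by (intro mod_hom_pair right_module.zero_hom right_module_zero_submodule right_module_incoming right_module_others)
          (simp add: Tk_obj)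
      then show ?thesis unfolding Sobj using True by simp
    next
      case False
      interpret S: right_module A "obj ?S n" by (rule complex_right_module[OF Sb])
      have "?g n u = \<zero>\<^bsub>obj ?S n\<^esub>" if "u \<in> carrier (obj Tk n)" for u
        using that False xA by (auto simp: Tk_obj Lk_obj w0)
      then show ?thesis using S.zero_hom[of "obj Tk n"] complex_right_module[OF bounded_Tk, of n]
        unfolding mod_hom_def right_module_def abelian_group_def
        by (auto simp: abelian_monoid.a_closed right_module.act_closed[OF complex_right_module[OF bounded_Tk, of n]] simp del: shift_obj)
    qed
    fix u assume u: "u \<in> carrier (obj Tk n)"
    have wu: "snd u i \<in> carrier A"
    proof (cases "n = 0")
      case True
      then show ?thesis using u proj_closed[OF iV w] by (auto simp: Tk_obj)
    next
      case False
      then show ?thesis using u w0 by (auto simp: Tk_obj)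
    qed
    interpret T: abelian_group "obj Tk n" by (rule complex_group[OF bounded_Tk])
    have T0: "\<zero>\<^bsub>obj Tk n\<^esub> = ((\<zero>, \<zero>\<^bsub>incoming\<^esub>), \<zero>\<^bsub>others\<^esub>)" by (simp add: Tk_obj Lk_obj)
    have neg: "\<ominus>\<^bsub>obj Tk n\<^esub> \<zero>\<^bsub>obj Tk n\<^esub> = \<zero>\<^bsub>obj Tk n\<^esub>" by (rule T.minus_equality) simp_all
    have fxw: "inmap (x \<otimes> snd u i) = \<zero>\<^bsub>incoming\<^esub>"
      using mod_hom_act[OF inmap_hom x wu] fx wu by simp
    have "diff Tk (n - 1) (?g n u) = \<zero>\<^bsub>obj Tk n\<^esub>" using fxw by (simp add: Tk_diff T0)
    then have "diff ?S n (?g n u) = \<zero>\<^bsub>obj Tk n\<^esub>" using neg by (simp add: shift_def)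
    moreover have "snd (diff Tk n u) = \<zero>\<^bsub>others\<^esub>"
      using Tk_diff[of n "fst (fst u)" "snd (fst u)" "snd u"] by simp
    ultimately show "?g (n + 1) (diff Tk n u) = diff ?S n (?g n u)"
      using xA by (simp add: w0 T0)
  qed
  \<comment> \<open>The generator \<open>e i\<close> of the summand \<open>P_i\<close>, which
    \<open>?g\<close> sends to \<open>x \<otimes> e i\<close>.\<close>
  let ?u = "((\<zero>, \<zero>\<^bsub>incoming\<^esub>), unit_vector (V - {k}) id i)"
  have uv: "unit_vector (V - {k}) id i \<in> carrier others"
    using unit_vector_closed[of "V - {k}" id i] finite_V i by (simp add: others_def)
  have "?u \<in> cycles Tk 0"
    using uv by (simp add: cycles_def Tk_obj Lk_obj Tk_diff)
  moreover have "derived_hom_vanishes A Tk ?S" using til unfolding tilting_complex_def by simp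
  ultimately have "?g 0 ?u \<in> boundaries ?S 0"
    by (intro derived_hom_vanishes_boundaries[OF bounded_Tk Sb fd_algebra_axioms _ g])
  moreover have "boundaries ?S 0 = {\<zero>\<^bsub>obj ?S 0\<^esub>}"
  proof -
    have "carrier (obj ?S (0 - 1)) = {\<zero>\<^bsub>obj ?S (0 - 1)\<^esub>}" using Tk_trivial[of "-2"] by simp
    then show ?thesis
      using mod_hom_zero[OF complex_group[OF Sb] complex_group[OF Sb] complex_diff'[OF Sb, of 0]]
      by (simp add: boundaries_def)
  qed
  ultimately show "x \<otimes> e i = \<zero>"
    using i by (simp add: Tk_obj Lk_obj unit_vector_def)
qed

lemma tilting_Tk_iff: "tilting_complex A Tk \<longleftrightarrow> kernel_at_k"
  using tilting_complex_Tk kernel_at_k_of_tilting by blast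

lemma inmap_inj_iff:
  "inj_on inmap (carrier (proj k)) \<longleftrightarrow> (\<forall>x\<in>carrier (proj k). inmap x = \<zero>\<^bsub>incoming\<^esub> \<longrightarrow> x = \<zero>)"
proof
  assume inj: "inj_on inmap (carrier (proj k))"
  have "\<zero> \<in> carrier (proj k)" using k by (simp add: mem_proj)
  then show "\<forall>x\<in>carrier (proj k). inmap x = \<zero>\<^bsub>incoming\<^esub> \<longrightarrow> x = \<zero>"
    using inj_onD[OF inj, of _ \<zero>] by (simp add: inmap_zero)
next
  assume ker: "\<forall>x\<in>carrier (proj k). inmap x = \<zero>\<^bsub>incoming\<^esub> \<longrightarrow> x = \<zero>"
  show "inj_on inmap (carrier (proj k))"
  proof (rule inj_onI)
    fix x y assume xy: "x \<in> carrier (proj k)" "y \<in> carrier (proj k)" "inmap x = inmap y"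
    have "inmap (x \<ominus>\<^bsub>proj k\<^esub> y) = \<zero>\<^bsub>incoming\<^esub>"
      using mod_hom_diff[OF pk.M.abelian_group_axioms inc.M.abelian_group_axioms inmap_hom xy(1,2)] xy(3)
        mod_hom_closed[OF inmap_hom xy(2)] by (simp add: a_minus_def inc.M.r_neg)
    moreover have "x \<ominus>\<^bsub>proj k\<^esub> y \<in> carrier (proj k)"
      unfolding a_minus_def by (rule pk.M.a_closed[OF xy(1) pk.M.a_inv_closed[OF xy(2)]])
    ultimately have "x \<ominus>\<^bsub>proj k\<^esub> y = \<zero>\<^bsub>proj k\<^esub>" using ker by simp
    then show "x = y" by (rule eq_of_minus_eq_zero[OF pk.M.abelian_group_axioms xy(1,2)])
  qed
qed

lemma right_module_simple: "right_module A simple"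
proof (rule right_moduleI[OF ring_axioms])
  show "abelian_group simple"
    by (rule abelian_groupI) (auto simp: simple_def intro: exI[of _ "- x" for x])
  have "\<chi> k \<one> = 1" using char_scalar[OF k, of 1] by simp
  then show "act simple m \<one> = m" for m by (simp add: simple_def)
qed (simp_all add: simple_def char_add[OF k] char_mult[OF k] algebra_simps)

lemma simple_simps [simp]: "carrier simple = UNIV" "\<zero>\<^bsub>simple\<^esub> = 0" "x \<oplus>\<^bsub>simple\<^esub> y = x + y"
  "act simple x a = x * \<chi> k a"
  by (simp_all add: simple_def)

lemma kernel_fd: "fd_module A (mod_kernel (proj k) incoming inmap)"
  unfolding mod_kernel_def
proof (rule fd_restrict[OF fd_proj[OF k]])
  show "x \<oplus>\<^bsub>proj k\<^esub> y \<in> {x \<in> carrier (proj k). inmap x = \<zero>\<^bsub>incoming\<^esub>}"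
    if "x \<in> {x \<in> carrier (proj k). inmap x = \<zero>\<^bsub>incoming\<^esub>}" "y \<in> {x \<in> carrier (proj k). inmap x = \<zero>\<^bsub>incoming\<^esub>}" for x y
    using that mod_hom_add[OF inmap_hom, of x y] pk.M.a_closed[of x y] inc.M.l_zero by simp
  show "act (proj k) x a \<in> {x \<in> carrier (proj k). inmap x = \<zero>\<^bsub>incoming\<^esub>}"
    if "x \<in> {x \<in> carrier (proj k). inmap x = \<zero>\<^bsub>incoming\<^esub>}" "a \<in> carrier A" for x a
    using that mod_hom_act[OF inmap_hom, of x a] pk.act_closed[of x a] inc.act_zero_left[of a] by simp
qed (use inmap_zero pk.M.zero_closed in auto)

text \<open>By subtracting a scalar from \<open>a\<close> it is enough to treat \<open>b\<close>
  with character zero at \<open>k\<close>. As \<open>x b\<close> lies in \<open>ker f\<close>, it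
  equals \<open>x b e_k\<close>, and \<open>b e_k\<close> is a combination of terms
  \<open>c \<alpha>\<close> with arrows \<open>\<alpha>\<close> into \<open>k\<close>. Each
  \<open>x c \<alpha>\<close> vanishes, because \<open>x c\<close> lies in \<open>ker f\<close> and
  is annihilated by the idempotent at the source of \<open>\<alpha>\<close>, a vertex other than
  \<open>k\<close>.\<close>

lemma kernel_act:
  assumes ker: kernel_at_k and x: "x \<in> carrier (mod_kernel (proj k) incoming inmap)" and a: "a \<in> carrier A"
  shows "x \<otimes> a = x \<otimes> (\<chi> k a \<odot> \<one>)"
proof -
  let ?K = "mod_kernel (proj k) incoming inmap"
  interpret K: right_module A ?K by (rule fd_right_module[OF kernel_fd])
  have act: "act ?K = (\<otimes>)" by (simp add: mod_kernel_def proj_def)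
  have KA: "z \<in> carrier A" if "z \<in> carrier ?K" for z
    using that proj_closed[OF k] by (simp add: mod_kernel_def)
  have Kz: "\<zero>\<^bsub>?K\<^esub> = \<zero>" by (simp add: mod_kernel_def)
  have Ke: "z \<otimes> e i = \<zero>" if "z \<in> carrier ?K" "i \<in> V" "i \<noteq> k" for z i
    using ker that unfolding kernel_at_k_def by (simp add: mod_kernel_def)
  have Kk: "z = z \<otimes> e k" if "z \<in> carrier ?K" for z
    using act_decompose_single[OF K.right_module_axioms that k] Ke[OF that] by (simp add: act Kz)
  have nil: "x \<otimes> b = \<zero>" if b: "b \<in> carrier A" "\<chi> k b = 0" for b
  proof -
    obtain c where c: "c \<in> Arr \<rightarrow> carrier A" "b \<otimes> e k = (\<Oplus>\<alpha>\<in>Arr. c \<alpha> \<otimes> arr \<alpha>)"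
      using arr_generate[OF b] by blast
    have cA: "c \<alpha> \<in> carrier A" if "\<alpha> \<in> Arr" for \<alpha> using c(1) that by auto
    have "x \<otimes> b \<in> carrier ?K" using K.act_closed[OF x b(1)] by (simp add: act)
    then have "x \<otimes> b = x \<otimes> (b \<otimes> e k)" using Kk KA[OF x] b(1) k by (simp flip: m_assoc)
    also have "\<dots> = (\<Oplus>\<alpha>\<in>Arr. x \<otimes> (c \<alpha> \<otimes> arr \<alpha>))"
      unfolding c(2) using cA KA[OF x] by (intro finsum_rdistr finite_Arr) auto
    also have "\<dots> = (\<Oplus>\<alpha>\<in>Arr. \<zero>)"
    proof (rule finsum_cong'[OF refl])
      fix \<alpha> assume \<alpha>: "\<alpha> \<in> Arr"
      have xc: "x \<otimes> c \<alpha> \<in> carrier ?K" using K.act_closed[OF x cA[OF \<alpha>]] by (simp add: act)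
      have "x \<otimes> (c \<alpha> \<otimes> arr \<alpha>) = (x \<otimes> c \<alpha>) \<otimes> (e (src \<alpha>) \<otimes> arr \<alpha>)"
        using KA[OF x] cA[OF \<alpha>] \<alpha> by (simp add: e_arr m_assoc)
      also have "\<dots> = (x \<otimes> c \<alpha> \<otimes> e (src \<alpha>)) \<otimes> arr \<alpha>"
        using KA[OF xc] src(1)[OF \<alpha>] \<alpha> by (simp add: m_assoc[of "x \<otimes> c \<alpha>"])
      also have "\<dots> = \<zero>" using Ke[OF xc src(1)[OF \<alpha>] src(2)[OF \<alpha>]] \<alpha> by simp
      finally show "x \<otimes> (c \<alpha> \<otimes> arr \<alpha>) = \<zero>" .
    qed simp
    finally show ?thesis by simp
  qed
  have "\<chi> k (a \<ominus> \<chi> k a \<odot> \<one>) = 0" using a by (simp add: char_minus[OF k] char_scalar[OF k])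
  from nil[OF _ this] have "x \<otimes> (a \<ominus> \<chi> k a \<odot> \<one>) = \<zero>" using a by simp
  then have 0: "x \<otimes> a \<ominus> x \<otimes> (\<chi> k a \<odot> \<one>) = \<zero>"
    using KA[OF x] a by (simp add: minus_eq r_distr r_minus)
  show ?thesis
    by (rule eq_of_minus_eq_zero[OF abelian_group_axioms _ _ 0]) (use KA[OF x] a in simp_all)
qed

text \<open>By \<open>kernel_act\<close> the algebra acts on \<open>ker f\<close> through the
  character of \<open>S_k\<close>, so every basis over \<open>K\<close> gives an isomorphism, and
  \<open>m\<close> is the dimension of \<open>ker f\<close>. Conversely, \<open>e_i\<close> with
  \<open>i \<noteq> k\<close> annihilates every power of \<open>S_k\<close>.\<close>

lemma kernel_at_k_iff:
  "kernel_at_k \<longleftrightarrow> (\<exists>m::nat. mod_iso A (mod_kernel (proj k) incoming inmap) (mod_bigsum {..<m} (\<lambda>_. simple)))"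
proof
  let ?K = "mod_kernel (proj k) incoming inmap"
  note Kr = fd_right_module[OF kernel_fd]
  interpret K: right_module A ?K by (rule Kr)
  have act: "act ?K x a = x \<otimes> a" and Kz: "\<zero>\<^bsub>?K\<^esub> = \<zero>" for x a by (simp_all add: mod_kernel_def)
  assume ker: kernel_at_k
  \<comment> \<open>A spanning set of least cardinality serves as basis.\<close>
  define P where "P = (\<lambda>B. finite B \<and> B \<subseteq> carrier ?K \<and> carrier ?K \<subseteq> kspan A ?K B)"
  have "\<exists>B. P B" using kernel_fd unfolding fd_module_iff P_def by blast
  then obtain B where B: "P B" and min: "\<And>B'. P B' \<Longrightarrow> card B \<le> card B'"
    using ex_has_least_nat[of P _ card] by blast
  have fB: "finite B" and BK: "B \<subseteq> carrier ?K" and span: "carrier ?K \<subseteq> kspan A ?K B"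
    using B by (auto simp: P_def)
  obtain b where b: "bij_betw b {..<card B} B"
    using ex_bij_betw_nat_finite[OF fB] by (auto simp: atLeast0LessThan)
  let ?m = "card B"
  let ?N = "mod_bigsum {..<?m} (\<lambda>_. simple)"
  let ?f = "\<lambda>c. \<Oplus>\<^bsub>?K\<^esub>j\<in>{..<?m}. act ?K (b j) (c j \<odot> \<one>)"
  have bK: "b j \<in> carrier ?K" if "j < ?m" for j using bij_betwE[OF b] BK that by auto
  have cl: "act ?K (b j) (c \<odot> \<one>) \<in> carrier ?K" if "j < ?m" for j c by (rule K.act_closed[OF bK[OF that] scalar_closed])
  have f: "?f \<in> mod_hom A ?N ?K"
  proof (rule mod_homI)
    fix c d assume "c \<in> carrier ?N" "d \<in> carrier ?N"
    have "?f (c \<oplus>\<^bsub>?N\<^esub> d) = (\<Oplus>\<^bsub>?K\<^esub>j\<in>{..<?m}. act ?K (b j) (c j \<odot> \<one>) \<oplus>\<^bsub>?K\<^esub> act ?K (b j) (d j \<odot> \<one>))"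
      using cl bK by (intro K.M.finsum_cong') (auto simp: scalar_add K.act_add_right)
    also have "\<dots> = ?f c \<oplus>\<^bsub>?K\<^esub> ?f d" using cl by (intro K.M.finsum_addf) auto
    finally show "?f (c \<oplus>\<^bsub>?N\<^esub> d) = ?f c \<oplus>\<^bsub>?K\<^esub> ?f d" .
  next
    fix c a assume a: "a \<in> carrier A"
    have "act ?K (b j) ((c j * \<chi> k a) \<odot> \<one>) = act ?K (act ?K (b j) (c j \<odot> \<one>)) a" if "j < ?m" for j
      using kernel_act[OF ker cl[OF that] a] bK[OF that]
      by (simp add: scalar_mult K.act_mult) (simp add: act)
    then have "?f (act ?N c a) = (\<Oplus>\<^bsub>?K\<^esub>j\<in>{..<?m}. act ?K (act ?K (b j) (c j \<odot> \<one>)) a)"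
      using cl a by (intro K.M.finsum_cong') (auto intro!: K.act_closed[OF cl])
    also have "\<dots> = act ?K (?f c) a" using cl a by (intro K.act_finsum_left[symmetric]) auto
    finally show "?f (act ?N c a) = act ?K (?f c) a" .
  qed (use cl in \<open>auto intro!: K.M.finsum_closed\<close>)
  note Nr = right_module_mod_bigsum[OF ring_axioms, of "{..<?m}" "\<lambda>_. simple", OF right_module_simple]
  interpret N: right_module A ?N by (rule Nr)
  \<comment> \<open>A relation with nonzero coefficient at \<open>b j\<close> would put
    \<open>b j\<close> into the span of the remaining vectors, which would then be a smaller
    spanning set.\<close>
  have indep: "c j = 0" if c: "?f c = \<zero>\<^bsub>?K\<^esub>" and j: "j < ?m" for c j
  proof (rule ccontr)
    assume cj: "c j \<noteq> 0"
    let ?B = "B - {b j}"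
    have B'K: "?B \<subseteq> carrier ?K" using BK by blast
    let ?s = "\<Oplus>\<^bsub>?K\<^esub>i\<in>{..<?m} - {j}. act ?K (b i) (c i \<odot> \<one>)"
    have "?s \<in> kspan A ?K ?B"
    proof (rule kspan_finsum[OF Kr _ B'K])
      fix i assume i: "i \<in> {..<?m} - {j}"
      then have "b i \<noteq> b j" using b j by (auto simp: bij_betw_def inj_on_def)
      then have "b i \<in> ?B" using i bij_betwE[OF b] by auto
      then show "act ?K (b i) (c i \<odot> \<one>) \<in> kspan A ?K ?B"
        by (intro kspan_scale[OF Kr B'K] kspan_superset[OF Kr B'K])
    qed simp
    moreover have sK: "?s \<in> carrier ?K" using cl by (intro K.M.finsum_closed) auto
    moreover have "act ?K (b j) (c j \<odot> \<one>) \<oplus>\<^bsub>?K\<^esub> ?s = \<zero>\<^bsub>?K\<^esub>"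
    proof -
      have "?f c = (\<Oplus>\<^bsub>?K\<^esub>i\<in>insert j ({..<?m} - {j}). act ?K (b i) (c i \<odot> \<one>))"
        using j by (simp add: insert_absorb)
      also have "\<dots> = act ?K (b j) (c j \<odot> \<one>) \<oplus>\<^bsub>?K\<^esub> ?s"
        using cl j by (intro K.M.finsum_insert) auto
      finally show ?thesis using c by simp
    qed
    then have "act ?K (b j) (c j \<odot> \<one>) = \<ominus>\<^bsub>?K\<^esub> ?s"
      using K.M.minus_equality[OF _ sK cl[OF j]] by simp
    ultimately have "act ?K (b j) (c j \<odot> \<one>) \<in> kspan A ?K ?B" using kspan_inv[OF Kr B'K] by simp
    from kspan_scale[OF Kr B'K this, of "inverse (c j)"]
    have "act ?K (b j) ((c j * inverse (c j)) \<odot> \<one>) \<in> kspan A ?K ?B"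
      unfolding scalar_mult using bK[OF j] by (simp add: K.act_mult)
    then have "b j \<in> kspan A ?K ?B" using cj K.act_one[OF bK[OF j]] by simp
    then have "B \<subseteq> kspan A ?K ?B" using kspan_superset[OF Kr B'K] by blast
    then have "kspan A ?K B \<subseteq> kspan A ?K ?B"
      by (intro kspan_least[OF Kr] kspan.zero kspan_add[OF Kr B'K] kspan_scale[OF Kr B'K])
    then have "P ?B" unfolding P_def using fB B'K span by blast
    from min[OF this] have "card B \<le> card ?B" .
    moreover have "b j \<in> B" using bij_betwE[OF b] j by auto
    ultimately show False using card_Diff1_less[OF fB] by (metis linorder_not_less)
  qed
  have "inj_on ?f (carrier ?N)"
  proof (rule inj_onI)
    fix c d assume cd: "c \<in> carrier ?N" "d \<in> carrier ?N" "?f c = ?f d"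
    have "?f (c \<ominus>\<^bsub>?N\<^esub> d) = ?f c \<ominus>\<^bsub>?K\<^esub> ?f d"
      by (rule mod_hom_diff[OF N.M.abelian_group_axioms K.M.abelian_group_axioms f cd(1,2)])
    also have "\<dots> = \<zero>\<^bsub>?K\<^esub>"
      unfolding cd(3) a_minus_def by (rule K.M.r_neg[OF mod_hom_closed[OF f cd(2)]])
    finally have *: "?f (c \<ominus>\<^bsub>?N\<^esub> d) = \<zero>\<^bsub>?K\<^esub>" .
    have mem: "c \<ominus>\<^bsub>?N\<^esub> d \<in> carrier ?N"
      unfolding a_minus_def by (rule N.M.a_closed[OF cd(1) N.M.a_inv_closed[OF cd(2)]])
    have "c \<ominus>\<^bsub>?N\<^esub> d = \<zero>\<^bsub>?N\<^esub>"
    proof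
      fix j show "(c \<ominus>\<^bsub>?N\<^esub> d) j = \<zero>\<^bsub>?N\<^esub> j"
        using indep[OF *, of j] mem by (cases "j < ?m") (auto simp: PiE_iff extensional_def)
    qed
    then show "c = d" by (rule eq_of_minus_eq_zero[OF N.M.abelian_group_axioms cd(1,2)])
  qed
  moreover have "?f ` carrier ?N = carrier ?K"
  proof
    show "?f ` carrier ?N \<subseteq> carrier ?K" using mod_hom_closed[OF f] by blast
    show "carrier ?K \<subseteq> ?f ` carrier ?N"
    proof
      fix x assume "x \<in> carrier ?K"
      then obtain c where c: "x = (\<Oplus>\<^bsub>?K\<^esub>v\<in>B. act ?K v (c v \<odot> \<one>))"
        using span kspan_iff_finsum[OF Kr fB BK] by blast
      have "(\<Oplus>\<^bsub>?K\<^esub>v\<in>b ` {..<?m}. act ?K v (c v \<odot> \<one>)) = (\<Oplus>\<^bsub>?K\<^esub>j\<in>{..<?m}. act ?K (b j) (c (b j) \<odot> \<one>))"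
        using b by (intro K.M.finsum_reindex) (auto simp: bij_betw_def K.act_closed subsetD[OF BK])
      moreover have "\<dots> = ?f (\<lambda>j\<in>{..<?m}. c (b j))"
        using cl by (intro K.M.finsum_cong') auto
      ultimately have "x = ?f (\<lambda>j\<in>{..<?m}. c (b j))" using c b by (simp add: bij_betw_def)
      moreover have "(\<lambda>j\<in>{..<?m}. c (b j)) \<in> carrier ?N" by simp
      from imageI[OF this, of ?f] have "?f (\<lambda>j\<in>{..<?m}. c (b j)) \<in> ?f ` carrier ?N" .
      ultimately show "x \<in> ?f ` carrier ?N" by (simp only:)
    qed
  qed
  ultimately have "mod_iso A ?N ?K" unfolding mod_iso_def using f by (intro bexI[of _ ?f]) (auto simp: bij_betw_def)
  then show "\<exists>m::nat. mod_iso A ?K (mod_bigsum {..<m} (\<lambda>_. simple))"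
    using mod_iso_sym[OF _ Nr] by blast
next
  let ?K = "mod_kernel (proj k) incoming inmap"
  interpret K: right_module A ?K by (rule fd_right_module[OF kernel_fd])
  assume "\<exists>m::nat. mod_iso A ?K (mod_bigsum {..<m} (\<lambda>_. simple))"
  then obtain m :: nat and g where g: "g \<in> mod_hom A ?K (mod_bigsum {..<m} (\<lambda>_. simple))"
    and bij: "bij_betw g (carrier ?K) (carrier (mod_bigsum {..<m} (\<lambda>_. simple)))"
    unfolding mod_iso_def by blast
  note Nr = right_module_mod_bigsum[OF ring_axioms, of "{..<m}" "\<lambda>_. simple", OF right_module_simple]
  show kernel_at_k
    unfolding kernel_at_k_def
  proof (intro ballI impI)
    fix x i assume x: "x \<in> carrier (proj k)" "inmap x = \<zero>\<^bsub>incoming\<^esub>" and i: "i \<in> V - {k}"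
    have xK: "x \<in> carrier ?K" using x by (simp add: mod_kernel_def)
    have ei: "e i \<in> carrier A" using i by simp
    have "g (act ?K x (e i)) = act (mod_bigsum {..<m} (\<lambda>_. simple)) (g x) (e i)" by (rule mod_hom_act[OF g xK ei])
    also have "\<dots> = \<zero>\<^bsub>mod_bigsum {..<m} (\<lambda>_. simple)\<^esub>" using i k by (auto simp: char_e intro!: restrict_ext)
    also have "\<dots> = g \<zero>\<^bsub>?K\<^esub>"
      by (rule mod_hom_zero[OF K.M.abelian_group_axioms right_module_group[OF Nr] g, symmetric])
    finally have "act ?K x (e i) = \<zero>\<^bsub>?K\<^esub>"
      by (rule inj_onD[OF bij_betw_imp_inj_on[OF bij] _ K.act_closed[OF xK ei] K.M.zero_closed])
    then show "x \<otimes> e i = \<zero>" by (simp add: mod_kernel_def)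
  qed
qed

text \<open>The module is the cokernel of the differential, carried by lists: a representative is
  chosen in each coset of the boundaries and embedded into lists, and the structure is transported
  along the resulting map \<open>q\<close>, whose fibres are exactly the cosets.\<close>

lemma Tk_quasi_iso_stalk:
  assumes inj: "inj_on inmap (carrier (proj k))"
  shows "\<exists>(M :: ('r, 'k list) rmodule) s. fd_module A M \<and> quasi_iso A Tk (stalk M) s"
proof -
  let ?T = "obj Tk 0" and ?B = "boundaries Tk 0"
  note Tb = bounded_Tk
  interpret T: right_module A ?T by (rule complex_right_module[OF Tb])
  \<comment> \<open>The choice depends only on the coset of \<open>x\<close>, because elements of
    one coset satisfy the same defining condition; \<open>c_eq\<close> makes this precise.\<close>
  let ?c = "\<lambda>x. SOME y. y \<in> carrier ?T \<and> x \<ominus>\<^bsub>?T\<^esub> y \<in> ?B"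
  have refl: "x \<ominus>\<^bsub>?T\<^esub> x \<in> ?B" if "x \<in> carrier ?T" for x
    using that boundaries_zero[OF Tb, of 0] by (simp add: a_minus_def T.M.r_neg)
  have c: "?c x \<in> carrier ?T" "x \<ominus>\<^bsub>?T\<^esub> ?c x \<in> ?B" if "x \<in> carrier ?T" for x
    using someI[of "\<lambda>y. y \<in> carrier ?T \<and> x \<ominus>\<^bsub>?T\<^esub> y \<in> ?B" x] refl that by auto
  have c_eq: "?c x = ?c y" if "x \<in> carrier ?T" "y \<in> carrier ?T" "x \<ominus>\<^bsub>?T\<^esub> y \<in> ?B" for x y
  proof -
    have "(z \<in> carrier ?T \<and> x \<ominus>\<^bsub>?T\<^esub> z \<in> ?B) = (z \<in> carrier ?T \<and> y \<ominus>\<^bsub>?T\<^esub> z \<in> ?B)" for z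
      using coboundary_trans[OF Tb that(3)] coboundary_trans[OF Tb coboundary_sym[OF Tb that(3)]] that by blast
    then show ?thesis by presburger
  qed
  define q where "q = (\<lambda>x. list_embedding A ?T (?c x))"
  have q_iff: "q x = q y \<longleftrightarrow> x \<ominus>\<^bsub>?T\<^esub> y \<in> ?B" if xy: "x \<in> carrier ?T" "y \<in> carrier ?T" for x y
  proof
    assume "q x = q y"
    then have "?c x = ?c y" unfolding q_def
      by (rule inj_onD[OF inj_on_list_embedding[OF complex_fd[OF Tb]] _ c(1)[OF xy(1)] c(1)[OF xy(2)]])
    then have "x \<ominus>\<^bsub>?T\<^esub> ?c y \<in> ?B" using c(2)[OF xy(1)] by simp
    from coboundary_trans[OF Tb this coboundary_sym[OF Tb c(2)[OF xy(2)] xy(2) c(1)[OF xy(2)]] xy(1) c(1)[OF xy(2)] xy(2)]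
    show "x \<ominus>\<^bsub>?T\<^esub> y \<in> ?B" .
  next
    assume "x \<ominus>\<^bsub>?T\<^esub> y \<in> ?B"
    then show "q x = q y" unfolding q_def using c_eq[OF xy] by simp
  qed
  let ?M = "image_module q ?T"
  have Bact: "act ?T u a \<in> ?B" if "u \<in> ?B" "a \<in> carrier A" for u a
  proof -
    obtain v where v: "v \<in> carrier (obj Tk (0 - 1))" "u = diff Tk (0 - 1) v"
      using \<open>u \<in> ?B\<close> by (auto simp: boundaries_def)
    show ?thesis
      by (rule boundariesI[OF Tb right_module.act_closed[OF complex_right_module[OF Tb] v(1) that(2)]])
        (use v that(2) mod_hom_act[OF complex_diff'[OF Tb] v(1) that(2)] in simp)
  qed
  have "q (x \<oplus>\<^bsub>?T\<^esub> y) = q (x' \<oplus>\<^bsub>?T\<^esub> y')"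
    if "x \<in> carrier ?T" "x' \<in> carrier ?T" "y \<in> carrier ?T" "y' \<in> carrier ?T" "q x = q x'" "q y = q y'" for x x' y y'
  proof -
    have "(x \<ominus>\<^bsub>?T\<^esub> x') \<oplus>\<^bsub>?T\<^esub> (y \<ominus>\<^bsub>?T\<^esub> y') \<in> ?B"
      using that by (intro boundaries_add[OF Tb]) (simp_all add: q_iff)
    also have "(x \<ominus>\<^bsub>?T\<^esub> x') \<oplus>\<^bsub>?T\<^esub> (y \<ominus>\<^bsub>?T\<^esub> y') = (x \<oplus>\<^bsub>?T\<^esub> y) \<ominus>\<^bsub>?T\<^esub> (x' \<oplus>\<^bsub>?T\<^esub> y')"
      using that by (simp add: a_minus_def T.M.minus_add T.M.a_ac)
    finally show ?thesis using that by (simp add: q_iff)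
  qed
  moreover have "q (act ?T x a) = q (act ?T x' a)"
    if "x \<in> carrier ?T" "x' \<in> carrier ?T" "q x = q x'" "a \<in> carrier A" for x x' a
  proof -
    have "act ?T (x \<ominus>\<^bsub>?T\<^esub> x') a \<in> ?B" using that by (intro Bact) (simp_all add: q_iff)
    then show ?thesis using that
      by (simp add: q_iff T.act_closed a_minus_def T.act_add_left T.act_inv_left)
  qed
  ultimately have Mr: "right_module A ?M" and q: "q \<in> mod_hom A ?T ?M"
    using image_module_hom[OF T.right_module_axioms, of q] by blast+
  have Mc: "carrier ?M = q ` carrier ?T" and Mz: "\<zero>\<^bsub>?M\<^esub> = q \<zero>\<^bsub>?T\<^esub>" by (simp_all add: image_module_def)
  have Md: "fd_module A ?M" by (rule fd_image[OF complex_fd[OF Tb] Mr q Mc[symmetric]])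
  note Sb = bounded_stalk[OF Md]
  interpret M: right_module A ?M by (rule Mr)
  let ?s = "\<lambda>(n::int) x. if n = 0 then q x else \<zero>\<^bsub>?M\<^esub>"
  have Sobj: "obj (stalk ?M) n = (if n = 0 then ?M else zero_submodule ?M)" for n by (simp add: stalk_obj)
  have Sd: "diff (stalk ?M) n x = \<zero>\<^bsub>?M\<^esub>" for n x by (simp add: stalk_def)
  have qB: "q x = \<zero>\<^bsub>?M\<^esub> \<longleftrightarrow> x \<in> ?B" if "x \<in> carrier ?T" for x
    unfolding Mz using q_iff[OF that T.M.zero_closed] minus_zero_right[OF T.M.abelian_group_axioms that] by simp
  have s: "chain_map A Tk (stalk ?M) ?s"
    unfolding chain_map_def
  proof (intro conjI allI ballI)
    show "?s n \<in> mod_hom A (obj Tk n) (obj (stalk ?M) n)" for n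
    proof (cases "n = 0")
      case False
      then show ?thesis
        using right_module.zero_hom[OF right_module_zero_submodule[OF Mr], of "obj Tk n"] by (simp add: Sobj)
    qed (simp add: Sobj q)
    fix n x assume x: "x \<in> carrier (obj Tk n)"
    have "?s (n + 1) (diff Tk n x) = \<zero>\<^bsub>?M\<^esub>"
    proof (cases "n = -1")
      case True
      have m: "diff Tk n x \<in> ?B"
        by (rule boundariesI[OF Tb, of x]) (use x True in simp_all)
      show ?thesis using iffD2[OF qB[OF subsetD[OF boundaries_subset[OF Tb] m]] m] True by simp
    qed simp
    then show "?s (n + 1) (diff Tk n x) = diff (stalk ?M) n (?s n x)" by (simp add: Sd)
  qed
  have "quasi_iso A Tk (stalk ?M) ?s"
  proof (rule quasi_isoI[OF Tb Sb s])
    fix n x assume x: "x \<in> cycles Tk n" "?s n x \<in> boundaries (stalk ?M) n"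
    note xT = cycles_carrier[OF Tb x(1)]
    show "x \<in> boundaries Tk n"
    proof (cases "n = 0")
      case True
      have "q x = \<zero>\<^bsub>?M\<^esub>" using x(2) True by (auto simp: boundaries_def Sd)
      then show ?thesis using qB xT True by simp
    next
      case False
      have "x = \<zero>\<^bsub>obj Tk n\<^esub>"
      proof (cases "n = -1")
        case True
        obtain y where y: "y \<in> carrier (proj k)" "x = ((y, \<zero>\<^bsub>incoming\<^esub>), \<zero>\<^bsub>others\<^esub>)"
          using xT True by (auto simp: Tk_obj Lk_obj)
        have "inmap y = \<zero>\<^bsub>incoming\<^esub>"
          using x(1) True unfolding y(2) by (simp add: cycles_def Tk_diff Tk_obj Lk_obj)
        \<comment> \<open>Here injectivity enters: \<open>T\<close> has no cohomology in degree
          -1.\<close>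
        then have "y = \<zero>" using inj y(1) unfolding inmap_inj_iff by blast
        then show ?thesis using y(2) by (simp add: Tk_obj Lk_obj)
      next
        case F: False
        then show ?thesis using xT Tk_trivial[OF F False] by simp
      qed
      then show ?thesis using boundaries_zero[OF Tb, of n] by simp
    qed
  next
    fix n y assume y: "y \<in> cycles (stalk ?M) n"
    note yM = cycles_carrier[OF Sb y]
    have "\<exists>x\<in>cycles Tk n. y = ?s n x"
    proof (cases "n = 0")
      case True
      then obtain x where x: "x \<in> carrier ?T" "y = q x" using yM by (auto simp: Sobj Mc)
      have "diff Tk 0 x = \<zero>\<^bsub>obj Tk 1\<^esub>"
        using mod_hom_closed[OF complex_diff[OF Tb] x(1)] Tk_trivial[of 1] by simp
      then have "x \<in> cycles Tk 0" using x(1) by (simp add: cycles_def)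
      then show ?thesis using x(2) True by auto
    next
      case False
      then show ?thesis using yM boundaries_cycles[OF Tb boundaries_zero[OF Tb, of n]]
        by (intro bexI[of _ "\<zero>\<^bsub>obj Tk n\<^esub>"]) (simp_all add: Sobj)
    qed
    then obtain x where x: "x \<in> cycles Tk n" "y = ?s n x" by blast
    interpret S: abelian_group "obj (stalk ?M) n" by (rule complex_group[OF Sb])
    have "y \<ominus>\<^bsub>obj (stalk ?M) n\<^esub> y = \<zero>\<^bsub>obj (stalk ?M) n\<^esub>" using yM by (simp add: a_minus_def S.r_neg)
    then show "\<exists>x\<in>cycles Tk n. y \<ominus>\<^bsub>obj (stalk ?M) n\<^esub> ?s n x \<in> boundaries (stalk ?M) n"
      using x boundaries_zero[OF Sb, of n] by (intro bexI[OF _ x(1)]) (simp only:)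
  qed
  then show ?thesis using Md by blast
qed

text \<open>If \<open>f\<close> is injective, its kernel is zero, so \<open>T\<close> is tilting,
  and a copy of \<open>T\<close> by lists is the tilting complex isomorphic to the cokernel.
  Conversely, the stalk of a module is exact in degree -1, a property that passes along derived
  isomorphisms to \<open>T\<close>, where it says that \<open>ker f\<close> is zero.\<close>

lemma tilting_module_Tk_iff:
  "(\<exists>M. tilting_module A M \<and> derived_iso A Tk (stalk M)) \<longleftrightarrow> inj_on inmap (carrier (proj k))"
proof
  assume inj: "inj_on inmap (carrier (proj k))"
  then have kernel_at_k
    unfolding kernel_at_k_def inmap_inj_iff by auto
  note til = tilting_complex_Tk[OF this]
  obtain M :: "('r, 'k list) rmodule" and s where M: "fd_module A M" and s: "quasi_iso A Tk (stalk M) s"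
    using Tk_quasi_iso_stalk[OF inj] by blast
  let ?T = "complex_copy A Tk"
  note T = complex_copy[OF bounded_Tk] and Mb = bounded_stalk[OF M]
  have "tilting_complex A ?T" by (rule tilting_complex_chain_iso[OF T til])
  moreover obtain c where c: "chain_iso A ?T Tk c" by (rule chain_isoE[OF bounded_Tk T(2)])
  have "derived_iso A (stalk M) ?T"
    by (rule derived_iso_sym[OF quasi_iso_derived_iso[OF T(1) Mb
          quasi_iso_comp[OF T(1) bounded_Tk Mb s chain_iso_quasi_iso[OF T(1) bounded_Tk c]]]])
  ultimately have "tilting_module A M" unfolding tilting_module_def using M by blast
  moreover have "derived_iso A Tk (stalk M)" by (rule quasi_iso_derived_iso[OF bounded_Tk Mb s])
  ultimately show "\<exists>M. tilting_module A M \<and> derived_iso A Tk (stalk M)" by blast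
next
  assume "\<exists>M. tilting_module A M \<and> derived_iso A Tk (stalk M)"
  then obtain M :: "('r, 'k list) rmodule" where M: "fd_module A M" and iso: "derived_iso A Tk (stalk M)"
    unfolding tilting_module_def by blast
  note Mb = bounded_stalk[OF M]
  have "cycles (stalk M) (-1) \<subseteq> boundaries (stalk M) (-1)"
    using boundaries_zero[OF Mb, of "-1"] by (auto simp: cycles_def stalk_obj)
  from derived_iso_exact[OF bounded_Tk Mb iso this]
  have ex: "cycles Tk (-1) \<subseteq> boundaries Tk (-1)" .
  have B: "boundaries Tk (-1) = {\<zero>\<^bsub>obj Tk (-1)\<^esub>}"
    using mod_hom_zero[OF complex_group[OF bounded_Tk] complex_group[OF bounded_Tk] complex_diff'[OF bounded_Tk, of "-1"]]
      Tk_trivial[of "-2"] by (simp add: boundaries_def)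
  show "inj_on inmap (carrier (proj k))"
    unfolding inmap_inj_iff
  proof (intro ballI impI)
    fix x assume x: "x \<in> carrier (proj k)" "inmap x = \<zero>\<^bsub>incoming\<^esub>"
    have "((x, \<zero>\<^bsub>incoming\<^esub>), \<zero>\<^bsub>others\<^esub>) \<in> cycles Tk (-1)"
      using x by (simp add: cycles_def Tk_obj Lk_obj Tk_diff)
    then have "((x, \<zero>\<^bsub>incoming\<^esub>), \<zero>\<^bsub>others\<^esub>) = \<zero>\<^bsub>obj Tk (-1)\<^esub>" using ex B by blast
    then show "x = \<zero>" by (simp add: Tk_obj Lk_obj)
  qed
qed

end

section \<open>Bound quiver algebras\<close>

text \<open>Transfers the ring axioms from the quotient ring to the record that extends it by a
  scalar multiplication.\<close>

lemma ring_fields_cong: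
  assumes "ring R" "carrier S = carrier R" "mult S = mult R" "one S = one R" "zero S = zero R" "add S = add R"
  shows "ring S"
proof -
  interpret R: ring R by fact
  show ?thesis
  proof (rule ringI)
    show "abelian_group S"
    proof (rule abelian_groupI)
      show "\<exists>y\<in>carrier S. y \<oplus>\<^bsub>S\<^esub> x = \<zero>\<^bsub>S\<^esub>" if "x \<in> carrier S" for x
        using that R.l_neg[of x] R.a_inv_closed[of x] unfolding assms(2-6) by blast
      show "x \<oplus>\<^bsub>S\<^esub> y = y \<oplus>\<^bsub>S\<^esub> x" if "x \<in> carrier S" "y \<in> carrier S" for x y
        using that unfolding assms(2-6) by (rule R.a_comm)
    qed (simp_all add: assms(2-6) R.a_assoc)
    show "Group.monoid S"
      by (rule monoidI) (simp_all add: assms(2-6) R.m_assoc)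
  qed (simp_all add: assms(2-6) R.l_distr R.r_distr)
qed

locale bound_quiver = fin_digraph Q for Q :: "('v, 'a) pre_digraph" +
  fixes I :: "(('v, 'a) path \<Rightarrow> 'k::field) set"
  assumes admissible: "admissible_ideal Q I"
begin

abbreviation PA :: "(('v, 'a) path \<Rightarrow> 'k) ring" where "PA \<equiv> path_algebra Q"
abbreviation pend :: "'v \<Rightarrow> 'a list \<Rightarrow> 'v" where "pend \<equiv> path_end Q"

section \<open>Paths\<close>

lemma pend_simps [simp]: "pend u [] = u" "pend u (a # p) = pend (head Q a) p"
  by simp_all

lemma pend_append: "pend u (p @ q) = pend (pend u p) q"
  by (induction p arbitrary: u) simp_all

lemma path_iff: "(u, p) \<in> paths Q \<longleftrightarrow> awalk u p (pend u p)"
proof -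
  have "awalk u p (pend u p)" if "awalk u p v" for v
  proof -
    have "pend u p = v" using that by (rule awalkE')
    then show ?thesis using that by simp
  qed
  then show ?thesis unfolding paths_def by blast
qed

lemma path_append: "(u, p @ q) \<in> paths Q \<longleftrightarrow> (u, p) \<in> paths Q \<and> (pend u p, q) \<in> paths Q"
  unfolding path_iff pend_append by (rule awalk_append_iff)

lemma path_Nil: "(u, []) \<in> paths Q \<longleftrightarrow> u \<in> verts Q"
  unfolding path_iff by (simp add: awalk_Nil_iff)

lemma path_single: "(u, [a]) \<in> paths Q \<longleftrightarrow> a \<in> arcs Q \<and> u = tail Q a"
  unfolding path_iff by (auto simp: awalk_def)

lemma path_start: "(u, p) \<in> paths Q \<Longrightarrow> u \<in> verts Q"
  using path_append[of u "[]" p] path_Nil by simp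

lemma path_end_vert: "(u, p) \<in> paths Q \<Longrightarrow> pend u p \<in> verts Q"
  using path_append[of u p "[]"] path_Nil by simp

section \<open>The path algebra as a ring\<close>

lemma PA_carrier: "x \<in> carrier PA \<longleftrightarrow> finite {w. x w \<noteq> 0} \<and> {w. x w \<noteq> 0} \<subseteq> paths Q"
  and PA_mult: "(x \<otimes>\<^bsub>PA\<^esub> y) (u, r) = (\<Sum>j\<le>length r. x (u, take j r) * y (pend u (take j r), drop j r))"
  and PA_one: "\<one>\<^bsub>PA\<^esub> (u, r) = (if u \<in> verts Q \<and> r = [] then 1 else 0)"
  and PA_zero: "\<zero>\<^bsub>PA\<^esub> = (\<lambda>w. 0)"
  and PA_add: "x \<oplus>\<^bsub>PA\<^esub> y = (\<lambda>w. x w + y w)"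
  by (simp_all add: path_algebra_def)

lemma PA_nonpath: "x \<in> carrier PA \<Longrightarrow> w \<notin> paths Q \<Longrightarrow> x w = 0"
  by (auto simp: PA_carrier)

text \<open>The support of a product consists of concatenations of composable paths from the two
  supports.\<close>

lemma PA_mult_closed:
  assumes x: "x \<in> carrier PA" and y: "y \<in> carrier PA"
  shows "x \<otimes>\<^bsub>PA\<^esub> y \<in> carrier PA"
proof -
  let ?S = "{(s, t). x s \<noteq> 0 \<and> y t \<noteq> 0 \<and> pend (fst s) (snd s) = fst t}"
  let ?h = "\<lambda>(s :: ('v, 'a) path, t :: ('v, 'a) path). (fst s, snd s @ snd t)"
  have "?S \<subseteq> {w. x w \<noteq> 0} \<times> {w. y w \<noteq> 0}" by auto
  then have "finite ?S" by (rule finite_subset) (use x y in \<open>simp add: PA_carrier\<close>)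
  then have fin: "finite (?h ` ?S)" by (rule finite_imageI)
  have sub: "{w. (x \<otimes>\<^bsub>PA\<^esub> y) w \<noteq> 0} \<subseteq> ?h ` ?S"
  proof
    fix w assume "w \<in> {w. (x \<otimes>\<^bsub>PA\<^esub> y) w \<noteq> 0}"
    then obtain u r where w: "w = (u, r)" "(x \<otimes>\<^bsub>PA\<^esub> y) (u, r) \<noteq> 0" by (cases w) auto
    then obtain j where "x (u, take j r) * y (pend u (take j r), drop j r) \<noteq> 0"
      unfolding PA_mult by (metis (mono_tags, lifting) sum.neutral)
    then show "w \<in> ?h ` ?S"
      using w(1) by (intro image_eqI[of _ _ "((u, take j r), (pend u (take j r), drop j r))"]) auto
  qed
  have "?h ` ?S \<subseteq> paths Q"
  proof
    fix w assume "w \<in> ?h ` ?S"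
    then obtain u p q where w: "w = (u, p @ q)" "x (u, p) \<noteq> 0" "y (pend u p, q) \<noteq> 0" by force
    then have "(u, p) \<in> paths Q" "(pend u p, q) \<in> paths Q" using x y PA_nonpath by blast+
    then show "w \<in> paths Q" using w(1) path_append by simp
  qed
  then show ?thesis using sub finite_subset[OF sub fin] by (auto simp: PA_carrier)
qed

text \<open>Both sides sum over all ways of cutting a path into three pieces; the two orders of
  summation are matched by reindexing a triangle.\<close>

lemma PA_mult_assoc: "(x \<otimes>\<^bsub>PA\<^esub> y) \<otimes>\<^bsub>PA\<^esub> z = x \<otimes>\<^bsub>PA\<^esub> (y \<otimes>\<^bsub>PA\<^esub> z)"
proof
  fix w :: "('v, 'a) path"
  show "((x \<otimes>\<^bsub>PA\<^esub> y) \<otimes>\<^bsub>PA\<^esub> z) w = (x \<otimes>\<^bsub>PA\<^esub> (y \<otimes>\<^bsub>PA\<^esub> z)) w"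
  proof (cases w)
    case (Pair u r)
    let ?n = "length r"
    \<comment> \<open>The contribution of the cuts after \<open>i\<close> and after
      \<open>i + l\<close> arrows.\<close>
    define f where "f = (\<lambda>i l. x (u, take i r) * y (pend u (take i r), take l (drop i r)) *
      z (pend u (take (i + l) r), drop (i + l) r))"
    have "((x \<otimes>\<^bsub>PA\<^esub> y) \<otimes>\<^bsub>PA\<^esub> z) (u, r) = (\<Sum>j\<le>?n. \<Sum>i\<le>j. f i (j - i))"
      unfolding PA_mult[of "x \<otimes>\<^bsub>PA\<^esub> y"]
    proof (rule sum.cong[OF refl])
      fix j assume j: "j \<in> {..?n}"
      have "(x \<otimes>\<^bsub>PA\<^esub> y) (u, take j r) = (\<Sum>i\<le>j. x (u, take i r) * y (pend u (take i r), take (j - i) (drop i r)))"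
        unfolding PA_mult using j by (intro sum.cong) (auto simp: min_def drop_take)
      then show "(x \<otimes>\<^bsub>PA\<^esub> y) (u, take j r) * z (pend u (take j r), drop j r) = (\<Sum>i\<le>j. f i (j - i))"
        by (simp add: f_def sum_distrib_right)
    qed
    also have "\<dots> = (\<Sum>(i, l)\<in>{(i, l). i + l \<le> ?n}. f i l)"
      by (rule sum.triangle_reindex_eq[symmetric])
    also have "{(i, l). i + l \<le> ?n} = Sigma {..?n} (\<lambda>i. {..?n - i})" by auto
    also have "(\<Sum>(i, l)\<in>Sigma {..?n} (\<lambda>i. {..?n - i}). f i l) = (\<Sum>i\<le>?n. \<Sum>l\<le>?n - i. f i l)"
      by (rule sum.Sigma[symmetric]) auto
    also have "\<dots> = (x \<otimes>\<^bsub>PA\<^esub> (y \<otimes>\<^bsub>PA\<^esub> z)) (u, r)"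
      unfolding PA_mult f_def
      by (intro sum.cong refl) (simp add: sum_distrib_left mult.assoc take_add pend_append add.commute)
    finally show ?thesis using Pair by simp
  qed
qed

lemma PA_one_closed: "\<one>\<^bsub>PA\<^esub> \<in> carrier PA"
proof -
  have eq: "{w. \<one>\<^bsub>PA\<^esub> w \<noteq> (0::'k)} = verts Q \<times> {[]}" by (auto simp: PA_one split: if_splits)
  show ?thesis unfolding PA_carrier eq by (auto simp: path_Nil)
qed

lemma PA_l_one: "x \<in> carrier PA \<Longrightarrow> \<one>\<^bsub>PA\<^esub> \<otimes>\<^bsub>PA\<^esub> x = x"
proof
  fix w :: "('v, 'a) path"
  assume x: "x \<in> carrier PA"
  obtain u r where w: "w = (u, r)" by (cases w)
  have "(\<one>\<^bsub>PA\<^esub> \<otimes>\<^bsub>PA\<^esub> x) (u, r) = (\<Sum>j\<le>length r. if j = 0 then (if u \<in> verts Q then x (u, r) else 0) else 0)"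
    unfolding PA_mult by (rule sum.cong) (auto simp: PA_one)
  also have "\<dots> = x (u, r)" using PA_nonpath[OF x, of "(u, r)"] path_start by auto
  finally show "(\<one>\<^bsub>PA\<^esub> \<otimes>\<^bsub>PA\<^esub> x) w = x w" by (simp add: w)
qed

lemma PA_r_one: "x \<in> carrier PA \<Longrightarrow> x \<otimes>\<^bsub>PA\<^esub> \<one>\<^bsub>PA\<^esub> = x"
proof
  fix w :: "('v, 'a) path"
  assume x: "x \<in> carrier PA"
  obtain u r where w: "w = (u, r)" by (cases w)
  have "(x \<otimes>\<^bsub>PA\<^esub> \<one>\<^bsub>PA\<^esub>) (u, r) = (\<Sum>j\<le>length r. if j = length r then (if pend u r \<in> verts Q then x (u, r) else 0) else 0)"
    unfolding PA_mult by (rule sum.cong) (auto simp: PA_one)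
  also have "\<dots> = x (u, r)" using PA_nonpath[OF x, of "(u, r)"] path_end_vert by auto
  finally show "(x \<otimes>\<^bsub>PA\<^esub> \<one>\<^bsub>PA\<^esub>) w = x w" by (simp add: w)
qed

lemma PA_add_closed:
  assumes "x \<in> carrier PA" "y \<in> carrier PA"
  shows "x \<oplus>\<^bsub>PA\<^esub> y \<in> carrier PA"
proof -
  have "{w. x w + y w \<noteq> 0} \<subseteq> {w. x w \<noteq> 0} \<union> {w. y w \<noteq> 0}" by auto
  then show ?thesis using assms unfolding PA_carrier PA_add
    by (meson finite_UnI finite_subset sup_least subset_trans)
qed

lemma PA_scale_closed: "x \<in> carrier PA \<Longrightarrow> (\<lambda>w. c * x w) \<in> carrier PA"
  unfolding PA_carrier by (auto elim!: finite_subset[rotated])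

lemma ring_PA: "ring PA"
proof (rule ringI)
  show "abelian_group PA"
  proof (rule abelian_groupI)
    show "\<exists>y\<in>carrier PA. y \<oplus>\<^bsub>PA\<^esub> x = \<zero>\<^bsub>PA\<^esub>" if "x \<in> carrier PA" for x
      by (rule bexI[OF _ PA_scale_closed[OF that, of "-1"]]) (simp add: PA_add PA_zero)
    show "x \<oplus>\<^bsub>PA\<^esub> y \<in> carrier PA" if "x \<in> carrier PA" "y \<in> carrier PA" for x y
      using that by (rule PA_add_closed)
    show "\<zero>\<^bsub>PA\<^esub> \<in> carrier PA" by (simp add: PA_carrier PA_zero)
  qed (simp_all add: PA_add PA_zero algebra_simps)
  show "Group.monoid PA"
    by (rule monoidI) (simp_all add: PA_mult_closed PA_one_closed PA_mult_assoc PA_l_one PA_r_one)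
qed (auto simp: PA_add PA_mult fun_eq_iff sum.distrib algebra_simps)

interpretation PA: ring PA by (rule ring_PA)

lemma PA_scale_left: "(\<lambda>w. c * x w) \<otimes>\<^bsub>PA\<^esub> y = (\<lambda>w. c * (x \<otimes>\<^bsub>PA\<^esub> y) w)"
  and PA_scale_right: "x \<otimes>\<^bsub>PA\<^esub> (\<lambda>w. c * y w) = (\<lambda>w. c * (x \<otimes>\<^bsub>PA\<^esub> y) w)"
  by (auto simp: fun_eq_iff PA_mult sum_distrib_left mult.assoc mult.left_commute)

lemma path_elem_closed: "w \<in> paths Q \<Longrightarrow> path_elem w \<in> carrier PA"
  by (auto simp: PA_carrier path_elem_def)

text \<open>At most one cut of \<open>r\<close> leaves \<open>q\<close> as its second piece, so at
  most one term of the product is nonzero: the coefficient of \<open>x\<close> at what remains after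
  stripping \<open>q\<close>.\<close>

lemma mult_path_elem:
  "(x \<otimes>\<^bsub>PA\<^esub> path_elem (v, q)) (u, r) = (if \<exists>p. r = p @ q \<and> pend u p = v then x (u, take (length r - length q) r) else 0)"
proof (cases "\<exists>p. r = p @ q \<and> pend u p = v")
  case True
  then obtain p where p: "r = p @ q" "pend u p = v" by blast
  have "(x \<otimes>\<^bsub>PA\<^esub> path_elem (v, q)) (u, r) = (\<Sum>j\<le>length r. if j = length p then x (u, p) else 0)"
    unfolding PA_mult
  proof (rule sum.cong[OF refl])
    fix j assume j: "j \<in> {..length r}"
    have "j = length p" if "drop j r = q"
    proof -
      have "length r - j = length q" using that length_drop by metis
      then show ?thesis using j by (simp add: p(1))
    qed
    then show "x (u, take j r) * path_elem (v, q) (pend u (take j r), drop j r) = (if j = length p then x (u, p) else 0)"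
      using p by (auto simp: path_elem_def)
  qed
  also have "\<dots> = x (u, p)" by (simp add: p(1))
  finally show ?thesis using True p by simp
next
  case False
  have "x (u, take j r) * path_elem (v, q) (pend u (take j r), drop j r) = 0" for j
  proof (cases "pend u (take j r) = v \<and> drop j r = q")
    case True
    then have "r = take j r @ q \<and> pend u (take j r) = v" by (metis append_take_drop_id)
    then show ?thesis using False by blast
  qed (auto simp: path_elem_def)
  then have "(x \<otimes>\<^bsub>PA\<^esub> path_elem (v, q)) (u, r) = 0"
    unfolding PA_mult by (intro sum.neutral) simp
  then show ?thesis using False by (simp only: if_False)
qed

lemma path_elem_mult: "(path_elem (u, p) :: _ \<Rightarrow> 'k) \<otimes>\<^bsub>PA\<^esub> path_elem (v, q) =
    (if pend u p = v then path_elem (u, p @ q) else \<zero>\<^bsub>PA\<^esub>)"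
proof
  fix w :: "('v, 'a) path"
  obtain s r where w: "w = (s, r)" by (cases w)
  show "(path_elem (u, p) \<otimes>\<^bsub>PA\<^esub> path_elem (v, q)) w = ((if pend u p = v then path_elem (u, p @ q) else \<zero>\<^bsub>PA\<^esub>) w :: 'k)"
    unfolding w mult_path_elem by (auto simp: path_elem_def PA_zero)
qed

text \<open>The filtration by path length, described by coefficients. It replaces the powers of the
  arrow ideal in all computations; \<open>arrow_ideal_long\<close> and \<open>long_subset_I\<close>
  make the link with admissibility.\<close>

definition long :: "nat \<Rightarrow> (('v, 'a) path \<Rightarrow> 'k) set" where
  "long n = {x \<in> carrier PA. \<forall>u p. length p < n \<longrightarrow> x (u, p) = 0}"

lemma long_mult:
  assumes "x \<in> long 1" "y \<in> long n"
  shows "x \<otimes>\<^bsub>PA\<^esub> y \<in> long (Suc n)"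
proof -
  have "x (u, take j r) * y (pend u (take j r), drop j r) = 0" if "length r < Suc n" for u j r
  proof (cases "take j r = []")
    case True
    have "x (u, take j r) = 0" unfolding True using assms(1) by (simp add: long_def)
    then show ?thesis by simp
  next
    case False
    then have "length (drop j r) < n" using that by (cases r; cases j) auto
    then show ?thesis using assms(2) by (simp add: long_def)
  qed
  then have "(x \<otimes>\<^bsub>PA\<^esub> y) (u, r) = 0" if "length r < Suc n" for u r
    unfolding PA_mult using that by (intro sum.neutral) blast
  moreover have "x \<otimes>\<^bsub>PA\<^esub> y \<in> carrier PA" using assms by (auto simp: long_def intro: PA_mult_closed)
  ultimately show ?thesis by (simp add: long_def)
qed

section \<open>Admissibility in terms of path length\<close>

lemma I_ideal: "ideal I PA"
  using admissible by (simp add: admissible_ideal_def)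

interpretation I: ideal I PA by (rule I_ideal)

lemma ideal_prod_subset_right:
  assumes "ideal J PA" "L \<subseteq> carrier PA"
  shows "ideal_prod PA L J \<subseteq> J"
proof
  interpret J: ideal J PA by fact
  fix x assume "x \<in> ideal_prod PA L J"
  then show "x \<in> J" using assms(2) by induction (auto intro: J.I_l_closed)
qed

lemma arrow_elem_closed: "a \<in> arcs Q \<Longrightarrow> arrow_elem Q a \<in> carrier PA"
  by (simp add: arrow_elem_def path_elem_closed path_single)

lemma arrow_ideal_ideal: "ideal (arrow_ideal Q :: (_ \<Rightarrow> 'k) set) PA"
  unfolding arrow_ideal_def by (rule PA.genideal_ideal) (auto simp: arrow_elem_closed)

lemma arrow_ideal_long: "arrow_ideal Q \<subseteq> long 1"
proof -
  have "ideal (long 1) PA"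
  proof (rule idealI[OF ring_PA])
    show "subgroup (long 1) (add_monoid PA)"
    proof (rule PA.add.subgroupI)
      show "\<ominus>\<^bsub>PA\<^esub> x \<in> long 1" if x: "x \<in> long 1" for x
      proof -
        have xc: "x \<in> carrier PA" using x by (simp add: long_def)
        have "\<ominus>\<^bsub>PA\<^esub> x = (\<lambda>w. - 1 * x w)"
          by (rule PA.minus_equality[OF _ xc PA_scale_closed[OF xc]]) (simp add: PA_add PA_zero)
        then show ?thesis using x PA_scale_closed[OF xc, of "-1"] by (simp add: long_def)
      qed
      have "\<zero>\<^bsub>PA\<^esub> \<in> long 1" using PA.zero_closed by (simp add: long_def PA_zero)
      then show "long 1 \<noteq> {}" by blast
    qed (auto simp: long_def PA_add dest: PA_add_closed)
  qed (auto simp: long_def PA_mult_closed PA_mult)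
  moreover have "arrow_elem Q a \<in> long 1" if "a \<in> arcs Q" for a
    using arrow_elem_closed[OF that] by (auto simp: long_def arrow_elem_def path_elem_def)
  ultimately show ?thesis unfolding arrow_ideal_def by (intro PA.genideal_minimal) blast+
qed

lemma arrow_ideal_power_carrier: "arrow_ideal_power Q n \<subseteq> carrier PA"
proof (induction n)
  case (Suc n)
  interpret J: ideal "arrow_ideal Q" PA by (rule arrow_ideal_ideal)
  show ?case using ideal_prod_subset_right[OF arrow_ideal_ideal Suc] J.a_subset by auto
qed simp

text \<open>Elements of \<open>I\<close> have coefficient zero at all trivial paths; this makes the
  characters of the simple modules well defined on classes.\<close>

lemma I_long: "I \<subseteq> long 1"
proof -
  have "I \<subseteq> arrow_ideal_power Q (Suc (Suc 0))"
    using admissible by (simp add: admissible_ideal_def numeral_2_eq_2)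
  also have "\<dots> \<subseteq> arrow_ideal Q"
    using ideal_prod_subset_right[OF arrow_ideal_ideal arrow_ideal_power_carrier[of "Suc 0"]] by simp
  finally show ?thesis using arrow_ideal_long by blast
qed

text \<open>The powers are formed by multiplying with the arrow ideal from the right, so the
  induction splits off the last arrow.\<close>

lemma path_elem_arrow_ideal_power:
  "(u, p) \<in> paths Q \<Longrightarrow> (path_elem (u, p) :: _ \<Rightarrow> 'k) \<in> arrow_ideal_power Q (length p)"
proof (induction p rule: rev_induct)
  case Nil
  then show ?case by (simp add: path_elem_closed)
next
  case (snoc a p)
  have p: "(u, p) \<in> paths Q" "a \<in> arcs Q" "pend u p = tail Q a"
    using snoc.prems by (auto simp: path_append path_single)
  have "arrow_elem Q ` arcs Q \<subseteq> (arrow_ideal Q :: (_ \<Rightarrow> 'k) set)"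
    unfolding arrow_ideal_def by (rule PA.genideal_self) (auto simp: arrow_elem_closed)
  then have "arrow_elem Q a \<in> (arrow_ideal Q :: (_ \<Rightarrow> 'k) set)" using p(2) by blast
  from ideal_prod.prod[where R = PA, OF snoc.IH[OF p(1)] this]
  show ?case by (simp add: arrow_elem_def path_elem_mult p(3))
qed

text \<open>An element is the finite sum of its scaled paths. The step is required only for paths in
  the support of \<open>x\<close>, so that a bound on their length is available there.\<close>

lemma support_induct:
  assumes x: "x \<in> carrier PA" and 0: "P \<zero>\<^bsub>PA\<^esub>"
    and step: "\<And>y w c. y \<in> carrier PA \<Longrightarrow> P y \<Longrightarrow> w \<in> paths Q \<Longrightarrow> x w \<noteq> 0 \<Longrightarrow> P (y \<oplus>\<^bsub>PA\<^esub> (\<lambda>v. x w * path_elem w v))"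
  shows "P x"
proof -
  have "P (\<lambda>w. if w \<in> S then x w else 0) \<and> (\<lambda>w. if w \<in> S then x w else 0) \<in> carrier PA"
    if "finite S" "S \<subseteq> {w. x w \<noteq> 0}" for S
    using that
  proof (induction S)
    case empty
    then show ?case using 0 PA.zero_closed by (simp add: PA_zero)
  next
    case (insert w S)
    have w: "w \<in> paths Q" "x w \<noteq> 0" using insert.prems x by (auto simp: PA_carrier)
    have eq: "(\<lambda>v. if v \<in> insert w S then x v else 0) = (\<lambda>v. if v \<in> S then x v else 0) \<oplus>\<^bsub>PA\<^esub> (\<lambda>v. x w * path_elem w v)"
      using insert.hyps by (auto simp: PA_add path_elem_def fun_eq_iff)
    show ?case unfolding eq using insert step w PA_add_closed PA_scale_closed[OF path_elem_closed[OF w(1)]] by blast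
  qed
  from this[of "{w. x w \<noteq> 0}"] have "P (\<lambda>w. if w \<in> {w. x w \<noteq> 0} then x w else 0)" using x by (simp add: PA_carrier)
  moreover have "(\<lambda>w. if w \<in> {w. x w \<noteq> 0} then x w else 0) = x" by auto
  ultimately show ?thesis by simp
qed

lemma I_scale: "x \<in> I \<Longrightarrow> (\<lambda>w. c * x w) \<in> I"
  using I.I_l_closed[of x "\<lambda>w. c * \<one>\<^bsub>PA\<^esub> w"] PA_scale_closed[OF PA_one_closed, of c] I.a_subset
  by (auto simp: PA_scale_left PA_l_one subset_iff)

text \<open>A path of length at least \<open>m\<close> begins with a path of length
  \<open>m\<close>, which lies in the \<open>m\<close>-th power of the arrow ideal and thus in
  \<open>I\<close>; the remaining part is absorbed by the ideal.\<close>

lemma long_subset_I: "\<exists>m. long m \<subseteq> I"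
proof -
  obtain m where m: "arrow_ideal_power Q m \<subseteq> I" using admissible by (auto simp: admissible_ideal_def)
  have pe: "path_elem (u, p) \<in> I" if p: "(u, p) \<in> paths Q" "m \<le> length p" for u p
  proof -
    have "p = take m p @ drop m p" by simp
    then have ap: "(u, take m p) \<in> paths Q" "(pend u (take m p), drop m p) \<in> paths Q"
      using path_append[of u "take m p" "drop m p"] p(1) by auto
    have "path_elem (u, take m p) \<in> I"
    proof -
      have "length (take m p) = m" using p(2) by simp
      with path_elem_arrow_ideal_power[OF ap(1)] show ?thesis using m by (metis subsetD)
    qed
    from I.I_r_closed[OF this path_elem_closed[OF ap(2)]] show ?thesis by (simp add: path_elem_mult)
  qed
  have "x \<in> I" if x: "x \<in> long m" for x
  proof -
    have xc: "x \<in> carrier PA" using x by (simp add: long_def)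
    show ?thesis
    proof (rule support_induct[OF xc])
      show "\<zero>\<^bsub>PA\<^esub> \<in> I" by simp
      fix y w assume "y \<in> I" "w \<in> paths Q" "x w \<noteq> 0"
      moreover obtain u p where w: "w = (u, p)" by (cases w)
      ultimately have "m \<le> length p" using x by (auto simp: long_def not_less[symmetric])
      then show "y \<oplus>\<^bsub>PA\<^esub> (\<lambda>v. x w * path_elem w v) \<in> I"
        using pe \<open>w \<in> paths Q\<close> \<open>y \<in> I\<close> I_scale w I.a_closed by simp
    qed
  qed
  then show ?thesis by blast
qed

section \<open>The bound quiver algebra and its data at the vertex \<open>k\<close>\<close>

abbreviation AA :: "('k, (('v, 'a) path \<Rightarrow> 'k) set) module" where "AA \<equiv> bound_quiver_algebra Q I"

definition cls :: "(('v, 'a) path \<Rightarrow> 'k) \<Rightarrow> (('v, 'a) path \<Rightarrow> 'k) set" where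
  "cls x = I +>\<^bsub>PA\<^esub> x"

lemma AA_carrier: "carrier AA = cls ` carrier PA"
  by (auto simp: bound_quiver_algebra_def ring.defs module.defs FactRing_def A_RCOSETS_def' cls_def)

lemma cls_self:
  assumes "x \<in> carrier PA"
  shows "x \<in> cls x"
  unfolding cls_def a_r_coset_def' by (rule UN_I[of "\<zero>\<^bsub>PA\<^esub>"]) (use assms in simp_all)

lemma cls_closed [simp]: "x \<in> carrier PA \<Longrightarrow> cls x \<in> carrier AA"
  by (simp add: AA_carrier)

lemma AA_add: "x \<in> carrier PA \<Longrightarrow> y \<in> carrier PA \<Longrightarrow> cls x \<oplus>\<^bsub>AA\<^esub> cls y = cls (x \<oplus>\<^bsub>PA\<^esub> y)"
  using I.a_rcos_sum by (simp add: bound_quiver_algebra_def ring.defs module.defs FactRing_def cls_def)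

lemma AA_mult: "x \<in> carrier PA \<Longrightarrow> y \<in> carrier PA \<Longrightarrow> cls x \<otimes>\<^bsub>AA\<^esub> cls y = cls (x \<otimes>\<^bsub>PA\<^esub> y)"
  using I.rcoset_mult_add by (simp add: bound_quiver_algebra_def ring.defs module.defs FactRing_def cls_def)

lemma AA_one: "\<one>\<^bsub>AA\<^esub> = cls \<one>\<^bsub>PA\<^esub>"
  by (simp add: bound_quiver_algebra_def ring.defs module.defs FactRing_def cls_def)

lemma cls_eq_iff: "x \<in> carrier PA \<Longrightarrow> y \<in> carrier PA \<Longrightarrow> cls x = cls y \<longleftrightarrow> x \<ominus>\<^bsub>PA\<^esub> y \<in> I"
  unfolding cls_def
  by (rule a_coset_eq_iff[OF PA.abelian_group_axioms I.a_subset]) (auto intro: I.a_inv_closed)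

lemma AA_zero: "\<zero>\<^bsub>AA\<^esub> = cls \<zero>\<^bsub>PA\<^esub>"
proof -
  have "\<zero>\<^bsub>AA\<^esub> = I" by (simp add: bound_quiver_algebra_def ring.defs module.defs FactRing_def)
  also have "I = cls \<zero>\<^bsub>PA\<^esub>" using I.a_subset unfolding cls_def a_r_coset_def' by (auto simp: PA_add PA_zero)
  finally show ?thesis .
qed

lemma ring_AA: "ring AA"
  by (rule ring_fields_cong[OF I.quotient_is_ring])
    (simp_all add: bound_quiver_algebra_def ring.defs module.defs)

text \<open>The definition takes a union over all representatives of the class; as \<open>I\<close>
  is closed under scalars, all of them contribute the same coset.\<close>

lemma AA_scale:
  assumes x: "x \<in> carrier PA"
  shows "c \<odot>\<^bsub>AA\<^esub> cls x = cls (\<lambda>w. c * x w)"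
proof -
  have "cls (\<lambda>w. c * y w) = cls (\<lambda>w. c * x w)" if y: "y \<in> cls x" for y
  proof -
    obtain h where h: "h \<in> I" "y = h \<oplus>\<^bsub>PA\<^esub> x" using y by (auto simp: cls_def a_r_coset_def')
    have hc: "h \<in> carrier PA" using h I.a_subset by blast
    have "(\<lambda>w. c * y w) = (\<lambda>w. c * h w) \<oplus>\<^bsub>PA\<^esub> (\<lambda>w. c * x w)" using h(2) by (simp add: PA_add distrib_left)
    then have "cls (\<lambda>w. c * y w) = cls (\<lambda>w. c * h w) \<oplus>\<^bsub>AA\<^esub> cls (\<lambda>w. c * x w)"
      using AA_add PA_scale_closed x hc by simp
    also have "cls (\<lambda>w. c * h w) = cls \<zero>\<^bsub>PA\<^esub>"
      using cls_eq_iff[OF PA_scale_closed[OF hc] PA.zero_closed] I_scale[OF h(1)]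
        minus_zero_right[OF PA.abelian_group_axioms PA_scale_closed[OF hc]] by simp
    also have "cls \<zero>\<^bsub>PA\<^esub> \<oplus>\<^bsub>AA\<^esub> cls (\<lambda>w. c * x w) = cls (\<lambda>w. c * x w)"
      using AA_add[OF PA.zero_closed PA_scale_closed[OF x]] PA_scale_closed[OF x] by simp
    finally show ?thesis .
  qed
  moreover note cls_self[OF x]
  moreover have "c \<odot>\<^bsub>AA\<^esub> cls x = (\<Union>y\<in>cls x. cls (\<lambda>w. c * y w))"
    by (simp add: bound_quiver_algebra_def ring.defs module.defs cls_def)
  ultimately show ?thesis by blast
qed

lemma AA_scalar: "c \<odot>\<^bsub>AA\<^esub> \<one>\<^bsub>AA\<^esub> = cls (\<lambda>w. c * \<one>\<^bsub>PA\<^esub> w)"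
  by (simp add: AA_one AA_scale PA_one_closed)

lemma AA_cases:
  assumes "a \<in> carrier AA"
  obtains x where "x \<in> carrier PA" "a = cls x"
  using assms by (auto simp: AA_carrier)

lemma cls_long:
  assumes "long m \<subseteq> I" "x \<in> carrier PA" "y \<in> carrier PA" "\<And>u p. length p < m \<Longrightarrow> x (u, p) = y (u, p)"
  shows "cls x = cls y"
proof -
  have "x \<ominus>\<^bsub>PA\<^esub> y = (\<lambda>w. x w + - 1 * y w)"
  proof -
    have "\<ominus>\<^bsub>PA\<^esub> y = (\<lambda>w. - 1 * y w)"
      by (rule PA.minus_equality[OF _ assms(3) PA_scale_closed[OF assms(3)]]) (simp add: PA_add PA_zero)
    then show ?thesis by (simp add: a_minus_def PA_add)
  qed
  then have "x \<ominus>\<^bsub>PA\<^esub> y \<in> long m" using assms(2-4) PA.minus_closed[OF assms(2,3)] by (simp add: long_def)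
  then show ?thesis using assms(1-3) cls_eq_iff by blast
qed

text \<open>If \<open>I\<close> contains everything supported in length at least \<open>m\<close>,
  the classes of the paths of length at most \<open>m\<close> span the quotient, and a finite quiver
  has only finitely many of these.\<close>

lemma fd_algebra_AA: "fd_algebra AA"
proof -
  interpret AA: ring AA by (rule ring_AA)
  show ?thesis
  proof unfold_locales
    let ?s = "\<lambda>c w. c * \<one>\<^bsub>PA\<^esub> w"
    have sc: "?s c \<in> carrier PA" for c by (rule PA_scale_closed[OF PA_one_closed])
    show "c \<odot>\<^bsub>AA\<^esub> \<one>\<^bsub>AA\<^esub> \<in> carrier AA" for c using sc by (simp add: AA_scalar)
    show "(c + d) \<odot>\<^bsub>AA\<^esub> \<one>\<^bsub>AA\<^esub> = c \<odot>\<^bsub>AA\<^esub> \<one>\<^bsub>AA\<^esub> \<oplus>\<^bsub>AA\<^esub> d \<odot>\<^bsub>AA\<^esub> \<one>\<^bsub>AA\<^esub>" for c d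
      unfolding AA_scalar AA_add[OF sc sc] by (simp add: PA_add distrib_right)
    show "(c * d) \<odot>\<^bsub>AA\<^esub> \<one>\<^bsub>AA\<^esub> = (c \<odot>\<^bsub>AA\<^esub> \<one>\<^bsub>AA\<^esub>) \<otimes>\<^bsub>AA\<^esub> (d \<odot>\<^bsub>AA\<^esub> \<one>\<^bsub>AA\<^esub>)" for c d
      unfolding AA_scalar AA_mult[OF sc sc] PA_scale_left PA_l_one[OF sc] by (simp add: mult.assoc)
    show "1 \<odot>\<^bsub>AA\<^esub> \<one>\<^bsub>AA\<^esub> = \<one>\<^bsub>AA\<^esub>" unfolding AA_scalar by (simp add: AA_one)
    show "(c \<odot>\<^bsub>AA\<^esub> \<one>\<^bsub>AA\<^esub>) \<otimes>\<^bsub>AA\<^esub> a = a \<otimes>\<^bsub>AA\<^esub> (c \<odot>\<^bsub>AA\<^esub> \<one>\<^bsub>AA\<^esub>)" if a: "a \<in> carrier AA" for a c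
    proof -
      obtain x where x: "x \<in> carrier PA" "a = cls x" by (rule AA_cases[OF a])
      show ?thesis unfolding AA_scalar x(2) AA_mult[OF sc x(1)] AA_mult[OF x(1) sc]
          PA_scale_left PA_scale_right PA_l_one[OF x(1)] PA_r_one[OF x(1)] ..
    qed
    obtain m where m: "long m \<subseteq> I" using long_subset_I by blast
    let ?W = "{(u, p). (u, p) \<in> paths Q \<and> length p \<le> m}"
    let ?B = "(\<lambda>w. cls (path_elem w)) ` ?W"
    have "?W \<subseteq> verts Q \<times> {p. set p \<subseteq> arcs Q \<and> length p \<le> m}"
      by (auto simp: paths_def awalk_def)
    then have finW: "finite ?W"
      by (rule finite_subset) (simp add: finite_lists_length_le)
    have span: "carrier AA \<subseteq> H"
      if H: "?B \<subseteq> H" "\<zero>\<^bsub>AA\<^esub> \<in> H" "\<forall>x\<in>H. \<forall>y\<in>H. x \<oplus>\<^bsub>AA\<^esub> y \<in> H" "\<forall>x\<in>H. \<forall>c. x \<otimes>\<^bsub>AA\<^esub> (c \<odot>\<^bsub>AA\<^esub> \<one>\<^bsub>AA\<^esub>) \<in> H" for H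
    proof
      fix a assume a: "a \<in> carrier AA"
      obtain x where x: "x \<in> carrier PA" "a = cls x" by (rule AA_cases[OF a])
      \<comment> \<open>Dropping the coefficients at paths of length at least \<open>m\<close> does
        not change the class, and leaves a combination of the finitely many spanning paths.\<close>
      let ?x = "\<lambda>w. if length (snd w) < m then x w else 0"
      have xc: "?x \<in> carrier PA" using x(1) unfolding PA_carrier by (auto elim!: finite_subset[rotated])
      have "cls ?x \<in> H"
      proof (rule support_induct[OF xc])
        show "cls \<zero>\<^bsub>PA\<^esub> \<in> H" using H(2) by (simp add: AA_zero)
        fix y w assume y: "y \<in> carrier PA" "cls y \<in> H" and w: "w \<in> paths Q" "?x w \<noteq> 0"
        have "cls (path_elem w) \<in> H" using w H(1) by (cases w) (auto split: if_splits simp: image_subset_iff)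
        then have "cls (path_elem w) \<otimes>\<^bsub>AA\<^esub> (?x w \<odot>\<^bsub>AA\<^esub> \<one>\<^bsub>AA\<^esub>) \<in> H" using H(4) by blast
        then have "cls (\<lambda>v. ?x w * path_elem w v) \<in> H"
          unfolding AA_scalar AA_mult[OF path_elem_closed[OF w(1)] sc] PA_scale_right PA_r_one[OF path_elem_closed[OF w(1)]] .
        then have "cls y \<oplus>\<^bsub>AA\<^esub> cls (\<lambda>v. ?x w * path_elem w v) \<in> H" using H(3) y(2) by blast
        then show "cls (y \<oplus>\<^bsub>PA\<^esub> (\<lambda>v. ?x w * path_elem w v)) \<in> H"
          unfolding AA_add[OF y(1) PA_scale_closed[OF path_elem_closed[OF w(1)]]] .
      qed
      moreover have "cls ?x = a" unfolding x(2) by (rule cls_long[OF m xc x(1)]) simp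
      ultimately show "a \<in> H" by simp
    qed
    show "\<exists>B. finite B \<and> B \<subseteq> carrier AA \<and> (\<forall>H. B \<subseteq> H \<and> \<zero>\<^bsub>AA\<^esub> \<in> H \<and>
        (\<forall>x\<in>H. \<forall>y\<in>H. x \<oplus>\<^bsub>AA\<^esub> y \<in> H) \<and> (\<forall>x\<in>H. \<forall>c. x \<otimes>\<^bsub>AA\<^esub> (c \<odot>\<^bsub>AA\<^esub> \<one>\<^bsub>AA\<^esub>) \<in> H) \<longrightarrow> carrier AA \<subseteq> H)"
    proof (intro exI[of _ ?B] conjI allI impI)
      show "finite ?B" by (rule finite_imageI[OF finW])
      show "?B \<subseteq> carrier AA" by (auto simp: path_elem_closed)
    qed (elim conjE, rule span)
  qed
qed

lemma cls_finsum:
  assumes "finite J" "\<And>j. j \<in> J \<Longrightarrow> z j \<in> carrier PA"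
  shows "(\<Oplus>\<^bsub>AA\<^esub>j\<in>J. cls (z j)) = cls (\<lambda>w. \<Sum>j\<in>J. z j w) \<and> (\<lambda>w. \<Sum>j\<in>J. z j w) \<in> carrier PA"
  using assms
proof (induction J)
  case empty
  interpret AA: ring AA by (rule ring_AA)
  show ?case using PA.zero_closed by (simp add: AA_zero PA_zero)
next
  case (insert j J)
  interpret AA: ring AA by (rule ring_AA)
  have eq: "(\<lambda>w. \<Sum>j\<in>insert j J. z j w) = z j \<oplus>\<^bsub>PA\<^esub> (\<lambda>w. \<Sum>j\<in>J. z j w)"
    using insert.hyps by (simp add: PA_add)
  have "(\<Oplus>\<^bsub>AA\<^esub>j\<in>insert j J. cls (z j)) = cls (z j) \<oplus>\<^bsub>AA\<^esub> (\<Oplus>\<^bsub>AA\<^esub>j\<in>J. cls (z j))"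
    using insert.hyps insert.prems by (intro AA.finsum_insert) auto
  then show ?case unfolding eq using insert by (simp add: AA_add PA_add_closed)
qed

text \<open>The same choice of representative as in \<open>simple_at\<close>, so that
  \<open>simple_at k\<close> is equal to the abstract simple module and not merely isomorphic to
  it.\<close>

definition char :: "'v \<Rightarrow> (('v, 'a) path \<Rightarrow> 'k) set \<Rightarrow> 'k" where
  "char i X = (SOME x. x \<in> X) (i, [])"

lemma char_cls:
  assumes x: "x \<in> carrier PA"
  shows "char i (cls x) = x (i, [])"
proof -
  have "(SOME y. y \<in> cls x) \<in> cls x" using cls_self[OF x] by (rule someI[where P = "\<lambda>y. y \<in> cls x"])
  then obtain h where "h \<in> I" "(SOME y. y \<in> cls x) = h \<oplus>\<^bsub>PA\<^esub> x" by (auto simp: cls_def a_r_coset_def')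
  then show ?thesis using I_long by (auto simp: char_def PA_add long_def)
qed

text \<open>The filtration is the one by path length, nilpotent on classes by
  \<open>long_subset_I\<close>. The axiom on generation by arrows comes from splitting off the last
  arrow of every path that ends at \<open>k\<close>.\<close>

lemma basic_algebra_AA:
  assumes k: "k \<in> verts Q" and loop: "\<And>\<alpha>. \<alpha> \<in> arcs Q \<Longrightarrow> \<not> (tail Q \<alpha> = k \<and> head Q \<alpha> = k)"
  shows "basic_algebra AA (verts Q) (\<lambda>i. path_class Q I (i, [])) char (\<lambda>n. cls ` long n) k
    (arrows_to Q k) (tail Q) (\<lambda>\<alpha>. path_class Q I (tail Q \<alpha>, [\<alpha>]))"
proof -
  interpret AA: fd_algebra AA by (rule fd_algebra_AA)
  have pc: "path_class Q I w = cls (path_elem w)" for w by (simp add: path_class_def cls_def)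
  note pe = path_elem_closed
  have vp: "i \<in> verts Q \<Longrightarrow> (i, []) \<in> paths Q" for i by (simp add: path_Nil)
  have ap: "\<alpha> \<in> arrows_to Q k \<Longrightarrow> (tail Q \<alpha>, [\<alpha>]) \<in> paths Q" for \<alpha> by (simp add: path_single arrows_to_def)
  have finA: "finite (arrows_to Q k)" by (simp add: arrows_to_def)
  have long_sub: "long n \<subseteq> carrier PA" for n by (auto simp: long_def)
  show ?thesis
  proof unfold_locales
    show "finite (verts Q)" by simp
    show "k \<in> verts Q" by (rule k)
    show "path_class Q I (i, []) \<in> carrier AA" if "i \<in> verts Q" for i using that by (simp add: pc pe vp)
    show "path_class Q I (i, []) \<otimes>\<^bsub>AA\<^esub> path_class Q I (j, []) = (if i = j then path_class Q I (i, []) else \<zero>\<^bsub>AA\<^esub>)"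
      if "i \<in> verts Q" "j \<in> verts Q" for i j
      using that by (simp add: pc AA_mult pe vp path_elem_mult AA_zero)
    have "(\<lambda>w. \<Sum>i\<in>verts Q. path_elem (i, []) w) = \<one>\<^bsub>PA\<^esub>"
      by (auto simp: fun_eq_iff PA_one path_elem_def intro!: sum.neutral)
    then show "(\<Oplus>\<^bsub>AA\<^esub>i\<in>verts Q. path_class Q I (i, [])) = \<one>\<^bsub>AA\<^esub>"
      unfolding pc AA_one using cls_finsum[of "verts Q" "\<lambda>i. path_elem (i, [])"] pe vp by simp
    show "char i (a \<oplus>\<^bsub>AA\<^esub> b) = char i a + char i b" if "a \<in> carrier AA" "b \<in> carrier AA" for i a b
      using that by (auto elim!: AA_cases simp: AA_add char_cls PA_add_closed) (simp add: PA_add)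
    show "char i (a \<otimes>\<^bsub>AA\<^esub> b) = char i a * char i b" if "a \<in> carrier AA" "b \<in> carrier AA" for i a b
      using that by (auto elim!: AA_cases simp: AA_mult char_cls PA_mult_closed) (simp add: PA_mult)
    show "char i (c \<odot>\<^bsub>AA\<^esub> \<one>\<^bsub>AA\<^esub>) = c" if "i \<in> verts Q" for i c
      using that by (simp add: AA_scalar char_cls PA_scale_closed PA_one_closed PA_one)
    show "char i (path_class Q I (j, [])) = (if i = j then 1 else 0)" if "i \<in> verts Q" "j \<in> verts Q" for i j
      unfolding pc char_cls[OF pe[OF vp[OF that(2)]]] by (simp add: path_elem_def)
    show "cls ` long 0 = carrier AA" by (simp add: long_def AA_carrier)
    show "a \<in> cls ` long 1" if a: "a \<in> carrier AA" "\<And>i. i \<in> verts Q \<Longrightarrow> char i a = 0" for a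
    proof -
      obtain x where x: "x \<in> carrier PA" "a = cls x" by (rule AA_cases[OF a(1)])
      have "x (u, []) = 0" for u
        using a(2)[of u] PA_nonpath[OF x(1), of "(u, [])"] x by (cases "u \<in> verts Q") (auto simp: char_cls path_Nil)
      then show ?thesis using x by (auto simp: long_def)
    qed
    show "cls ` long n \<subseteq> carrier AA" for n
      using long_sub[of n] by (auto intro!: cls_closed)
    show "\<zero>\<^bsub>AA\<^esub> \<in> cls ` long n" for n
      unfolding AA_zero using PA.zero_closed by (auto simp: long_def PA_zero)
    show "a \<oplus>\<^bsub>AA\<^esub> b \<in> cls ` long n" if ab: "a \<in> cls ` long n" "b \<in> cls ` long n" for n a b
    proof -
      obtain x y where xy: "x \<in> long n" "a = cls x" "y \<in> long n" "b = cls y" using ab by blast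
      have c: "x \<in> carrier PA" "y \<in> carrier PA" using xy by (auto simp: long_def)
      have "x \<oplus>\<^bsub>PA\<^esub> y \<in> long n" using xy(1,3) PA_add_closed[OF c] by (simp add: long_def) (simp add: PA_add)
      then show ?thesis unfolding xy(2,4) AA_add[OF c] by (rule imageI)
    qed
    show "a \<otimes>\<^bsub>AA\<^esub> b \<in> cls ` long (Suc n)" if ab: "a \<in> cls ` long 1" "b \<in> cls ` long n" for n a b
    proof -
      obtain x y where xy: "x \<in> long 1" "a = cls x" "y \<in> long n" "b = cls y" using ab by blast
      have c: "x \<in> carrier PA" "y \<in> carrier PA" using xy by (auto simp: long_def)
      show ?thesis unfolding xy(2,4) AA_mult[OF c] by (rule imageI[OF long_mult[OF xy(1,3)]])
    qed
    obtain m where m: "long m \<subseteq> I" using long_subset_I by blast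
    have "cls x = \<zero>\<^bsub>AA\<^esub>" if "x \<in> long m" for x
      unfolding AA_zero
      by (rule cls_long[OF m _ PA.zero_closed]) (use that in \<open>simp_all add: long_def PA_zero\<close>)
    then show "\<exists>n. cls ` long n \<subseteq> {\<zero>\<^bsub>AA\<^esub>}" by blast
    show "finite (arrows_to Q k)" by (rule finA)
    show "tail Q \<alpha> \<in> verts Q" "tail Q \<alpha> \<noteq> k" if "\<alpha> \<in> arrows_to Q k" for \<alpha>
      using that loop by (auto simp: arrows_to_def)
    show "path_class Q I (tail Q \<alpha>, [\<alpha>]) \<in> carrier AA" if "\<alpha> \<in> arrows_to Q k" for \<alpha>
      using that by (simp add: pc pe ap)
    show "path_class Q I (tail Q \<alpha>, []) \<otimes>\<^bsub>AA\<^esub> path_class Q I (tail Q \<alpha>, [\<alpha>]) = path_class Q I (tail Q \<alpha>, [\<alpha>])"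
      if "\<alpha> \<in> arrows_to Q k" for \<alpha>
      using that by (simp add: pc AA_mult pe vp ap path_elem_mult path_start[OF ap])
    show "\<exists>b\<in>arrows_to Q k \<rightarrow> carrier AA. a \<otimes>\<^bsub>AA\<^esub> path_class Q I (k, []) =
        (\<Oplus>\<^bsub>AA\<^esub>\<alpha>\<in>arrows_to Q k. b \<alpha> \<otimes>\<^bsub>AA\<^esub> path_class Q I (tail Q \<alpha>, [\<alpha>]))"
      if a: "a \<in> carrier AA" "char k a = 0" for a
    proof -
      obtain x where x: "x \<in> carrier PA" "a = cls x" by (rule AA_cases[OF a(1)])
      have xk: "x (k, []) = 0" using a(2) x by (simp add: char_cls)
      \<comment> \<open>The part of \<open>x\<close> on paths with last arrow
        \<open>\<alpha>\<close>, with that arrow stripped; the sum of the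
        \<open>y \<alpha> \<alpha>\<close> over the arrows into \<open>k\<close> recovers
        \<open>x e_k\<close>, because \<open>x\<close> has coefficient zero at the trivial path at
        \<open>k\<close>.\<close>
      define y where "y = (\<lambda>\<alpha> (w :: ('v, 'a) path). x (fst w, snd w @ [\<alpha>]))"
      have y: "y \<alpha> \<in> carrier PA" for \<alpha>
      proof -
        \<comment> \<open>Appending a fixed arrow is injective on paths, so the support stays
          finite.\<close>
        have "{w. y \<alpha> w \<noteq> 0} = (\<lambda>w. (fst w, snd w @ [\<alpha>])) -` {w. x w \<noteq> 0}" by (auto simp: y_def)
        moreover have "finite \<dots>" using x(1)
          by (intro finite_vimageI) (auto simp: PA_carrier inj_def prod_eq_iff)
        moreover have "w \<in> paths Q" if "y \<alpha> w \<noteq> 0" for w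
          using that PA_nonpath[OF x(1), of "(fst w, snd w @ [\<alpha>])"] path_append[of "fst w" "snd w" "[\<alpha>]"]
          by (auto simp: y_def)
        ultimately show ?thesis unfolding PA_carrier by auto
      qed
      let ?z = "\<lambda>\<alpha>. y \<alpha> \<otimes>\<^bsub>PA\<^esub> path_elem (tail Q \<alpha>, [\<alpha>])"
      have z: "?z \<alpha> \<in> carrier PA" if "\<alpha> \<in> arrows_to Q k" for \<alpha>
        by (rule PA_mult_closed[OF y pe[OF ap[OF that]]])
      have "x \<otimes>\<^bsub>PA\<^esub> path_elem (k, []) = (\<lambda>w. \<Sum>\<alpha>\<in>arrows_to Q k. ?z \<alpha> w)"
      proof
        fix w :: "('v, 'a) path"
        obtain u r where w: "w = (u, r)" by (cases w)
        have L: "(x \<otimes>\<^bsub>PA\<^esub> path_elem (k, [])) (u, r) = (if pend u r = k then x (u, r) else 0)"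
          by (simp add: mult_path_elem)
        show "(x \<otimes>\<^bsub>PA\<^esub> path_elem (k, [])) w = (\<Sum>\<alpha>\<in>arrows_to Q k. ?z \<alpha> w)"
        proof (cases r rule: rev_cases)
          case Nil
          then show ?thesis unfolding w L mult_path_elem using xk by simp
        next
          case (snoc p \<beta>)
          \<comment> \<open>A nontrivial path has a unique last arrow \<open>\<beta>\<close>, so
            only the summand for \<open>\<beta>\<close> can contribute.\<close>
          have "?z \<alpha> (u, r) = (if \<beta> = \<alpha> then (if pend u p = tail Q \<beta> then x (u, r) else 0) else 0)" for \<alpha>
            unfolding mult_path_elem by (auto simp: snoc y_def)
          then have "(\<Sum>\<alpha>\<in>arrows_to Q k. ?z \<alpha> (u, r)) =
              (if \<beta> \<in> arrows_to Q k then (if pend u p = tail Q \<beta> then x (u, r) else 0) else 0)"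
            using finA by simp
          also have "\<dots> = (if pend u r = k then x (u, r) else 0)"
          \<comment> \<open>A nonzero coefficient means that \<open>r\<close> is a path from
            \<open>u\<close>, so \<open>\<beta>\<close> starts where \<open>p\<close> ends, and
            ending at \<open>k\<close> is the same as \<open>\<beta>\<close> being an arrow into
            \<open>k\<close>.\<close>
          proof (cases "x (u, r) = 0")
            case False
            then have "(u, r) \<in> paths Q" using PA_nonpath[OF x(1)] by blast
            then have "\<beta> \<in> arcs Q" "pend u p = tail Q \<beta>" by (auto simp: snoc path_append path_single)
            then show ?thesis by (simp add: snoc pend_append arrows_to_def)
          qed simp
          finally show ?thesis unfolding w L by simp
        qed
      qed
      then have "a \<otimes>\<^bsub>AA\<^esub> path_class Q I (k, []) = cls (\<lambda>w. \<Sum>\<alpha>\<in>arrows_to Q k. ?z \<alpha> w)"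
        using x pe vp k by (simp add: pc AA_mult)
      also have "\<dots> = (\<Oplus>\<^bsub>AA\<^esub>\<alpha>\<in>arrows_to Q k. cls (?z \<alpha>))"
        using cls_finsum[OF finA, of ?z] z by simp
      also have "\<dots> = (\<Oplus>\<^bsub>AA\<^esub>\<alpha>\<in>arrows_to Q k. cls (y \<alpha>) \<otimes>\<^bsub>AA\<^esub> path_class Q I (tail Q \<alpha>, [\<alpha>]))"
        using y pe ap z by (intro AA.finsum_cong') (auto simp: pc AA_mult)
      finally show ?thesis using y by (intro bexI[of _ "\<lambda>\<alpha>. cls (y \<alpha>)"]) auto
    qed
  qed
qed

end

theorem corollary2p2:
  fixes Q :: "('v, 'a) pre_digraph"
    and I :: "(('v, 'a) path \<Rightarrow> 'k::field) set"
    and k :: 'v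
  assumes "fin_digraph Q"
    and "admissible_ideal Q I"
    and "k \<in> verts Q"
    and "\<And>\<alpha>. \<alpha> \<in> arcs Q \<Longrightarrow> \<not> (tail Q \<alpha> = k \<and> head Q \<alpha> = k)"
  shows "(tilting_complex (bound_quiver_algebra Q I) (T_minus Q I k) \<longleftrightarrow>
      (\<exists>m::nat. mod_iso (bound_quiver_algebra Q I)
         (mod_kernel (proj_at Q I k) (incoming_sum Q I k) (incoming_map Q I k))
         (mod_bigsum {..<m} (\<lambda>_. simple_at k)))) \<and>
    ((\<exists>M. tilting_module (bound_quiver_algebra Q I) M \<and>
         derived_iso (bound_quiver_algebra Q I) (T_minus Q I k) (stalk M)) \<longleftrightarrow>
      inj_on (incoming_map Q I k) (carrier (proj_at Q I k)))"
proof -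
  interpret bound_quiver Q I
    using assms(1,2) by (simp add: bound_quiver_def bound_quiver_axioms_def)
  interpret B: basic_algebra AA "verts Q" "\<lambda>i. path_class Q I (i, [])" char "\<lambda>n. cls ` long n" k
    "arrows_to Q k" "tail Q" "\<lambda>\<alpha>. path_class Q I (tail Q \<alpha>, [\<alpha>])"
    by (rule basic_algebra_AA[OF assms(3,4)])
  \<comment> \<open>The constructions in the statement are equal to those of the interpretation, so
    the results transfer by rewriting.\<close>
  have proj: "proj_at Q I = B.proj" by (simp add: fun_eq_iff proj_at_def B.proj_def)
  have inc: "incoming_sum Q I k = B.incoming" by (simp add: incoming_sum_def B.incoming_def proj)
  have inmap: "incoming_map Q I k = B.inmap" by (simp add: fun_eq_iff incoming_map_def B.inmap_def)
  have simple: "simple_at k = B.simple" by (simp add: simple_at_def B.simple_def char_def)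
  have L: "L_complex Q I k = B.Lk" unfolding L_complex_def B.Lk_def proj inc inmap ..
  have T: "T_minus Q I k = B.Tk" by (simp add: T_minus_def B.Tk_def L B.others_def proj)
  show ?thesis
    unfolding proj inc inmap simple T
    using B.tilting_Tk_iff B.kernel_at_k_iff B.tilting_module_Tk_iff by blast
qed

end
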